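(* Let $U(x)$ be a regular solution of the system $(\ast)$ in $D$ satisfying $$|U(y)|+|T(\partial_y,n)U(y)|\le M,\quad y\in\partial D\setminus S,$$ $$|U(y)|+|T(\partial_y,n)U(y)|\le\delta,\quad 0<\delta<1,\quad y\in S.$$ Then, for $x\in D$, $$|U(x)|\le C_4(x)\,\delta^{x_n/x_n^0}\Big(\ln\frac M\delta\Big)^m,$$ where $x_n^0=\max_Dx_n$ and $C_4(x)=\tilde C\int_{\partial D}\frac1{r^n}\,ds_y$, $r=|x-y|$, with $\tilde C$ a constant depending on $\lambda,\mu,\varepsilon,\beta,\nu$.
   Context: **Domain.** $n=2m$ or $n=2m+1$ with $m\ge1$; $D\subset\mathbb R^n$ is a bounded simply connected domain with piecewise smooth boundary consisting of a piece $\Sigma$ of the plane $y_n=0$ and a smooth surface $S$ lying in $y_n>0$; $n(y)$ is the unit outward normal on $\partial D$. **Constants.** $\lambda,\mu,\nu,\beta,\varepsilon,\alpha,\rho,\sigma,\theta$ are real with $\mu>0$, $3\lambda+2\mu>0$, $\alpha>0$, $\varepsilon>0$, $3\varepsilon+2\nu>0$, $\beta>0$, $\rho>0$, $\sigma>0$. $\varepsilon_{kjp}$ ($1\le k,j,p\le n$) is the Levi-Civita symbol: $0$ if two subscripts are equal, $1$ (resp. $-1$) if $(k,j,p)$ is an even (resp. odd) permutation of the three subscripts in increasing order. **System.** For $U=(u,w)=(u_1,\dots,u_n,w_1,\dots,w_n)$ the system $(\ast)$ is $$(\mu+\alpha)\Delta u+(\lambda+\mu-\alpha)\,\mathrm{grad}\,\mathrm{div}\,u+2\alpha\,\mathrm{rot}\,w+\rho\sigma^2u=0,$$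 $$(\nu+\beta)\Delta w+(\varepsilon+\nu-\beta)\,\mathrm{grad}\,\mathrm{div}\,w+2\alpha\,\mathrm{rot}\,u-4\alpha w+\theta\sigma^2w=0,$$ $(\mathrm{rot}\,v)_k=-\sum_{j,p}\varepsilon_{kjp}\,\partial v_j/\partial x_p$. A solution is regular if $U\in C^1(\overline D)\cap C^2(D)$. $|U|=(\sum_{i=1}^n(u_i^2+w_i^2))^{1/2}$. **Stress operator.** For $k=1,\dots,n$, $$(TU)_k=\lambda n_k\,\mathrm{div}\,u+(\mu-\alpha)\sum_j n_j\frac{\partial u_j}{\partial y_k}+(\mu+\alpha)\frac{\partial u_k}{\partial n}-2\alpha\sum_{j,p}\varepsilon_{kjp}n_pw_j,$$ $$(TU)_{n+k}=\varepsilon n_k\,\mathrm{div}\,w+(\nu-\beta)\sum_jn_j\frac{\partial w_j}{\partial y_k}+(\nu+\beta)\frac{\partial w_k}{\partial n}.$$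
   Formalization: The constant may depend on D, n, all material constants, and on fixed κ>1 and M₀; the bound is proved for κδ ≤ M ≤ M₀, as it fails for M=δ and uniformly for unbounded M; ν+β≠0 and ε+2ν≠0 are added, since otherwise the system is not elliptic and the claim can fail. *)

theory Defs
  imports "HOL-Analysis.Analysis"
begin

section \<open>Hausdorff measure\<close>

text \<open>
  The surface element on the boundary of a domain in \<open>n\<close>-dimensional space is the
  \<open>(n - 1)\<close>-dimensional Hausdorff measure, normalised (via the volume of the unit ball) so that it
  agrees with the classical surface area on smooth surfaces.
\<close>

definition hausdorff_weight :: "nat \<Rightarrow> 'a::metric_space set \<Rightarrow> ennreal" where
  "hausdorff_weight s B =
     (if B = {} then 0 else ennreal (unit_ball_vol (real s) * (diameter B / 2) ^ s))"

definition hausdorff_pre :: "nat \<Rightarrow> real \<Rightarrow> 'a::metric_space set \<Rightarrow> ennreal" where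
  "hausdorff_pre s r A =
     (INF B\<in>{B :: nat \<Rightarrow> 'a set. A \<subseteq> (\<Union>i. B i) \<and> (\<forall>i. bounded (B i) \<and> diameter (B i) \<le> r)}.
        \<Sum>i. hausdorff_weight s (B i))"

definition hausdorff_outer :: "nat \<Rightarrow> 'a::metric_space set \<Rightarrow> ennreal" where
  "hausdorff_outer s A = (SUP r\<in>{0<..}. hausdorff_pre s r A)"

definition hausdorff_measure :: "nat \<Rightarrow> 'a::metric_space measure" where
  "hausdorff_measure s = measure_of UNIV (sets borel) (hausdorff_outer s)"

text \<open>
  Since \<^const>\<open>measure_of\<close> silently returns the zero measure for a set function that is not a measure,
  we check that Hausdorff outer measure is one on the Borel sets.
\<close>

lemma hausdorff_weight_empty [simp]: "hausdorff_weight s {} = 0"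
  by (simp add: hausdorff_weight_def)

lemma hausdorff_pre_le:
  assumes "A \<subseteq> (\<Union>i. B i)" "\<And>i. bounded (B i)" "\<And>i. diameter (B i) \<le> r"
  shows "hausdorff_pre s r A \<le> (\<Sum>i. hausdorff_weight s (B i))"
  unfolding hausdorff_pre_def by (rule INF_lower) (use assms in auto)

lemma hausdorff_pre_mono: "A \<subseteq> A' \<Longrightarrow> hausdorff_pre s r A \<le> hausdorff_pre s r A'"
  unfolding hausdorff_pre_def by (rule INF_superset_mono) auto

lemma hausdorff_pre_antimono: "r \<le> r' \<Longrightarrow> hausdorff_pre s r' A \<le> hausdorff_pre s r A"
  unfolding hausdorff_pre_def by (rule INF_superset_mono) (auto intro: order_trans)

lemma hausdorff_pre_empty: "0 \<le> r \<Longrightarrow> hausdorff_pre s r {} = 0"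
  using hausdorff_pre_le[of "{}" "\<lambda>_. {}" r s] by simp

lemma hausdorff_pre_UN:
  fixes A :: "nat \<Rightarrow> 'a::metric_space set"
  shows "hausdorff_pre s r (\<Union>i. A i) \<le> (\<Sum>i. hausdorff_pre s r (A i))"
proof (rule ennreal_le_epsilon)
  fix e :: real assume fin: "(\<Sum>i. hausdorff_pre s r (A i)) < top" and e: "0 < e"
  have fin': "hausdorff_pre s r (A i) < top" for i
    using fin by (metis ennreal_suminf_lessD)
  have "\<exists>B. A i \<subseteq> (\<Union>j. B j) \<and> (\<forall>j. bounded (B j) \<and> diameter (B j) \<le> r) \<and>
      (\<Sum>j. hausdorff_weight s (B j)) \<le> hausdorff_pre s r (A i) + ennreal (e * (1/2) ^ Suc i)" for i
  proof -
    have "hausdorff_pre s r (A i) < hausdorff_pre s r (A i) + ennreal (e * (1/2) ^ Suc i)"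
      using fin'[of i] e by (simp add: ennreal_lessI ennreal_less_zero_iff less_top[symmetric])
    then show ?thesis
      unfolding hausdorff_pre_def[of s r "A i"] by (subst (asm) INF_less_iff) (auto intro: less_imp_le)
  qed
  then obtain B where B: "\<And>i. A i \<subseteq> (\<Union>j. B i j)" "\<And>i j. bounded (B i j)"
     "\<And>i j. diameter (B i j) \<le> r"
     "\<And>i. (\<Sum>j. hausdorff_weight s (B i j)) \<le> hausdorff_pre s r (A i) + ennreal (e * (1/2) ^ Suc i)"
    by metis
  define C where "C = case_prod B \<circ> prod_decode"
  have "(\<Union>i. A i) \<subseteq> (\<Union>k. C k)"
  proof
    fix x assume "x \<in> (\<Union>i. A i)"
    then obtain i j where "x \<in> B i j" using B(1) by blast
    then have "x \<in> C (prod_encode (i, j))" by (simp add: C_def)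
    then show "x \<in> (\<Union>k. C k)" by blast
  qed
  then have "hausdorff_pre s r (\<Union>i. A i) \<le> (\<Sum>k. hausdorff_weight s (C k))"
    by (rule hausdorff_pre_le) (auto simp: C_def B split: prod.split)
  also have "\<dots> = (\<Sum>i. \<Sum>j. hausdorff_weight s (B i j))"
    using suminf_ennreal_2dimen[of "\<lambda>i. \<Sum>j. hausdorff_weight s (B i j)"
        "\<lambda>(i,j). hausdorff_weight s (B i j)"]
    by (simp add: C_def comp_def split_beta)
  also have "\<dots> \<le> (\<Sum>i. hausdorff_pre s r (A i) + ennreal (e * (1/2) ^ Suc i))"
    by (intro suminf_le B) auto
  also have "\<dots> = (\<Sum>i. hausdorff_pre s r (A i)) + (\<Sum>i. ennreal (e * (1/2) ^ Suc i))"
    by (rule suminf_add[symmetric]) auto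
  also have "(\<Sum>i. ennreal (e * (1/2) ^ Suc i)) = ennreal e"
    using sums_mult[OF power_half_series, of e] e
    by (intro suminf_ennreal_eq) auto
  finally show "hausdorff_pre s r (\<Union>i. A i) \<le> (\<Sum>i. hausdorff_pre s r (A i)) + ennreal e" .
qed

lemma hausdorff_pre_le_outer: "0 < r \<Longrightarrow> hausdorff_pre s r A \<le> hausdorff_outer s A"
  unfolding hausdorff_outer_def by (rule SUP_upper) auto

lemma hausdorff_outer_mono: "A \<subseteq> A' \<Longrightarrow> hausdorff_outer s A \<le> hausdorff_outer s A'"
  unfolding hausdorff_outer_def by (intro SUP_mono) (auto intro: hausdorff_pre_mono)

lemma hausdorff_outer_empty [simp]: "hausdorff_outer s {} = 0"
  by (auto simp: hausdorff_outer_def hausdorff_pre_empty intro!: SUP_eq_const)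

lemma hausdorff_outer_UN:
  "hausdorff_outer s (\<Union>i::nat. A i) \<le> (\<Sum>i. hausdorff_outer s (A i))"
  unfolding hausdorff_outer_def[of s "\<Union>i. A i"]
proof (rule SUP_least)
  fix r :: real assume "r \<in> {0<..}"
  then show "hausdorff_pre s r (\<Union>i. A i) \<le> (\<Sum>i. hausdorff_outer s (A i))"
    by (intro order_trans[OF hausdorff_pre_UN] suminf_le hausdorff_pre_le_outer) auto
qed

lemma hausdorff_outer_Un: "hausdorff_outer s (A \<union> B) \<le> hausdorff_outer s A + hausdorff_outer s B"
proof -
  let ?A = "\<lambda>i::nat. if i = 0 then A else if i = 1 then B else {}"
  have "A \<union> B = (\<Union>i. ?A i)" by (auto split: if_splits)
  then have "hausdorff_outer s (A \<union> B) \<le> (\<Sum>i. hausdorff_outer s (?A i))"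
    using hausdorff_outer_UN[of s ?A] by simp
  also have "\<dots> = (\<Sum>i\<in>{0,1}. hausdorff_outer s (?A i))"
    by (rule suminf_finite) auto
  finally show ?thesis by simp
qed

lemma hausdorff_pre_separated:
  assumes sep: "\<And>x y. x \<in> P \<Longrightarrow> y \<in> Q \<Longrightarrow> d \<le> dist x y" and "r < d"
  shows "hausdorff_pre s r P + hausdorff_pre s r Q \<le> hausdorff_pre s r (P \<union> Q)"
  unfolding hausdorff_pre_def[of s r "P \<union> Q"]
proof (rule INF_greatest)
  fix B :: "nat \<Rightarrow> 'a set"
  assume "B \<in> {B. P \<union> Q \<subseteq> (\<Union>i. B i) \<and> (\<forall>i. bounded (B i) \<and> diameter (B i) \<le> r)}"
  then have B: "P \<union> Q \<subseteq> (\<Union>i. B i)" "\<And>i. bounded (B i)" "\<And>i. diameter (B i) \<le> r" by auto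
  define X where "X R i = (if B i \<inter> R = {} then {} else B i)" for R :: "'a set" and i
  have *: "hausdorff_pre s r R \<le> (\<Sum>i. hausdorff_weight s (X R i))" if "R \<subseteq> P \<union> Q" for R
  proof (rule hausdorff_pre_le)
    show "R \<subseteq> (\<Union>i. X R i)" using that B(1) by (fastforce simp: X_def)
    show "bounded (X R i)" for i using B by (simp add: X_def)
    have "0 \<le> r" using B(3)[of 0] diameter_ge_0[OF B(2)[of 0]] by linarith
    then show "diameter (X R i) \<le> r" for i using B by (simp add: X_def)
  qed
  have disj: "B i \<inter> P = {} \<or> B i \<inter> Q = {}" for i
  proof (rule ccontr)
    assume "\<not> (B i \<inter> P = {} \<or> B i \<inter> Q = {})"
    then obtain x y where xy: "x \<in> B i" "x \<in> P" "y \<in> B i" "y \<in> Q" by blast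
    then have "dist x y \<le> r" using diameter_bounded_bound[OF B(2)[of i]] B(3)[of i] by fastforce
    then show False using sep[of x y] xy \<open>r < d\<close> by linarith
  qed
  have "hausdorff_pre s r P + hausdorff_pre s r Q
      \<le> (\<Sum>i. hausdorff_weight s (X P i)) + (\<Sum>i. hausdorff_weight s (X Q i))"
    by (intro add_mono *) auto
  also have "\<dots> = (\<Sum>i. hausdorff_weight s (X P i) + hausdorff_weight s (X Q i))"
    by (rule suminf_add) auto
  also have "\<dots> \<le> (\<Sum>i. hausdorff_weight s (B i))"
    by (intro suminf_le) (use disj in \<open>auto simp: X_def\<close>)
  finally show "hausdorff_pre s r P + hausdorff_pre s r Q \<le> (\<Sum>i. hausdorff_weight s (B i))" .
qed

lemma hausdorff_outer_separated:
  assumes sep: "\<And>x y. x \<in> P \<Longrightarrow> y \<in> Q \<Longrightarrow> d \<le> dist x y" and "0 < d"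
  shows "hausdorff_outer s P + hausdorff_outer s Q \<le> hausdorff_outer s (P \<union> Q)"
proof -
  have le: "hausdorff_pre s a P + hausdorff_pre s b Q \<le> hausdorff_outer s (P \<union> Q)"
    if "0 < a" "0 < b" for a b
  proof -
    define r where "r = min (min a b) (d / 2)"
    have r: "0 < r" "r \<le> a" "r \<le> b" "r < d" using that \<open>0 < d\<close> by (auto simp: r_def)
    have "hausdorff_pre s a P + hausdorff_pre s b Q \<le> hausdorff_pre s r P + hausdorff_pre s r Q"
      using r by (intro add_mono hausdorff_pre_antimono) auto
    also have "\<dots> \<le> hausdorff_pre s r (P \<union> Q)"
      using sep r by (intro hausdorff_pre_separated)
    also have "\<dots> \<le> hausdorff_outer s (P \<union> Q)" using r by (intro hausdorff_pre_le_outer)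
    finally show ?thesis .
  qed
  have ne: "{0::real<..} \<noteq> {}" using gt_ex[of "0::real"] by auto
  have "hausdorff_pre s a P + hausdorff_outer s Q \<le> hausdorff_outer s (P \<union> Q)" if "0 < a" for a
    unfolding hausdorff_outer_def[of s Q] ennreal_SUP_add_right[OF ne]
    using le[OF that] by (intro SUP_least) auto
  then show ?thesis
    unfolding hausdorff_outer_def[of s P] ennreal_SUP_add_left[OF ne, symmetric]
    by (intro SUP_least) auto
qed

lemma hausdorff_outer_closed_split:
  fixes F :: "'a::metric_space set"
  assumes F: "closed F"
  shows "hausdorff_outer s (A \<inter> F) + hausdorff_outer s (A - F) \<le> hausdorff_outer s A"
proof (cases "F = {} \<or> hausdorff_outer s A = top")
  case True
  then show ?thesis by auto
next
  case False
  let ?H = "hausdorff_outer s"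
  from False have ne: "F \<noteq> {}" and fin: "?H A < top" by (auto simp: less_top)
  define P where "P k = {x \<in> A. 1 / real (Suc k) \<le> infdist x F}" for k
  define R where "R k = P (Suc k) - P k" for k
  have P_sub: "P k \<subseteq> A" for k by (auto simp: P_def)
  have P_Suc: "P k \<subseteq> P (Suc k)" for k
    unfolding P_def by (auto intro: order_trans[rotated] simp: frac_le)
  have P_mono: "k \<le> l \<Longrightarrow> P k \<subseteq> P l" for k l
    using P_Suc lift_Suc_mono_le[of P] by blast
  have lip: "infdist x F \<le> infdist y F + dist x y" for x y
    using infdist_triangle by auto
  have split: "?H (A \<inter> F) + ?H (P k) \<le> ?H A" for k
  proof -
    have "?H (A \<inter> F) + ?H (P k) \<le> ?H (A \<inter> F \<union> P k)"
    proof (rule hausdorff_outer_separated)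
      fix x y assume "x \<in> A \<inter> F" "y \<in> P k"
      then show "1 / real (Suc k) \<le> dist x y"
        using infdist_le[of x F y] by (auto simp: P_def dist_commute)
    qed simp
    also have "\<dots> \<le> ?H A" using P_sub by (intro hausdorff_outer_mono) auto
    finally show ?thesis .
  qed
  define g where "g j = ?H (R (Suc j))" for j
  have rings: "(\<Sum>j<N. g (2 * j + c)) \<le> ?H (P (2 * N + c))" for N c
  proof (induction N)
    case (Suc N)
    let ?k = "2 * N + c"
    have "(\<Sum>j<Suc N. g (2 * j + c)) \<le> ?H (P ?k) + ?H (R (Suc ?k))"
      using Suc by (simp add: g_def add_right_mono)
    also have "\<dots> \<le> ?H (P ?k \<union> R (Suc ?k))"
    proof (rule hausdorff_outer_separated)
      fix x y assume "x \<in> P ?k" "y \<in> R (Suc ?k)"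
      then have "1 / real (Suc ?k) \<le> infdist x F" "infdist y F \<le> 1 / real (Suc (Suc ?k))"
        by (auto simp: P_def R_def)
      then show "1 / real (Suc ?k) - 1 / real (Suc (Suc ?k)) \<le> dist x y"
        using lip[of x y] by linarith
    qed (simp add: frac_less2)
    also have "\<dots> \<le> ?H (P (2 * Suc N + c))"
      using P_mono[of ?k "2 * Suc N + c"] by (intro hausdorff_outer_mono) (auto simp: R_def)
    finally show ?case .
  qed simp
  have g_sum: "(\<Sum>j. g j) \<le> 2 * ?H A"
  proof (rule suminf_le_const)
    fix N
    have "(\<Sum>j<N. g j) \<le> (\<Sum>j<2 * N. g j)" by (rule sum_mono2) auto
    also have "\<dots> = (\<Sum>j<N. g (2 * j)) + (\<Sum>j<N. g (2 * j + 1))"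
      by (induction N) (auto simp: algebra_simps)
    also have "\<dots> \<le> ?H A + ?H A"
      using order_trans[OF rings[of 0 N] hausdorff_outer_mono[OF P_sub]]
        order_trans[OF rings[of 1 N] hausdorff_outer_mono[OF P_sub]]
      by (intro add_mono) auto
    finally show "(\<Sum>j<N. g j) \<le> 2 * ?H A" by (simp add: mult_2)
  qed auto
  then have g_fin: "(\<Sum>j. g j) < top"
    using fin by (auto simp: ennreal_mult_less_top intro: le_less_trans)
  show ?thesis
  proof (rule ennreal_le_epsilon)
    fix e :: real assume e: "0 < e"
    have "(\<lambda>k. (\<Sum>j. g j) - (\<Sum>j<k. g j)) \<longlonglongrightarrow> (\<Sum>j. g j) - (\<Sum>j. g j)"
      using g_fin by (intro tendsto_diff_ennreal tendsto_const summable_LIMSEQ) auto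
    then have "(\<lambda>k. (\<Sum>j. g j) - (\<Sum>j<k. g j)) \<longlonglongrightarrow> 0"
      using g_fin by simp
    then have "eventually (\<lambda>k. (\<Sum>j. g j) - (\<Sum>j<k. g j) < ennreal e) sequentially"
      using e by (intro order_tendstoD) auto
    then obtain k where k: "(\<Sum>j. g j) - (\<Sum>j<k. g j) < ennreal e"
      by (auto simp: eventually_sequentially)
    have part_fin: "(\<Sum>j<k. g j) < top"
      using sum_le_suminf[of g "{..<k}"] g_fin by (intro le_less_trans[OF _ g_fin]) auto
    have "(\<Sum>j. g j) = (\<Sum>j<k. g j) + (\<Sum>j. g (j + k))"
      using suminf_offset[of g k] by (simp add: add.commute)
    then have "(\<Sum>j. g j) - (\<Sum>j<k. g j) = (\<Sum>j. g (j + k))"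
      using part_fin by (metis ennreal_add_diff_cancel_left less_irrefl infinity_ennreal_def)
    then have tail: "(\<Sum>j. g (j + k)) \<le> ennreal e"
      using k by (metis less_imp_le)
    have "x \<in> P (Suc k) \<union> (\<Union>j. R (Suc (j + k)))" if x: "x \<in> A - F" for x
    proof -
      have "0 < infdist x F"
        using x F ne in_closed_iff_infdist_zero[of F x] infdist_nonneg[of x F] by (auto simp: less_le)
      then obtain i where "1 / real (Suc i) < infdist x F" using nat_approx_posE by metis
      then have "x \<in> P i" using x by (simp add: P_def)
      then have ex: "\<exists>i. x \<in> P i" by blast
      define i0 where "i0 = (LEAST i. x \<in> P i)"
      have i0: "x \<in> P i0" "\<And>i. i < i0 \<Longrightarrow> x \<notin> P i"
        unfolding i0_def using ex by (auto intro: LeastI_ex dest: not_less_Least)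
      show ?thesis
      proof (cases "i0 \<le> Suc k")
        case True
        then show ?thesis using i0(1) P_mono by blast
      next
        case False
        then obtain j where "i0 = Suc (Suc (j + k))"
          by (metis add.commute add_Suc less_imp_Suc_add not_le)
        then have "x \<in> R (Suc (j + k))"
          using i0(1) i0(2)[of "Suc (j + k)"] by (simp add: R_def)
        then show ?thesis by blast
      qed
    qed
    then have "?H (A - F) \<le> ?H (P (Suc k) \<union> (\<Union>j. R (Suc (j + k))))"
      by (intro hausdorff_outer_mono) blast
    also have "\<dots> \<le> ?H (P (Suc k)) + ?H (\<Union>j. R (Suc (j + k)))"
      by (rule hausdorff_outer_Un)
    also have "\<dots> \<le> ?H (P (Suc k)) + ennreal e"
      using hausdorff_outer_UN[of s "\<lambda>j. R (Suc (j + k))"] tail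
      by (intro add_left_mono) (auto simp: g_def intro: order_trans)
    finally have "?H (A \<inter> F) + ?H (A - F) \<le> ?H (A \<inter> F) + ?H (P (Suc k)) + ennreal e"
      by (simp add: add.assoc add_left_mono)
    also have "\<dots> \<le> ?H A + ennreal e"
      by (intro add_right_mono split)
    finally show "?H (A \<inter> F) + ?H (A - F) \<le> ?H A + ennreal e" .
  qed
qed

lemma measure_space_hausdorff:
  "measure_space UNIV (sets (borel :: 'a::metric_space measure)) (hausdorff_outer s)"
proof -
  let ?H = "hausdorff_outer s :: 'a set \<Rightarrow> ennreal"
  let ?L = "lambda_system UNIV (Pow UNIV) ?H"
  interpret P: sigma_algebra UNIV "Pow UNIV :: 'a set set" by (rule sigma_algebra_Pow)
  have "outer_measure_space (Pow UNIV) ?H"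
    unfolding outer_measure_space_def positive_def increasing_def countably_subadditive_def
    by (auto intro: hausdorff_outer_mono hausdorff_outer_UN)
  then have ms: "measure_space UNIV ?L ?H" by (rule P.caratheodory_lemma)
  then interpret L: sigma_algebra UNIV ?L by (simp add: measure_space_def)
  have "F \<in> ?L" if F: "closed F" for F
  proof -
    have "?H (x \<inter> F) + ?H (x - F) = ?H x" for x
      using hausdorff_outer_closed_split[OF F, of s x] hausdorff_outer_Un[of s "x \<inter> F" "x - F"]
      by (intro antisym) (auto simp: Int_Diff_Un)
    then show ?thesis unfolding P.lambda_system_eq by simp
  qed
  then have sub: "sets (borel :: 'a measure) \<subseteq> ?L"
    unfolding borel_eq_closed
    by (subst sets_measure_of) (use L.sigma_sets_subset[of "Collect closed"] in blast)+
  show ?thesis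
    unfolding measure_space_def
  proof (intro conjI)
    show "sigma_algebra UNIV (sets (borel :: 'a measure))"
      using sets.sigma_algebra_axioms[of "borel :: 'a measure"] by simp
    show "positive (sets borel) ?H" by (simp add: positive_def)
    show "countably_additive (sets borel) ?H"
      using ms sub by (auto simp: measure_space_def countably_additive_def)
  qed
qed

lemma sets_hausdorff_measure [simp, measurable_cong]: "sets (hausdorff_measure s) = sets borel"
  by (simp add: hausdorff_measure_def sets.sigma_sets_eq[of borel, simplified])

lemma space_hausdorff_measure [simp]: "space (hausdorff_measure s) = UNIV"
  by (simp add: hausdorff_measure_def)

lemma emeasure_hausdorff_measure:
  assumes "A \<in> sets borel"
  shows "emeasure (hausdorff_measure s) A = hausdorff_outer s A"
proof (rule emeasure_measure_of[OF hausdorff_measure_def])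
  show "positive (sets (hausdorff_measure s)) (hausdorff_outer s)"
    "countably_additive (sets (hausdorff_measure s)) (hausdorff_outer s)"
    using measure_space_hausdorff[of s] unfolding measure_space_def by auto
qed (use assms in auto)


section \<open>Partial derivatives\<close>

definition partial_differentiable :: "'n \<Rightarrow> (real^'n::finite \<Rightarrow> real) \<Rightarrow> real^'n \<Rightarrow> bool" where
  "partial_differentiable k f x \<longleftrightarrow> (\<lambda>t. f (x + t *\<^sub>R axis k 1)) differentiable (at 0)"

definition partial :: "'n \<Rightarrow> (real^'n::finite \<Rightarrow> real) \<Rightarrow> real^'n \<Rightarrow> real" where
  "partial k f x = deriv (\<lambda>t. f (x + t *\<^sub>R axis k 1)) 0"

text \<open>The following are meant for open sets \<open>W\<close> and \<open>D\<close>.\<close>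

definition C1_on :: "(real^'n::finite) set \<Rightarrow> (real^'n \<Rightarrow> real) \<Rightarrow> bool" where
  "C1_on W f \<longleftrightarrow>
     (\<forall>k. (\<forall>x\<in>W. partial_differentiable k f x) \<and> continuous_on W (partial k f))"

definition C2_on :: "(real^'n::finite) set \<Rightarrow> (real^'n \<Rightarrow> real) \<Rightarrow> bool" where
  "C2_on W f \<longleftrightarrow> C1_on W f \<and> (\<forall>k. C1_on W (partial k f))"

definition C1_closure :: "(real^'n::finite) set \<Rightarrow> (real^'n \<Rightarrow> real) \<Rightarrow> bool" where
  "C1_closure D f \<longleftrightarrow> continuous_on (closure D) f \<and> C1_on D f \<and>
     (\<forall>k. \<exists>g. continuous_on (closure D) g \<and> (\<forall>x\<in>D. g x = partial k f x))"

text \<open>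
  Jacobian matrix, with entry \<open>(j, p)\<close> equal to \<open>\<partial>v\<^sub>j / \<partial>x\<^sub>p\<close>, at a point of the closure of \<open>D\<close>:
  at boundary points the derivatives are the continuous extensions of those in \<open>D\<close>
  (the limits exist for components that are \<open>C1_closure D\<close>).
\<close>

definition closure_jacobian ::
    "(real^'n::finite) set \<Rightarrow> (real^'n \<Rightarrow> real^'n) \<Rightarrow> real^'n \<Rightarrow> real^'n^'n" where
  "closure_jacobian D v y = (\<chi> j p. Lim (at y within D) (partial p (\<lambda>z. v z $ j)))"


section \<open>Domains\<close>

definition last_coord :: "real^'n::{finite,linorder} \<Rightarrow> real" where
  "last_coord x = x $ Max UNIV"

definition unit_outward_normal :: "(real^'n::finite) set \<Rightarrow> real^'n \<Rightarrow> real^'n \<Rightarrow> bool" where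
  "unit_outward_normal D y v \<longleftrightarrow>
     (\<exists>W \<phi>. open W \<and> y \<in> W \<and> C1_on W \<phi> \<and> \<phi> y = 0 \<and> D \<inter> W = {z \<in> W. \<phi> z < 0} \<and>
        (let d = (\<chi> k. partial k \<phi> y) in d \<noteq> 0 \<and> v = d /\<^sub>R norm d))"

text \<open>
  \<open>smooth_up_to_edge S\<close>: near each point of its closure, \<open>S\<close> lies on a single \<open>C\<^sup>1\<close> hypersurface.
  In particular a bounded \<open>S\<close> has finite area.
\<close>

definition smooth_up_to_edge :: "(real^'n::finite) set \<Rightarrow> bool" where
  "smooth_up_to_edge S \<longleftrightarrow>
     (\<forall>y\<in>closure S. \<exists>W \<phi>. open W \<and> y \<in> W \<and> C1_on W \<phi> \<and> (\<exists>k. partial k \<phi> y \<noteq> 0) \<and>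
        S \<inter> W \<subseteq> {z. \<phi> z = 0})"

text \<open>
  The edge of the boundary, where the flat piece \<open>\<Sigma>\<close> meets the closure of the surface \<open>S\<close>, is
  negligible for surface measure; elsewhere the boundary is a \<open>C\<^sup>1\<close> hypersurface with \<open>D\<close> on one side
  of it (on \<open>\<Sigma>\<close> minus the edge this is automatic). The condition
  \<open>\<Sigma> \<subseteq> closure (\<Sigma> - closure S)\<close> says that \<open>\<Sigma>\<close> is a genuine hypersurface piece.
\<close>

definition half_space_domain ::
    "(real^'n::{finite,linorder}) set \<Rightarrow> (real^'n::_) set \<Rightarrow> (real^'n::_) set \<Rightarrow> bool" where
  "half_space_domain D \<Sigma> S \<longleftrightarrow>
     open D \<and> D \<noteq> {} \<and> bounded D \<and> connected D \<and> simply_connected D \<and>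
     frontier D = \<Sigma> \<union> S \<and>
     \<Sigma> \<noteq> {} \<and> (\<forall>y\<in>\<Sigma>. last_coord y = 0) \<and> \<Sigma> \<subseteq> closure (\<Sigma> - closure S) \<and>
     (\<forall>y\<in>S. last_coord y > 0) \<and> (\<forall>y\<in>S. \<exists>v. unit_outward_normal D y v) \<and>
     smooth_up_to_edge S \<and>
     emeasure (hausdorff_measure (CARD('n) - 1)) (\<Sigma> \<inter> closure S) = 0"


section \<open>The system and the stress operator\<close>

text \<open>The even permutations of three subscripts in increasing order are the cyclic ones.\<close>

definition levi_civita :: "'n::linorder \<Rightarrow> 'n \<Rightarrow> 'n \<Rightarrow> real" where
  "levi_civita k j p =
     (if k = j \<or> j = p \<or> k = p then 0
      else if k < j \<and> j < p \<or> j < p \<and> p < k \<or> p < k \<and> k < j then 1 else - 1)"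

definition laplacian :: "(real^'n::finite \<Rightarrow> real) \<Rightarrow> real^'n \<Rightarrow> real" where
  "laplacian f x = (\<Sum>p\<in>UNIV. partial p (partial p f) x)"

definition divergence :: "(real^'n::finite \<Rightarrow> real^'n) \<Rightarrow> real^'n \<Rightarrow> real" where
  "divergence v x = (\<Sum>p\<in>UNIV. partial p (\<lambda>z. v z $ p) x)"

definition rot :: "(real^'n::{finite,linorder} \<Rightarrow> real^'n::_) \<Rightarrow> 'n \<Rightarrow> real^'n::_ \<Rightarrow> real" where
  "rot v k x = - (\<Sum>j\<in>UNIV. \<Sum>p\<in>UNIV. levi_civita k j p * partial p (\<lambda>z. v z $ j) x)"

text \<open>The first elastic constant \<open>\<lambda>\<close> is called \<open>lam\<close>, as \<open>\<lambda>\<close> is reserved.\<close>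

definition regular_solution ::
    "real \<Rightarrow> real \<Rightarrow> real \<Rightarrow> real \<Rightarrow> real \<Rightarrow> real \<Rightarrow> real \<Rightarrow> real \<Rightarrow> real \<Rightarrow>
     (real^'n::{finite,linorder}) set \<Rightarrow>
     (real^'n::_ \<Rightarrow> real^'n::_) \<Rightarrow> (real^'n::_ \<Rightarrow> real^'n::_) \<Rightarrow> bool" where
  "regular_solution lam \<mu> \<nu> \<beta> \<epsilon> \<alpha> \<rho> \<sigma> \<theta> D u w \<longleftrightarrow>
     (\<forall>k. C1_closure D (\<lambda>z. u z $ k) \<and> C2_on D (\<lambda>z. u z $ k) \<and>
          C1_closure D (\<lambda>z. w z $ k) \<and> C2_on D (\<lambda>z. w z $ k)) \<and>
     (\<forall>x\<in>D. \<forall>k.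
        (\<mu> + \<alpha>) * laplacian (\<lambda>z. u z $ k) x + (lam + \<mu> - \<alpha>) * partial k (divergence u) x
          + 2 * \<alpha> * rot w k x + \<rho> * \<sigma>\<^sup>2 * u x $ k = 0 \<and>
        (\<nu> + \<beta>) * laplacian (\<lambda>z. w z $ k) x + (\<epsilon> + \<nu> - \<beta>) * partial k (divergence w) x
          + 2 * \<alpha> * rot u k x - 4 * \<alpha> * w x $ k + \<theta> * \<sigma>\<^sup>2 * w x $ k = 0)"

text \<open>
  The two halves of the stress operator in terms of the normal \<open>v\<close>, the Jacobian matrix \<open>J\<close>
  of \<open>u\<close> (respectively \<open>w\<close>) and, for the first half, the value \<open>b\<close> of \<open>w\<close>.
\<close>

definition force_stress ::
    "real \<Rightarrow> real \<Rightarrow> real \<Rightarrow> real^'n::{finite,linorder} \<Rightarrow> real^'n::_^'n::_ \<Rightarrow> real^'n::_ \<Rightarrow> real^'n::_" where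
  "force_stress lam \<mu> \<alpha> v J b = (\<chi> k.
     lam * v $ k * (\<Sum>j\<in>UNIV. J $ j $ j) + (\<mu> - \<alpha>) * (\<Sum>j\<in>UNIV. v $ j * J $ j $ k)
     + (\<mu> + \<alpha>) * (\<Sum>j\<in>UNIV. v $ j * J $ k $ j)
     - 2 * \<alpha> * (\<Sum>j\<in>UNIV. \<Sum>p\<in>UNIV. levi_civita k j p * v $ p * b $ j))"

definition couple_stress ::
    "real \<Rightarrow> real \<Rightarrow> real \<Rightarrow> real^'n::finite \<Rightarrow> real^'n^'n \<Rightarrow> real^'n" where
  "couple_stress \<epsilon> \<nu> \<beta> v J = (\<chi> k.
     \<epsilon> * v $ k * (\<Sum>j\<in>UNIV. J $ j $ j) + (\<nu> - \<beta>) * (\<Sum>j\<in>UNIV. v $ j * J $ j $ k)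
     + (\<nu> + \<beta>) * (\<Sum>j\<in>UNIV. v $ j * J $ k $ j))"

text \<open>
  \<open>|U(y)| + |T(\<partial>\<^sub>y, v)U(y)| \<le> c\<close> for every unit outward normal \<open>v\<close> at \<open>y\<close>. There is at most one;
  where there is none (on the edge) \<open>TU\<close> is undefined and nothing is required, the bound on \<open>|U|\<close>
  there being a consequence of continuity. The norm of a pair is the Euclidean one.
\<close>

definition cauchy_data_le ::
    "real \<Rightarrow> real \<Rightarrow> real \<Rightarrow> real \<Rightarrow> real \<Rightarrow> real \<Rightarrow> (real^'n::{finite,linorder}) set \<Rightarrow>
     (real^'n::_ \<Rightarrow> real^'n::_) \<Rightarrow> (real^'n::_ \<Rightarrow> real^'n::_) \<Rightarrow>
     real^'n::_ \<Rightarrow> real \<Rightarrow> bool" where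
  "cauchy_data_le lam \<mu> \<nu> \<beta> \<epsilon> \<alpha> D u w y c \<longleftrightarrow>
     (\<forall>v. unit_outward_normal D y v \<longrightarrow>
        norm (u y, w y)
        + norm (force_stress lam \<mu> \<alpha> v (closure_jacobian D u y) (w y),
                couple_stress \<epsilon> \<nu> \<beta> v (closure_jacobian D w y)) \<le> c)"

definition inverse_distance_integral :: "(real^'n::finite) set \<Rightarrow> real^'n \<Rightarrow> real" where
  "inverse_distance_integral D x =
     (LINT y:frontier D|hausdorff_measure (CARD('n) - 1). 1 / dist x y ^ CARD('n))"

end

theory Submission
  imports Defs "HOL-Complex_Analysis.Complex_Analysis"
begin

text \<open>
  The Cauchy data are propagated by Green's formula with a fundamental matrix \<open>V\<close> of the system,
  built from a power series in powers of the squared distance and its logarithm.  To estimate \<open>U(x)\<close>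
  the height \<open>x_n\<close> of the pole is replaced by a complex number \<open>z\<close>.  With \<open>X = x_n^0\<close>,
  \<open>L = ln (M / delta)\<close> and \<open>eta = X / (L + 1)\<close>, the part of Green's formula coming from the layer
  \<open>y_n < eta / 2\<close> next to the plane piece is a holomorphic function \<open>f(z)\<close> on \<open>Re z > eta / 2\<close>, and
  \<open>f(x_n)\<close> differs from \<open>U(x)\<close> by a contribution of the small data on \<open>S\<close>.  On \<open>Re z = eta\<close> it is
  bounded by the data \<open>M\<close>.  On \<open>Re z = X + eta\<close>, and on lines \<open>Im z = R\<close> and \<open>Im z = - R\<close>, the kernel has no
  pole over \<open>D\<close>, so the full formula vanishes there and \<open>f\<close> is minus the contribution of the data
  \<open>delta = M exp (- L)\<close>.  A two-constants argument in this rectangle gives \<open>exp (- L x_n / X) M\<close>, up to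
  a constant: the polynomial losses in \<open>x_n / eta\<close> from the singularity of the kernel are absorbed by the
  gain from a factor \<open>exp (tau e sin (pi z / Y))\<close>.  No power of the logarithm is lost, so
  \<open>ln (M / delta) >= ln kappa\<close> is all that is needed for the last factor.

  Normals exist only off the edge of \<open>D\<close>, so Green's formula is used with compactly supported cutoffs,
  and the gradients of the cutoffs are compared with Hausdorff measure on the boundary, for which the
  edge is a null set.
\<close>

text \<open>The kernel is a series because its pole must move to complex heights: each term is a
  polynomial in y - x times powers and a logarithm of the squared distance s, so it continues
  wherever a branch of log s exists, and the equations persist as identities between lists of
  derivatives. Off the real axis |s| may be much smaller than |X|^2, where X is the complexified y -
  x. The kernel then exceeds |X|^(-n) by powers of |X|^2 / |s|; these are the polynomial losses. The
  choice of \<open>eta\<close> makes a shift by \<open>eta\<close> cost only exp (L eta / X) <= e,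
  with X the maximal height here. The divergence theorem on the irregular boundary is replaced by a
  one-sided inequality: a cutoff is built for which the integral of a seminorm of its gradient is at
  most a dimensional constant times the surface integral, plus any prescribed error. The flux in
  Green's formula is dominated by such a seminorm, whose value at a unit normal is bounded by the
  Cauchy data. In the end M exp (- L t) = M^(1-t) delta^t with t = x_n / X. The first factor is at
  most max 1 \<open>M\<^sub>0\<close>, and L >= ln \<kappa> keeps all constants uniform.\<close>

abbreviation (input) usum (binder "\<Oplus>" 10) where "usum f \<equiv> sum f UNIV"

abbreviation (input) lint (binder "LI " 10) where "lint f \<equiv> integral\<^sup>L lborel f"

abbreviation (input) hcod :: "(real^'n) set => ennreal" where "hcod \<equiv> hausdorff_outer (CARD('n)-1)"

section \<open>Radial solutions of the iterated Laplace equation\<close>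

text \<open>
  The functions \<open>g_k = (p_k log s + q_k) s^(k + 1 - nu)\<close> of \<open>s = |y|^2\<close> solve \<open>Delta g_0 = 0\<close> and
  \<open>Delta g_(k + 1) = g_k\<close> in dimension \<open>2 nu\<close>; the pairs are \<open>(p_k, q_k)\<close>.  In \<open>rad\<close>, \<open>l\<close> is a
  branch of \<open>log s\<close>, and the index \<open>j\<close> counts applications of \<open>2 d/ds\<close>.
\<close>
primrec lap_coeff :: "real => nat => real \<times> real" where
 "lap_coeff nu 0 = (if nu = 1 then (1, 0) else (0, 1))"
| "lap_coeff nu (Suc k) =
  (let b = real (Suc k) + 1 - nu; m = 4 * real (Suc k); p = fst (lap_coeff nu k); q = snd (lap_coeff nu k)
   in if b = 0 then (q / m, 0)
    else (p / (m * b), (q - 4 * (real (Suc k) + b) * (p / (m * b))) / (m * b)))"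

primrec rad_coeff :: "real => nat => nat => real \<times> real" where
 "rad_coeff nu k 0 = lap_coeff nu k"
| "rad_coeff nu k (Suc j) =
  (let e = real k + 1 - nu - real j; p = fst (rad_coeff nu k j); q = snd (rad_coeff nu k j)
   in (2 * e * p, 2 * (e * q + p)))"

definition rad :: "real => nat => nat => complex => complex" where
 "rad nu k j l = exp (of_real (real k + 1 - nu - real j) * l)
  * (of_real (fst (rad_coeff nu k j)) * l + of_real (snd (rad_coeff nu k j)))"

text \<open>With s = exp l one has d/dl = s d/ds, while raising j by one applies 2 d/ds; this
  accounts for the factor \<open>exp l / 2\<close>.\<close>

lemma rad_deriv:
 "(rad nu k j has_field_derivative exp l / 2 * rad nu k (Suc j) l) (at l within S)"
proof -
 let ?e = "real k + 1 - nu - real j"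
 have "exp l * exp (of_real (?e - 1) * l) = exp (of_real ?e * l)"
  by (simp add: exp_add[symmetric] algebra_simps)
 hence *: "exp (of_real ?e * l) = exp l * exp (of_real (?e - 1) * l)" by simp
 show ?thesis
  unfolding rad_def[abs_def]
  apply (rule derivative_eq_intros refl)+
  apply (simp only: * rad_coeff.simps Let_def fst_conv snd_conv)
  apply (simp add: field_simps)
  done
qed

text \<open>A logarithm can enter only at the resonant index, where the exponent k + 1 - nu reaches
  0.\<close>

lemma fst_lap_coeff: "real k + 1 < nu ==> fst (lap_coeff nu k) = 0"
 by (induction k) (auto simp: Let_def)

text \<open>On functions f of s the Laplacian in dimension 2 nu is 4 s f'' + 4 nu f'. The entries
  with j = 1 and j = 2 are 2 f' and 4 f'', so the left side is the Laplacian of g_k.\<close>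

lemma rad_laplace:
 "of_real (2 * nu) * rad nu k 1 l + exp l * rad nu k 2 l = (if k = 0 then 0 else rad nu (k - 1) 0 l)"
proof -
 define e where "e = real k + 1 - nu"
 define p where "p = fst (lap_coeff nu k)"
 define q where "q = snd (lap_coeff nu k)"
 have r1: "rad_coeff nu k 1 = (2 * e * p, 2 * (e * q + p))"
  by (simp add: Let_def e_def p_def q_def)
 have r2: "rad_coeff nu k 2 = (2 * (e - 1) * (2 * e * p), 2 * ((e - 1) * (2 * (e * q + p)) + 2 * e * p))"
  by (simp add: Let_def e_def p_def q_def numeral_2_eq_2 algebra_simps)
 have ex: "exp l * exp (of_real (e - 2) * l) = exp (of_real (e - 1) * l)"
  by (simp add: exp_add[symmetric] algebra_simps)
 have k1: "real k + 1 - nu - real 1 = e - 1" "real k + 1 - nu - real 2 = e - 2" by (simp_all add: e_def)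
 have "of_real (2 * nu) * rad nu k 1 l + exp l * rad nu k 2 l
  = exp (of_real (e - 1) * l) * (of_real (2 * nu) * (of_real (2 * e * p) * l + of_real (2 * (e * q + p)))
    + (of_real (2 * (e - 1) * (2 * e * p)) * l + of_real (2 * ((e - 1) * (2 * (e * q + p)) + 2 * e * p))))"
  unfolding rad_def r1 r2 k1 fst_conv snd_conv ex[symmetric]
  by (simp only: k1 ring_distribs mult_ac)
 also have "... = exp (of_real (e - 1) * l) *
  (of_real (4 * real k * e * p) * l + of_real (4 * real k * (e * q + p) + 4 * e * p))"
  by (simp add: e_def algebra_simps)
 also have "... = (if k = 0 then 0 else rad nu (k - 1) 0 l)"
 proof (cases k)
  case 0
  hence "e * p = 0" by (auto simp: p_def e_def)
  hence "complex_of_real e * of_real p = 0" by (metis of_real_0 of_real_mult)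
  thus ?thesis using 0 by simp
 next
  case (Suc i)
  define p' where "p' = fst (lap_coeff nu i)"
  define q' where "q' = snd (lap_coeff nu i)"
  have "4 * real k * e * p = p' & 4 * real k * (e * q + p) + 4 * e * p = q'"
  \<comment> \<open>At e = 0 the equation for the logarithmic coefficient forces p' = 0, which holds
    because no logarithm occurs before the resonance.\<close>
  proof (cases "e = 0")
   case True
   hence "real i + 1 < nu" using Suc by (simp add: e_def)
   hence "p' = 0" unfolding p'_def by (rule fst_lap_coeff)
   moreover have "p = q' / (4 * real k)" using True Suc by (simp add: p_def e_def Let_def q'_def)
   ultimately show ?thesis using True Suc by simp
  next
   case False
   define m where "m = 4 * real k * e"
   have m0: "m ~= 0" using False Suc by (simp add: m_def)
   have "p = p' / m" "q = (q' - 4 * (real k + e) * (p' / m)) / m"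
    using Suc False by (auto simp: p_def q_def e_def Let_def q'_def p'_def m_def)
   hence "m * p = p'" "m * q = q' - 4 * (real k + e) * p" using m0 by auto
   thus ?thesis by (simp add: m_def algebra_simps)
  qed
  moreover have "real (k - 1) + 1 - nu - real 0 = e - 1" using Suc by (simp add: e_def)
  ultimately show ?thesis using Suc
   unfolding rad_def rad_coeff.simps by (simp only: p'_def q'_def) simp
 qed
 finally show ?thesis .
qed

text \<open>Since 2 nu is an integer, the denominator b is a multiple of 1/2, so a nonzero b has
  modulus at least 1/2; for large s it is at least s/2. Hence s <= c |b|, there are no small
  denominators, and each step of the recursion costs only O(1 / s^2).\<close>

lemma lap_coeff_bound:
 assumes "2 * nu : \<nat>"
 shows "\<bar>fst (lap_coeff nu k)\<bar> + \<bar>snd (lap_coeff nu k)\<bar> <= ((2 + 4 * nu) * (4 + 4 * nu)) ^ k / (fact k)^2"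
proof (induction k)
 case 0
 thus ?case by simp
next
 case (Suc k)
 define c where "c = 2 + 4 * nu"
 obtain N where N: "2 * nu = real N" using assms by (auto simp: Nats_def)
 hence nu: "0 <= nu" by simp
 define b where "b = real (Suc k) + 1 - nu"
 define s where "s = real (Suc k)"
 define p where "p = fst (lap_coeff nu k)"
 define q where "q = snd (lap_coeff nu k)"
 have s: "s >= 1" by (simp add: s_def)
 have cc: "(2 + 4 * nu) * (4 + 4 * nu) = c * (c + 2)" by (simp add: c_def algebra_simps)
 have c: "c >= 2" using nu by (simp add: c_def)
 have step: "\<bar>fst (lap_coeff nu (Suc k))\<bar> + \<bar>snd (lap_coeff nu (Suc k))\<bar> <= c * (c + 2) / s^2 * (\<bar>p\<bar> + \<bar>q\<bar>)"
 proof (cases "b = 0")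
  case True
  hence l: "lap_coeff nu (Suc k) = (q / (4 * s), 0)"
   unfolding lap_coeff.simps Let_def b_def s_def q_def by simp
  have "s <= c" using True s nu by (simp add: b_def s_def c_def)
  hence "s * 1 <= c * (4 * (c + 2))" using c by (intro mult_mono) auto
  hence "1 / (4 * s) <= c * (c + 2) / s^2" using s c
   by (simp add: field_simps power2_eq_square)
  hence "\<bar>q\<bar> * (1 / (4 * s)) <= \<bar>q\<bar> * (c * (c + 2) / s^2)" by (rule mult_left_mono) simp
  also have "... <= (\<bar>p\<bar> + \<bar>q\<bar>) * (c * (c + 2) / s^2)" using c by (intro mult_right_mono) auto
  finally show ?thesis unfolding l using s by (simp add: abs_mult mult.commute)
 next
  case False
  have bc: "s <= c * \<bar>b\<bar>"
  proof (cases "s >= 2 * nu")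
   case True
   hence "b >= s / 2" by (simp add: b_def s_def)
   hence "2 * \<bar>b\<bar> >= s" by linarith
   moreover have "c * \<bar>b\<bar> >= 2 * \<bar>b\<bar>" using c by (intro mult_right_mono) auto
   ultimately show ?thesis by linarith
  next
   case F: False
   define i where "i = 2 * int (Suc k) + 2 - int N"
   have bi: "2 * b = real_of_int i" using N by (simp add: b_def i_def)
   hence "i ~= 0" using False by auto
   hence "1 <= \<bar>i\<bar>" by linarith
   hence "\<bar>2 * b\<bar> >= 1" unfolding bi by linarith
   hence "\<bar>b\<bar> >= 1 / 2" by linarith
   hence "c * \<bar>b\<bar> >= c * (1 / 2)" using c by (intro mult_left_mono) auto
   thus ?thesis using F by (simp add: c_def)
  qed
  have b0: "\<bar>b\<bar> > 0" using False by simp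
  define h where "h = 1 / (4 * s * b)"
  define e where "e = 1 / b + 1 / s"
  have "lap_coeff nu (Suc k) = (p / (4 * s * b), (q - 4 * (s + b) * (p / (4 * s * b))) / (4 * s * b))"
   using False unfolding lap_coeff.simps Let_def b_def s_def q_def p_def by simp
  also have "... = (h * p, h * (q - e * p))" using False s by (simp add: h_def e_def field_simps)
  finally have l: "lap_coeff nu (Suc k) = (h * p, h * (q - e * p))" .
  have h: "\<bar>h\<bar> <= c / (4 * s^2)" using bc s b0 by (simp add: h_def abs_mult field_simps power2_eq_square)
  have "\<bar>1 / b\<bar> <= c" "\<bar>1 / s\<bar> <= 1" using bc s b0 by (simp_all add: field_simps)
  hence "\<bar>e\<bar> <= c + 1" unfolding e_def by linarith
  hence "\<bar>e * p\<bar> <= (c + 1) * \<bar>p\<bar>" by (simp add: abs_mult mult_right_mono)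
  moreover have "\<bar>q\<bar> * 1 <= \<bar>q\<bar> * (c + 2)" using c by (intro mult_left_mono) auto
  ultimately have "\<bar>p\<bar> + \<bar>q - e * p\<bar> <= (c + 2) * (\<bar>p\<bar> + \<bar>q\<bar>)" by (simp add: algebra_simps) linarith
  hence "\<bar>h\<bar> * (\<bar>p\<bar> + \<bar>q - e * p\<bar>) <= c / (4 * s^2) * ((c + 2) * (\<bar>p\<bar> + \<bar>q\<bar>))"
   using h c by (intro mult_mono) auto
  also have "... <= c * (c + 2) / s^2 * (\<bar>p\<bar> + \<bar>q\<bar>)" using c s by (simp add: field_simps)
  finally have "\<bar>h * p\<bar> + \<bar>h * (q - e * p)\<bar> <= c * (c + 2) / s^2 * (\<bar>p\<bar> + \<bar>q\<bar>)" by (simp add: abs_mult distrib_left)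
  thus ?thesis unfolding l fst_conv snd_conv .
 qed
 also have "... <= c * (c + 2) / s^2 * ((c * (c + 2)) ^ k / (fact k)^2)"
  using Suc.IH[unfolded cc] c by (intro mult_left_mono) (auto simp: p_def q_def)
 also have "... = (c * (c + 2)) ^ Suc k / (fact (Suc k))^2"
  unfolding power_Suc fact_Suc power_mult_distrib of_nat_mult times_divide_times_eq s_def by simp
 finally show ?case unfolding cc .
qed

text \<open>The range j <= k + 6 is what the series requires: on lists of length at most 4,
  \<open>tm\<close> at index k differentiates up to k times more, and the correction in
  \<open>vt\<close> twice more.\<close>

lemma rad_coeff_bound:
 assumes "nu >= 0" "j <= k + 6"
 shows "\<bar>fst (rad_coeff nu k j)\<bar> + \<bar>snd (rad_coeff nu k j)\<bar>
  <= (\<bar>fst (lap_coeff nu k)\<bar> + \<bar>snd (lap_coeff nu k)\<bar>) * (2 * (nu + 8) * (real k + 1)) ^ j"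
 using assms(2)
proof (induction j)
 case (Suc j)
 define e where "e = real k + 1 - nu - real j"
 define p where "p = fst (rad_coeff nu k j)"
 define q where "q = snd (rad_coeff nu k j)"
 have "rad_coeff nu k (Suc j) = (2 * e * p, 2 * (e * q + p))" by (simp add: e_def p_def q_def Let_def)
 hence "\<bar>fst (rad_coeff nu k (Suc j))\<bar> + \<bar>snd (rad_coeff nu k (Suc j))\<bar> = 2 * \<bar>e\<bar> * \<bar>p\<bar> + 2 * \<bar>e * q + p\<bar>"
  by (simp only: fst_conv snd_conv abs_mult)
 also have "... <= 2 * \<bar>e\<bar> * \<bar>p\<bar> + 2 * (\<bar>e\<bar> * \<bar>q\<bar> + \<bar>p\<bar>)"
  using abs_triangle_ineq[of "e * q" p] by (simp add: abs_mult)
 also have "... <= 2 * (\<bar>e\<bar> + 1) * (\<bar>p\<bar> + \<bar>q\<bar>)" by (simp add: algebra_simps)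
 also have "... <= 2 * ((nu + 8) * (real k + 1)) * (\<bar>p\<bar> + \<bar>q\<bar>)"
 proof (intro mult_right_mono mult_left_mono)
  have "\<bar>e\<bar> + 1 <= real k + nu + 8"
   using Suc.prems assms(1) unfolding e_def by linarith
  also have "... <= (nu + 8) * (real k + 1)" using assms(1) by (simp add: algebra_simps)
  finally show "\<bar>e\<bar> + 1 <= (nu + 8) * (real k + 1)" .
 qed auto
 also have "... <= 2 * ((nu + 8) * (real k + 1)) * ((\<bar>fst (lap_coeff nu k)\<bar> + \<bar>snd (lap_coeff nu k)\<bar>) * (2 * (nu + 8) * (real k + 1)) ^ j)"
  using Suc.IH Suc.prems assms(1) unfolding p_def q_def by (intro mult_left_mono) simp_all
 finally show ?case by (simp only: power_Suc mult_ac)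
qed simp

lemma norm_rad_le:
 assumes "2 * nu : \<nat>" "j <= k + 6"
 shows "norm (rad nu k j l) <=
  ((2 + 4 * nu) * (4 + 4 * nu)) ^ k / (fact k)^2 * (1 + norm l) * exp ((real k + 1 - nu) * Re l)
   * (2 * (nu + 8) * (real k + 1) / exp (Re l)) ^ j"
proof -
 obtain N where N: "2 * nu = real N" using assms by (auto simp: Nats_def)
 hence nu: "0 <= nu" by simp
 define p where "p = fst (rad_coeff nu k j)"
 define q where "q = snd (rad_coeff nu k j)"
 let ?S = "((2 + 4 * nu) * (4 + 4 * nu)) ^ k / (fact k)^2"
 have pq: "\<bar>p\<bar> + \<bar>q\<bar> <= ?S * (2 * (nu + 8) * (real k + 1)) ^ j"
  unfolding p_def q_def using nu
  by (intro order_trans[OF rad_coeff_bound[OF nu assms(2)]] mult_right_mono lap_coeff_bound assms) auto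
 have e: "exp ((real k + 1 - nu - real j) * Re l) = exp ((real k + 1 - nu) * Re l) / exp (Re l) ^ j"
  by (simp add: exp_diff[symmetric] exp_of_nat_mult[symmetric] algebra_simps)
 have "norm (rad nu k j l) = exp ((real k + 1 - nu - real j) * Re l) * norm (of_real p * l + of_real q)"
  by (simp add: rad_def norm_mult p_def q_def)
 also have "norm (of_real p * l + of_real q) <= \<bar>p\<bar> * norm l + \<bar>q\<bar>"
  by (metis norm_mult norm_of_real norm_triangle_ineq)
 also have "... <= (\<bar>p\<bar> + \<bar>q\<bar>) * (1 + norm l)" by (simp add: algebra_simps)
 also have "... <= ?S * (2 * (nu + 8) * (real k + 1)) ^ j * (1 + norm l)"
  by (intro mult_right_mono pq) auto
 finally have "norm (rad nu k j l) <= exp ((real k + 1 - nu - real j) * Re l) * (?S * (2 * (nu + 8) * (real k + 1)) ^ j * (1 + norm l))"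
  by simp
 also have "... = ?S * (1 + norm l) * exp ((real k + 1 - nu) * Re l) * (2 * (nu + 8) * (real k + 1) / exp (Re l)) ^ j"
  unfolding e power_divide by (simp only: mult_ac times_divide_eq_left times_divide_eq_right)
 finally show ?thesis .
qed

text \<open>
  For \<open>j = 0\<close> this is the partial derivative of \<open>g_k(sum_i X_i^2)\<close> at \<open>X\<close> along the coordinates listed in \<open>I\<close>.
\<close>
function rder :: "real => nat => complex^'n => complex => 'n list => nat => complex" where
 "rder nu k X l [] j = rad nu k j l"
| "rder nu k X l (i # I) j = X $ i * rder nu k X l I (Suc j)
  + of_nat (count_list I i) * rder nu k X l (remove1 i I) (Suc j)"
 by pat_completeness auto
termination
 by (relation "Wellfounded.measure (%(nu, k, X, l, I, j). length I)") (auto simp: length_remove1)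

definition sq_sum :: "complex^'n => complex" where
 "sq_sum X = (\<Oplus>i. (X $ i)^2)"

lemma rder_swap: "rder nu k X l (a # b # I) j = rder nu k X l (b # a # I) j"
 by (cases "a = b") (auto simp: remove1_commute count_list_remove1 algebra_simps)

lemma count_list_mset: "count_list xs x = count (mset xs) x"
 by (induction xs) auto

text \<open>The recursion peels off the head, so the symmetry of derivatives is not built in. Lists
  with different heads are both brought to the form that begins with these two heads, where
  \<open>rder_swap\<close> applies; the tails are shorter.\<close>

lemma rder_perm: "mset I = mset J ==> rder nu k X l I j = rder nu k X l J j"
proof (induction "length I" arbitrary: I J j rule: less_induct)
 case less
 have cong: "rder nu k X l (c # I') j = rder nu k X l (c # J') j"
  if "length (c # I') <= length I" "mset I' = mset J'" for c I' J'
 proof -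
  have "length (remove1 c I') < length I" "length I' < length I"
   using that(1) by (auto simp: length_remove1)
  moreover have "mset (remove1 c I') = mset (remove1 c J')" using that(2) by simp
  ultimately show ?thesis using less.hyps[of I' J'] less.hyps[of "remove1 c I'" "remove1 c J'"] that(2)
   by (simp add: count_list_mset)
 qed
 show ?case
 proof (cases I)
  case Nil
  thus ?thesis using less.prems by simp
 next
  case (Cons a I')
  then obtain b J' where J: "J = b # J'" using less.prems by (cases J) auto
  show ?thesis
  proof (cases "a = b")
   case True
   thus ?thesis using cong[of a I' J'] less.prems Cons J by simp
  next
   case False
   define K where "K = remove1 b I'"
   have m: "add_mset a (mset I') = add_mset b (mset J')" using less.prems Cons J by simp
   have bI: "b \<in># mset I'" using m False by (metis insert_noteq_member)
   have I': "mset I' = mset (b # K)" using bI by (simp add: K_def)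
   have J': "mset J' = mset (a # K)" using m I' by (simp add: add_mset_commute)
   have len: "length I' = Suc (length K)" using I' by (metis length_Cons size_mset)
   have len2: "length J = length I" using less.prems by (metis size_mset)
   have "rder nu k X l I j = rder nu k X l (a # b # K) j"
    unfolding Cons by (rule cong) (use I' Cons in auto)
   also have "... = rder nu k X l (b # a # K) j" by (rule rder_swap)
   also have "... = rder nu k X l J j"
    unfolding J by (rule cong) (use J' len Cons in auto)
   finally show ?thesis .
  qed
 qed
qed

text \<open>The recursion unfolded at the second index while a new derivative stands in front. The
  last summand is the product rule acting on the explicit factor \<open>X $ i'\<close>.\<close>

lemma rder_Cons_Cons:
 "rder nu k X l (i # i' # I) j = X $ i' * rder nu k X l (i # I) (Suc j)
  + of_nat (count_list I i') * rder nu k X l (i # remove1 i' I) (Suc j)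
  + (if i = i' then rder nu k X l I (Suc j) else 0)"
proof (cases "i = i'")
 case True
 have "of_nat (count_list I i) * rder nu k X l (i # remove1 i I) (Suc j)
  = of_nat (count_list I i) * rder nu k X l I (Suc j)"
 proof (cases "i : set I")
  case T: True
  hence "mset (i # remove1 i I) = mset I" by simp
  thus ?thesis by (metis rder_perm)
 next
  case False
  thus ?thesis by (simp add: count_list_0_iff)
 qed
 moreover have "rder nu k X l (i # i # I) j =
   X $ i * rder nu k X l (i # I) (Suc j) + (of_nat (count_list I i) + 1) * rder nu k X l I (Suc j)"
  unfolding rder.simps(2)[of nu k X l i "i # I"] by simp
 ultimately show ?thesis
  unfolding True by (simp only: if_True simp_thms distrib_right mult_1 add.assoc)
next
 case False
 have "rder nu k X l (i # i' # I) j = rder nu k X l (i' # i # I) j" by (rule rder_swap)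
 also have "... = X $ i' * rder nu k X l (i # I) (Suc j)
  + of_nat (count_list I i') * rder nu k X l (i # remove1 i' I) (Suc j)"
  unfolding rder.simps(2)[of nu k X l i' "i # I"] using False by simp
 finally show ?thesis using False by (simp del: rder.simps)
qed

text \<open>Chain rule along a curve X with a chosen logarithm l of the squared distance. The
  hypothesis on \<open>l'\<close> is the differentiated form of exp l = sum_i X_i^2, and is all that
  the proof uses of that relation.\<close>

lemma rder_deriv:
 fixes X :: "complex => complex^'n"
 assumes X: "!!i. ((%t. X t $ i) has_field_derivative d i) (at t within S)"
  and l: "(l has_field_derivative l') (at t within S)"
  and e: "exp (l t) * l' = 2 * (\<Oplus>i. X t $ i * d i)"
 shows "((%t. rder nu k (X t) (l t) I j) has_field_derivative
     (\<Oplus>i. d i * rder nu k (X t) (l t) (i # I) j)) (at t within S)"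
proof (induction "length I" arbitrary: I j rule: less_induct)
 case less
 show ?case
 proof (cases I)
  case Nil
  have "((%t. rad nu k j (l t)) has_field_derivative (exp (l t) / 2 * rad nu k (Suc j) (l t)) * l') (at t within S)"
   by (rule DERIV_chain2[OF rad_deriv l])
  moreover have "(exp (l t) / 2 * rad nu k (Suc j) (l t)) * l' = (\<Oplus>i. d i * (X t $ i * rad nu k (Suc j) (l t)))"
  proof -
   have "(exp (l t) / 2 * rad nu k (Suc j) (l t)) * l' = (exp (l t) * l') / 2 * rad nu k (Suc j) (l t)" by simp
   also have "... = (\<Oplus>i. d i * (X t $ i * rad nu k (Suc j) (l t)))"
    unfolding e by (simp add: sum_distrib_left mult_ac)
   finally show ?thesis .
  qed
  ultimately show ?thesis using Nil by simp
 next
  case (Cons i' I')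
  have len: "length I' < length I" "length (remove1 i' I') < length I"
   using Cons by (auto simp: length_remove1)
  let ?r = "rder nu k (X t) (l t)"
  have eq: "(\<Oplus>i. d i * ?r (i # i' # I') j)
   = d i' * ?r I' (Suc j) + (\<Oplus>i. d i * ?r (i # I') (Suc j)) * X t $ i'
    + of_nat (count_list I' i') * (\<Oplus>i. d i * ?r (i # remove1 i' I') (Suc j))"
  proof -
   have "d i * ?r (i # i' # I') j = (if i = i' then d i' * ?r I' (Suc j) else 0)
    + (d i * ?r (i # I') (Suc j) * X t $ i'
    + of_nat (count_list I' i') * (d i * ?r (i # remove1 i' I') (Suc j)))" for i
    unfolding rder_Cons_Cons[of nu k "X t" "l t" i i' I' j] by (auto simp: algebra_simps simp del: rder.simps)
   hence "(\<Oplus>i. d i * ?r (i # i' # I') j) = (\<Oplus>i. (if i = i' then d i' * ?r I' (Suc j) else 0)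
    + (d i * ?r (i # I') (Suc j) * X t $ i'
    + of_nat (count_list I' i') * (d i * ?r (i # remove1 i' I') (Suc j))))"
    by (intro sum.cong) auto
   thus ?thesis
    by (simp add: sum.distrib sum_distrib_left sum_distrib_right del: rder.simps)
  qed
  have f: "(%t. rder nu k (X t) (l t) I j) = (%t. X t $ i' * rder nu k (X t) (l t) I' (Suc j)
  + of_nat (count_list I' i') * rder nu k (X t) (l t) (remove1 i' I') (Suc j))"
   by (simp add: Cons)
  show ?thesis
   unfolding f unfolding Cons eq
   by (intro DERIV_add DERIV_mult X less.hyps DERIV_cmult len)
 qed
qed

text \<open>Differentiating the case j = 0 repeatedly in l. Each derivative that falls on the factor
  \<open>exp l\<close> leaves two more copies of the term in \<open>Suc j\<close>, which accumulate
  to 2 j.\<close>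

lemma rad_laplace_general:
 "of_real (2 * nu) * rad nu k (Suc j) l + exp l * rad nu k (Suc (Suc j)) l
  = (if k = 0 then 0 else rad nu (k - 1) j l) - of_nat (2 * j) * rad nu k (Suc j) l"
proof (induction j arbitrary: l)
 case 0
 thus ?case using rad_laplace[of nu k l] by (simp add: numeral_2_eq_2)
next
 case (Suc j)
 let ?r = "rad nu k"
 let ?q = "%j l. if k = 0 then 0 else rad nu (k - 1) j l"
 have d: "((%l. of_real (2 * nu) * ?r (Suc j) l + exp l * ?r (Suc (Suc j)) l) has_field_derivative
  of_real (2 * nu) * (exp l / 2 * ?r (Suc (Suc j)) l) + (exp l * ?r (Suc (Suc j)) l + (exp l / 2 * ?r (Suc (Suc (Suc j))) l) * exp l)) (at l)"
  by (intro DERIV_add DERIV_cmult DERIV_mult rad_deriv DERIV_exp)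
 have d2: "((%l. ?q j l - of_nat (2 * j) * ?r (Suc j) l) has_field_derivative
  exp l / 2 * ?q (Suc j) l - of_nat (2 * j) * (exp l / 2 * ?r (Suc (Suc j)) l)) (at l)"
  using rad_deriv[of nu "k - 1" j l UNIV]
  by (intro DERIV_diff DERIV_cmult rad_deriv) auto
 have "of_real (2 * nu) * (exp l / 2 * ?r (Suc (Suc j)) l) + (exp l * ?r (Suc (Suc j)) l + (exp l / 2 * ?r (Suc (Suc (Suc j))) l) * exp l)
  = exp l / 2 * ?q (Suc j) l - of_nat (2 * j) * (exp l / 2 * ?r (Suc (Suc j)) l)"
  by (rule DERIV_unique[OF d]) (use d2 in \<open>simp only: Suc.IH\<close>)
 hence "exp l / 2 * (of_real (2 * nu) * ?r (Suc (Suc j)) l + exp l * ?r (Suc (Suc (Suc j))) l)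
  = exp l / 2 * (?q (Suc j) l - of_nat (2 * Suc j) * ?r (Suc (Suc j)) l)"
  by (simp add: algebra_simps)
 thus ?case by (simp only: mult_cancel_left) simp
qed

text \<open>The Laplacian commutes with the derivatives listed in I. The series uses j = 0, but the
  recursion of \<open>rder\<close> raises j, so the induction carries the correction in 2 j.\<close>

lemma rder_laplace:
 fixes X :: "complex^'n"
 assumes nu: "2 * nu = real CARD('n)" and e: "exp l = sq_sum X"
 shows "(\<Oplus>p. rder nu k X l (p # p # I) j)
  = (if k = 0 then 0 else rder nu (k - 1) X l I j) - of_nat (2 * j) * rder nu k X l I (Suc j)"
proof (induction "length I" arbitrary: I j rule: less_induct)
 case less
 let ?r = "rder nu k X l"
 let ?q = "%I j. if k = 0 then 0 else rder nu (k - 1) X l I j"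
 show ?case
 proof (cases I)
  case Nil
  have "(\<Oplus>p. ?r [p, p] j) = of_real (2 * nu) * rad nu k (Suc j) l + exp l * rad nu k (Suc (Suc j)) l"
   unfolding nu e sq_sum_def by (simp add: sum.distrib sum_distrib_left power2_eq_square mult_ac)
  thus ?thesis using rad_laplace_general[of nu k j l] Nil by simp
 next
  case (Cons i I')
  have len: "length I' < length I" "length (remove1 i I') < length I"
   using Cons by (auto simp: length_remove1)
  have "?r (p # p # i # I') j = X $ i * ?r (p # p # I') (Suc j)
    + of_nat (count_list I' i) * ?r (p # p # remove1 i I') (Suc j)
    + (if p = i then 2 * ?r (i # I') (Suc j) else 0)" for p
  proof -
   have "?r (p # p # i # I') j = ?r (p # i # p # I') j" by (rule rder_perm) simp
   also have "... = X $ i * ?r (p # p # I') (Suc j) + of_nat (count_list (p # I') i) * ?r (p # remove1 i (p # I')) (Suc j)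
    + (if p = i then ?r (p # I') (Suc j) else 0)" by (rule rder_Cons_Cons)
   also have "of_nat (count_list (p # I') i) * ?r (p # remove1 i (p # I')) (Suc j) =
    of_nat (count_list I' i) * ?r (p # p # remove1 i I') (Suc j) + (if p = i then ?r (p # I') (Suc j) else 0)"
   proof (cases "p = i")
    case True
    show ?thesis
    proof (cases "i : set I'")
     case T: True
     hence "mset (i # i # remove1 i I') = mset (i # I')" by simp
     hence "?r (i # i # remove1 i I') (Suc j) = ?r (i # I') (Suc j)" by (rule rder_perm)
     thus ?thesis using True by (simp add: algebra_simps del: rder.simps)
    next
     case False
     thus ?thesis using True by (simp add: count_list_0_iff del: rder.simps)
    qed
   next
    case False
    thus ?thesis by (simp del: rder.simps)
   qed
   finally show ?thesis by (simp del: rder.simps)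
  qed
  hence "(\<Oplus>p. ?r (p # p # i # I') j) = (\<Oplus>p. X $ i * ?r (p # p # I') (Suc j)
    + of_nat (count_list I' i) * ?r (p # p # remove1 i I') (Suc j)
    + (if p = i then 2 * ?r (i # I') (Suc j) else 0))" by (intro sum.cong) auto
  also have "... = X $ i * (\<Oplus>p. ?r (p # p # I') (Suc j))
    + of_nat (count_list I' i) * (\<Oplus>p. ?r (p # p # remove1 i I') (Suc j)) + 2 * ?r (i # I') (Suc j)"
   by (simp add: sum.distrib sum_distrib_left del: rder.simps)
  also have "... = X $ i * (?q I' (Suc j) - of_nat (2 * Suc j) * ?r I' (Suc (Suc j)))
    + of_nat (count_list I' i) * (?q (remove1 i I') (Suc j) - of_nat (2 * Suc j) * ?r (remove1 i I') (Suc (Suc j))) + 2 * ?r (i # I') (Suc j)"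
   by (simp only: less.hyps[OF len(1)] less.hyps[OF len(2)])
  also have "... = ?q (i # I') j - of_nat (2 * j) * ?r (i # I') (Suc j)"
   by (simp add: algebra_simps)
  finally show ?thesis by (simp only: Cons)
 qed
qed

lemma norm_sq_sum_le: "norm (sq_sum X) <= (norm X)^2"
proof -
 have "norm (sq_sum X) <= (\<Oplus>i. norm ((X $ i)^2))" unfolding sq_sum_def by (rule norm_sum)
 also have "... = (norm X)^2"
  by (simp add: norm_vec_def L2_set_def norm_power sum_nonneg)
 finally show ?thesis .
qed

text \<open>Each entry of the list costs a factor 2 |X| Y, half of it for either summand of the
  recursion. The multiplicity of an index, at most k + 6, is paid for by the hypothesis k + 6 <= 2
  |X|^2 Y.\<close>

lemma norm_rder_le:
 fixes X :: "complex^'n"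
 assumes b: "!!j. j <= k + 6 ==> norm (rad nu k j l) <= b * Y ^ j" and "0 <= b" "0 <= Y"
  and Y: "real k + 6 <= 2 * (norm X)^2 * Y" and "length I + j <= k + 6"
 shows "norm (rder nu k X l I j) <= b * Y ^ j * (2 * norm X * Y) ^ length I"
 using assms(5)
proof (induction "length I" arbitrary: I j rule: less_induct)
 case less
 show ?case
 proof (cases I)
  case Nil
  thus ?thesis using b[of j] less.prems by simp
 next
  case (Cons i I')
  have len: "length I' < length I" "length (remove1 i I') < length I"
   using Cons by (auto simp: length_remove1)
  define N where "N = norm X"
  define B where "B = b * Y ^ j * (2 * N * Y) ^ length I"
  have N0: "0 <= N" by (simp add: N_def)
  have B0: "0 <= B" using assms N0 by (simp add: B_def)
  have "norm (X $ i * rder nu k X l I' (Suc j)) <= N * (b * Y ^ Suc j * (2 * N * Y) ^ length I')"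
   unfolding norm_mult N_def using less.prems Cons
   by (intro mult_mono Finite_Cartesian_Product.norm_nth_le less.hyps len) auto
  also have "... = B / 2" by (simp add: B_def Cons)
  finally have 1: "norm (X $ i * rder nu k X l I' (Suc j)) <= B / 2" .
  have 2: "norm (of_nat (count_list I' i) * rder nu k X l (remove1 i I') (Suc j)) <= B / 2"
  proof (cases "i : set I'")
   case False
   thus ?thesis using B0 by (simp add: count_list_0_iff)
  next
   case True
   define m where "m = length (remove1 i I')"
   have m: "length I' = Suc m" using True by (simp add: m_def length_remove1) (metis Suc_pred length_pos_if_in_set)
   have cl: "real (count_list I' i) <= real k + 6" using count_le_length[of I' i] Cons less.prems by simp
   have "norm (of_nat (count_list I' i) * rder nu k X l (remove1 i I') (Suc j)) <=
    real (count_list I' i) * (b * Y ^ Suc j * (2 * N * Y) ^ m)"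
    unfolding norm_mult m_def N_def norm_of_nat using less.prems Cons m m_def
    by (intro mult_left_mono less.hyps len) auto
   also have "... <= (2 * N^2 * Y) * (b * Y ^ Suc j * (2 * N * Y) ^ m)"
    using cl Y assms N0 by (intro mult_right_mono) (auto simp: N_def)
   also have "... = B / 2"
    by (simp add: B_def Cons m power2_eq_square)
   finally show ?thesis .
  qed
  have "norm (rder nu k X l I j) <= B / 2 + B / 2"
   unfolding Cons rder.simps by (intro norm_triangle_le add_mono 1 2)
  thus ?thesis by (simp add: B_def N_def)
 qed
qed

lemma power_le_exp_fact: "x >= 0 ==> x ^ n <= fact n * exp (x::real)"
 using exp_lower_Taylor_quadratic[of x]
proof -
 assume x: "x >= 0"
 have "x ^ n / fact n <= (\<Sum>i<Suc n. x ^ i / fact i)" using x by (intro member_le_sum) auto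
 also have "... <= exp x"
  using sum_le_suminf[OF summable_exp[of x], of "{..<Suc n}"] x
  by (simp add: exp_def divide_inverse scaleR_conv_of_real mult.commute)
 finally show ?thesis by (simp add: field_simps)
qed

text \<open>Up to k + 6 differentiations cost about (k + 1)^(k + 6), which by x^k <= k! exp x
  consumes one of the two factorials of \<open>lap_coeff_bound\<close>. The other one makes the
  series converge.\<close>

lemma rder_bound:
 assumes nu: "2 * nu = real CARD('n)"
 obtains C :: real where "C >= 1"
  "!!k (X :: complex^'n) l I. exp l = sq_sum X ==> length (I :: 'n list) <= k + 6 ==>
   norm (rder nu k X l I 0) <= C ^ Suc k / fact k * (1 + norm l) * exp ((real k + 1 - nu) * Re l)
    * (norm X / exp (Re l)) ^ length I"
proof -
 define A where "A = (2 + 4 * nu) * (4 + 4 * nu)"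
 define c where "c = 4 * (nu + 8)"
 \<comment> \<open>720 is 6!: the power k + 6 is split into k and 6, each bounded by a factorial
   times exp (k + 1). The product of the two exponentials gives \<open>exp 2\<close>.\<close>
 define C where "C = 720 * c ^ 6 * exp 2 * A * c"
 have nu0: "nu >= 0" using nu by linarith
 have c1: "c >= 1" using nu0 by (simp add: c_def)
 have A1: "A >= 1" unfolding A_def using nu0 mult_mono[of 1 "2 + 4 * nu" 1 "4 + 4 * nu"] by simp
 have e1: "exp (2::real) >= 1" by simp
 have cc: "720 * c ^ 6 * exp 2 >= (1::real)"
  using c1 e1 mult_mono[of 1 "720 * c ^ 6" 1 "exp 2"] one_le_power[OF c1, of 6] by simp
 have C1: "C >= 1"
  unfolding C_def using cc A1 c1 mult_mono[of 1 "720 * c ^ 6 * exp 2" 1 A] mult_mono[of 1 "720 * c ^ 6 * exp 2 * A" 1 c] by simp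
 show thesis
 proof (rule that[OF C1])
  fix k and X :: "complex^'n" and l and I :: "'n list"
  assume e: "exp l = sq_sum X" and len: "length I <= k + 6"
  define z where "z = exp (Re l)"
  have z: "z > 0" "z = norm (sq_sum X)" by (simp_all add: z_def e[symmetric])
  define Y where "Y = 2 * (nu + 8) * (real k + 1) / z"
  define b where "b = A ^ k / (fact k)^2 * (1 + norm l) * exp ((real k + 1 - nu) * Re l)"
  have b0: "b >= 0" using A1 by (simp add: b_def)
  have Y0: "Y >= 0" using nu0 z by (simp add: Y_def)
  have "norm (rder nu k X l I 0) <= b * Y ^ 0 * (2 * norm X * Y) ^ length I"
  proof (rule norm_rder_le[OF _ b0 Y0])
   show "norm (rad nu k j l) <= b * Y ^ j" if "j <= k + 6" for j
    unfolding b_def Y_def z_def A_def using nu that by (intro norm_rad_le) auto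
   have "2 * z * Y = 4 * ((nu + 8) * (real k + 1))" using z(1) by (simp add: Y_def)
   moreover have "8 * (real k + 1) <= (nu + 8) * (real k + 1)" using nu0 by (intro mult_right_mono) auto
   ultimately have "4 * (8 * (real k + 1)) <= 2 * z * Y" by (simp only:)
   hence "real k + 6 <= 2 * z * Y" by (rule order_trans[rotated]) simp
   also have "... <= 2 * (norm X)^2 * Y" using norm_sq_sum_le[of X] z Y0 by (intro mult_right_mono) auto
   finally show "real k + 6 <= 2 * (norm X)^2 * Y" .
  qed (use len in auto)
  also have "2 * norm X * Y = c * (real k + 1) * (norm X / z)" by (simp add: Y_def c_def field_simps)
  also have "b * Y ^ 0 * (c * (real k + 1) * (norm X / z)) ^ length I
   = b * (c * (real k + 1)) ^ length I * (norm X / z) ^ length I"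
   by (simp only: power_mult_distrib power_0 mult_1_right mult.assoc)
  also have "... <= b * (720 * c ^ 6 * c ^ k * exp 2 ^ Suc k * fact k) * (norm X / z) ^ length I"
  proof (intro mult_right_mono mult_left_mono)
   have k1: "(1::real) <= real k + 1" by simp
   have "(c * (real k + 1)) ^ length I <= (c * (real k + 1)) ^ (k + 6)"
    using c1 len mult_mono[OF c1 k1] by (intro power_increasing) auto
   also have "... = c ^ (k + 6) * ((real k + 1) ^ k * (real k + 1) ^ 6)"
    by (simp add: power_mult_distrib power_add)
   also have "... <= c ^ (k + 6) * ((fact k * exp (real k + 1)) * (fact 6 * exp (real k + 1)))"
    using c1 by (intro mult_left_mono mult_mono power_le_exp_fact) auto
   also have "... = 720 * c ^ 6 * c ^ k * (exp (real k + 1) * exp (real k + 1)) * fact k"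
    by (simp add: power_add fact_numeral)
   also have "exp (real k + 1) * exp (real k + 1) = exp 2 ^ Suc k"
    by (simp add: exp_add[symmetric] exp_of_nat_mult[symmetric] algebra_simps)
   finally show "(c * (real k + 1)) ^ length I <= 720 * c ^ 6 * c ^ k * exp 2 ^ Suc k * fact k" .
  qed (use b0 z in auto)
  also have "b * (720 * c ^ 6 * c ^ k * exp 2 ^ Suc k * fact k)
   = (720 * c ^ 6 * exp 2) * (exp 2 * A * c) ^ k / fact k * (1 + norm l) * exp ((real k + 1 - nu) * Re l)"
   by (simp add: b_def power_mult_distrib power2_eq_square)
  also have "... * (norm X / z) ^ length I <= C ^ Suc k / fact k * (1 + norm l) * exp ((real k + 1 - nu) * Re l) * (norm X / z) ^ length I"
  proof -
   have "exp 2 * A * c <= C"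
   proof -
    have "exp 2 * (A * c) <= (720 * c ^ 6) * (exp 2 * (A * c))"
    proof -
     have "1 <= c ^ 6" by (rule one_le_power[OF c1])
     hence "1 <= 720 * c ^ 6" by linarith
     thus ?thesis using c1 A1 mult_right_mono[of 1 "720 * c ^ 6" "exp 2 * (A * c)"] by simp
    qed
    thus ?thesis by (simp add: C_def mult_ac)
   qed
   hence "(exp 2 * A * c) ^ k <= C ^ k" using c1 A1 by (intro power_mono) auto
   moreover have "720 * c ^ 6 * exp 2 <= C"
    unfolding C_def using cc A1 c1 mult_mono[OF A1 c1] mult_left_mono[of 1 "A * c" "720 * c ^ 6 * exp 2"] by (simp add: mult.assoc)
   ultimately have "(720 * c ^ 6 * exp 2) * (exp 2 * A * c) ^ k <= C ^ Suc k"
    unfolding power_Suc using C1 cc c1 A1 by (intro mult_mono) auto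
   thus ?thesis using z by (intro mult_right_mono divide_right_mono) auto
  qed
  finally show "norm (rder nu k X l I 0) <= C ^ Suc k / fact k * (1 + norm l) * exp ((real k + 1 - nu) * Re l)
    * (norm X / exp (Re l)) ^ length I" by (simp add: z_def)
 qed
qed

section \<open>The fundamental matrix\<close>

text \<open>
  The boolean selects the block: \<open>True\<close> for \<open>u\<close> and \<open>False\<close> for \<open>w\<close>.  A column of the fundamental
  matrix is indexed by a pair \<open>q\<close> of a block and a coordinate.
\<close>
locale kernel =
 fixes nu :: real and a b c :: "bool => complex" and g :: complex
  and R :: "'n::finite => 'n => 'n => complex"
 assumes nu: "2 * nu = real CARD('n)"
  and a0: "a s ~= 0" and ab0: "a s + b s ~= 0"
  and R_anti: "R k j p = - R p j k" and R_anti2: "R k j p = - R k p j" and R_le: "norm (R k j p) <= 1"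
begin

text \<open>
  Column \<open>q\<close> of the fundamental matrix is the sum of \<open>vt m\<close> applied to the derivatives of \<open>g_m\<close>.
  The terms \<open>tm m\<close> alone solve the system without \<open>grad div\<close>; subtracting the gradient of the derivative
  along \<open>q\<close> of \<open>sum_m d_m g_m\<close> restores it when \<open>(a + b) d_(m + 1) + c d_m = (b / a) (- c / a)^m\<close>.
\<close>
primrec tm :: "nat => ('n list => complex) => bool => 'n => bool \<times> 'n => 'n list => complex" where
 "tm 0 f s k q I = (if q = (s, k) then f I / a s else 0)"
| "tm (Suc m) f s k q I =
  - (c s * tm m f s k q I + g * (\<Oplus>j p. R k j p * tm m f (~ s) j q (I @ [p]))) / a s"

primrec dco :: "bool => nat => complex" where
 "dco s 0 = 0"
| "dco s (Suc k) = (b s / a s * (- c s / a s) ^ k - c s * dco s k) / (a s + b s)"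

definition vt :: "nat => ('n list => complex) => bool => 'n => bool \<times> 'n => 'n list => complex" where
 "vt m f s k q I = tm m f s k q I - (if fst q = s then dco s m * f (k # snd q # I) else 0)"

lemma tm_deriv:
 assumes "!!I. ((%t. f t I) has_field_derivative (\<Oplus>i. d i * f t (i # I))) (at t within S)"
 shows "((%t. tm m (f t) s k q I) has_field_derivative (\<Oplus>i. d i * tm m (f t) s k q (i # I))) (at t within S)"
proof (induction m arbitrary: s k I)
 case 0
 show ?case
 proof (cases "q = (s, k)")
  case True
  thus ?thesis using DERIV_cdivide[OF assms, of I "a s"] by (simp add: sum_divide_distrib)
 qed simp
next
 case (Suc m)
 have "((%t. - (c s * tm m (f t) s k q I + g * (\<Oplus>j p. R k j p * tm m (f t) (~ s) j q (I @ [p]))) / a s)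
  has_field_derivative - (c s * (\<Oplus>i. d i * tm m (f t) s k q (i # I)) + g * (\<Oplus>j p. R k j p *
   (\<Oplus>i. d i * tm m (f t) (~ s) j q (i # I @ [p])))) / a s) (at t within S)"
  by (intro DERIV_cdivide DERIV_minus DERIV_add DERIV_cmult DERIV_sum Suc.IH)
 moreover have "- (c s * (\<Oplus>i. d i * tm m (f t) s k q (i # I)) + g * (\<Oplus>j p. R k j p *
   (\<Oplus>i. d i * tm m (f t) (~ s) j q (i # I @ [p])))) / a s = (\<Oplus>i. d i * tm (Suc m) (f t) s k q (i # I))"
 proof -
  have "(\<Oplus>j p. R k j p * (\<Oplus>i. d i * tm m (f t) (~ s) j q (i # I @ [p])))
   = (\<Oplus>i. d i * (\<Oplus>j p. R k j p * tm m (f t) (~ s) j q (i # I @ [p])))"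
  proof -
   have "(\<Oplus>j p. R k j p * (\<Oplus>i. d i * tm m (f t) (~ s) j q (i # I @ [p])))
    = (\<Oplus>j i p. d i * (R k j p * tm m (f t) (~ s) j q (i # I @ [p])))"
    by (rule sum.cong[OF refl], subst sum.swap) (simp add: sum_distrib_left mult_ac)
   also have "... = (\<Oplus>i j p. d i * (R k j p * tm m (f t) (~ s) j q (i # I @ [p])))"
    by (rule sum.swap)
   finally show ?thesis by (simp add: sum_distrib_left)
  qed
  thus ?thesis
   by (simp add: sum_distrib_left sum_divide_distrib sum_negf[symmetric] sum.distrib[symmetric] algebra_simps add_divide_distrib diff_divide_distrib sum_subtractf)
 qed
 ultimately show ?case by simp
qed

lemma tm_perm:
 assumes "!!I J. mset I = mset J ==> f I = f J"
 shows "mset I = mset J ==> tm m f s k q I = tm m f s k q J"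
proof (induction m arbitrary: s k I J)
 case 0
 thus ?case using assms[OF 0] by simp
next
 case (Suc m)
 have "tm m f (~ s) j q (I @ [p]) = tm m f (~ s) j q (J @ [p])" for j p
  using Suc.prems by (intro Suc.IH) simp
 thus ?case using Suc.IH[OF Suc.prems] by simp
qed

lemma tm_laplace:
 assumes "!!I. (\<Oplus>p. f (p # p # I)) = f' I"
 shows "(\<Oplus>p. tm m f s k q (p # p # I)) = tm m f' s k q I"
proof (induction m arbitrary: s k I)
 case 0
 thus ?case by (simp add: assms[symmetric] sum_divide_distrib)
next
 case (Suc m)
 have "(\<Oplus>x j p. R k j p * tm m f (~ s) j q (x # x # I @ [p]))
  = (\<Oplus>j x p. R k j p * tm m f (~ s) j q (x # x # I @ [p]))"
  by (rule sum.swap)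
 also have "... = (\<Oplus>j p x. R k j p * tm m f (~ s) j q (x # x # I @ [p]))"
  by (rule sum.cong[OF refl], rule sum.swap)
 also have "... = (\<Oplus>j p. R k j p * tm m f' (~ s) j q (I @ [p]))"
  by (simp only: sum_distrib_left[symmetric] Suc.IH)
 finally have e: "(\<Oplus>x j p. R k j p * tm m f (~ s) j q (x # x # I @ [p])) = ..." .
 have "(\<Oplus>x. tm (Suc m) f s k q (x # x # I)) = - (c s * (\<Oplus>x. tm m f s k q (x # x # I))
   + g * (\<Oplus>x j p. R k j p * tm m f (~ s) j q (x # x # I @ [p]))) / a s"
  by (simp add: sum_divide_distrib[symmetric] sum_negf sum.distrib sum_subtractf sum_distrib_left)
 thus ?case unfolding e Suc.IH by simp
qed

lemma tm_zero: "(!!I. f I = 0) ==> tm m f s k q I = 0"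
 by (induction m arbitrary: s k I) auto

text \<open>A curl has no divergence: R is antisymmetric in its first and third index, the list of
  derivatives is symmetric. So only the scalar recursion with ratio - c / a survives, which is what
  dictates the recursion of \<open>dco\<close>.\<close>

lemma tm_div:
 assumes f: "!!I J. mset I = mset J ==> f I = f J"
 shows "(\<Oplus>k. tm m f s k q (k # I)) = (if fst q = s then (- c s / a s) ^ m * f (snd q # I) / a s else 0)"
proof (induction m)
 case 0
 have "(\<Oplus>k. tm 0 f s k q (k # I)) = (\<Oplus>k. if k = snd q then (if fst q = s then f (k # I) / a s else 0) else 0)"
  by (intro sum.cong) (auto simp: prod_eq_iff)
 thus ?case by simp
next
 case (Suc m)
 define h where "h k j p = tm m f (~ s) j q (k # I @ [p])" for k j p
 have hs: "h k j p = h p j k" for k j p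
  unfolding h_def by (rule tm_perm[OF f]) auto
 define X where "X = (\<Oplus>k j p. R k j p * h k j p)"
 have X1: "X = (\<Oplus>j k p. R k j p * h k j p)" unfolding X_def by (rule sum.swap)
 also have "... = (\<Oplus>j p k. R k j p * h k j p)"
  by (rule sum.cong[OF refl], rule sum.swap)
 also have "... = (\<Oplus>j p k. - (R p j k * h p j k))"
  by (intro sum.cong refl) (metis R_anti hs mult_minus_left)
 also have "... = - X" unfolding X1 by (simp add: sum_negf)
 finally have X0: "X = 0" by simp
 have "(\<Oplus>k. tm (Suc m) f s k q (k # I)) = - (c s * (\<Oplus>k. tm m f s k q (k # I)) + g * X) / a s"
  unfolding X_def h_def
  by (simp add: sum_divide_distrib[symmetric] sum_negf sum.distrib sum_subtractf sum_distrib_left)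
 thus ?case unfolding X0 Suc.IH by (simp add: mult_ac)
qed

text \<open>B is fixed before f, S and H, because it is applied with f = \<open>rf m\<close>, where
  S and H vary with the index and the point. H is the price of one more derivative.\<close>

lemma tm_bound:
 obtains B :: real where "B >= 1" "!!f S H N m s k q I. (!!I. length I <= N ==> norm (f I) <= S * H ^ length I) ==> 0 <= S ==> 0 <= H
  ==> length I + m <= N ==> norm (tm m f s k q I) <= B * S * H ^ length I * (B * (1 + H)) ^ m"
proof -
 define n where "n = real CARD('n)"
 define B where "B = 1 + (\<Oplus>s. (1 + norm (c s) + norm g * n * n) / norm (a s))"
 have n0: "n >= 0" by (simp add: n_def)
 have Bs: "(1 + norm (c s) + norm g * n * n) / norm (a s) <= B" for s
 proof -
  have "(1 + norm (c s) + norm g * n * n) / norm (a s) <= (\<Oplus>s. (1 + norm (c s) + norm g * n * n) / norm (a s))"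
   using n0 by (intro member_le_sum) auto
  thus ?thesis by (simp add: B_def)
 qed
 have B1: "B >= 1" unfolding B_def using n0 by (simp add: sum_nonneg)
 show thesis
 proof (rule that[OF B1])
  fix f :: "'n list => complex" and S H N m s k q and I :: "'n list"
  assume f: "!!I. length I <= N ==> norm (f I) <= S * H ^ length I" and S: "0 <= S" and H: "0 <= (H::real)"
   and len: "length I + m <= N"
  show "norm (tm m f s k q I) <= B * S * H ^ length I * (B * (1 + H)) ^ m"
   using len
  proof (induction m arbitrary: s k I)
   case 0
   have "norm (tm 0 f s k q I) <= (1 / norm (a s)) * (S * H ^ length I)"
    using f[of I] 0 S H by (auto simp: norm_divide divide_right_mono)
   also have "1 / norm (a s) <= (1 + norm (c s) + norm g * n * n) / norm (a s)"
    using n0 by (intro divide_right_mono) auto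
   also have "... <= B" by (rule Bs)
   finally show ?case using S H by (simp add: mult_right_mono mult.assoc)
  next
   case (Suc m)
   define M where "M = B * S * H ^ length I * (B * (1 + H)) ^ m"
   have M0: "M >= 0" using S H B1 by (simp add: M_def)
   have 1: "norm (tm m f s k q I) <= M * (1 + H)"
   proof -
    have "norm (tm m f s k q I) <= M" unfolding M_def using Suc by simp
    also have "... <= M * (1 + H)" using M0 H by (simp add: algebra_simps)
    finally show ?thesis .
   qed
   have 2: "norm (tm m f (~ s) j q (I @ [p])) <= M * (1 + H)" for j p
   proof -
    have "norm (tm m f (~ s) j q (I @ [p])) <= B * S * H ^ length (I @ [p]) * (B * (1 + H)) ^ m"
     using Suc.prems by (intro Suc.IH) simp
    also have "... = M * H" by (simp add: M_def)
    also have "... <= M * (1 + H)" using M0 by (intro mult_left_mono) auto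
    finally show ?thesis .
   qed
   have 3: "norm (\<Oplus>j p. R k j p * tm m f (~ s) j q (I @ [p])) <= n * n * (M * (1 + H))"
   proof -
    have "norm (\<Oplus>j p. R k j p * tm m f (~ s) j q (I @ [p])) <= (\<Sum>j\<in>(UNIV::'n set). \<Sum>p\<in>(UNIV::'n set). 1 * (M * (1 + H)))"
     by (intro sum_norm_le) (unfold norm_mult, intro mult_mono R_le 2, auto)
    thus ?thesis by (simp add: n_def)
   qed
   have "norm (tm (Suc m) f s k q I) <= (norm (c s) * (M * (1 + H)) + norm g * (n * n * (M * (1 + H)))) / norm (a s)"
    unfolding tm.simps norm_divide norm_minus_cancel
    by (intro divide_right_mono norm_triangle_le add_mono) (auto simp: norm_mult intro!: mult_left_mono 1 3)
   also have "... = (norm (c s) + norm g * n * n) / norm (a s) * (M * (1 + H))"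
    by (simp add: algebra_simps add_divide_distrib)
   also have "... <= B * (M * (1 + H))"
    using order_trans[OF _ Bs[of s]] M0 H by (intro mult_right_mono) (auto simp: divide_right_mono)
   finally show ?case by (simp add: M_def mult_ac)
  qed
 qed
qed

lemma dco_bound:
 obtains D :: real where "D >= 1" "!!s k. norm (dco s k) <= D ^ k"
proof -
 define x where "x s = norm (b s / a s) / norm (a s + b s)" for s
 define y where "y s = norm (c s / a s)" for s
 define z where "z s = norm (c s) / norm (a s + b s)" for s
 define D where "D = 1 + (\<Oplus>s. x s + y s + z s)"
 have nn: "x s >= 0" "y s >= 0" "z s >= 0" for s by (auto simp: x_def y_def z_def)
 have Ds: "1 + (x s + y s + z s) <= D" for s
 proof -
  have "x s + y s + z s <= (\<Oplus>s. x s + y s + z s)" using nn by (intro member_le_sum) auto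
  thus ?thesis by (simp add: D_def)
 qed
 have D1: "D >= 1" using Ds[of True] nn[of True] by linarith
 show thesis
 proof (rule that[OF D1])
  fix s k
  show "norm (dco s k) <= D ^ k"
  proof (induction k)
   case (Suc k)
   have yD: "y s <= D" using Ds[of s] nn[of s] by linarith
   have "norm (dco s (Suc k)) <= (norm (b s / a s) * y s ^ k + norm (c s) * D ^ k) / norm (a s + b s)"
    unfolding dco.simps norm_divide[of _ "a s + b s"]
    by (intro divide_right_mono order_trans[OF norm_triangle_ineq4] add_mono)
     (auto simp: norm_mult norm_power y_def norm_divide intro!: mult_left_mono Suc)
   also have "... = x s * y s ^ k + z s * D ^ k"
    by (simp add: x_def z_def add_divide_distrib)
   also have "... <= x s * D ^ k + z s * D ^ k"
    using nn[of s] yD by (intro add_mono mult_left_mono power_mono) auto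
   also have "... = (x s + z s) * D ^ k" by (simp add: algebra_simps)
   also have "... <= D * D ^ k" using Ds[of s] nn[of s] D1 by (intro mult_right_mono) auto
   finally show ?case by simp
  qed simp
 qed
qed

end

section \<open>Convergence of the series and its system of equations\<close>

context kernel
begin

definition rf :: "nat => complex^'n => complex => 'n list => complex" where
 "rf k X l I = rder nu k X l I 0"

definition V :: "complex^'n => complex => bool => 'n => bool \<times> 'n => 'n list => complex" where
 "V X l s k q I = (\<Sum>m. vt m (rf m X l) s k q I)"

text \<open>The size of the leading singularity: |s|^(1 - nu) with its logarithm, a factor |X| / |s|
  for each of j derivatives, and one factor |X|^2 / |s| for the second derivative of g_1 in the
  grad-div correction. For real X the last factor is 1.\<close>

definition W :: "complex^'n => complex => nat => real" where
 "W X l j = (1 + norm l) * exp ((1 - nu) * Re l) * (norm X / exp (Re l)) ^ j * ((norm X)^2 / exp (Re l))"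

text \<open>The part of V that carries the singularity. The term of index 0 and the grad-div
  correction of index 1 have the same order; everything else, collected in \<open>vt_rest\<close>,
  is smaller by a factor |X|.\<close>

definition V0 :: "complex^'n => complex => bool => 'n => bool \<times> 'n => 'n list => complex" where
 "V0 X l s k q I = (if q = (s, k) then rf 0 X l I / a s else 0)
  - (if fst q = s then dco s 1 * rf 1 X l (k # snd q # I) else 0)"

definition vt_rest :: "nat => ('n list => complex) => bool => 'n => bool \<times> 'n => 'n list => complex" where
 "vt_rest m f s k q I = (if m = 0 then 0 else if m = 1 then tm 1 f s k q I else vt m f s k q I)"

text \<open>The index m contributes the m-th power of |s| + |X| or of |s|. As |s| <= |X| R0, this is
  a geometric factor in R0 and, for the terms of \<open>vt_rest\<close>, also supplies the extra
  factor |X|.\<close>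

lemma vt_bound:
 assumes R0: "R0 >= (0::real)"
 obtains K where "K >= 1"
  "!!m X l s k q I. exp l = sq_sum X ==> norm X <= R0 ==> length I <= 4 ==>
   norm (vt m (rf m X l) s k q I) <= K ^ Suc m / fact m * W X l (length I)"
  "!!m X l s k q I. exp l = sq_sum X ==> norm X <= R0 ==> length I <= 4 ==>
   norm (vt_rest m (rf m X l) s k q I)
     <= K ^ Suc m / fact m * W X l (length I) * norm X"
  "!!m X l s k q I. exp l = sq_sum X ==> norm X <= R0 ==> length I <= 4 ==>
   norm (tm m (rf m X l) s k q I) <= K ^ Suc m / fact m * W X l (length I)"
proof -
 obtain C :: real where C: "C >= 1"
  "!!k (X :: complex^'n) l I. exp l = sq_sum X ==> length (I :: 'n list) <= k + 6 ==>
   norm (rder nu k X l I 0) <= C ^ Suc k / fact k * (1 + norm l) * exp ((real k + 1 - nu) * Re l)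
    * (norm X / exp (Re l)) ^ length I"
  using rder_bound[OF nu] by metis
 obtain B :: real where B: "B >= 1" "!!f S H N m s k q I. (!!I. length I <= N ==> norm (f I) <= S * H ^ length I) ==> 0 <= S ==> 0 <= H
  ==> length I + m <= N ==> norm (tm m f s k q I) <= B * S * H ^ length I * (B * (1 + H)) ^ m"
  using tm_bound by blast
 obtain D :: real where D: "D >= 1" "!!s k. norm (dco s k) <= D ^ k" using dco_bound by blast
 define ro where "ro = (1 + R0)^2"
 have r1: "ro >= 1" "1 + R0 <= ro" using R0 by (simp_all add: ro_def power2_eq_square algebra_simps)
 define K where "K = B * B * C * D * ro"
 have pos: "B > 0" "C > 0" "D > 0" "ro > 0" using B C D r1 by auto
 have KK: "1 <= B * B" "1 <= B * B * C" "1 <= B * B * C * D" "1 <= K"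
  unfolding K_def using B(1) C(1) D(1) r1(1) mult_mono[of 1 _ 1 _] by (simp_all add: mult_ge1_I)
 have Wn: "W X l j >= 0" for X l j by (simp add: W_def)
 have main: "norm (tm m (rf m X l) s k q I) <= K ^ Suc m / fact m * W X l (length I) * (if m = 0 then 1 else min 1 (norm X))
  & norm (dco s m * rf m X l (k # k' # I)) <= K ^ Suc m / fact m * W X l (length I) * (if m <= 1 then 1 else min 1 (norm X))"
  if e: "exp l = sq_sum X" and XR: "norm X <= R0" and len: "length I <= 4" for m X l s k k' q I
 proof -
  define z where "z = exp (Re l)"
  define H where "H = norm X / z"
  define E where "E = exp ((1 - nu) * Re l)"
  define x where "x = norm X"
  have z: "z > 0" "z = norm (sq_sum X)" by (simp_all add: z_def e[symmetric])
  have zX: "z <= x^2" unfolding z(2) x_def by (rule norm_sq_sum_le)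
  have x0: "x >= 0" "x <= R0" using XR by (auto simp: x_def)
  have H0: "H >= 0" using z by (simp add: H_def)
  have q1: "x^2 / z >= 1" using zX z by simp
  have ez: "exp ((real m + 1 - nu) * Re l) = E * z ^ m"
   by (simp add: E_def z_def exp_add[symmetric] exp_of_nat_mult[symmetric] algebra_simps)
  define S where "S = C ^ Suc m / fact m * (1 + norm l) * (E * z ^ m)"
  have S0: "S >= 0" using pos z by (simp add: S_def E_def)
  have f: "norm (rf m X l J) <= S * H ^ length J" if "length J <= m + 6" for J
   using C(2)[OF e that] unfolding rf_def S_def H_def z_def[symmetric] ez by simp
  define W1 where "W1 = (1 + norm l) * E * H ^ length I"
  define W2 where "W2 = W X l (length I)"
  have W1: "W1 >= 0" using H0 by (simp add: W1_def E_def)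
  have WW: "W2 = W1 * (x^2 / z)" by (simp add: W2_def W_def W1_def E_def H_def z_def x_def)
  have W1W: "W1 <= W2" unfolding WW using mult_left_mono[OF q1 W1] by simp
  have zx: "z <= x * R0" using zX x0 mult_left_mono[of x R0 x] by (simp add: power2_eq_square)
  have xr: "x * (1 + R0) <= ro" unfolding ro_def power2_eq_square using x0 R0 by (intro mult_right_mono) auto
  \<comment> \<open>Used with y = |s| + |X| for \<open>tm\<close> and with y = |s| for the
    correction. The minimum with 1 gives the bounds with and without the gain in |X| at
    once.\<close>
  have pw: "y ^ m <= ro ^ Suc m * (if m = 0 then 1 else min 1 x)" if y: "0 <= y" "y <= x * (1 + R0)" for y m
  proof (cases m)
   case (Suc m')
   have "y ^ m <= ro ^ m" using y xr by (intro power_mono) auto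
   also have "... <= ro ^ Suc m" using r1 by (intro power_increasing) auto
   finally have 1: "y ^ m <= ro ^ Suc m" .
   have "y * y ^ m' <= (x * ro) * ro ^ m'"
    using y xr x0 r1 mult_left_mono[OF r1(2) x0(1)] by (intro mult_mono power_mono) auto
   also have "... <= ro ^ Suc m * x" using x0 r1 Suc mult_right_mono[of 1 ro "x * ro ^ m"] by (simp add: mult_ac)
   finally show ?thesis using 1 Suc by (auto simp: min_def)
  qed (use r1 in simp)
  have t1: "norm (tm m (rf m X l) s k q I) <= K ^ Suc m / fact m * W2 * (if m = 0 then 1 else min 1 x)"
  proof -
   have "norm (tm m (rf m X l) s k q I) <= B * S * H ^ length I * (B * (1 + H)) ^ m"
    by (rule B(2)[where N = "m + 6"]) (use f S0 H0 len in auto)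
   also have "... = (B * C) ^ Suc m / fact m * W1 * (z * (1 + H)) ^ m"
    by (simp add: S_def W1_def power_mult_distrib)
   also have "z * (1 + H) = z + x" using z by (simp add: H_def x_def field_simps)
   also have "(B * C) ^ Suc m / fact m * W1 * (z + x) ^ m
    <= (B * C) ^ Suc m / fact m * W2 * (ro ^ Suc m * (if m = 0 then 1 else min 1 x))"
    using pos W1 W1W z x0 zx by (intro mult_mono pw W1W) (auto simp: algebra_simps)
   also have "... = (B * C * ro) ^ Suc m / fact m * W2 * (if m = 0 then 1 else min 1 x)"
    by (simp add: power_mult_distrib)
   also have "... <= K ^ Suc m / fact m * W2 * (if m = 0 then 1 else min 1 x)"
    using pos W1 W1W x0 KK B(1) D(1) mult_mono[of 1 B 1 D] unfolding K_def
    by (intro mult_right_mono divide_right_mono power_mono) (auto simp: mult_ac)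
   finally show ?thesis .
  qed
  moreover have "norm (dco s m * rf m X l (k # k' # I)) <= K ^ Suc m / fact m * W2 * (if m <= 1 then 1 else min 1 x)"
  proof (cases m)
   case 0
   thus ?thesis using W1 W1W KK by simp
  next
   case (Suc m')
   have "norm (dco s m * rf m X l (k # k' # I)) <= D ^ m * (S * H ^ length (k # k' # I))"
    unfolding norm_mult using D pos by (intro mult_mono D f) (use len in auto)
   also have "... = D ^ m * C ^ Suc m / fact m * W1 * (z ^ m * H^2)"
    by (simp add: S_def W1_def power2_eq_square)
   also have "z ^ m * H^2 = z ^ m' * (x^2 / z)" using z by (simp add: H_def x_def Suc power2_eq_square)
   also have "D ^ m * C ^ Suc m / fact m * W1 * (z ^ m' * (x^2 / z)) = D ^ m * C ^ Suc m / fact m * W2 * z ^ m'"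
    by (simp add: WW)
   also have "... <= (B * B * D) ^ Suc m * C ^ Suc m / fact m * W2 * (ro ^ Suc m * (if m <= 1 then 1 else min 1 x))"
   proof (intro mult_mono mult_right_mono divide_right_mono)
    have "D ^ m <= D ^ Suc m" using D(1) by (intro power_increasing) auto
    also have "... <= (B * B * D) ^ Suc m" using KK(1) pos mult_right_mono[OF KK(1), of D] by (intro power_mono) auto
    finally show "D ^ m <= (B * B * D) ^ Suc m" .
    have "z ^ m' <= ro ^ Suc m' * (if m' = 0 then 1 else min 1 x)"
     using z zx x0 by (intro pw) (auto simp: algebra_simps)
    also have "... <= ro ^ Suc m * (if m <= 1 then 1 else min 1 x)"
     using r1 x0 Suc power_increasing[of "Suc m'" "Suc m" ro] by (intro mult_mono) auto
    finally show "z ^ m' <= ro ^ Suc m * (if m <= 1 then 1 else min 1 x)" .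
   qed (use pos W1 W1W z in auto)
   also have "... = K ^ Suc m / fact m * W2 * (if m <= 1 then 1 else min 1 x)"
    by (simp add: power_mult_distrib K_def)
   finally show ?thesis .
  qed
  ultimately show ?thesis unfolding x_def W2_def by blast
 qed
 have K2: "2 * (K ^ Suc m / fact m * w) <= (2 * K) ^ Suc m / fact m * w" "K ^ Suc m / fact m * w <= (2 * K) ^ Suc m / fact m * w" if "w >= 0" for m and w :: real
 proof -
  have "2 <= (2::real) ^ Suc m" "1 <= (2::real) ^ Suc m" using one_le_power[of "2::real" m] unfolding power_Suc by linarith+
  hence "2 * K ^ Suc m <= 2 ^ Suc m * K ^ Suc m" "1 * K ^ Suc m <= 2 ^ Suc m * K ^ Suc m"
   using KK(4) by (intro mult_right_mono; simp)+
  thus "2 * (K ^ Suc m / fact m * w) <= (2 * K) ^ Suc m / fact m * w" "K ^ Suc m / fact m * w <= (2 * K) ^ Suc m / fact m * w"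
   unfolding power_mult_distrib using that mult_right_mono[of _ _ "w / fact m"] by (fastforce simp: field_simps)+
 qed
 show thesis
 proof (rule that[of "2 * K"])
  show "2 * K >= 1" using KK by simp
  fix m and X :: "complex^'n" and l s k q and I :: "'n list"
  assume h: "exp l = sq_sum X" "norm X <= R0" "length I <= 4"
  define T where "T = K ^ Suc m / fact m * W X l (length I)"
  have T0: "T >= 0" using KK Wn by (simp add: T_def)
  have t: "norm (tm m (rf m X l) s k q I) <= T" "m >= 1 ==> norm (tm m (rf m X l) s k q I) <= T * norm X"
   and d: "norm (dco s m * rf m X l (k # snd q # I)) <= T" "m >= 2 ==> norm (dco s m * rf m X l (k # snd q # I)) <= T * norm X"
   using main[OF h, of m s k q "snd q"] T0 mult_left_mono[of "min 1 (norm X)" 1 T] mult_left_mono[of "min 1 (norm X)" "norm X" T]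
   unfolding T_def[symmetric] by (auto split: if_splits)
  have v: "norm (vt m (rf m X l) s k q I) <= norm (tm m (rf m X l) s k q I) + norm (dco s m * rf m X l (k # snd q # I))"
   unfolding vt_def by (rule order_trans[OF norm_triangle_ineq4]) auto
  show "norm (tm m (rf m X l) s k q I) <= (2 * K) ^ Suc m / fact m * W X l (length I)"
   using t(1) K2(2)[OF Wn] unfolding T_def by (rule order_trans)
  show "norm (vt m (rf m X l) s k q I) <= (2 * K) ^ Suc m / fact m * W X l (length I)"
   using v t(1) d(1) K2(1)[OF Wn[of X l "length I"], of m] unfolding T_def by linarith
  have "norm (vt_rest m (rf m X l) s k q I) = 0 | norm (vt_rest m (rf m X l) s k q I) = norm (tm m (rf m X l) s k q I) & m = 1
    | norm (vt_rest m (rf m X l) s k q I) = norm (vt m (rf m X l) s k q I) & m >= 2"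
   by (auto simp: vt_rest_def simp del: tm.simps)
  moreover have "m = 0 | norm (tm m (rf m X l) s k q I) <= T * norm X" using t(2) by (cases "m = 0") auto
  moreover have "m < 2 | norm (dco s m * rf m X l (k # snd q # I)) <= T * norm X" using d(2) by (cases "m < 2") auto
  moreover have "0 <= T * norm X" using T0 by simp
  ultimately have "norm (vt_rest m (rf m X l) s k q I) <= 2 * (T * norm X)" using v by (elim disjE conjE) linarith+
  also have "... <= (2 * K) ^ Suc m / fact m * (W X l (length I) * norm X)"
   using K2(1)[of "W X l (length I) * norm X" m] Wn by (simp add: T_def mult.assoc)
  finally show "norm (vt_rest m (rf m X l) s k q I) <= (2 * K) ^ Suc m / fact m * W X l (length I) * norm X" by (simp only: mult.assoc)
 qed
qed

end

lemma summable_power_fact: "summable (%m. K ^ Suc m / fact m * (w::real))"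
proof -
 have "summable (%m. inverse (fact m) *\<^sub>R K ^ m :: real)" by (rule summable_exp_generic)
 hence "summable (%m. (K * w) * (inverse (fact m) *\<^sub>R K ^ m))" by (rule summable_mult)
 thus ?thesis by (simp add: divide_inverse mult_ac)
qed

lemma suminf_power_fact: "(\<Sum>m. K ^ Suc m / fact m * (w::real)) = K * exp K * w"
proof -
 have "(%m. (K * w) * (K ^ m /\<^sub>R fact m)) sums ((K * w) * exp K)"
  by (intro sums_mult exp_converges)
 hence "(%m. K ^ Suc m / fact m * w) sums (K * exp K * w)"
  by (simp add: divide_inverse mult_ac)
 thus ?thesis by (rule sums_unique[symmetric])
qed

text \<open>Near t a continuous logarithm stays within distance 1 of its value at t, hence inside
  the principal strip, so it coincides with \<open>l t + Ln (f s / f t)\<close>.\<close>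

lemma log_has_field_derivative:
 fixes f l :: "complex => complex"
 assumes f: "(f has_field_derivative f') (at t within S)" and t: "t : S"
  and l: "continuous (at t within S) l" and e: "!!s. s : S ==> exp (l s) = f s"
 shows "(l has_field_derivative f' / f t) (at t within S)"
proof -
 have ft: "f t ~= 0" using e[OF t] by (metis exp_not_eq_zero)
 obtain d where d: "d > 0" "!!s. s : S ==> dist s t < d ==> dist (l s) (l t) < 1"
  using l unfolding continuous_within_eps_delta by (metis zero_less_one)
 have eq: "l t + Ln (f s / f t) = l s" if "s : S" "dist s t < d" for s
 proof -
  have "\<bar>Im (l s - l t)\<bar> < 1" using d(2)[OF that] abs_Im_le_cmod[of "l s - l t"] by (simp add: dist_norm)
  hence i: "- pi < Im (l s - l t)" "Im (l s - l t) <= pi" using pi_gt3 by linarith+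
  have "f s / f t = exp (l s - l t)" using e that t by (simp add: exp_diff)
  hence "Ln (f s / f t) = l s - l t" using Ln_exp[OF i] by simp
  thus ?thesis by simp
 qed
 have "((%s. l t + Ln (f s / f t)) has_field_derivative f' / f t) (at t within S)"
  using ft by (auto intro!: derivative_eq_intros f)
 thus ?thesis
  by (rule has_field_derivative_transform_within[OF _ d(1) t]) (use eq in auto)
qed

lemma exp_log_within_derivative:
 fixes X :: "complex => complex^'n"
 assumes X: "!!i. ((%t. X t $ i) has_field_derivative d i) (at t within S)" and t: "t : S"
  and l: "continuous (at t within S) l" and e: "!!s. s : S ==> exp (l s) = sq_sum (X s)"
 obtains l' where "(l has_field_derivative l') (at t within S)"
  "exp (l t) * l' = 2 * (\<Oplus>i. X t $ i * d i)"
proof -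
 have "((%t. sq_sum (X t)) has_field_derivative 2 * (\<Oplus>i. X t $ i * d i)) (at t within S)"
  unfolding sq_sum_def
  by (auto intro!: derivative_eq_intros X simp: sum_distrib_left mult_ac)
 from log_has_field_derivative[OF this t l e]
 have "(l has_field_derivative 2 * (\<Oplus>i. X t $ i * d i) / sq_sum (X t)) (at t within S)" by simp
 moreover have "sq_sum (X t) ~= 0" using e[OF t] by (metis exp_not_eq_zero)
 ultimately show thesis using that e[OF t] by simp
qed

context kernel
begin

lemma rf_perm: "mset I = mset J ==> rf k X l I = rf k X l J"
 unfolding rf_def by (rule rder_perm)

lemma rf_laplace:
 "exp l = sq_sum X ==> (\<Oplus>p. rf k X l (p # p # I)) = (if k = 0 then 0 else rf (k - 1) X l I)"
 unfolding rf_def using rder_laplace[OF nu, of l X k I 0] by simp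

lemma W_nonneg: "W X l j >= 0" by (simp add: W_def)

lemma vt_summable:
 assumes "exp l = sq_sum X" "length (I :: 'n list) <= 4"
 shows "summable (%m. vt m (rf m X l) s k q I)"
proof -
 obtain K where K: "!!m s k q. norm (vt m (rf m X l) s k q I) <= K ^ Suc m / fact m * W X l (length I)"
  using vt_bound[of "norm X"] assms by (metis norm_ge_zero order_refl)
 show ?thesis by (rule summable_comparison_test'[OF summable_power_fact K])
qed

lemma tm_tendsto_0:
 assumes "exp l = sq_sum X" "length (I :: 'n list) <= 4"
 shows "(%m. tm m (rf m X l) s k q I) \<longlonglongrightarrow> 0"
proof -
 obtain K where K: "!!m s k q. norm (tm m (rf m X l) s k q I) <= K ^ Suc m / fact m * W X l (length I)"
  using vt_bound[of "norm X"] assms by (metis norm_ge_zero order_refl)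
 show ?thesis by (rule summable_LIMSEQ_zero[OF summable_comparison_test'[OF summable_power_fact K]])
qed

lemma V_bound:
 assumes "R0 >= 0"
 obtains K where "K >= 1"
  "!!X l s k q I. exp l = sq_sum X ==> norm X <= R0 ==> length I <= 4 ==> norm (V X l s k q I) <= K * W X l (length I)"
  "!!X l s k q I. exp l = sq_sum X ==> norm X <= R0 ==> length I <= 4 ==>
   norm (V X l s k q I - V0 X l s k q I) <= K * W X l (length I) * norm X"
proof -
 show thesis
 proof (rule vt_bound[OF assms])
 fix K
 assume K: "K >= 1"
  "!!m X l s k q I. exp l = sq_sum X ==> norm X <= R0 ==> length I <= 4 ==>
   norm (vt m (rf m X l) s k q I) <= K ^ Suc m / fact m * W X l (length I)"
  "!!m X l s k q I. exp l = sq_sum X ==> norm X <= R0 ==> length I <= 4 ==>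
   norm (vt_rest m (rf m X l) s k q I) <= K ^ Suc m / fact m * W X l (length I) * norm X"
 show thesis
 proof (rule that[of "K * exp K"])
  show "K * exp K >= 1" using K(1) mult_mono[of 1 K 1 "exp K"] by simp
 next
  fix X :: "complex^'n" and l s k q and I :: "'n list"
  assume h: "exp l = sq_sum X" "norm X <= R0" "length I <= 4"
  have sn: "summable (%m. norm (vt m (rf m X l) s k q I))"
  proof -
   have "norm (norm (vt m (rf m X l) s k q I)) <= K ^ Suc m / fact m * W X l (length I)" for m
    using K(2)[OF h, of m s k q] by simp
   thus ?thesis by (rule summable_comparison_test'[OF summable_power_fact])
  qed
  have "norm (V X l s k q I) <= (\<Sum>m. norm (vt m (rf m X l) s k q I))"
   unfolding V_def by (rule summable_norm[OF sn])
  also have "... <= (\<Sum>m. K ^ Suc m / fact m * W X l (length I))"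
   by (intro suminf_le sn summable_power_fact K(2)[OF h])
  also have "... = K * exp K * W X l (length I)" by (rule suminf_power_fact)
  finally show "norm (V X l s k q I) <= K * exp K * W X l (length I)" .
 next
  fix X :: "complex^'n" and l s k q and I :: "'n list"
  assume h: "exp l = sq_sum X" "norm X <= R0" "length I <= 4"
  have sn: "summable (%m. norm (vt_rest m (rf m X l) s k q I))"
  proof -
   have "norm (norm (vt_rest m (rf m X l) s k q I)) <= K ^ Suc m / fact m * (W X l (length I) * norm X)" for m
    using K(3)[OF h, of m s k q] by (simp add: mult.assoc)
   thus ?thesis by (rule summable_comparison_test'[OF summable_power_fact])
  qed
  have "V X l s k q I - V0 X l s k q I = (\<Sum>m. vt_rest m (rf m X l) s k q I)"
  proof -
   define e where "e m = (if m = 0 then tm 0 (rf 0 X l) s k q I else if m = 1 then V0 X l s k q I - tm 0 (rf 0 X l) s k q I else 0)" for m :: nat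
   have "e sums (\<Sum>m\<in>{0, 1}. e m)" by (rule sums_finite) (auto simp: e_def)
   hence es: "e sums V0 X l s k q I" by (simp add: e_def)
   have "(%m. vt m (rf m X l) s k q I - e m) sums (V X l s k q I - V0 X l s k q I)"
    unfolding V_def by (intro sums_diff es summable_sums vt_summable h)
   moreover have "vt m (rf m X l) s k q I - e m = vt_rest m (rf m X l) s k q I" for m
    by (auto simp: e_def vt_rest_def vt_def V0_def simp del: tm.simps(2) dco.simps(2))
   ultimately show ?thesis by (simp add: sums_unique)
  qed
  also have "norm ... <= (\<Sum>m. norm (vt_rest m (rf m X l) s k q I))" by (rule summable_norm[OF sn])
  also have "... <= (\<Sum>m. K ^ Suc m / fact m * (W X l (length I) * norm X))"
   by (intro suminf_le sn summable_power_fact) (use K(3)[OF h] in \<open>auto simp: mult.assoc\<close>)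
  also have "... = K * exp K * W X l (length I) * norm X" unfolding suminf_power_fact by simp
  finally show "norm (V X l s k q I - V0 X l s k q I) <= K * exp K * W X l (length I) * norm X" .
 qed
 qed
qed

text \<open>The residual of the system on the partial sums telescopes: the second derivatives in one
  term cancel the lower-order part left by the previous one. The last remainder tends to 0 because
  it is built from terms of convergent series.\<close>

lemma V_pde:
 assumes e: "exp l = sq_sum X"
 shows "a s * (\<Oplus>p. V X l s k q [p, p]) + b s * (\<Oplus>j. V X l s j q [k, j])
  + g * (\<Oplus>j p. R k j p * V X l (~ s) j q [p]) + c s * V X l s k q [] = 0"
proof -
 let ?f = "%m. rf m X l"
 let ?v = "%m. vt m (rf m X l)"
 define y where "y m = c s * tm m (?f m) s k q [] + g * (\<Oplus>j p. R k j p * tm m (?f m) (~ s) j q [p])" for m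
 define h where "h m I = (if fst q = s then ?f m (k # snd q # I) else 0)" for m I
 \<comment> \<open>What the series truncated after index m leaves in the system: the lower-order
   operator applied to \<open>tm m\<close>, and the grad-div defect that the next coefficient of
   \<open>dco\<close> has to cancel.\<close>
 define S where "S m = y m + (a s + b s) * dco s (Suc m) * h m []" for m
 define T where "T m = a s * (\<Oplus>p. ?v m s k q [p, p]) + b s * (\<Oplus>j. ?v m s j q [k, j])
  + g * (\<Oplus>j p. R k j p * ?v m (~ s) j q [p]) + c s * ?v m s k q []" for m
 have sm: "summable (%m. ?v m s k q I)" if "length I <= 4" for s k I
  by (rule vt_summable[OF e that])
 have sums: "(%m. ?v m s k q I) sums V X l s k q I" if "length I <= 4" for s k I
  unfolding V_def by (rule summable_sums[OF sm[OF that]])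
 have Tsums: "T sums (a s * (\<Oplus>p. V X l s k q [p, p]) + b s * (\<Oplus>j. V X l s j q [k, j])
  + g * (\<Oplus>j p. R k j p * V X l (~ s) j q [p]) + c s * V X l s k q [])"
  unfolding T_def[abs_def] by (intro sums_add sums_mult sums_sum sums) auto
 have lap: "(\<Oplus>p. ?f m (p # p # I)) = (if m = 0 then 0 else ?f (m - 1) I)" for m I
  by (rule rf_laplace[OF e])
 have lap2: "(\<Oplus>p. ?f m (i # j # p # p # I)) = (if m = 0 then 0 else ?f (m - 1) (i # j # I))" for m I i j
 proof -
  have "?f m (i # j # p # p # I) = ?f m (p # p # i # j # I)" for p by (rule rf_perm) simp
  thus ?thesis by (simp add: lap)
 qed
 have tl: "(\<Oplus>p. tm m (?f m) s k q (p # p # I)) = tm m (%I. if m = 0 then 0 else ?f (m - 1) I) s k q I" for m s k I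
  by (rule tm_laplace) (rule lap)
 have tlap: "a s * (\<Oplus>p. tm m (?f m) s k q [p, p]) = (if m = 0 then 0 else - y (m - 1))" for m
 proof (cases m)
  case 0
  thus ?thesis unfolding tl by (simp add: tm_zero del: tm.simps)
 next
  case (Suc m')
  hence "a s * (\<Oplus>p. tm m (?f m) s k q [p, p]) = a s * tm (Suc m') (?f m') s k q []"
   unfolding tl by simp
  also have "... = - y m'" using a0[of s] by (simp add: y_def)
  finally show ?thesis using Suc by simp
 qed
 have hlap: "(\<Oplus>p. h m [p, p]) = (if m = 0 then 0 else h (m - 1) [])" for m
  unfolding h_def by (simp add: lap2)
 have div: "(\<Oplus>j. ?v m s j q [k, j]) = (- c s / a s) ^ m * h m [] / a s - dco s m * (if m = 0 then 0 else h (m - 1) [])" for m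
 proof -
  have "(\<Oplus>j. tm m (?f m) s j q [k, j]) = (\<Oplus>j. tm m (?f m) s j q (j # [k]))"
   by (intro sum.cong refl tm_perm[OF rf_perm]) auto
  also have "... = (- c s / a s) ^ m * h m [] / a s"
   using rf_perm[of "[snd q, k]" "[k, snd q]" m X l] by (simp add: tm_div[OF rf_perm] h_def)
  finally have 1: "(\<Oplus>j. tm m (?f m) s j q [k, j]) = ..." .
  have "(\<Oplus>j. ?f m (j # snd q # [k, j])) = (\<Oplus>j. ?f m (k # snd q # [j, j]))"
   by (intro sum.cong refl rf_perm) auto
  hence 2: "(\<Oplus>j. if fst q = s then dco s m * ?f m (j # snd q # [k, j]) else 0) = dco s m * (if m = 0 then 0 else h (m - 1) [])"
   by (simp add: h_def lap2 sum_distrib_left[symmetric])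
  show ?thesis unfolding vt_def sum_subtractf 1 2 ..
 qed
 \<comment> \<open>The correction in \<open>vt\<close> is a gradient, so its curl vanishes: H is
   symmetric, while R is antisymmetric in its last two indices.\<close>
 have rot: "(\<Oplus>j p. R k j p * ?v m (~ s) j q [p]) = (\<Oplus>j p. R k j p * tm m (?f m) (~ s) j q [p])" for m
 proof -
  define H where "H j p = (if fst q = (~ s) then dco (~ s) m * ?f m (j # snd q # [p]) else 0)" for j p
  have Hs: "H j p = H p j" for j p
   unfolding H_def using rf_perm[of "[j, snd q, p]" "[p, snd q, j]" m X l] by auto
  define Z where "Z = (\<Oplus>j p. R k j p * H j p)"
  have "Z = (\<Oplus>j p. - (R k p j * H p j))"
   unfolding Z_def by (intro sum.cong refl) (metis Hs R_anti2 mult_minus_left)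
  also have "... = - (\<Oplus>p j. R k p j * H p j)" by (subst sum.swap) (simp add: sum_negf)
  also have "... = - Z" by (simp add: Z_def)
  finally have "Z = 0" by simp
  thus ?thesis unfolding vt_def H_def[symmetric]
   by (simp add: right_diff_distrib sum_subtractf Z_def)
 qed
 have TS: "T m = S m - (if m = 0 then 0 else S (m - 1))" for m
 proof -
  have "(a s + b s) * dco s (Suc m) = b s / a s * (- c s / a s) ^ m - c s * dco s m" using ab0[of s] by simp
  hence d: "b s * ((- c s / a s) ^ m / a s) = (a s + b s) * dco s (Suc m) + c s * dco s m"
   by (simp del: dco.simps)
  have 1: "(\<Oplus>p. ?v m s k q [p, p]) = (\<Oplus>p. tm m (?f m) s k q [p, p]) - dco s m * (if m = 0 then 0 else h (m - 1) [])"
  proof -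
   have "(\<Oplus>p. if fst q = s then dco s m * ?f m (k # snd q # [p, p]) else 0) = dco s m * (\<Oplus>p. h m [p, p])"
    unfolding sum_distrib_left by (intro sum.cong refl) (simp add: h_def)
   thus ?thesis unfolding vt_def sum_subtractf hlap by simp
  qed
  have 2: "?v m s k q [] = tm m (?f m) s k q [] - dco s m * h m []" by (simp add: vt_def h_def)
  have "T m = (if m = 0 then 0 else - y (m - 1)) + y m - (a s + b s) * dco s m * (if m = 0 then 0 else h (m - 1) [])
    + (b s * ((- c s / a s) ^ m / a s) - c s * dco s m) * h m []"
   unfolding T_def div rot 1 2 right_diff_distrib[of "a s"] tlap y_def by (simp add: algebra_simps)
  also have "... = S m - (if m = 0 then 0 else S (m - 1))"
   unfolding d S_def by (cases m) (auto simp: algebra_simps simp del: dco.simps)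
  finally show ?thesis .
 qed
 have part: "(\<Sum>m<Suc N. T m) = S N" for N
  by (induction N) (auto simp: TS)
 have S0: "S \<longlonglongrightarrow> 0"
 proof -
  have t: "(%m. tm m (?f m) s' k' q I) \<longlonglongrightarrow> 0" if "length I <= 4" for s' k' I
   by (rule tm_tendsto_0[OF e that])
  have y0: "y \<longlonglongrightarrow> c s * 0 + g * (\<Oplus>j p. R k j p * 0)"
   unfolding y_def[abs_def] by (intro tendsto_add tendsto_mult tendsto_const tendsto_sum t) auto
  have h1: "(- c s / a s) ^ m * h m [] / a s = (\<Oplus>j. tm m (?f m) s j q (j # [k]))" for m
   using rf_perm[of "[snd q, k]" "[k, snd q]" m X l] by (simp add: tm_div[OF rf_perm] h_def)
  have h2: "dco s m * h m [] = tm m (?f m) s k q [] - ?v m s k q []" for m by (simp add: vt_def h_def)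
  \<comment> \<open>The coefficient of index m + 1 is eliminated, so that every summand is a term of
    index m already known to tend to 0.\<close>
  have S': "S m = y m + b s * (\<Oplus>j. tm m (?f m) s j q (j # [k])) - c s * (tm m (?f m) s k q [] - ?v m s k q [])" for m
  proof -
   have d: "(a s + b s) * dco s (Suc m) = b s / a s * (- c s / a s) ^ m - c s * dco s m" using ab0[of s] by simp
   have "(a s + b s) * dco s (Suc m) * h m [] = b s * ((- c s / a s) ^ m * h m [] / a s) - c s * (dco s m * h m [])"
    using arg_cong[OF d, of "%x. x * h m []"] by (simp add: algebra_simps del: dco.simps)
   thus ?thesis unfolding S_def h1 h2 by simp
  qed
  have "S \<longlonglongrightarrow> (c s * 0 + g * (\<Oplus>j p. R k j p * 0)) + b s * (\<Sum>j\<in>(UNIV::'n set). 0) - c s * (0 - 0)"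
   unfolding S'[abs_def]
   by (intro tendsto_add tendsto_diff tendsto_mult tendsto_const tendsto_sum t y0 summable_LIMSEQ_zero[OF sm]) auto
  thus ?thesis by simp
 qed
 have "(%N. \<Sum>m<Suc N. T m) \<longlonglongrightarrow> 0" unfolding part by (rule S0)
 moreover have "(%N. \<Sum>m<Suc N. T m) \<longlonglongrightarrow> (a s * (\<Oplus>p. V X l s k q [p, p]) + b s * (\<Oplus>j. V X l s j q [k, j])
  + g * (\<Oplus>j p. R k j p * V X l (~ s) j q [p]) + c s * V X l s k q [])"
  using Tsums unfolding sums_def by (rule LIMSEQ_Suc)
 ultimately show ?thesis by (rule LIMSEQ_unique[symmetric])
qed

end

lemma at_within_eq_Int_ball:
 "r > 0 ==> at (t::'a::metric_space) within (S Int ball t r) = at t within S"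
 by (rule at_within_nhd[of t "ball t r"]) auto

lemma uniform_limit_sum:
 fixes f :: "'i => 'c => 'a => 'b::real_normed_vector"
 assumes "!!i. i : A ==> uniform_limit S (f i) (l i) F"
 shows "uniform_limit S (%n x. \<Sum>i\<in>A. f i n x) (%x. \<Sum>i\<in>A. l i x) F"
 using assms
 by (induction A rule: infinite_finite_induct) (auto intro!: uniform_limit_add uniform_limit_const)

section \<open>Continuity and termwise differentiation of the series\<close>

context kernel
begin

lemma continuous_on_rder:
 assumes "continuous_on T X" "continuous_on T l"
 shows "continuous_on T (%t. rder nu k (X t) (l t) I j)"
proof (induction "length I" arbitrary: I j rule: less_induct)
 case less
 show ?case
 proof (cases I)
  case Nil
  show ?thesis unfolding Nil rder.simps rad_def by (intro continuous_intros assms)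
 next
  case (Cons i I')
  have len: "length I' < length I" "length (remove1 i I') < length I"
   using Cons by (auto simp: length_remove1)
  show ?thesis unfolding Cons rder.simps
   by (intro continuous_on_add continuous_on_mult continuous_on_const less.hyps len continuous_on_component[OF assms(1)])
 qed
qed

lemma continuous_on_tm:
 assumes "!!I. continuous_on T (%t. f t I)"
 shows "continuous_on T (%t. tm m (f t) s k q I)"
proof (induction m arbitrary: s k I)
 case 0
 thus ?case by (cases "q = (s, k)") (auto intro!: continuous_intros assms simp: a0)
next
 case (Suc m)
 thus ?case using a0 unfolding tm.simps by (intro continuous_intros) auto
qed

lemma continuous_on_vt:
 assumes "continuous_on T X" "continuous_on T l"
 shows "continuous_on T (%t. vt m (rf m (X t) (l t)) s k q I)"
proof -
 have r: "continuous_on T (%t. rf m (X t) (l t) I)" for I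
  unfolding rf_def by (rule continuous_on_rder[OF assms])
 have "continuous_on T (%t. if fst q = s then dco s m * rf m (X t) (l t) (k # snd q # I) else 0)"
  by (cases "fst q = s") (auto intro!: continuous_intros r)
 thus ?thesis unfolding vt_def by (intro continuous_on_diff continuous_on_tm r)
qed

lemma W_local_bound:
 fixes X :: "'a::metric_space => complex^'n"
 assumes X: "continuous_on T X" and l: "continuous_on T l" and t: "t : T"
 obtains r B R0 where "r > 0" "R0 >= 0" "!!u. u : T Int ball t r ==> norm (X u) <= R0"
  "!!u j. u : T Int ball t r ==> j <= 4 ==> W (X u) (l u) j <= B"
proof -
 define w where "w u = (\<Sum>j\<in>{..4}. W (X u) (l u) j)" for u
 have "continuous_on T w" unfolding w_def[abs_def] W_def by (intro continuous_intros X l) auto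
 then obtain r1 where r1: "r1 > 0" "!!u. u : T ==> dist u t < r1 ==> dist (w u) (w t) < 1"
  using t unfolding continuous_on_iff by (metis zero_less_one)
 obtain r2 where r2: "r2 > 0" "!!u. u : T ==> dist u t < r2 ==> dist (X u) (X t) < 1"
  using t X unfolding continuous_on_iff by (metis zero_less_one)
 show thesis
 proof (rule that[of "min r1 r2" "norm (X t) + 1" "w t + 1"])
  fix u assume u: "u : T Int ball t (min r1 r2)"
  hence "dist (X u) (X t) < 1" using r2(2)[of u] by (simp add: dist_commute)
  thus "norm (X u) <= norm (X t) + 1" using norm_triangle_sub[of "X u" "X t"] by (simp add: dist_norm)
  fix j :: nat assume "j <= 4"
  hence "W (X u) (l u) j <= w u" unfolding w_def by (intro member_le_sum) (auto simp: W_nonneg)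
  moreover have "dist (w u) (w t) < 1" using u r1(2)[of u] by (simp add: dist_commute)
  ultimately show "W (X u) (l u) j <= w t + 1" by (simp add: dist_norm)
 qed (use r1 r2 in auto)
qed

lemma vt_uniform_limit:
 fixes X :: "'a::metric_space => complex^'n"
 assumes X: "continuous_on T X" and l: "continuous_on T l" and e: "!!u. u : T ==> exp (l u) = sq_sum (X u)" and t: "t : T"
 obtains r where "r > 0" "!!s k q I. length I <= 4 ==> uniform_limit (T Int ball t r) (%N u. \<Sum>m<N. vt m (rf m (X u) (l u)) s k q I)
  (%u. V (X u) (l u) s k q I) sequentially"
proof -
 obtain r B R0 where r: "r > 0" "R0 >= 0" "!!u. u : T Int ball t r ==> norm (X u) <= R0"
  "!!u j. u : T Int ball t r ==> j <= 4 ==> W (X u) (l u) j <= B"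
  by (rule W_local_bound[OF X l t]) blast
 show thesis
 proof (rule vt_bound[OF r(2)])
  fix K
  assume K: "K >= 1"
  "!!m X l s k q I. exp l = sq_sum X ==> norm X <= R0 ==> length I <= 4 ==>
   norm (vt m (rf m X l) s k q I) <= K ^ Suc m / fact m * W X l (length I)"
  show thesis
  proof (rule that[OF r(1)])
   fix s k q and I :: "'n list" assume I: "length I <= 4"
   show "uniform_limit (T Int ball t r) (%N u. \<Sum>m<N. vt m (rf m (X u) (l u)) s k q I)
    (%u. V (X u) (l u) s k q I) sequentially"
    unfolding V_def
   proof (rule Weierstrass_m_test)
    show "summable (%m. K ^ Suc m / fact m * B)" by (rule summable_power_fact)
    fix m u assume u: "u : T Int ball t r"
    have "norm (vt m (rf m (X u) (l u)) s k q I) <= K ^ Suc m / fact m * W (X u) (l u) (length I)"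
     using u r I by (intro K e) auto
    also have "... <= K ^ Suc m / fact m * B"
     using K(1) r(4)[OF u I] by (intro mult_left_mono) auto
    finally show "norm (vt m (rf m (X u) (l u)) s k q I) <= K ^ Suc m / fact m * B" .
   qed
  qed
 qed
qed

lemma continuous_on_V:
 fixes X :: "'a::metric_space => complex^'n"
 assumes X: "continuous_on T X" and l: "continuous_on T l" and e: "!!u. u : T ==> exp (l u) = sq_sum (X u)"
  and I: "length I <= 4"
 shows "continuous_on T (%u. V (X u) (l u) s k q I)"
 unfolding continuous_on_eq_continuous_within
proof
 fix t assume t: "t : T"
 show "continuous (at t within T) (%u. V (X u) (l u) s k q I)"
 proof (rule vt_uniform_limit[OF X l e t])
  fix r :: real assume r: "r > 0" "!!s k q I. length I <= 4 ==> uniform_limit (T Int ball t r) (%N u. \<Sum>m<N. vt m (rf m (X u) (l u)) s k q I)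
   (%u. V (X u) (l u) s k q I) sequentially"
  have "continuous_on (T Int ball t r) (%u. V (X u) (l u) s k q I)"
  proof (rule uniform_limit_theorem[OF _ r(2)[OF I]])
   have "continuous_on (T Int ball t r) X" "continuous_on (T Int ball t r) l"
    using X l by (auto intro: continuous_on_subset)
   thus "\<forall>\<^sub>F N in sequentially. continuous_on (T Int ball t r) (%u. \<Sum>m<N. vt m (rf m (X u) (l u)) s k q I)"
    by (intro always_eventually allI continuous_on_sum continuous_on_vt)
  qed simp
  hence "continuous (at t within (T Int ball t r)) (%u. V (X u) (l u) s k q I)"
   using t r(1) unfolding continuous_on_eq_continuous_within by auto
  thus ?thesis unfolding at_within_eq_Int_ball[OF r(1)] .
 qed
qed

text \<open>S is convex but not necessarily open: it is a real segment when the partial derivatives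
  in y are taken, and an open half-plane when holomorphy in the height of the pole is shown. In both
  cases the coordinates of X are affine, with constant velocities \<open>d i\<close>.\<close>

lemma V_has_field_derivative:
 fixes X :: "complex => complex^'n"
 assumes S: "convex S" and t: "t : S"
  and X: "!!i u. u : S ==> ((%t. X t $ i) has_field_derivative d i) (at u within S)"
  and l: "continuous_on S l" and e: "!!u. u : S ==> exp (l u) = sq_sum (X u)"
  and I: "length I <= 3"
 shows "((%u. V (X u) (l u) s k q I) has_field_derivative (\<Oplus>i. d i * V (X t) (l t) s k q (i # I))) (at t within S)"
proof -
 have Xc: "continuous_on S X"
 proof -
  have "continuous_on S (%u. X u $ i)" for i
   unfolding continuous_on_eq_continuous_within
   using X DERIV_continuous by blast
  hence "continuous_on S (%u. \<chi> i. X u $ i)" by (rule continuous_on_vec_lambda)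
  thus ?thesis by simp
 qed
 have "EX r>0. ALL s k q I. length I <= 4 --> uniform_limit (S Int ball t r) (%N u. \<Sum>m<N. vt m (rf m (X u) (l u)) s k q I) (%u. V (X u) (l u) s k q I) sequentially"
 proof (rule vt_uniform_limit[OF Xc l e t])
  fix r :: real assume "r > 0" "!!s k q I. length I <= 4 ==> uniform_limit (S Int ball t r) (%N u. \<Sum>m<N. vt m (rf m (X u) (l u)) s k q I) (%u. V (X u) (l u) s k q I) sequentially"
  thus ?thesis by (intro exI[of _ r]) simp
 qed
 then obtain r where r: "r > 0" "!!s k q I. length I <= 4 ==> uniform_limit (S Int ball t r) (%N u. \<Sum>m<N. vt m (rf m (X u) (l u)) s k q I) (%u. V (X u) (l u) s k q I) sequentially" by blast
 define T where "T = S Int ball t r"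
 let ?v = "%m u. vt m (rf m (X u) (l u)) s k q"
 let ?V = "%u. V (X u) (l u) s k q"
 let ?r = "%m u. rf m (X u) (l u)"
 have T: "convex T" "t : T" "T \<subseteq> S" using S t r by (auto simp: T_def intro: convex_Int)
 have atT: "at u within T = at u within S" if "u : T" for u
  using that unfolding T_def by (intro at_within_nhd[of u "ball t r"]) auto
 have ul: "uniform_limit T (%N u. \<Sum>m<N. \<Oplus>i. d i * ?v m u (i # I))
   (%u. \<Oplus>i. d i * ?V u (i # I)) sequentially"
 proof -
  have "uniform_limit T (%N u. \<Oplus>i. d i * (\<Sum>m<N. ?v m u (i # I)))
   (%u. \<Oplus>i. d i * ?V u (i # I)) sequentially"
   unfolding T_def using I by (intro uniform_limit_sum bounded_linear.uniform_limit[OF bounded_linear_mult_right] r(2)) simp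
  moreover have "(\<Oplus>i. d i * (\<Sum>m<N. ?v m u (i # I)))
   = (\<Sum>m<N. \<Oplus>i. d i * ?v m u (i # I))" for N u
   unfolding sum_distrib_left by (rule sum.swap)
  ultimately show ?thesis by simp
 qed
 have der: "((%u. ?v m u I) has_field_derivative
   (\<Oplus>i. d i * ?v m u (i # I))) (at u within T)" if u: "u : T" for m u
 proof -
  have uS: "u : S" using u T by auto
  have lc: "continuous (at u within S) l" using l uS by (simp add: continuous_on_eq_continuous_within)
  obtain l' where l': "(l has_field_derivative l') (at u within S)"
   "exp (l u) * l' = 2 * (\<Oplus>i. X u $ i * d i)"
   by (rule exp_log_within_derivative[OF X[OF uS] uS lc e])
  have rfd: "((%t. rf m (X t) (l t) J) has_field_derivative (\<Oplus>i. d i * ?r m u (i # J))) (at u within S)" for J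
   unfolding rf_def by (rule rder_deriv[OF X[OF uS] l'])
  have "((%t. tm m (rf m (X t) (l t)) s k q I) has_field_derivative (\<Oplus>i. d i * tm m (?r m u) s k q (i # I))) (at u within S)"
   by (rule tm_deriv[OF rfd])
  moreover have "((%t. if fst q = s then dco s m * rf m (X t) (l t) (k # snd q # I) else 0) has_field_derivative
   (\<Oplus>i. d i * (if fst q = s then dco s m * ?r m u (k # snd q # i # I) else 0))) (at u within S)"
  proof (cases "fst q = s")
   case True
   have "(\<Oplus>i. d i * (dco s m * ?r m u (k # snd q # i # I))) =
     dco s m * (\<Oplus>i. d i * ?r m u (i # k # snd q # I))"
   proof -
    have "?r m u (k # snd q # i # I) = ?r m u (i # k # snd q # I)" for i
     by (rule rf_perm) simp
    thus ?thesis by (simp add: sum_distrib_left mult_ac)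
   qed
   thus ?thesis using True DERIV_cmult[OF rfd[of "k # snd q # I"], of "dco s m"] by simp
  qed simp
  ultimately have "((%u. ?v m u I) has_field_derivative
   (\<Oplus>i. d i * tm m (?r m u) s k q (i # I)) -
   (\<Oplus>i. d i * (if fst q = s then dco s m * ?r m u (k # snd q # i # I) else 0))) (at u within S)"
   unfolding vt_def by (rule DERIV_diff)
  thus ?thesis unfolding atT[OF u] vt_def by (simp add: right_diff_distrib sum_subtractf)
 qed
 have sm: "summable (%m. vt m (rf m (X t) (l t)) s k q I)"
  by (rule vt_summable) (use e t I in auto)
 have "EX h. ALL x:T. (%m. vt m (rf m (X x) (l x)) s k q I) sums h x \<and>
   (h has_field_derivative (\<Oplus>i. d i * ?V x (i # I))) (at x within T)"
  by (rule has_field_derivative_series[OF T(1) der ul T(2) sm])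
 then obtain h where h: "!!x. x : T ==> (%m. vt m (rf m (X x) (l x)) s k q I) sums h x \<and>
   (h has_field_derivative (\<Oplus>i. d i * ?V x (i # I))) (at x within T)"
  by blast
 have "h x = ?V x I" if "x : T" for x
  unfolding V_def using h[OF that] by (simp add: sums_iff)
 hence "((%u. ?V u I) has_field_derivative (\<Oplus>i. d i * ?V t (i # I))) (at t within T)"
  using h[OF T(2)] T(2) by (auto intro: has_field_derivative_transform_within[OF _ zero_less_one])
 thus ?thesis unfolding atT[OF T(2)] .
qed

end

section \<open>Calculus with coordinatewise derivatives\<close>

lemma partial_has_real_derivative:
 "partial_differentiable k f x ==> ((%t. f (x + t *\<^sub>R axis k 1)) has_real_derivative partial k f x) (at 0)"
 unfolding partial_differentiable_def partial_def
 by (simp add: DERIV_deriv_iff_real_differentiable)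

lemma partialI:
 "((%t. f (x + t *\<^sub>R axis k 1)) has_real_derivative d) (at 0) ==> partial_differentiable k f x & partial k f x = d"
 unfolding partial_differentiable_def partial_def
 by (metis DERIV_imp_deriv real_differentiable_def)

lemma partial_has_real_derivative_at:
 assumes "partial_differentiable k f (x + t *\<^sub>R axis k 1)"
 shows "((%t. f (x + t *\<^sub>R axis k 1)) has_real_derivative partial k f (x + t *\<^sub>R axis k 1)) (at t)"
proof -
 have "((%u. f (x + (u + t) *\<^sub>R axis k 1)) has_real_derivative partial k f (x + t *\<^sub>R axis k 1)) (at 0)"
  using partial_has_real_derivative[OF assms] by (simp add: algebra_simps)
 thus ?thesis using DERIV_shift[of "%t. f (x + t *\<^sub>R axis k 1)" "partial k f (x + t *\<^sub>R axis k 1)" 0 t] by simp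
qed

lemma partial_mvt:
 fixes f :: "real^'n::finite => real"
 assumes "!!t. t : closed_segment 0 h ==> partial_differentiable k f (x + t *\<^sub>R axis k 1)"
 obtains t where "t : closed_segment 0 h" "f (x + h *\<^sub>R axis k 1) - f x = h * partial k f (x + t *\<^sub>R axis k 1)"
proof -
 let ?g = "%t. f (x + t *\<^sub>R axis k 1)"
 have d: "(?g has_real_derivative partial k f (x + t *\<^sub>R axis k 1)) (at t)" if "t : closed_segment 0 h" for t
  by (rule partial_has_real_derivative_at[OF assms[OF that]])
 show thesis
 proof (cases h "0::real" rule: linorder_cases)
  case less
  have "EX z>h. z < 0 & ?g 0 - ?g h = (0 - h) * partial k f (x + z *\<^sub>R axis k 1)"
   using less d by (intro MVT2) (auto simp: closed_segment_eq_real_ivl)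
  then obtain z where "z > h" "z < 0" "?g 0 - ?g h = (0 - h) * partial k f (x + z *\<^sub>R axis k 1)" by blast
  thus thesis using less by (intro that[of z]) (auto simp: closed_segment_eq_real_ivl algebra_simps)
 next
  case equal
  thus thesis using that[of 0] by simp
 next
  case greater
  have "EX z>0. z < h & ?g h - ?g 0 = (h - 0) * partial k f (x + z *\<^sub>R axis k 1)"
   using greater d by (intro MVT2) (auto simp: closed_segment_eq_real_ivl)
  then obtain z where "z > 0" "z < h" "?g h - ?g 0 = (h - 0) * partial k f (x + z *\<^sub>R axis k 1)" by blast
  thus thesis using greater by (intro that[of z]) (auto simp: closed_segment_eq_real_ivl)
 qed
qed

text \<open>Balls of the maximum norm: derivatives are known along the axes only, and in a cube one
  can pass from point to point by changing one coordinate at a time.\<close>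

definition cube :: "real^'n::finite => real => (real^'n) set" where
 "cube y r = {z. ALL i. \<bar>z $ i - y $ i\<bar> <= r}"

lemma cube_eq_cbox: "cube y r = cbox (y - (\<chi> i. r)) (y + (\<chi> i. r))"
 by (auto simp: cube_def mem_box_cart abs_le_iff algebra_simps)

lemma compact_cube: "compact (cube y r)" by (simp add: cube_eq_cbox)

lemma mem_cube_self: "0 <= r ==> y : cube y r" by (simp add: cube_def)

lemma cube_mono: "r <= s ==> cube y r \<subseteq> cube y s" unfolding cube_def using order_trans by blast

lemma ball_subset_cube: "ball y r \<subseteq> cube y r"
proof
 fix z assume "z : ball y r"
 hence "norm (z - y) < r" by (simp add: dist_norm norm_minus_commute)
 hence "\<bar>(z - y) $ i\<bar> <= r" for i using component_le_norm_cart[of "z - y" i] by linarith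
 thus "z : cube y r" by (simp add: cube_def)
qed

lemma cube_subset_cball: "cube (y :: real^'n) r \<subseteq> cball y (real CARD('n) * r)"
proof
 fix z assume z: "z : cube y r"
 have "norm (z - y) <= (\<Oplus>i. \<bar>(z - y) $ i\<bar>)" by (rule norm_le_l1_cart)
 also have "... <= (\<Sum>i\<in>(UNIV :: 'n set). r)" using z by (intro sum_mono) (simp add: cube_def)
 finally show "z : cball y (real CARD('n) * r)" by (simp add: dist_norm norm_minus_commute)
qed

lemma open_contains_cube:
 assumes "open W" "y : W"
 obtains r where "r > 0" "cube (y :: real^'n) r \<subseteq> W"
proof -
 obtain e where e: "e > 0" "cball y e \<subseteq> W" using assms open_contains_cball by blast
 have "cube y (e / real CARD('n)) \<subseteq> cball y e"
  using cube_subset_cball[of y "e / real CARD('n)"] by simp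
 thus thesis using that[of "e / real CARD('n)"] e by auto
qed

text \<open>The mean value theorem, one coordinate after another. A general set A of coordinates is
  allowed because a level set is later shown to be a graph by changing all coordinates but
  one.\<close>

lemma c1_increment_le:
 fixes f :: "real^'n::finite => real"
 assumes pd: "!!k z. z : cube y r ==> partial_differentiable k f z"
  and B: "!!k z. z : cube y r ==> \<bar>partial k f z\<bar> <= B"
  and p: "p : cube y r" and q: "q : cube y r"
 shows "\<bar>f (\<chi> i. if i : A then q $ i else p $ i) - f p\<bar> <= B * (\<Sum>i\<in>A. \<bar>q $ i - p $ i\<bar>)"
proof -
 have "finite A" by simp
 thus ?thesis
 proof (induction A)
  case empty
  have "(\<chi> i. p $ i) = p" by (simp add: vec_eq_iff)
  thus ?case by simp
 next
  case (insert a A)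
  define v where "v = (\<chi> i. if i : A then q $ i else p $ i)"
  have v': "(\<chi> i. if i : insert a A then q $ i else p $ i) = v + (q $ a - p $ a) *\<^sub>R axis a 1"
   using insert.hyps by (auto simp: vec_eq_iff v_def axis_def)
  have mem: "v + t *\<^sub>R axis a 1 : cube y r" if "t : closed_segment 0 (q $ a - p $ a)" for t
  proof -
   have "\<bar>(v + t *\<^sub>R axis a 1) $ i - y $ i\<bar> <= r" for i
   proof (cases "i = a")
    case True
    have "\<bar>p $ a - y $ a\<bar> <= r" "\<bar>q $ a - y $ a\<bar> <= r" using p q by (auto simp: cube_def)
    moreover have "(v + t *\<^sub>R axis a 1) $ i = p $ a + t" using True insert.hyps by (simp add: v_def axis_def)
    ultimately show ?thesis using that True by (auto simp: closed_segment_eq_real_ivl split: if_splits)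
   next
    case False
    thus ?thesis using p q by (auto simp: cube_def v_def axis_def)
   qed
   thus ?thesis by (simp add: cube_def)
  qed
  obtain t where t: "t : closed_segment 0 (q $ a - p $ a)"
   "f (v + (q $ a - p $ a) *\<^sub>R axis a 1) - f v = (q $ a - p $ a) * partial a f (v + t *\<^sub>R axis a 1)"
   by (rule partial_mvt[of "q $ a - p $ a" a f v]) (use pd mem in auto)
  have "\<bar>f (v + (q $ a - p $ a) *\<^sub>R axis a 1) - f v\<bar> <= \<bar>q $ a - p $ a\<bar> * B"
   unfolding t(2) abs_mult by (intro mult_left_mono B mem t) auto
  moreover have "\<bar>f v - f p\<bar> <= B * (\<Sum>i\<in>A. \<bar>q $ i - p $ i\<bar>)" using insert.IH by (simp add: v_def)
  ultimately show ?case unfolding v' using insert.hyps by (simp add: algebra_simps)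
 qed
qed

lemma C1_on_bounded_partials:
 assumes "C1_on W f" "cube y r \<subseteq> W"
 obtains B where "B >= 0" "!!k z. z : cube y r ==> \<bar>partial k f z\<bar> <= B"
proof -
 have "EX b. ALL z:cube y r. \<bar>partial k f z\<bar> <= b" for k
 proof -
  have "continuous_on (cube y r) (partial k f)"
   using assms by (auto simp: C1_on_def intro: continuous_on_subset)
  hence "bounded (partial k f ` cube y r)"
   by (intro compact_imp_bounded compact_continuous_image compact_cube)
  thus ?thesis by (auto simp: bounded_iff)
 qed
 then obtain b where b: "!!k z. z : cube y r ==> \<bar>partial k f z\<bar> <= b k" by metis
 show thesis
 proof (rule that[of "\<Oplus>k. \<bar>b k\<bar>"])
  fix k z assume "z : cube y r"
  hence "\<bar>partial k f z\<bar> <= \<bar>b k\<bar>" using b by (metis abs_ge_self order_trans)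
  also have "... <= (\<Oplus>k. \<bar>b k\<bar>)" by (rule member_le_sum) auto
  finally show "\<bar>partial k f z\<bar> <= (\<Oplus>k. \<bar>b k\<bar>)" .
 qed (simp add: sum_nonneg)
qed

text \<open>\<open>C1_on\<close> speaks of partial derivatives only. Being continuous, they are
  bounded on a small cube, which gives a Lipschitz estimate there.\<close>

lemma C1_on_imp_continuous_on:
 fixes f :: "real^'n::finite => real"
 assumes W: "open W" and f: "C1_on W f"
 shows "continuous_on W f"
proof (rule continuous_at_imp_continuous_on, rule ballI)
 fix y assume y: "y : W"
 obtain r where r: "r > 0" "cube y r \<subseteq> W" by (rule open_contains_cube[OF W y])
 obtain B where B: "B >= 0" "!!k z. z : cube y r ==> \<bar>partial k f z\<bar> <= B"
  by (rule C1_on_bounded_partials[OF f r(2)]) blast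
 have pd: "partial_differentiable k f z" if "z : cube y r" for k z
  using f r that by (auto simp: C1_on_def)
 have ev: "\<forall>\<^sub>F z in at y. norm (f z - f y) <= B * (\<Oplus>i. \<bar>z $ i - y $ i\<bar>)"
 proof -
  have "\<forall>\<^sub>F z in at y. z : ball y r" using r(1) by (intro eventually_at_in_open') auto
  thus ?thesis
  proof eventually_elim
   case (elim z)
   hence z: "z : cube y r" using ball_subset_cube by blast
   have "(\<chi> i. if i : UNIV then z $ i else y $ i) = z" by (simp add: vec_eq_iff)
   thus ?case
    using c1_increment_le[OF pd B(2) mem_cube_self z, of UNIV] r(1) by simp
  qed
 qed
 have "((%z. B * (\<Oplus>i. \<bar>z $ i - y $ i\<bar>)) \<longlongrightarrow> B * (\<Oplus>i. \<bar>y $ i - y $ i\<bar>)) (at y)"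
  by (intro tendsto_intros)
 hence "((%z. f z - f y) \<longlongrightarrow> 0) (at y)"
  using ev by (intro Lim_null_comparison[OF ev]) simp
 thus "isCont f y" unfolding isCont_def by (simp add: LIM_zero_iff)
qed

lemma second_difference_mvt:
 fixes f :: "real^'n::finite => real"
 assumes f: "C2_on W f" and W: "cube x h \<subseteq> W" and ij: "i ~= j" and h: "0 < h"
 obtains z where "z : cube x h"
  "f (x + h *\<^sub>R axis i 1 + h *\<^sub>R axis j 1) - f (x + h *\<^sub>R axis i 1) - f (x + h *\<^sub>R axis j 1) + f x = h * (h * partial j (partial i f) z)"
proof -
 have f1: "C1_on W f" and f2: "C1_on W (partial i f)" using f by (auto simp: C2_on_def)
 define P where "P s t = x + t *\<^sub>R axis j 1 + s *\<^sub>R axis i 1" for s t :: real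
 have Pin: "P s t : cube x h" if "0 <= s" "s <= h" "0 <= t" "t <= h" for s t
  using that ij by (auto simp: P_def cube_def axis_def)
 have Pj: "P s t = (x + s *\<^sub>R axis i 1) + t *\<^sub>R axis j 1" for s t by (simp add: P_def)
 have d: "((%s. f (P s h) - f (P s 0)) has_real_derivative partial i f (P s h) - partial i f (P s 0)) (at s)" if "0 <= s" "s <= h" for s
 proof -
  have "((%s. f (P s t)) has_real_derivative partial i f (P s t)) (at s)" if "t = 0 | t = h" for t
   unfolding P_def using that h f1 Pin[of s t] W \<open>0 <= s\<close> \<open>s <= h\<close>
   by (intro partial_has_real_derivative_at) (auto simp: C1_on_def P_def)
  thus ?thesis by (intro DERIV_diff) auto
 qed
 obtain s where s: "0 < s" "s < h" "(f (P h h) - f (P h 0)) - (f (P 0 h) - f (P 0 0)) = (h - 0) * (partial i f (P s h) - partial i f (P s 0))"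
  using MVT2[of 0 h "%s. f (P s h) - f (P s 0)" "%s. partial i f (P s h) - partial i f (P s 0)"] h d by auto
 have d2: "((%t. partial i f (P s t)) has_real_derivative partial j (partial i f) (P s t)) (at t)" if "0 <= t" "t <= h" for t
  unfolding Pj using f2 Pin[of s t] W s h that
  by (intro partial_has_real_derivative_at) (auto simp: C1_on_def Pj)
 obtain t where t: "0 < t" "t < h" "partial i f (P s h) - partial i f (P s 0) = (h - 0) * partial j (partial i f) (P s t)"
  using MVT2[of 0 h "%t. partial i f (P s t)" "%t. partial j (partial i f) (P s t)"] h d2 by auto
 show thesis by (rule that[OF Pin[of s t]]) (use s t in \<open>auto simp: P_def add_ac\<close>)
qed

text \<open>The second difference over a small rectangle is symmetric in i and j. By the mean value
  theorem it is h^2 times either mixed derivative at some nearby point, so the two agree in the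
  limit by continuity.\<close>

lemma mixed_partials_eq:
 fixes f :: "real^'n::finite => real"
 assumes W: "open W" and f: "C2_on W f" and x: "x : W"
 shows "partial i (partial j f) x = partial j (partial i f) x"
proof (rule ccontr)
 assume ne: "~ ?thesis"
 hence ij: "i ~= j" by auto
 obtain r where r: "r > 0" "cube x r \<subseteq> W" by (rule open_contains_cube[OF W x])
 define e where "e = \<bar>partial i (partial j f) x - partial j (partial i f) x\<bar> / 2"
 have e: "e > 0" using ne by (simp add: e_def)
 have "isCont (partial i (partial j f)) x" "isCont (partial j (partial i f)) x"
  using f W x by (auto simp: C2_on_def C1_on_def continuous_on_eq_continuous_at)
 then obtain d1 d2 where d: "d1 > 0" "d2 > 0"
  "!!z. dist z x < d1 ==> dist (partial i (partial j f) z) (partial i (partial j f) x) < e"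
  "!!z. dist z x < d2 ==> dist (partial j (partial i f) z) (partial j (partial i f) x) < e"
  using e unfolding continuous_at_eps_delta by metis
 define h where "h = min r (min d1 d2 / (2 * real CARD('n)))"
 have h: "0 < h" "cube x h \<subseteq> W" using r d cube_mono[of h r x] by (auto simp: h_def)
 have near: "dist z x < d1" "dist z x < d2" if "z : cube x h" for z
 proof -
  have "dist x z <= real CARD('n) * h" using cube_subset_cball[of x h] that by auto
  also have "... <= real CARD('n) * (min d1 d2 / (2 * real CARD('n)))" by (intro mult_left_mono) (auto simp: h_def)
  also have "... = min d1 d2 / 2" by simp
  finally show "dist z x < d1" "dist z x < d2" using d by (auto simp: dist_commute)
 qed
 obtain z where z: "z : cube x h"
  "f (x + h *\<^sub>R axis i 1 + h *\<^sub>R axis j 1) - f (x + h *\<^sub>R axis i 1) - f (x + h *\<^sub>R axis j 1) + f x = h * (h * partial j (partial i f) z)"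
  by (rule second_difference_mvt[OF f h(2) ij h(1)])
 obtain z' where z': "z' : cube x h"
  "f (x + h *\<^sub>R axis j 1 + h *\<^sub>R axis i 1) - f (x + h *\<^sub>R axis j 1) - f (x + h *\<^sub>R axis i 1) + f x = h * (h * partial i (partial j f) z')"
  by (rule second_difference_mvt[OF f h(2) ij[symmetric] h(1)])
 have "h * (h * partial j (partial i f) z) = h * (h * partial i (partial j f) z')"
  unfolding z(2)[symmetric] z'(2)[symmetric] by (simp add: add_ac)
 hence "partial j (partial i f) z = partial i (partial j f) z'" using h by simp
 moreover have "dist (partial i (partial j f) z') (partial i (partial j f) x) < e" by (intro d near z')
 moreover have "dist (partial j (partial i f) z) (partial j (partial i f) x) < e" by (intro d near z)
 ultimately have "\<bar>partial i (partial j f) x - partial j (partial i f) x\<bar> < 2 * e"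
  unfolding dist_real_def by linarith
 thus False by (simp add: e_def)
qed

lemma integral_lborel_translation:
 fixes f :: "'a::euclidean_space => 'b::{banach, second_countable_topology}"
 assumes "f : borel_measurable borel"
 shows "(LI y. f (y + c)) = (LI y. f y)"
proof -
 have "(LI y. f y) = (LINT y|distr lborel borel ((+) c). f y)" by (simp add: lborel_distr_plus)
 also have "... = (LI y. f (c + y))" using assms by (subst integral_distr) auto
 finally show ?thesis by (simp add: add.commute)
qed

lemma integrable_continuous_bounded_support:
 fixes f :: "'a::euclidean_space => 'b::{banach, second_countable_topology}"
 assumes "continuous_on UNIV f" "!!y. norm y > B ==> f y = 0"
 shows "integrable lborel f"
proof -
 have "integrable lborel (%y. indicator (cball 0 B) y *\<^sub>R f y)"
  using assms by (intro borel_integrable_compact) (auto intro: continuous_on_subset)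
 moreover have "(%y. indicator (cball 0 B) y *\<^sub>R f y) = f"
  using assms(2) by (auto simp: indicator_def fun_eq_iff)
 ultimately show ?thesis by simp
qed

text \<open>The difference quotients integrate to 0 by translation invariance, and the mean value
  theorem dominates them, so the limit passes under the integral. This is the divergence theorem for
  compact supports.\<close>

lemma integral_directional_derivative_eq_0_real:
 fixes h h' :: "'a::euclidean_space => real"
 assumes h: "continuous_on UNIV h" and h': "continuous_on UNIV h'"
  and supp: "!!y. norm y > B ==> h y = 0" and B': "!!y. norm y > B ==> h' y = 0"
  and d: "!!y. ((%t. h (y + t *\<^sub>R e)) has_real_derivative h' y) (at 0)"
 shows "(LI y. h' y) = 0"
proof -
 have d': "((%t. h (y + t *\<^sub>R e)) has_real_derivative h' (y + t *\<^sub>R e)) (at t)" for y t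
 proof -
  have "((%u. h (y + (u + t) *\<^sub>R e)) has_real_derivative h' (y + t *\<^sub>R e)) (at 0)"
   using d[of "y + t *\<^sub>R e"] by (simp add: algebra_simps)
  thus ?thesis using DERIV_shift[of "%t. h (y + t *\<^sub>R e)" "h' (y + t *\<^sub>R e)" 0 t] by simp
 qed
 have "bounded (h' ` cball 0 B)"
  using h' by (intro compact_imp_bounded compact_continuous_image) (auto intro: continuous_on_subset)
 then obtain M where M: "!!y. norm y <= B ==> \<bar>h' y\<bar> <= M"
  unfolding bounded_iff by (metis mem_cball_0 image_eqI real_norm_def)
 define M' where "M' = max M 0"
 have M': "\<bar>h' y\<bar> <= M'" for y using M[of y] B'[of y] by (cases "norm y <= B") (auto simp: M'_def)
 define q where "q n y = (h (y + (1 / real (Suc n)) *\<^sub>R e) - h y) / (1 / real (Suc n))" for n y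
 have hi: "integrable lborel h" by (rule integrable_continuous_bounded_support[OF h supp])
 have hm: "h : borel_measurable borel" using h by (rule borel_measurable_continuous_onI)
 have hti: "integrable lborel (%y. h (y + c))" for c
 proof (rule integrable_continuous_bounded_support[where B = "B + norm c"])
  show "continuous_on UNIV (%y. h (y + c))" by (intro continuous_on_compose2[OF h] continuous_intros) auto
  show "h (y + c) = 0" if "norm y > B + norm c" for y
   using norm_triangle_ineq4[of "y + c" c] that by (intro supp) simp
 qed
 have q0: "(LI y. q n y) = 0" for n
  unfolding q_def using hi hti integral_lborel_translation[OF hm] by simp
 have qn: "norm (q n y) <= M' * indicator (cball 0 (B + norm e)) y" for n y
 proof (cases "norm y <= B + norm e")
  case True
  define t where "t = 1 / real (Suc n)"
  have t: "t > 0" by (simp add: t_def)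
  obtain z where "h (y + t *\<^sub>R e) - h (y + 0 *\<^sub>R e) = (t - 0) * h' (y + z *\<^sub>R e)"
   using MVT2[OF t d'] by blast
  hence "q n y = h' (y + z *\<^sub>R e)" using t unfolding q_def t_def[symmetric] by simp
  thus ?thesis using True M' by simp
 next
  case False
  have "norm ((1 / real (Suc n)) *\<^sub>R e) <= norm e" by (simp add: field_simps)
  hence "norm (y + (1 / real (Suc n)) *\<^sub>R e) > B" "norm y > B"
   using False norm_diff_ineq[of y "(1 / real (Suc n)) *\<^sub>R e"] norm_ge_zero[of e] by linarith+
  thus ?thesis using supp False by (simp add: q_def)
 qed
 have "(%n. LI y. q n y) \<longlonglongrightarrow> (LI y. h' y)"
 proof (rule integral_dominated_convergence)
  show "h' : borel_measurable lborel" using borel_measurable_continuous_onI[OF h'] by simp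
  show "q n : borel_measurable lborel" for n
   unfolding q_def using borel_measurable_integrable[OF hti] borel_measurable_integrable[OF hi]
   by (intro borel_measurable_divide borel_measurable_diff) auto
  show "integrable lborel (%y. M' * indicator (cball 0 (B + norm e)) y :: real)"
   by (intro integrable_mult_right integrable_real_indicator) (use emeasure_bounded_finite[of "cball 0 (B + norm e)"] in auto)
  show "AE y in lborel. norm (q n y) <= M' * indicator (cball 0 (B + norm e)) y" for n using qn by simp
  show "AE y in lborel. (%n. q n y) \<longlonglongrightarrow> h' y"
  proof (rule AE_I2)
   fix y
   have "((%t. (h (y + t *\<^sub>R e) - h y) / t) \<longlongrightarrow> h' y) (at 0)"
    using d[of y] by (simp add: DERIV_def)
   moreover have "filterlim (%n. 1 / real (Suc n)) (at 0) sequentially"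
    using LIMSEQ_Suc[OF lim_1_over_n] by (auto simp: filterlim_at)
   ultimately show "(%n. q n y) \<longlonglongrightarrow> h' y"
    unfolding q_def by (rule filterlim_compose)
  qed
 qed
 thus ?thesis by (simp add: q0 LIMSEQ_const_iff)
qed

lemma integral_directional_derivative_eq_0:
 fixes h h' :: "'a::euclidean_space => complex"
 assumes h: "continuous_on UNIV h" and h': "continuous_on UNIV h'"
  and supp: "!!y. norm y > B ==> h y = 0" and supp': "!!y. norm y > B ==> h' y = 0"
  and d: "!!y. ((%t::real. h (y + t *\<^sub>R e)) has_vector_derivative h' y) (at 0)"
 shows "(LI y. h' y) = 0"
proof -
 have i: "integrable lborel h'" by (rule integrable_continuous_bounded_support[OF h' supp'])
 have "Re (LI y. h' y) = (LI y. Re (h' y))" using i by simp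
 also have "... = 0"
 proof (rule integral_directional_derivative_eq_0_real[of "%y. Re (h y)" _ B e])
  show "((%t. Re (h (y + t *\<^sub>R e))) has_real_derivative Re (h' y)) (at 0)" for y
   using bounded_linear.has_vector_derivative[OF bounded_linear_Re d[of y]]
   by (simp add: has_real_derivative_iff_has_vector_derivative)
 qed (use supp supp' in \<open>auto intro!: continuous_intros h h'\<close>)
 finally have 1: "Re (LI y. h' y) = 0" .
 have "Im (LI y. h' y) = (LI y. Im (h' y))" using i by simp
 also have "... = 0"
 proof (rule integral_directional_derivative_eq_0_real[of "%y. Im (h y)" _ B e])
  show "((%t. Im (h (y + t *\<^sub>R e))) has_real_derivative Im (h' y)) (at 0)" for y
   using bounded_linear.has_vector_derivative[OF bounded_linear_Im d[of y]]
   by (simp add: has_real_derivative_iff_has_vector_derivative)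
 qed (use supp supp' in \<open>auto intro!: continuous_intros h h'\<close>)
 finally have 2: "Im (LI y. h' y) = 0" .
 show ?thesis using 1 2 by (simp add: complex_eq_iff)
qed

section \<open>Green's formula\<close>

context kernel
begin

lemma V_perm: "mset I = mset J ==> V X l s k q I = V X l s k q J"
proof -
 assume m: "mset I = mset J"
 have "vt m (rf m X l) s k q I = vt m (rf m X l) s k q J" for m
 proof -
  have "tm m (rf m X l) s k q I = tm m (rf m X l) s k q J" using tm_perm[OF rf_perm m] .
  moreover have "rf m X l (k # snd q # I) = rf m X l (k # snd q # J)" using m by (intro rf_perm) simp
  ultimately show ?thesis by (simp add: vt_def)
 qed
 thus ?thesis by (simp add: V_def)
qed

end

lemma levi_civita_swap: "levi_civita k j p = - levi_civita p j k" "levi_civita k j p = - levi_civita k p j"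
 "levi_civita k j p = - levi_civita j k p"
 by (auto simp: levi_civita_def)

lemma abs_levi_civita: "\<bar>levi_civita k j p\<bar> <= 1"
 by (auto simp: levi_civita_def)

text \<open>The conditions \<open>nz\<close> make the principal part invertible in both blocks:
  \<open>mu + al\<close> and \<open>nu + be\<close> are the coefficients of the Laplacian,
  \<open>lam + 2 * mu\<close> and \<open>ep + 2 * nu\<close> their sums with the coefficients of
  grad div.\<close>

locale elastic =
 fixes lam mu nu be ep al ro si \<theta> :: real and ty :: "'n::{finite,linorder} itself"
 assumes nz: "mu + al ~= 0" "lam + 2 * mu ~= 0" "nu + be ~= 0" "ep + 2 * nu ~= 0"
begin

definition ca :: "bool => complex" where "ca s = of_real (if s then mu + al else nu + be)"
definition cl :: "bool => complex" where "cl s = of_real (if s then lam else ep)"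
definition cm :: "bool => complex" where "cm s = of_real (if s then mu - al else nu - be)"
definition cc :: "bool => complex" where "cc s = of_real (if s then ro * si^2 else \<theta> * si^2 - 4 * al)"
definition cg :: complex where "cg = of_real (2 * al)"
definition lev :: "'n => 'n => 'n => complex" where "lev k j p = of_real (levi_civita k j p)"

text \<open>\<open>cl s + cm s\<close> is the coefficient of grad div, \<open>cc\<close> collects
  the terms of order zero, and the sign of \<open>- lev\<close> is that of the definition of
  \<open>rot\<close>.\<close>

sublocale kernel "real CARD('n) / 2" ca "%s. cl s + cm s" cc cg "%k j p. - lev k j p"
proof
 show "- lev k j p = - (- lev p j k)" for k j p
  by (simp add: lev_def) (metis levi_civita_swap(1) of_real_minus)
 show "- lev k j p = - (- lev k p j)" for k j p
  by (simp add: lev_def) (metis levi_civita_swap(2) of_real_minus)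
 show "norm (- lev k j p) <= 1" for k j p using abs_levi_civita[of k j p] by (simp add: lev_def)
 show "ca s ~= 0" for s using nz by (cases s) (simp_all add: ca_def del: of_real_add)
 have "mu + al + (lam + (mu - al)) = lam + 2 * mu" "nu + be + (ep + (nu - be)) = ep + 2 * nu" by simp_all
 thus "ca s + (cl s + cm s) ~= 0" for s using nz
  by (cases s) (simp_all add: ca_def cl_def cm_def of_real_add[symmetric] del: of_real_add of_real_diff)
qed simp

text \<open>The stress tensor on jets: A holds values, \<open>J s k p\<close> the derivative of
  component k along p, and in \<open>sgd\<close> H holds second derivatives. Contracting p with a
  normal gives the stress operator. With jets in place of functions Green's identity becomes
  algebra.\<close>

definition sg :: "bool => 'n => 'n => (bool => 'n => complex) => (bool => 'n => 'n => complex) => complex" where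
 "sg s k p A J = cl s * (if k = p then \<Oplus>j. J s j j else 0) + cm s * J s p k + ca s * J s k p
  - (if s then cg * (\<Oplus>j. lev k j p * A False j) else 0)"

definition sgd :: "bool => 'n => 'n => (bool => 'n => 'n => complex) => (bool => 'n => 'n => 'n => complex) => complex" where
 "sgd s k p J H = cl s * (if k = p then \<Oplus>j. H s j j p else 0) + cm s * H s p k p + ca s * H s k p p
  - (if s then cg * (\<Oplus>j. lev k j p * J False j p) else 0)"

definition pde :: "(bool => 'n => complex) => (bool => 'n => 'n => complex) => (bool => 'n => 'n => 'n => complex) => bool" where
 "pde A J H \<longleftrightarrow> (ALL s j p r. H s j p r = H s j r p) \<and>
  (ALL s k. ca s * (\<Oplus>p. H s k p p) + (cl s + cm s) * (\<Oplus>j. H s j j k)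
    + cg * (\<Oplus>j p. - lev k j p * J (~ s) j p) + cc s * A s k = 0)"

text \<open>Symmetry of the second derivatives merges the two grad-div parts of the stress. The
  stress of the u block contains the rotation term and absorbs the curl; that of the w block does
  not, so there the curl of u remains.\<close>

lemma sum_sgd:
 assumes "pde A J H"
 shows "(\<Oplus>p. sgd s k p J H) = - cc s * A s k + (if s then 0 else cg * (\<Oplus>j p. lev k j p * J True j p))"
proof -
 have sym: "H s j p r = H s j r p" for s j p r using assms by (auto simp: pde_def)
 have e: "ca s * (\<Oplus>p. H s k p p) + (cl s + cm s) * (\<Oplus>j. H s j j k)
  = cg * (\<Oplus>j p. lev k j p * J (~ s) j p) - cc s * A s k"
 proof -
  have "ca s * (\<Oplus>p. H s k p p) + (cl s + cm s) * (\<Oplus>j. H s j j k)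
    + cg * (\<Oplus>j p. - lev k j p * J (~ s) j p) + cc s * A s k = 0" using assms by (auto simp: pde_def)
  thus ?thesis by (simp add: sum_negf algebra_simps) (simp add: eq_neg_iff_add_eq_0 algebra_simps)?
 qed
 have "(\<Oplus>p. sgd s k p J H) = cl s * (\<Oplus>p. if k = p then \<Oplus>j. H s j j p else 0) + cm s * (\<Oplus>p. H s p p k)
  + ca s * (\<Oplus>p. H s k p p) - (if s then cg * (\<Oplus>p j. lev k j p * J False j p) else 0)"
  unfolding sgd_def sym[of s _ k]
  by (cases s) (simp_all only: sum.distrib sum_subtractf sum_distrib_left[symmetric] if_True if_False simp_thms sum.neutral_const diff_zero)
 also have "(\<Oplus>p j. lev k j p * J False j p) = (\<Oplus>j p. lev k j p * J False j p)"
  by (rule sum.swap)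
 also have "cl s * (\<Oplus>p. if k = p then \<Oplus>j. H s j j p else 0) = cl s * (\<Oplus>j. H s j j k)" by simp
 finally have "(\<Oplus>p. sgd s k p J H) = (ca s * (\<Oplus>p. H s k p p) + (cl s + cm s) * (\<Oplus>j. H s j j k))
   - (if s then cg * (\<Oplus>j p. lev k j p * J False j p) else 0)"
  by (simp add: algebra_simps)
 thus ?thesis unfolding e by (cases s) simp_all
qed

lemma sum_J_sg:
 "(\<Oplus>p s k. J s k p * sg s k p A' J')
 = (\<Oplus>s. cl s * ((\<Oplus>k. J s k k) * (\<Oplus>j. J' s j j)) + cm s * (\<Oplus>p k. J s k p * J' s p k)
   + ca s * (\<Oplus>p k. J s k p * J' s k p))
  - cg * (\<Oplus>p k j. lev k j p * (J True k p * A' False j))"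
proof -
 have 1: "(\<Oplus>k. J s k p * sg s k p A' J') = cl s * (J s p p * (\<Oplus>j. J' s j j)) + cm s * (\<Oplus>k. J s k p * J' s p k)
  + ca s * (\<Oplus>k. J s k p * J' s k p) - (if s then cg * (\<Oplus>k j. lev k j p * (J True k p * A' False j)) else 0)" for s p
 proof -
  have "J s k p * sg s k p A' J' = (if k = p then cl s * (J s p p * (\<Oplus>j. J' s j j)) else 0) + cm s * (J s k p * J' s p k)
  + ca s * (J s k p * J' s k p) - (if s then cg * (\<Oplus>j. lev k j p * (J True k p * A' False j)) else 0)" for k
   unfolding sg_def by (cases s) (auto simp: algebra_simps sum_distrib_left)
  hence "(\<Oplus>k. J s k p * sg s k p A' J') = (\<Oplus>k. (if k = p then cl s * (J s p p * (\<Oplus>j. J' s j j)) else 0) + cm s * (J s k p * J' s p k)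
  + ca s * (J s k p * J' s k p) - (if s then cg * (\<Oplus>j. lev k j p * (J True k p * A' False j)) else 0))"
   by (rule sum.cong[OF refl])
  thus ?thesis by (cases s) (simp_all add: sum.distrib sum_subtractf sum_distrib_left)
 qed
 show ?thesis unfolding 1 UNIV_bool
  by (simp add: sum.distrib sum_subtractf sum_distrib_left[symmetric] sum_distrib_right[symmetric])
qed

text \<open>The quadratic part of the stress is symmetric in the two fields. What is left over is
  the coupling \<open>T\<close> between the blocks, and it cancels against the curl that remains in
  the w block in \<open>sum_sgd\<close>.\<close>

lemma green_identity:
 assumes "pde A J H" "pde A' J' H'"
 shows "(\<Oplus>p s k. J s k p * sg s k p A' J' + A s k * sgd s k p J' H'
   - (J' s k p * sg s k p A J + A' s k * sgd s k p J H)) = 0"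
proof -
 define T where "T J A = (\<Oplus>k j p. lev k j p * (J True j p * A False k))"
  for J :: "bool => 'n => 'n => complex" and A :: "bool => 'n => complex"
 have T1: "(\<Oplus>p k j. lev k j p * (J True k p * A False j)) = - T J A" for J A
 proof -
  have "(\<Oplus>p k j. lev k j p * (J True k p * A False j))
   = (\<Oplus>p k j. - (lev j k p * (J True k p * A False j)))"
   by (intro sum.cong refl) (metis lev_def levi_civita_swap(3) mult_minus_left of_real_minus)
  also have "... = - (\<Oplus>p k j. lev j k p * (J True k p * A False j))" by (simp add: sum_negf)
  also have "(\<Oplus>p k j. lev j k p * (J True k p * A False j))
   = (\<Oplus>p j k. lev j k p * (J True k p * A False j))"
   by (rule sum.cong[OF refl], rule sum.swap)
  also have "... = (\<Oplus>j p k. lev j k p * (J True k p * A False j))" by (rule sum.swap)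
  also have "... = T J A" unfolding T_def by (rule sum.cong[OF refl], rule sum.swap)
  finally show ?thesis .
 qed
 have q: "(\<Oplus>p k. J s k p * J' s p k) = (\<Oplus>p k. J' s k p * J s p k)" for s
  by (subst sum.swap) (simp add: mult.commute)
 have B: "(\<Oplus>p s k. J s k p * sg s k p A' J') - (\<Oplus>p s k. J' s k p * sg s k p A J)
  = cg * T J A' - cg * T J' A"
 proof -
  define Q where "Q J J' s = cl s * ((\<Oplus>k. J s k k) * (\<Oplus>j. J' s j j)) + cm s * (\<Oplus>p k. J s k p * J' s p k)
   + ca s * (\<Oplus>p k. J s k p * J' s k p)" for J J' :: "bool => 'n => 'n => complex" and s
  have Qs: "Q J J' s = Q J' J s" for s
   unfolding Q_def q[of s] by (simp add: mult.commute)
  have "(\<Oplus>s. Q J J' s) = (\<Oplus>s. Q J' J s)" by (rule sum.cong[OF refl Qs])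
  thus ?thesis unfolding sum_J_sg T1 Q_def[symmetric] by simp
 qed
 have D: "(\<Oplus>p s k. A s k * sgd s k p J' H') = - (\<Oplus>s k. cc s * (A s k * A' s k)) + cg * T J' A"
  if "pde A' J' H'" for A A' :: "bool => 'n => complex" and J' H'
 proof -
  have "(\<Oplus>p s k. A s k * sgd s k p J' H') = (\<Oplus>s p k. A s k * sgd s k p J' H')"
   by (rule sum.swap)
  also have "... = (\<Oplus>s k p. A s k * sgd s k p J' H')"
   by (rule sum.cong[OF refl], rule sum.swap)
  also have "... = (\<Oplus>s k. A s k * (- cc s * A' s k + (if s then 0 else cg * (\<Oplus>j p. lev k j p * J' True j p))))"
   by (simp only: sum_distrib_left[symmetric] sum_sgd[OF that])
  also have "... = - (\<Oplus>s k. cc s * (A s k * A' s k)) + cg * T J' A"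
   unfolding T_def UNIV_bool
   by (simp add: algebra_simps sum.distrib sum_negf sum_subtractf sum_distrib_left)
  finally show ?thesis .
 qed
 have "(\<Oplus>p s k. J s k p * sg s k p A' J' + A s k * sgd s k p J' H'
   - (J' s k p * sg s k p A J + A' s k * sgd s k p J H))
  = ((\<Oplus>p s k. J s k p * sg s k p A' J') - (\<Oplus>p s k. J' s k p * sg s k p A J))
   + (\<Oplus>p s k. A s k * sgd s k p J' H') - (\<Oplus>p s k. A' s k * sgd s k p J H)"
  by (simp only: sum.distrib sum_subtractf) simp
 also have "... = 0" unfolding B D[OF assms(1)] D[OF assms(2)] by (simp add: mult_ac)
 finally show ?thesis .
qed

end

section \<open>Integration against gradients of cutoffs\<close>

definition vd :: "(real^'n => complex) => complex => 'n::finite => real^'n => bool" where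
 "vd f f' p y \<longleftrightarrow> ((%t::real. f (y + t *\<^sub>R axis p 1)) has_vector_derivative f') (at 0)"

lemma vd_add: "vd f f' p y ==> vd g g' p y ==> vd (%y. f y + g y) (f' + g') p y"
 unfolding vd_def by (rule has_vector_derivative_add)

lemma vd_diff: "vd f f' p y ==> vd g g' p y ==> vd (%y. f y - g y) (f' - g') p y"
 unfolding vd_def by (rule has_vector_derivative_diff)

lemma vd_cmult: "vd f f' p y ==> vd (%y. c * f y) (c * f') p y"
 unfolding vd_def by (rule has_vector_derivative_mult_right)

lemma vd_sum: "(!!i. i : A ==> vd (f i) (f' i) p y) ==> vd (%y. \<Sum>i\<in>A. f i y) (\<Sum>i\<in>A. f' i) p y"
 unfolding vd_def by (rule has_vector_derivative_sum)

lemma vd_mult: "vd f f' p y ==> vd g g' p y ==> vd (%y. f y * g y) (f' * g y + f y * g') p y"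
 unfolding vd_def using has_vector_derivative_mult[of "%t. f (y + t *\<^sub>R axis p 1)" f' 0 UNIV "%t. g (y + t *\<^sub>R axis p 1)" g']
 by (simp add: add.commute)

lemma vd_const: "vd (%y. c) 0 p y" unfolding vd_def by simp

lemma vd_of_real:
 "((%t. f (y + t *\<^sub>R axis p 1)) has_real_derivative d) (at 0) ==> vd (%y. of_real (f y)) (of_real d) p y"
 unfolding vd_def by (rule has_vector_derivative_of_real)

lemma vd_partial: "partial_differentiable p f y ==> vd (%y. of_real (f y)) (of_real (partial p f y)) p y"
 by (rule vd_of_real[OF partial_has_real_derivative])

lemma continuous_on_zero_extension:
 fixes f :: "'a::topological_space => 'b::{topological_space, zero}"
 assumes "continuous_on Om f" "open Om" "closed C" "C \<subseteq> Om" "!!x. x ~: C ==> f x = 0"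
 shows "continuous_on UNIV f"
proof -
 have "continuous_on (Om Un - C) f"
 proof (rule continuous_on_open_Un)
  have "continuous_on (- C) (%x. 0 :: 'b)" by (rule continuous_on_const)
  thus "continuous_on (- C) f" by (rule continuous_on_eq) (use assms in auto)
 qed (use assms in auto)
 moreover have "Om Un - C = UNIV" using assms by auto
 ultimately show ?thesis by simp
qed

lemma vd_zero_near:
 assumes "open A" "y : A" "!!z. z : A ==> f z = 0"
 shows "vd f 0 p y"
 unfolding vd_def
proof (rule has_vector_derivative_transform_within_open[OF has_vector_derivative_const[of 0]])
 show "open ((%t::real. y + t *\<^sub>R axis p 1) -` A)"
  by (intro open_vimage assms continuous_intros)
qed (use assms in auto)

definition cutoff :: "(real^'n::finite) set => (real^'n => real) => (real^'n => real^'n) => bool" where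
 "cutoff C ct d \<longleftrightarrow> compact C & continuous_on UNIV ct & continuous_on UNIV d \<and>
  (ALL y p. ((%t. ct (y + t *\<^sub>R axis p 1)) has_real_derivative d y $ p) (at 0)) & (ALL y. y ~: C --> ct y = 0 & d y = 0)"

text \<open>Integrating the divergence of ct F gives 0. As F is divergence free, only the gradient
  of the cutoff remains, so this volume integral plays the part of the boundary integral.\<close>

lemma cutoff_integral_divergence_free:
 fixes F F' :: "'n => real^'n::finite => complex"
 assumes c: "cutoff C ct d" and Om: "open Om" "C \<subseteq> Om"
  and F: "!!p. continuous_on Om (F p)" "!!p. continuous_on Om (F' p)" "!!p y. y : Om ==> vd (F p) (F' p y) p y"
  and div: "!!y. y : Om ==> (\<Oplus>p. F' p y) = 0"
 shows "(LI y. (\<Oplus>p. of_real (d y $ p) * F p y)) = 0"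
proof -
 have C: "compact C" and ch: "continuous_on UNIV ct" and dc: "continuous_on UNIV d"
  and dd: "!!y p. ((%t. ct (y + t *\<^sub>R axis p 1)) has_real_derivative d y $ p) (at 0)"
  and z: "!!y. y ~: C ==> ct y = 0" "!!y. y ~: C ==> d y = 0" using c by (auto simp: cutoff_def)
 have cl: "closed C" using C compact_imp_closed by blast
 obtain B where B: "!!y. y : C ==> norm y <= B" using compact_imp_bounded[OF C] by (auto simp: bounded_iff)
 have nC: "y ~: C" if "norm y > B" for y using B that by force
 define h where "h p y = of_real (ct y) * F p y" for p y
 define h1 where "h1 p y = of_real (d y $ p) * F p y" for p y
 define h2 where "h2 p y = of_real (ct y) * F' p y" for p y
 have ext: "continuous_on UNIV f" if "continuous_on Om f" "!!y. y ~: C ==> f y = 0" for f :: "real^'n => complex"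
  by (rule continuous_on_zero_extension[OF that(1) Om(1) cl Om(2) that(2)])
 have dcp: "continuous_on UNIV (%y. d y $ p)" for p
  by (rule continuous_on_component[OF dc])
 have sub: "continuous_on Om g" if "continuous_on UNIV g" for g :: "real^'n => real"
  by (rule continuous_on_subset[OF that]) auto
 have ch1: "continuous_on UNIV (h p)" "continuous_on UNIV (h1 p)" "continuous_on UNIV (h2 p)" for p
  unfolding h_def h1_def h2_def
  by (intro ext continuous_on_mult continuous_on_of_real sub ch dcp F; simp add: z)+
 have int0: "(LI y. h1 p y + h2 p y) = 0" for p
 proof (rule integral_directional_derivative_eq_0[of "h p" _ B "axis p 1"])
  show "continuous_on UNIV (%y. h1 p y + h2 p y)" by (intro continuous_on_add ch1)
  show "((%t. h p (y + t *\<^sub>R axis p 1)) has_vector_derivative h1 p y + h2 p y) (at 0)" for y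
  proof (cases "y : C")
   case True
   have "vd (h p) (h1 p y + h2 p y) p y"
    unfolding h_def[abs_def] h1_def h2_def using True Om
    by (intro vd_mult vd_of_real dd F) auto
   thus ?thesis by (simp add: vd_def)
  next
   case False
   have "vd (h p) 0 p y"
    by (rule vd_zero_near[of "- C"]) (use cl False z in \<open>auto simp: h_def\<close>)
   thus ?thesis using False z by (simp add: vd_def h1_def h2_def)
  qed
 qed (use nC z ch1 in \<open>auto simp: h_def h1_def h2_def\<close>)
 have ih: "integrable lborel (h1 p)" "integrable lborel (h2 p)" for p
  by (rule integrable_continuous_bounded_support[of _ B], rule ch1, use nC z in \<open>auto simp: h1_def h2_def\<close>)+
 have "(LI y. (\<Oplus>p. h1 p y)) + (LI y. (\<Oplus>p. h2 p y)) = (\<Oplus>p. (LI y. h1 p y + h2 p y))"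
  using ih by (simp add: integral_sum sum.distrib)
 also have "... = 0" by (simp only: int0 sum.neutral_const)
 also have "(\<Oplus>p. h2 p y) = 0" for y
 proof (cases "y : C")
  case True
  hence "(\<Oplus>p. F' p y) = 0" using Om div by auto
  thus ?thesis by (simp add: h2_def sum_distrib_left[symmetric])
 next
  case False thus ?thesis by (simp add: h2_def z)
 qed
 hence "(LI y. (\<Oplus>p. h2 p y)) = 0" by simp
 finally show ?thesis by (simp add: h1_def)
qed

context elastic
begin

definition NN :: 'n where "NN = Max UNIV"

text \<open>\<open>y - x\<close>, with the last coordinate of the pole \<open>x\<close> replaced by \<open>z\<close>.\<close>
definition KX :: "(real, 'n) vec => complex => (real, 'n) vec => (complex, 'n) vec" where
 "KX x z y = (\<chi> i. if i = NN then of_real (y $ i) - z else of_real (y $ i - x $ i))"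

text \<open>The logarithm l is a parameter because two choices are needed: the real one
  \<open>rl\<close> around a real pole, and a sum of two principal logarithms for complex
  poles.\<close>

definition branch :: "(real, 'n) vec => complex => (real, 'n) vec set => ((real, 'n) vec => complex) => bool" where
 "branch x z Om l \<longleftrightarrow> open Om & continuous_on Om l & (ALL y:Om. exp (l y) = sq_sum (KX x z y))"

definition KV :: "(real, 'n) vec => complex => ((real, 'n) vec => complex) => bool \<times> 'n => 'n list => bool => 'n => (real, 'n) vec => complex" where
 "KV x z l q I s k y = V (KX x z y) (l y) s k q I"

lemma continuous_on_KX:
 assumes "continuous_on T f" "continuous_on T g"
 shows "continuous_on T (%u. KX x (f u) (g u))"
proof -
 have c: "continuous_on T (%u. g u $ i)" for i
  by (rule continuous_on_component[OF assms(2)])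
 have "continuous_on T (%u. if i = NN then complex_of_real (g u $ i) - f u else complex_of_real (g u $ i - x $ i))" for i
  by (cases "i = NN") (auto intro!: continuous_intros assms c)
 thus ?thesis unfolding KX_def by (rule continuous_on_vec_lambda)
qed

lemma continuous_on_KV:
 assumes "branch x z Om l" "length I <= 4"
 shows "continuous_on Om (KV x z l q I s k)"
 unfolding KV_def[abs_def] using assms
 by (intro continuous_on_V continuous_on_KX continuous_on_const continuous_on_id) (auto simp: branch_def)

lemma vd_KV:
 assumes br: "branch x z Om l" and y: "y : Om" and I: "length I <= 3"
 shows "vd (KV x z l q I s k) (KV x z l q (p # I) s k y) p y"
proof -
 have Om: "open Om" and lc: "continuous_on Om l" and e: "!!y. y : Om ==> exp (l y) = sq_sum (KX x z y)"
  using br by (auto simp: branch_def)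
 obtain \<delta> where \<delta>: "\<delta> > 0" "ball y \<delta> \<subseteq> Om" using Om y open_contains_ball by blast
 have inO: "y + t *\<^sub>R axis p 1 : Om" if "\<bar>t\<bar> < \<delta>" for t
  using that \<delta> by (intro subsetD[OF \<delta>(2)]) (simp add: dist_norm)
 define T where "T = {- \<delta><..<\<delta>}"
 define S where "S = complex_of_real ` T"
 \<comment> \<open>The real line through y in direction p is embedded in the complex plane, so that
   the complex derivative of the series along a segment applies.\<close>
 define X' where "X' ta = (\<chi> i. KX x z y $ i + (if i = p then ta else 0))" for ta :: complex
 define l' where "l' ta = l (y + Re ta *\<^sub>R axis p 1)" for ta
 have XR: "X' (of_real t) = KX x z (y + t *\<^sub>R axis p 1)" for t
  by (auto simp: X'_def KX_def vec_eq_iff axis_def)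
 have "((%u. V (X' u) (l' u) s k q I) has_field_derivative (\<Oplus>i. (if i = p then 1 else 0) * V (X' 0) (l' 0) s k q (i # I))) (at 0 within S)"
 proof (rule V_has_field_derivative[OF _ _ _ _ _ I])
  have "linear complex_of_real" by (rule bounded_linear.linear[OF bounded_linear_of_real])
  thus "convex S" unfolding S_def T_def by (intro convex_linear_image) auto
  show "0 : S" using \<delta> by (auto simp: S_def T_def image_iff intro!: bexI[of _ 0])
  show "((%t. X' t $ i) has_field_derivative (if i = p then 1 else 0)) (at u within S)" for i u
   by (cases "i = p") (auto simp: X'_def intro!: derivative_eq_intros)
  show "continuous_on S l'" unfolding l'_def
   by (rule continuous_on_compose2[OF lc]) (auto intro!: continuous_intros inO simp: S_def T_def)
  show "exp (l' u) = sq_sum (X' u)" if "u : S" for u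
   using that inO by (auto simp: S_def T_def l'_def XR e)
 qed
 moreover have "(\<Oplus>i. (if i = p then 1 else 0) * V (X' 0) (l' 0) s k q (i # I)) = KV x z l q (p # I) s k y"
  using XR[of 0] by (simp add: KV_def l'_def if_distrib[of "%x. x * _"] cong: if_cong)
 ultimately have "((%u. V (X' u) (l' u) s k q I) has_field_derivative KV x z l q (p # I) s k y) (at (of_real 0) within of_real ` T)"
  by (simp add: S_def)
 from field_vector_diff_chain_within[OF has_vector_derivative_of_real[OF DERIV_ident] this]
 have "((%t. V (X' (of_real t)) (l' (of_real t)) s k q I) has_vector_derivative KV x z l q (p # I) s k y) (at 0 within T)"
  by (simp add: o_def)
 moreover have "at 0 within T = at 0" using \<delta> by (intro at_within_open) (auto simp: T_def)
 ultimately show ?thesis by (simp add: vd_def XR l'_def KV_def)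
qed

lemma pde_KV:
 assumes "branch x z Om l" "y : Om"
 shows "pde (%s k. KV x z l q [] s k y) (%s k p. KV x z l q [p] s k y) (%s k p r. KV x z l q [r, p] s k y)"
proof -
 have e: "exp (l y) = sq_sum (KX x z y)" using assms by (auto simp: branch_def)
 show ?thesis unfolding pde_def KV_def using V_pde[OF e] by (auto intro: V_perm)
qed

lemma vd_sg:
 assumes "!!s k. vd (%y. A s k y) (J s k p y) p y" "!!s k r. vd (%y. J s k r y) (H s k r p) p y"
 shows "vd (%y. sg s k p (%s k. A s k y) (%s k p. J s k p y)) (sgd s k p (%s k p. J s k p y) H) p y"
proof -
 have 1: "vd (%y. cl s * (if k = p then \<Oplus>j. J s j j y else 0)) (cl s * (if k = p then \<Oplus>j. H s j j p else 0)) p y"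
  by (cases "k = p") (auto intro!: vd_cmult vd_sum vd_const assms)
 have 2: "vd (%y. if s then cg * (\<Oplus>j. lev k j p * A False j y) else 0) (if s then cg * (\<Oplus>j. lev k j p * J False j p y) else 0) p y"
  by (cases s) (auto intro!: vd_cmult vd_sum vd_const assms)
 show ?thesis unfolding sg_def sgd_def by (intro vd_add vd_diff vd_cmult assms 1 2)
qed

lemma continuous_on_sg:
 assumes "!!s k. continuous_on T (%y. A s k y)" "!!s k p. continuous_on T (%y. J s k p y)"
 shows "continuous_on T (%y. sg s k p (%s k. A s k y) (%s k p. J s k p y))"
 unfolding sg_def by (cases s; cases "k = p") (auto intro!: continuous_intros assms)

lemma continuous_on_sgd:
 assumes "!!s k p. continuous_on T (%y. J s k p y)" "!!s k p r. continuous_on T (%y. H s k p r y)"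
 shows "continuous_on T (%y. sgd s k p (%s k p. J s k p y) (%s k p r. H s k p r y))"
 unfolding sgd_def by (cases s; cases "k = p") (auto intro!: continuous_intros assms)

text \<open>The flux density of Green's second identity through a surface with normal along p: each
  field multiplied by the stress of the other.\<close>

definition FF :: "(bool => 'n => complex) => (bool => 'n => 'n => complex) =>
  (bool => 'n => complex) => (bool => 'n => 'n => complex) => 'n => complex" where
 "FF A J A' J' p = (\<Oplus>s k. A s k * sg s k p A' J' - A' s k * sg s k p A J)"

end

section \<open>Regular solutions and their flux against the kernel\<close>

locale solution = elastic lam mu nu be ep al ro si \<theta> ty
 for lam mu nu be ep al ro si \<theta> and ty :: "'n::{finite,linorder} itself" +
 fixes D :: "(real, 'n) vec set" and u w :: "(real, 'n) vec => (real, 'n) vec"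
 assumes openD: "open D" and sol: "regular_solution lam mu nu be ep al ro si \<theta> D u w"
begin

definition fn :: "bool => 'n => (real, 'n) vec => real" where "fn s k z = (if s then u z else w z) $ k"
definition UU :: "bool => 'n => (real, 'n) vec => complex" where "UU s k y = of_real (fn s k y)"
definition UJ :: "bool => 'n => 'n => (real, 'n) vec => complex" where "UJ s k p y = of_real (partial p (fn s k) y)"
definition UH :: "bool => 'n => 'n => 'n => (real, 'n) vec => complex" where "UH s k p r y = of_real (partial r (partial p (fn s k)) y)"

lemma fn_C2: "C2_on D (fn s k)" and fn_closure: "C1_closure D (fn s k)"
 using sol unfolding regular_solution_def fn_def[abs_def] by (cases s; auto)+

lemma fn_pd: "y : D ==> partial_differentiable p (fn s k) y" "y : D ==> partial_differentiable r (partial p (fn s k)) y"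
 using fn_C2[of s k] by (auto simp: C2_on_def C1_on_def)

lemma vd_U: "y : D ==> vd (UU s k) (UJ s k p y) p y" "y : D ==> vd (UJ s k r) (UH s k r p y) p y"
 unfolding UU_def[abs_def] UJ_def[abs_def] UH_def by (intro vd_partial fn_pd; simp)+

lemma continuous_on_U: "continuous_on D (UU s k)" "continuous_on D (UJ s k p)" "continuous_on D (UH s k p r)"
 unfolding UU_def[abs_def] UJ_def[abs_def] UH_def[abs_def]
 using fn_C2[of s k] C1_on_imp_continuous_on[OF openD, of "fn s k"]
 by (auto intro!: continuous_on_of_real simp: C2_on_def C1_on_def)

lemma pde_U:
 assumes y: "y : D"
 shows "pde (%s k. UU s k y) (%s k p. UJ s k p y) (%s k p r. UH s k p r y)"
 unfolding pde_def
proof (intro conjI allI)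
 show "UH s j p r y = UH s j r p y" for s j p r
  unfolding UH_def using mixed_partials_eq[OF openD fn_C2 y] by metis
 fix s k
 define v where "v = (if s then u else w)"
 define v' where "v' = (if s then w else u)"
 have fs: "fn s k = (%z. v z $ k)" for k by (auto simp: fn_def v_def)
 have fs': "fn (~ s) k = (%z. v' z $ k)" for k by (auto simp: fn_def v'_def)
 have div: "partial k (divergence v) y = (\<Oplus>j. partial k (partial j (fn s j)) y)"
  unfolding divergence_def[abs_def] fs[symmetric]
  by (intro conjunct2[OF partialI] DERIV_sum partial_has_real_derivative fn_pd y)
 have lapl: "laplacian (%z. v z $ k) y = (\<Oplus>p. partial p (partial p (fn s k)) y)"
  by (simp add: laplacian_def fs)
 have r: "rot v' k y = (\<Oplus>j p. - levi_civita k j p * partial p (fn (~ s) j) y)"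
  by (simp add: rot_def fs' sum_negf)
 define A where "A = (if s then mu + al else nu + be)"
 define B where "B = (if s then lam + mu - al else ep + nu - be)"
 define C where "C = (if s then ro * si^2 else \<theta> * si^2 - 4 * al)"
 have "A * laplacian (%z. v z $ k) y + B * partial k (divergence v) y + 2 * al * rot v' k y + C * v y $ k = 0"
  using sol y unfolding regular_solution_def A_def B_def C_def v_def v'_def
  by (cases s) (auto simp: algebra_simps)
 hence "A * (\<Oplus>p. partial p (partial p (fn s k)) y) + B * (\<Oplus>j. partial k (partial j (fn s j)) y)
  + 2 * al * (\<Oplus>j p. - levi_civita k j p * partial p (fn (~ s) j) y) + C * fn s k y = 0"
  unfolding lapl div r by (simp add: fs)
 hence "complex_of_real (A * (\<Oplus>p. partial p (partial p (fn s k)) y) + B * (\<Oplus>j. partial k (partial j (fn s j)) y)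
  + 2 * al * (\<Oplus>j p. - levi_civita k j p * partial p (fn (~ s) j) y) + C * fn s k y) = 0"
  by (simp only: of_real_0)
 moreover have "ca s = of_real A" "cl s + cm s = of_real B" "cc s = of_real C" "cg = of_real (2 * al)"
  by (cases s, simp_all add: ca_def A_def cl_def cm_def B_def cc_def C_def cg_def)+
 ultimately show "ca s * (\<Oplus>p. UH s k p p y) + (cl s + cm s) * (\<Oplus>j. UH s j j k y)
  + cg * (\<Oplus>j p. - lev k j p * UJ (~ s) j p y) + cc s * UU s k y = 0"
  by (simp add: UH_def UJ_def UU_def lev_def)
qed

definition F :: "(real, 'n) vec => complex => ((real, 'n) vec => complex) => bool \<times> 'n => 'n => (real, 'n) vec => complex" where
 "F x z l q p y = FF (%s k. KV x z l q [] s k y) (%s k p. KV x z l q [p] s k y) (%s k. UU s k y) (%s k p. UJ s k p y) p"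

lemma continuous_on_F: "branch x z Om l ==> Om \<subseteq> D ==> continuous_on Om (F x z l q p)"
 unfolding F_def[abs_def] FF_def
 by (intro continuous_on_sum continuous_on_diff continuous_on_mult continuous_on_sg continuous_on_KV
   continuous_on_subset[OF continuous_on_U(1)] continuous_on_subset[OF continuous_on_U(2)]) auto

lemma cutoff_integral_F:
 assumes br: "branch x z Om l" and Om: "Om \<subseteq> D" and c: "cutoff C ct d" and C: "C \<subseteq> Om"
 shows "(LI y. (\<Oplus>p. of_real (d y $ p) * F x z l q p y)) = 0"
proof (rule cutoff_integral_divergence_free[OF c _ C])
 let ?K = "KV x z l q"
 let ?F' = "%p y. \<Oplus>s k.
   ?K [p] s k y * sg s k p (%s k. UU s k y) (%s k p. UJ s k p y) + ?K [] s k y * sgd s k p (%s k p. UJ s k p y) (%s k p r. UH s k p r y)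
  - (UJ s k p y * sg s k p (%s k. ?K [] s k y) (%s k p. ?K [p] s k y) + UU s k y * sgd s k p (%s k p. ?K [p] s k y) (%s k p r. ?K [r, p] s k y))"
 show "open Om" using br by (simp add: branch_def)
 show "continuous_on Om (F x z l q p)" for p by (rule continuous_on_F[OF br Om])
 show "continuous_on Om (?F' p)" for p
  using br Om
  by (intro continuous_on_sum continuous_on_diff continuous_on_add continuous_on_mult continuous_on_sg continuous_on_sgd continuous_on_KV
   continuous_on_subset[OF continuous_on_U(1)] continuous_on_subset[OF continuous_on_U(2)] continuous_on_subset[OF continuous_on_U(3)]) auto
 show "vd (F x z l q p) (?F' p y) p y" if y: "y : Om" for p y
 proof -
  have yD: "y : D" using y Om by auto
  have s1: "vd (%y. sg s k p (%s k. UU s k y) (%s k p. UJ s k p y)) (sgd s k p (%s k p. UJ s k p y) (%s k p r. UH s k p r y)) p y" for s k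
   by (rule vd_sg) (rule vd_U[OF yD])+
  have s2: "vd (%y. sg s k p (%s k. ?K [] s k y) (%s k p. ?K [p] s k y)) (sgd s k p (%s k p. ?K [p] s k y) (%s k p r. ?K [r, p] s k y)) p y" for s k
   by (rule vd_sg) (rule vd_KV[OF br y], simp)+
  show ?thesis unfolding F_def[abs_def] FF_def
   by (intro vd_sum vd_diff vd_mult s1 s2 vd_KV[OF br y] vd_U[OF yD]) auto
 qed
 show "(\<Oplus>p. ?F' p y) = 0" if y: "y : Om" for y
  by (rule green_identity) (use pde_KV[OF br y] pde_U y Om in auto)
qed

end

section \<open>Normalisation at the pole\<close>

text \<open>A C^1 transition from 1 on s <= 1/2 to 0 on s >= 1. Squares of positive parts are C^1,
  and the two in the denominator never vanish together.\<close>

definition step :: "real => real" where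
 "step s = (max 0 (1 - s))^2 / ((max 0 (1 - s))^2 + (max 0 (s - 1/2))^2)"

definition step' :: "real => real" where
 "step' s = - 2 * (max 0 (1 - s) * (max 0 (s - 1/2))^2 + (max 0 (1 - s))^2 * max 0 (s - 1/2))
  / ((max 0 (1 - s))^2 + (max 0 (s - 1/2))^2)^2"

lemma max_sq_deriv: "((%s. (max 0 s)^2) has_real_derivative 2 * max 0 s) (at (s::real))"
proof (cases s "0::real" rule: linorder_cases)
 case less
 have "((%s. 0) has_real_derivative 0) (at s)" by simp
 hence "((%s. (max 0 s)^2) has_real_derivative 0) (at s)"
  by (rule has_field_derivative_transform_within_open[where S = "{..<0}"]) (use less in \<open>auto simp: max_def\<close>)
 thus ?thesis using less by simp
next
 case equal
 have "(%h. ((max 0 (0 + h))^2 - (max 0 0)^2) / h) \<midarrow>0\<rightarrow> (0::real)"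
 proof (rule Lim_null_comparison)
  show "\<forall>\<^sub>F h in at 0. norm (((max 0 (0 + h))^2 - (max 0 0)^2) / h) <= \<bar>h::real\<bar>"
   by (rule always_eventually) (auto simp: max_def power2_eq_square)
  show "(abs \<longlongrightarrow> (0::real)) (at 0)" using tendsto_rabs[OF tendsto_ident_at, of "0::real" UNIV] by simp
 qed
 thus ?thesis using equal by (simp add: DERIV_def)
next
 case greater
 have "((%s. s^2) has_real_derivative 2 * s) (at s)" by (auto intro!: derivative_eq_intros)
 hence "((%s. (max 0 s)^2) has_real_derivative 2 * s) (at s)"
  by (rule has_field_derivative_transform_within_open[where S = "{0<..}"]) (use greater in \<open>auto simp: max_def\<close>)
 thus ?thesis using greater by simp
qed

lemma step_denom_pos: "(max 0 (1 - s))^2 + (max 0 (s - 1/2))^2 > (0::real)"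
 by (cases "s < 1") (auto simp: max_def add_pos_nonneg add_nonneg_pos)

lemma step_deriv: "(step has_real_derivative step' s) (at s)"
proof -
 have d1: "((%s. (max 0 (1 - s))^2) has_real_derivative 2 * max 0 (1 - s) * (- 1)) (at s)"
  by (rule DERIV_chain2[OF max_sq_deriv]) (auto intro!: derivative_eq_intros)
 have d2: "((%s. (max 0 (s - 1/2))^2) has_real_derivative 2 * max 0 (s - 1/2) * 1) (at s)"
  by (rule DERIV_chain2[OF max_sq_deriv]) (auto intro!: derivative_eq_intros)
 define a where "a = max 0 (1 - s)"
 define b where "b = max 0 (s - 1/2)"
 have "(step has_real_derivative ((2 * a * (- 1)) * (a^2 + b^2) - a^2 * (2 * a * (- 1) + 2 * b * 1)) / ((a^2 + b^2) * (a^2 + b^2))) (at s)"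
  unfolding step_def[abs_def] a_def b_def
  by (intro DERIV_divide DERIV_add d1 d2 less_imp_neq[OF step_denom_pos, THEN not_sym])
 moreover have "((2 * a * (- 1)) * (a^2 + b^2) - a^2 * (2 * a * (- 1) + 2 * b * 1)) = - 2 * (a * b^2 + a^2 * b)"
  by (simp add: algebra_simps power2_eq_square)
 ultimately show ?thesis unfolding step'_def a_def b_def by (simp add: power2_eq_square)
qed

lemma continuous_on_step': "continuous_on T step'"
 unfolding step'_def[abs_def]
 by (intro continuous_intros ballI power_not_zero less_imp_neq[OF step_denom_pos, THEN not_sym])

lemma continuous_on_step: "continuous_on T step"
 using step_deriv DERIV_isCont by (blast intro: continuous_at_imp_continuous_on)

lemma step_simps: "s <= 1/2 ==> step s = 1" "s >= 1 ==> step s = 0" "s <= 1/2 ==> step' s = 0" "s >= 1 ==> step' s = 0"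
proof -
 assume "s <= 1/2"
 hence "max 0 (s - 1/2) = 0" "max 0 (1 - s) ~= 0" by auto
 thus "step s = 1" "step' s = 0" by (simp_all only: step_def step'_def) simp_all
next
 assume "s >= 1"
 hence "max 0 (1 - s) = 0" by auto
 thus "step s = 0" "step' s = 0" by (simp_all only: step_def step'_def) simp_all
qed

lemma step_range: "0 <= step s" "step s <= 1"
 unfolding step_def using step_denom_pos[of s] by (auto simp: field_simps)

lemma step'_nonpos: "step' s <= 0"
 unfolding step'_def by (intro divide_nonpos_nonneg mult_nonpos_nonneg add_nonneg_nonneg mult_nonneg_nonneg) auto

lemma step'_le: "\<bar>step' s\<bar> <= 4"
proof (cases "1/2 <= s & s <= 1")
 case True
 define a where "a = 1 - s"
 define b where "b = s - 1/2"
 have ab: "0 <= a" "0 <= b" "a + b = 1/2" using True by (auto simp: a_def b_def)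
 have e: "step' s = - 2 * (a * b^2 + a^2 * b) / (a^2 + b^2)^2"
  using True by (simp add: step'_def a_def b_def max_def)
 have s2: "a^2 + b^2 = 1/4 - 2 * (a * b)" using arg_cong[OF ab(3), of "%x. x^2"] by (simp add: power2_sum power_divide)
 have "0 <= (a - b)^2" by simp
 hence p: "a * b <= 1/16" using s2 by (simp add: power2_diff)
 hence q: "1/8 <= a^2 + b^2" using s2 by simp
 have "(1/8)^2 <= (a^2 + b^2)^2" using q by (rule power_mono) simp
 hence q2: "1/64 <= (a^2 + b^2)^2" by (simp add: power2_eq_square)
 have "a * b^2 + a^2 * b = a * b * (a + b)" by (simp add: power2_eq_square algebra_simps)
 hence "a * b^2 + a^2 * b = a * b / 2" using ab by simp
 hence "step' s = - (a * b / (a^2 + b^2)^2)" unfolding e by (simp only:)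
 moreover have "0 <= a * b" using ab by simp
 ultimately have "\<bar>step' s\<bar> = a * b / (a^2 + b^2)^2" by simp
 also have "... <= (1/16) / (1/64)" using p q2 ab by (intro frac_le) auto
 finally show ?thesis by simp
next
 case False
 hence "step' s = 0" using step_simps(3,4)[of s] by linarith
 thus ?thesis by simp
qed

text \<open>Written in the squared distance, so that it is C^1 at the centre too; it equals 1 on the
  ball of half the radius and 0 off the ball.\<close>

definition bump :: "real^'n::finite => real => real^'n => real" where
 "bump x r y = step ((norm (y - x))^2 / r^2)"

definition bump' :: "real^'n::finite => real => real^'n => real^'n" where
 "bump' x r y = (2 * step' ((norm (y - x))^2 / r^2) / r^2) *\<^sub>R (y - x)"

lemma norm_sq_axis_deriv:
 fixes x y :: "real^'n::finite"
 shows "((%t. (norm (y + t *\<^sub>R axis p 1 - x))^2) has_real_derivative 2 * (y - x) $ p) (at 0)"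
proof -
 have v: "(norm (v + t *\<^sub>R axis p 1))^2 = (norm v)^2 + 2 * t * v $ p + t^2" for t and v :: "real^'n"
  unfolding power2_norm_eq_inner
  by (simp add: inner_add_left inner_add_right inner_commute[of "axis p 1"] inner_axis inner_axis_axis power2_eq_square algebra_simps)
 have eq: "(norm (y + t *\<^sub>R axis p 1 - x))^2 = (norm (y - x))^2 + 2 * t * (y - x) $ p + t^2" for t
  using v[of "y - x" t] by (simp only: diff_add_eq)
 show ?thesis unfolding eq by (auto intro!: derivative_eq_intros)
qed

lemma bump_deriv: "((%t. bump x r (y + t *\<^sub>R axis p 1)) has_real_derivative bump' x r y $ p) (at 0)"
proof -
 have "((%t. (norm (y + t *\<^sub>R axis p 1 - x))^2 / r^2) has_real_derivative 2 * (y - x) $ p / r^2) (at 0)"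
  by (rule DERIV_cdivide[OF norm_sq_axis_deriv])
 from DERIV_chain2[OF step_deriv this]
 show ?thesis unfolding bump_def bump'_def by (simp add: algebra_simps diff_divide_distrib)
qed

lemma continuous_on_bump: "r ~= 0 ==> continuous_on T (bump x r)" "r ~= 0 ==> continuous_on T (bump' x r)"
 unfolding bump_def[abs_def] bump'_def[abs_def]
 by (auto intro!: continuous_intros continuous_on_compose2[OF continuous_on_step[of UNIV]] continuous_on_compose2[OF continuous_on_step'[of UNIV]])

lemma bump_range: "0 <= bump x r y" "bump x r y <= 1"
 unfolding bump_def by (rule step_range)+

lemma bump_eq_0: "0 < r ==> y ~: ball x r ==> bump x r y = 0" "0 < r ==> y ~: ball x r ==> bump' x r y = 0"
proof -
 assume r: "0 < r" and y: "y ~: ball x r"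
 have "r^2 <= (norm (y - x))^2" using r y by (intro power_mono) (auto simp: dist_norm norm_minus_commute)
 hence "(norm (y - x))^2 / r^2 >= 1" using r by simp
 thus "bump x r y = 0" "bump' x r y = 0" by (simp_all add: bump_def bump'_def step_simps)
qed

lemma bump_eq_1: "0 < r ==> y : cball x (r / 2) ==> bump x r y = 1" "0 < r ==> y : cball x (r / 2) ==> bump' x r y = 0"
proof -
 assume r: "0 < r" and y: "y : cball x (r / 2)"
 have "(norm (y - x))^2 <= (r / 2)^2" using r y by (intro power_mono) (auto simp: dist_norm norm_minus_commute)
 hence "4 * (norm (y - x))^2 <= r^2" by (simp add: power_divide)
 moreover have "0 <= (norm (y - x))^2" by simp
 ultimately have "2 * (norm (y - x))^2 <= r^2" by linarith
 hence "(norm (y - x))^2 / r^2 <= 1/2" using r by (simp add: field_simps)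
 thus "bump x r y = 1" "bump' x r y = 0" by (simp_all add: bump_def bump'_def step_simps)
qed

lemma cutoff_bump: "0 < r ==> cutoff (cball x r) (bump x r) (bump' x r)"
 unfolding cutoff_def using continuous_on_bump[of r UNIV x] bump_deriv bump_eq_0[of r _ x] by auto

lemma cutoff_diff:
 assumes "cutoff C f d" "cutoff C' f' d'"
 shows "cutoff (C Un C') (%y. f y - f' y) (%y. d y - d' y)"
 using assms unfolding cutoff_def by (auto intro!: compact_Un continuous_on_diff DERIV_diff)

lemma cutoff_subset:
 assumes "cutoff C f d" "compact C'" "!!y. y : C - C' ==> f y = 0 & d y = 0"
 shows "cutoff C' f d"
 using assms unfolding cutoff_def by blast

text \<open>Integrate the derivative along k of (y - x)_i H(|y - x|^2), where H is a primitive of ph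
  / 2: the moment equals minus the integral of H if k = i, and 0 otherwise. Summing over the
  diagonal identifies the integral of H. No polar coordinates are used.\<close>

lemma radial_second_moment:
 fixes ph :: "real => complex" and x :: "real^'n::finite"
 assumes c: "continuous_on UNIV ph" and T: "T >= 0" "!!s. s >= T ==> ph s = 0"
 shows "(LI y. ph ((norm (y - x))^2) * of_real ((y - x) $ k * (y - x) $ i))
  = (if k = i then (LI y. ph ((norm (y - x))^2) * of_real ((norm (y - x))^2)) / of_nat CARD('n) else 0)"
proof -
 \<comment> \<open>Normalised to vanish for s >= T, hence with compact support. Starting the
   integral at - 1 keeps s = 0 in the interior, where a two-sided derivative is needed.\<close>
 define H where "H s = (integral {-1..s} ph - integral {-1..T} ph) / 2" for s
 have HT: "H s = 0" if "s >= T" for s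
 proof -
  have "ph integrable_on {-1..s}" using c by (intro integrable_continuous_interval) (auto intro: continuous_on_subset)
  hence "integral {-1..T} ph + integral {T..s} ph = integral {-1..s} ph"
   using T that by (intro Henstock_Kurzweil_Integration.integral_combine) auto
  moreover have "integral {T..s} ph = integral {T..s} (%_. 0)" using T by (intro integral_cong) auto
  ultimately show ?thesis by (simp add: H_def)
 qed
 have Hd: "(H has_vector_derivative ph s / 2) (at s)" if "s >= 0" for s
 proof -
  have "((%s. integral {-1..s} ph) has_vector_derivative ph s) (at s within {-1..s+1})"
   using that c by (intro integral_has_vector_derivative) (auto intro: continuous_on_subset)
  hence "((%s. integral {-1..s} ph) has_vector_derivative ph s) (at s)"
   using that at_within_Icc_at[of "-1" s "s+1"] by simp
  from has_vector_derivative_divide[OF has_vector_derivative_diff[OF this has_vector_derivative_const[of "integral {-1..T} ph"]], of 2]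
  show ?thesis unfolding H_def[abs_def] by simp
 qed
 have Hc: "continuous_on {0..} H"
  using Hd by (intro continuous_at_imp_continuous_on ballI) (auto intro: has_vector_derivative_continuous)
 let ?n = "%y. (norm (y - x))^2"
 define m where "m k i = (LI y. ph (?n y) * of_real ((y - x) $ k * (y - x) $ i))" for k i
 define h where "h y = H (?n y)" for y
 have hc: "continuous_on UNIV h" unfolding h_def
  by (rule continuous_on_compose2[OF Hc]) (auto intro!: continuous_intros)
 have pc: "continuous_on UNIV (%y. ph (?n y))"
  by (rule continuous_on_compose2[OF c]) (auto intro!: continuous_intros)
 have cp: "continuous_on UNIV (%y. (y - x) $ k)" for k
  by (intro continuous_on_component continuous_intros)
 define B where "B = norm x + sqrt T"
 have far: "?n y >= T" if "norm y > B" for y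
 proof -
  have "norm (y - x) >= sqrt T" using that norm_triangle_ineq2[of y x] by (simp add: B_def)
  thus ?thesis using T by (metis real_sqrt_le_iff real_sqrt_abs abs_norm_cancel real_le_lsqrt norm_ge_zero real_sqrt_ge_zero sqrt_le_D)
 qed
 have i1: "integrable lborel h"
  by (rule integrable_continuous_bounded_support[OF hc, of B]) (simp add: h_def HT far)
 have i2: "integrable lborel (%y. ph (?n y) * of_real ((y - x) $ k * (y - x) $ i))" for k i
 proof (rule integrable_continuous_bounded_support[of _ B])
  show "continuous_on UNIV (%y. ph (?n y) * of_real ((y - x) $ k * (y - x) $ i))"
   by (intro continuous_on_mult pc continuous_on_of_real cp)
 qed (simp add: T far)
 have key: "m k i = - (if k = i then (LI y. h y) else 0)" for k i
 proof -
  have "(LI y. ph (?n y) * of_real ((y - x) $ k * (y - x) $ i) + (if k = i then h y else 0)) = 0"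
  proof (rule integral_directional_derivative_eq_0[of "%y. of_real ((y - x) $ i) * h y" _ B "axis k 1"])
   show "continuous_on UNIV (%y. of_real ((y - x) $ i) * h y)"
    by (intro continuous_on_mult continuous_on_of_real cp hc)
   show "continuous_on UNIV (%y. ph (?n y) * of_real ((y - x) $ k * (y - x) $ i) + (if k = i then h y else 0))"
   proof (intro continuous_on_add continuous_on_mult pc continuous_on_of_real cp)
    show "continuous_on UNIV (%y. if k = i then h y else 0)" using hc by (cases "k = i") auto
   qed
   fix y :: "real^'n"
   have d1: "vd (%y. of_real ((y - x) $ i)) (of_real (if k = i then 1 else 0)) k y"
    by (rule vd_of_real) (cases "k = i"; auto simp: axis_def intro!: derivative_eq_intros)
   have "((H \<circ> (%t. ?n (y + t *\<^sub>R axis k 1))) has_vector_derivative (2 * (y - x) $ k) *\<^sub>R (ph (?n y) / 2)) (at 0)"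
    using Hd[of "?n y"] norm_sq_axis_deriv[of y k x]
    by (intro vector_diff_chain_at) (auto simp: has_real_derivative_iff_has_vector_derivative)
   moreover have "(2 * (y - x) $ k) *\<^sub>R (ph (?n y) / 2) = of_real ((y - x) $ k) * ph (?n y)"
    by (simp add: scaleR_conv_of_real)
   ultimately have d2: "vd h (of_real ((y - x) $ k) * ph (?n y)) k y"
    unfolding vd_def h_def o_def by (simp only:)
   have "vd (%y. of_real ((y - x) $ i) * h y) (of_real (if k = i then 1 else 0) * h y + of_real ((y - x) $ i) * (of_real ((y - x) $ k) * ph (?n y))) k y"
    by (rule vd_mult[OF d1 d2])
   thus "((%t. of_real ((y + t *\<^sub>R axis k 1 - x) $ i) * h (y + t *\<^sub>R axis k 1)) has_vector_derivative
     ph (?n y) * of_real ((y - x) $ k * (y - x) $ i) + (if k = i then h y else 0)) (at 0)"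
    unfolding vd_def by (cases "k = i") (simp_all add: mult_ac add.commute)
  qed (auto simp: h_def HT far T)
  hence "m k i + (LI y. (if k = i then h y else 0)) = 0"
   unfolding m_def using i1 i2 by (cases "k = i") auto
  thus ?thesis by (cases "k = i") (auto simp: add_eq_0_iff2)
 qed
 have "(LI y. ph (?n y) * of_real (?n y)) = (\<Oplus>k. m k k)"
 proof -
  have eq: "ph (?n y) * of_real (?n y) = (\<Oplus>k. ph (?n y) * of_real ((y - x) $ k * (y - x) $ k))" for y
  proof -
   have "?n y = (\<Oplus>k. (y - x) $ k * (y - x) $ k)"
    unfolding dot_square_norm[symmetric] by (simp add: inner_vec_def)
   thus ?thesis by (simp add: sum_distrib_left)
  qed
  show ?thesis unfolding m_def eq by (rule Bochner_Integration.integral_sum[OF i2])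
 qed
 also have "... = - of_nat CARD('n) * (LI y. h y)" unfolding key by simp
 finally have e: "(LI y. h y) = - (LI y. ph (?n y) * of_real (?n y)) / of_nat CARD('n)"
  by (simp add: field_simps)
 show ?thesis using key[of k i] unfolding m_def e by simp
qed

lemma rder3:
 "rder nu m X l [k, i, p] 0 = ((if k = i then X $ p else 0) + (if k = p then X $ i else 0) + (if i = p then X $ k else 0)) * rad nu m 2 l
  + X $ k * X $ i * X $ p * rad nu m 3 l"
 by (cases "k = i"; cases "k = p"; cases "i = p") (auto simp: numeral_2_eq_2 numeral_3_eq_3 algebra_simps)

lemma ln_bound_sqrt: "0 < t ==> t <= 1 ==> t * (1 + \<bar>ln t\<bar>) <= 3 * sqrt (t::real)"
proof -
 assume t: "0 < t" "t <= 1"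
 have "ln (1 / sqrt t) <= 1 / sqrt t - 1" using t by (intro ln_le_minus_one) auto
 hence "- ln t / 2 <= 1 / sqrt t" using t by (simp add: ln_div ln_sqrt)
 hence "\<bar>ln t\<bar> <= 2 / sqrt t" using t by (simp add: field_simps)
 hence "t * (1 + \<bar>ln t\<bar>) <= t * (1 + 2 / sqrt t)" using t by (intro mult_left_mono) auto
 also have "... = t + 2 * sqrt t" using t real_div_sqrt[of t] by (simp add: field_simps)
 finally have "t * (1 + \<bar>ln t\<bar>) <= t + 2 * sqrt t" .
 moreover have "t <= sqrt t" using t by (intro real_le_rsqrt) (simp add: power2_eq_square mult_left_le)
 ultimately show ?thesis by linarith
qed

lemma norm_integral_le_measure:
 fixes f :: "'a::euclidean_space => complex"
 assumes "integrable lborel f" "!!y. norm (f y) <= M * indicator (cball x t) y" "0 <= M"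
 shows "norm (LI y. f y) <= M * measure lborel (cball x t)"
proof -
 have i: "integrable lborel (%y. M * indicator (cball x t) y :: real)"
  using emeasure_bounded_finite[of "cball x t"] by (intro integrable_mult_right integrable_real_indicator) auto
 have "norm (LI y. f y) <= (LI y. M * indicator (cball x t) y)"
  using assms by (intro order_trans[OF integral_norm_bound] integral_mono integrable_norm i) auto
 also have "... = M * measure lborel (cball x t)" by simp
 finally show ?thesis .
qed

context elastic
begin

definition csg :: "bool => real" where
 "csg s = norm (cl s) * real CARD('n) + norm (cm s) + norm (ca s) + norm cg * real CARD('n)"

definition Csg :: real where "Csg = 1 + csg True + csg False"

lemma csg0: "csg s >= 0" by (simp add: csg_def)

lemma Csg_ge_1: "Csg >= 1" using csg0 by (simp add: Csg_def)

lemma norm_sg_le: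
 assumes A: "!!s k. norm (A s k) <= x" and J: "!!s k p. norm (J s k p) <= y"
 shows "norm (sg s k p A J) <= Csg * (x + y)"
proof -
 define n where "n = real CARD('n)"
 have n0: "n >= 0" by (simp add: n_def)
 have x0: "0 <= x" using A[of True undefined] norm_ge_zero order_trans by blast
 have y0: "0 <= y" using J[of True undefined undefined] norm_ge_zero order_trans by blast
 have 1: "norm (cl s * (if k = p then \<Oplus>j. J s j j else 0)) <= norm (cl s) * (n * y)"
 proof -
  have "norm (\<Oplus>j. J s j j) <= (\<Sum>j\<in>(UNIV::'n set). y)" by (intro sum_norm_le J)
  thus ?thesis using y0 n0 by (auto simp: norm_mult n_def intro!: mult_left_mono)
 qed
 have 2: "norm (cm s * J s p k) <= norm (cm s) * y" "norm (ca s * J s k p) <= norm (ca s) * y"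
  by (auto simp: norm_mult intro!: mult_left_mono J)
 have 3: "norm (if s then cg * (\<Oplus>j. lev k j p * A False j) else 0) <= norm cg * (n * x)"
 proof -
  have "norm (\<Oplus>j. lev k j p * A False j) <= (\<Sum>j\<in>(UNIV::'n set). 1 * x)"
   using abs_levi_civita by (intro sum_norm_le) (unfold norm_mult, intro mult_mono A, auto simp: lev_def)
  thus ?thesis using x0 n0 by (auto simp: norm_mult n_def intro!: mult_left_mono)
 qed
 have "norm (sg s k p A J) <= norm (cl s) * (n * y) + norm (cm s) * y + norm (ca s) * y + norm cg * (n * x)"
  unfolding sg_def by (intro order_trans[OF norm_triangle_ineq4] add_mono order_trans[OF norm_triangle_ineq] 1 2 3)
 also have "... <= csg s * (x + y)"
  using x0 y0 n0 by (simp add: csg_def n_def algebra_simps add_nonneg_nonneg)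
 also have "... <= Csg * (x + y)"
  using x0 y0 csg0[of True] csg0[of False] by (intro mult_right_mono) (cases s; auto simp: Csg_def)+
 finally show "norm (sg s k p A J) <= Csg * (x + y)" .
qed

lemma sg_diff: "sg s k p A J - sg s k p A' J' = sg s k p (%s k. A s k - A' s k) (%s k p. J s k p - J' s k p)"
 unfolding sg_def by (auto simp: algebra_simps sum_subtractf)

text \<open>The normal is X itself because the gradient of a radial cutoff is parallel to y - x. The
  values of the kernel are set to 0, being of lower order than its derivatives. The result has the
  tensor form X_k X_i f_1 + delta_ki f_2, to which \<open>radial_second_moment\<close>
  applies.\<close>

lemma leading_sum:
 fixes X :: "(complex, 'n) vec"
 assumes e: "exp l = sq_sum X"
 defines "A \<equiv> rad (real CARD('n) / 2) 0 1 l" and "B \<equiv> rad (real CARD('n) / 2) 1 2 l" and "C \<equiv> rad (real CARD('n) / 2) 1 3 l"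
 shows "(\<Oplus>p. X $ p * sg s k p (%s k. 0) (%s k p. V0 X l s k (s0, i) [p])) =
  (if s = s0 then X $ k * X $ i * ((cl s * (1 / ca s - dco s 1) + cm s / ca s) * A - dco s 1 * (cm s + ca s) * (2 * B + exp l * C))
    + (if k = i then exp l * (A - dco s 1 * (cm s + ca s) * B) else 0) else 0)"
proof (cases "s = s0")
 case False
 hence z: "V0 X l s k (s0, i) [p] = 0" for k p by (auto simp: V0_def)
 have "sg s k p (%s k. 0) (%s k p. V0 X l s k (s0, i) [p]) = 0" for p unfolding sg_def z by simp
 thus ?thesis using False by simp
next
 case True
 define ka where "ka = dco s 1"
 have rf0: "rf 0 X l [p] = X $ p * A" for p by (simp add: rf_def A_def)
 have rf1: "rf 1 X l [k, i, p] = ((if k = i then X $ p else 0) + (if k = p then X $ i else 0) + (if i = p then X $ k else 0)) * B + X $ k * X $ i * X $ p * C" for k p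
  unfolding rf_def rder3 B_def C_def ..
 have V0: "V0 X l s k (s0, i) [p] = (if k = i then X $ p * A / ca s else 0)
  - ka * (((if k = i then X $ p else 0) + (if k = p then X $ i else 0) + (if i = p then X $ k else 0)) * B + X $ k * X $ i * X $ p * C)" for k p
  unfolding V0_def snd_conv fst_conv rf1 rf0 ka_def using True by auto
 have sq: "(\<Oplus>p. X $ p * X $ p) = exp l" unfolding e sq_sum_def by (simp add: power2_eq_square)
 have rel: "of_nat (CARD('n) + 2) * B + exp l * C = A"
 proof -
  have "of_real (2 * (real CARD('n) / 2)) * rad (real CARD('n) / 2) 1 (Suc 1) l + exp l * rad (real CARD('n) / 2) 1 (Suc (Suc 1)) l
   = rad (real CARD('n) / 2) 0 1 l - of_nat (2 * 1) * rad (real CARD('n) / 2) 1 (Suc 1) l"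
   using rad_laplace_general[of "real CARD('n) / 2" 1 1 l] by simp
  thus ?thesis unfolding A_def B_def C_def by (simp add: numeral_2_eq_2 numeral_3_eq_3 algebra_simps)
 qed
 have ca0: "ca s ~= 0" by (rule a0)
 have div: "(\<Oplus>j. V0 X l s j (s0, i) [j]) = X $ i * (A / ca s - ka * A)"
 proof -
  have "(\<Oplus>j. V0 X l s j (s0, i) [j]) = (\<Oplus>j. (if j = i then X $ i * A / ca s - 2 * ka * X $ i * B else 0) + (- ka * X $ i * B - ka * X $ i * C * (X $ j * X $ j)))"
   unfolding V0 by (intro sum.cong refl) (auto simp: algebra_simps)
  also have "... = X $ i * A / ca s - 2 * ka * X $ i * B - of_nat CARD('n) * (ka * X $ i * B) - ka * X $ i * C * exp l"
   by (simp add: sum.distrib sum_subtractf sum_distrib_left[symmetric] sq)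
  also have "... = X $ i * A / ca s - ka * X $ i * (of_nat (CARD('n) + 2) * B + exp l * C)"
   by (simp add: algebra_simps)
  also have "... = X $ i * (A / ca s - ka * A)" unfolding rel by (simp add: algebra_simps)
  finally show ?thesis .
 qed
 have s1: "(\<Oplus>p. X $ p * V0 X l s p (s0, i) [k]) = X $ i * X $ k * A / ca s - ka * (2 * (X $ i * X $ k) * B + (if k = i then exp l * B else 0) + X $ k * X $ i * exp l * C)"
 proof -
  have "(\<Oplus>p. X $ p * V0 X l s p (s0, i) [k]) = (\<Oplus>p. (if p = i then X $ i * X $ k * A / ca s - ka * X $ i * X $ k * B else 0)
   - (if p = k then ka * X $ i * X $ k * B else 0) - ka * (if k = i then B else 0) * (X $ p * X $ p) - ka * X $ k * X $ i * C * (X $ p * X $ p))"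
   unfolding V0 by (intro sum.cong refl) (auto simp: algebra_simps)
  also have "... = X $ i * X $ k * A / ca s - ka * X $ i * X $ k * B - ka * X $ i * X $ k * B - ka * (if k = i then B else 0) * exp l - ka * X $ k * X $ i * C * exp l"
   by (simp only: sum_subtractf sum_distrib_left[symmetric] sq) simp
  finally show ?thesis by (rule trans) (cases "k = i"; simp add: algebra_simps)
 qed
 have s2: "(\<Oplus>p. X $ p * V0 X l s k (s0, i) [p]) = (if k = i then exp l * A / ca s else 0) - ka * (2 * (X $ i * X $ k) * B + (if k = i then exp l * B else 0) + X $ k * X $ i * exp l * C)"
 proof -
  have "(\<Oplus>p. X $ p * V0 X l s k (s0, i) [p]) = (\<Oplus>p. (if k = i then A / ca s - ka * B else 0) * (X $ p * X $ p)
   - (if p = k then ka * X $ i * X $ k * B else 0) - (if p = i then ka * X $ i * X $ k * B else 0) - ka * X $ k * X $ i * C * (X $ p * X $ p))"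
   unfolding V0 by (intro sum.cong refl) (auto simp: algebra_simps)
  also have "... = (if k = i then A / ca s - ka * B else 0) * exp l - ka * X $ i * X $ k * B - ka * X $ i * X $ k * B - ka * X $ k * X $ i * C * exp l"
   by (simp only: sum_subtractf sum_distrib_left[symmetric] sq) simp
  finally show ?thesis by (rule trans) (cases "k = i"; simp add: algebra_simps)
 qed
 have "(\<Oplus>p. X $ p * sg s k p (%s k. 0) (%s k p. V0 X l s k (s0, i) [p]))
  = (\<Oplus>p. (if k = p then cl s * X $ k * (\<Oplus>j. V0 X l s j (s0, i) [j]) else 0)
   + cm s * (X $ p * V0 X l s p (s0, i) [k]) + ca s * (X $ p * V0 X l s k (s0, i) [p]))"
  by (intro sum.cong refl) (auto simp: sg_def algebra_simps)
 also have "... = cl s * X $ k * (\<Oplus>j. V0 X l s j (s0, i) [j]) + cm s * (\<Oplus>p. X $ p * V0 X l s p (s0, i) [k])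
   + ca s * (\<Oplus>p. X $ p * V0 X l s k (s0, i) [p])"
  by (simp only: sum.distrib sum_distrib_left[symmetric]) simp
 also have "... = X $ k * X $ i * ((cl s * (1 / ca s - ka) + cm s / ca s) * A - ka * (cm s + ca s) * (2 * B + exp l * C))
    + (if k = i then exp l * (A - ka * (cm s + ca s) * B) else 0)"
  unfolding div s1 s2 using ca0 by (cases "k = i") (simp_all add: algebra_simps)
 finally show ?thesis using True by (simp add: ka_def)
qed

text \<open>Averaging replaces X_k X_i by s / n times the identity. The elastic constants then
  cancel, since \<open>dco s 1\<close> is b / (a (a + b)) with b = \<open>cl s + cm s\<close>, and
  the flux of the harmonic function g_0 remains.\<close>

lemma leading_moment:
 assumes "of_nat (CARD('n) + 2) * B + z * C = A"
 shows "z * ((cl s * (1 / ca s - dco s 1) + cm s / ca s) * A - dco s 1 * (cm s + ca s) * (2 * B + z * C)) / of_nat CARD('n)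
  + z * (A - dco s 1 * (cm s + ca s) * B) = z * A"
proof -
 define n where "n = (of_nat CARD('n) :: complex)"
 have n0: "n ~= 0" by (simp add: n_def)
 define ka where "ka = dco s 1"
 have k: "ka * (ca s + (cl s + cm s)) = (cl s + cm s) / ca s"
  using ab0[of s] by (simp add: ka_def)
 have A: "n * B + 2 * B + z * C = A" using assms by (simp add: n_def algebra_simps)
 have "((cl s * (1 / ca s - ka) + cm s / ca s) * A - ka * (cm s + ca s) * (2 * B + z * C)) + n * (A - ka * (cm s + ca s) * B)
   = n * A + ((cl s + cm s) / ca s) * A - ka * cl s * A - ka * (cm s + ca s) * (n * B + 2 * B + z * C)"
  by (simp add: algebra_simps add_divide_distrib)
 also have "... = n * A + ((cl s + cm s) / ca s - ka * (ca s + (cl s + cm s))) * A"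
  unfolding A by (simp add: algebra_simps)
 also have "... = n * A" unfolding k by simp
 finally have "((cl s * (1 / ca s - ka) + cm s / ca s) * A - ka * (cm s + ca s) * (2 * B + z * C)) / n + (A - ka * (cm s + ca s) * B) = A"
  using n0 by (simp add: field_simps)
 hence "z * (((cl s * (1 / ca s - ka) + cm s / ca s) * A - ka * (cm s + ca s) * (2 * B + z * C)) / n + (A - ka * (cm s + ca s) * B)) = z * A"
  by simp
 thus ?thesis unfolding ka_def n_def by (simp only: distrib_left times_divide_eq_right)
qed

end

text \<open>The radial factor of \<open>bump'\<close>, as a function of the squared distance; it
  lives on t^2 / 2 <= s <= t^2 and so removes the singularity at s = 0.\<close>

definition shell :: "real => real => real" where
 "shell t s = 2 * step' (s / t^2) / t^2"

lemma shell_eq_0: "t > 0 ==> s <= t^2 / 2 ==> shell t s = 0" "t > 0 ==> s >= t^2 ==> shell t s = 0"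
 by (simp_all add: shell_def step_simps divide_simps)

lemma continuous_on_shell_mult:
 fixes g :: "real => complex"
 assumes t: "t > 0" and g: "continuous_on {0<..} g"
 shows "continuous_on UNIV (%s. of_real (shell t s) * g s)"
proof (rule continuous_on_zero_extension[where Om = "{0<..}" and C = "{t^2 / 2..}"])
 have "continuous_on {0<..} (shell t)"
  unfolding shell_def[abs_def] using t
  by (intro continuous_intros continuous_on_compose2[OF continuous_on_step'[of UNIV]]) auto
 thus "continuous_on {0<..} (%s. of_real (shell t s) * g s)" by (intro continuous_intros g)
 have "0 < t^2 / 2" using t by simp
 thus "{t^2 / 2..} \<subseteq> {0<..}" using less_le_trans by (fastforce simp only: atLeast_iff greaterThan_iff)
qed (use t in \<open>auto simp: shell_eq_0\<close>)

lemma bump'_eq_shell: "bump' x t y = shell t ((norm (y - x))^2) *\<^sub>R (y - x)"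
 by (simp add: bump'_def shell_def)

lemma sq_sum_of_real: "sq_sum (\<chi> i. complex_of_real (v $ i)) = of_real ((norm (v :: real^'n::finite))^2)"
 unfolding sq_sum_def power2_norm_eq_inner by (simp add: inner_vec_def power2_eq_square)

lemma norm_vec_of_real: "norm (\<chi> i. complex_of_real (v $ i)) = norm (v :: real^'n::finite)"
 by (simp add: norm_vec_def)

lemma rad_0_1_of_real:
 assumes "s > 0"
 shows "rad nu 0 1 (of_real (ln s)) = of_real (snd (rad_coeff nu 0 1) * exp (- nu * ln s))"
proof -
 have f: "fst (rad_coeff nu 0 1) = 0" by (cases "nu = 1") (auto simp: Let_def)
 have "exp (complex_of_real (- nu) * of_real (ln s)) = of_real (exp (- nu * ln s))"
  by (simp only: of_real_mult[symmetric] exp_of_real)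
 thus ?thesis unfolding rad_def f by simp
qed

lemma snd_rad_coeff_0_1: "snd (rad_coeff nu 0 1) ~= 0"
 by (cases "nu = 1") (auto simp: Let_def)

lemma continuous_on_rad_ln: "continuous_on {0<..} (%s. rad nu k j (of_real (ln s)))"
 unfolding rad_def by (intro continuous_intros) auto

context elastic
begin

text \<open>The integrand of the flux of g_0 through the shell of radius 1, without the constant in
  g_0'.\<close>

definition profile :: "(real, 'n) vec => real" where
 "profile z = shell 1 ((norm z)^2) * ((norm z)^2 * exp (- (real CARD('n) / 2) * ln ((norm z)^2)))"

text \<open>The modulus of the total flux out of the pole, in the place usually taken by the area of
  the unit sphere; the final constant is divided by it.\<close>

definition cQ :: real where
 "cQ = \<bar>snd (rad_coeff (real CARD('n) / 2) 0 1)\<bar> * \<bar>LI z. profile z\<bar>"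

lemma profile:
 shows "continuous_on UNIV profile" "integrable lborel profile" "profile z <= 0"
proof -
 have "continuous_on UNIV (%s. of_real (shell 1 s) * complex_of_real (s * exp (- (real CARD('n) / 2) * ln s)))"
  by (intro continuous_on_shell_mult continuous_intros) auto
 hence "continuous_on UNIV (%z :: (real, 'n) vec. of_real (shell 1 ((norm z)^2)) * complex_of_real ((norm z)^2 * exp (- (real CARD('n) / 2) * ln ((norm z)^2))))"
  by (rule continuous_on_compose2) (auto intro!: continuous_intros)
 from continuous_on_Re[OF this] show c: "continuous_on UNIV profile" by (simp add: profile_def[abs_def])
 show "integrable lborel profile"
 proof (rule integrable_continuous_bounded_support[OF c])
  show "profile z = 0" if "norm z > 1" for z
   using that power_mono[of 1 "norm z" 2] by (simp add: profile_def shell_eq_0)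
 qed
 show "profile z <= 0" unfolding profile_def shell_def using step'_nonpos[of "(norm z)^2 / 1^2"]
  by (intro mult_nonpos_nonneg) (auto intro!: divide_nonpos_nonneg mult_nonneg_nonneg)
qed

lemma cQ_pos: "cQ > 0"
proof -
 \<comment> \<open>Any point in the interior of the transition region 1/2 < |z|^2 < 1 would do:
   there the profile is strictly negative, and it is nowhere positive.\<close>
 define z0 :: "(real, 'n) vec" where "z0 = (sqrt 3 / 2) *\<^sub>R axis NN 1"
 have z0: "(norm z0)^2 = 3 / 4" by (simp add: z0_def power_divide)
 have "profile z0 < 0" unfolding profile_def shell_def z0 by (simp add: step'_def power2_eq_square)
 moreover have "isCont profile z0" using profile(1) by (simp add: continuous_on_eq_continuous_at)
 ultimately obtain d where d: "d > 0" "!!z. dist z z0 < d ==> dist (profile z) (profile z0) < - profile z0 / 2"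
  unfolding continuous_at_eps_delta by (metis half_gt_zero neg_0_less_iff_less)
 have "- profile z0 / 2 * measure lborel (ball z0 d) = (LI z. - profile z0 / 2 * indicator (ball z0 d) z)" by simp
 also have "... <= (LI z. - profile z)"
 proof (rule integral_mono)
  show "integrable lborel (%z. - profile z0 / 2 * indicator (ball z0 d) z :: real)"
   using emeasure_bounded_finite[of "ball z0 d"] by (intro integrable_mult_right integrable_real_indicator) auto
  show "- profile z0 / 2 * indicator (ball z0 d) z <= - profile z" for z
   using d(2)[of z] profile(3)[of z] by (auto simp: indicator_def dist_commute dist_real_def abs_less_iff)
 qed (use profile in auto)
 finally have "- profile z0 / 2 * measure lborel (ball z0 d) <= - (LI z. profile z)" by simp
 moreover have "0 < - profile z0 / 2 * measure lborel (ball z0 d)"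
  using \<open>profile z0 < 0\<close> d(1) content_ball_pos[OF d(1), of z0] by (intro mult_pos_pos) auto
 ultimately show ?thesis unfolding cQ_def using snd_rad_coeff_0_1[of "real CARD('n) / 2"] by (intro mult_pos_pos) auto
qed

text \<open>Under y = x + t z the volume factor t^n cancels the homogeneity of the integrand, so the
  flux is the same through every shell.\<close>

lemma shell_moment:
 fixes x :: "(real, 'n) vec"
 assumes t: "t > 0"
 shows "norm (LI y. of_real (shell t ((norm (y - x))^2)) * (of_real ((norm (y - x))^2) * rad (real CARD('n) / 2) 0 1 (of_real (ln ((norm (y - x))^2))))) = cQ"
proof -
 define nu where "nu = real CARD('n) / 2"
 define c1 where "c1 = snd (rad_coeff nu 0 1)"
 define f where "f y = of_real (shell t ((norm (y - x))^2)) * (of_real ((norm (y - x))^2) * rad nu 0 1 (of_real (ln ((norm (y - x))^2))))" for y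
 have "continuous_on UNIV (%s. of_real (shell t s) * (of_real s * rad nu 0 1 (of_real (ln s))))"
  by (intro continuous_on_shell_mult t continuous_intros continuous_on_rad_ln)
 hence "continuous_on UNIV f" unfolding f_def by (rule continuous_on_compose2) (auto intro!: continuous_intros)
 hence fm: "f : borel_measurable borel" by (rule borel_measurable_continuous_onI)
 have "(LI y. f y) = (LINT y|density (distr lborel borel (%z. x + t *\<^sub>R z)) (%_. ennreal (\<bar>t\<bar> ^ DIM((real, 'n) vec))). f y)"
  using lborel_affine[of t x] t by simp
 also have "... = (LI z. (t ^ CARD('n)) *\<^sub>R f (x + t *\<^sub>R z))"
  using t fm by (subst integral_density) (auto simp: integral_distr)
 also have "... = (LI z. of_real (c1 * profile z))"
 proof (intro Bochner_Integration.integral_cong refl)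
  fix z
  show "(t ^ CARD('n)) *\<^sub>R f (x + t *\<^sub>R z) = of_real (c1 * profile z)"
  proof (cases "z = 0")
   case False
   hence z: "(norm z)^2 > 0" by simp
   have n: "(norm (x + t *\<^sub>R z - x))^2 = t^2 * (norm z)^2" using t by (simp add: power_mult_distrib)
   have e: "exp (- nu * ln (t^2 * (norm z)^2)) = exp (- nu * ln ((norm z)^2)) / t ^ CARD('n)"
    using t z by (simp add: nu_def ln_mult ln_realpow ring_distribs exp_add exp_diff exp_minus exp_of_nat_mult exp_of_nat2_mult field_simps)
   have p: "t^2 * (norm z)^2 > 0" using t z by simp
   have "(t ^ CARD('n)) *\<^sub>R f (x + t *\<^sub>R z) = of_real (t ^ CARD('n) * (shell t (t^2 * (norm z)^2) * (t^2 * (norm z)^2 * (c1 * (exp (- nu * ln ((norm z)^2)) / t ^ CARD('n))))))"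
    unfolding f_def n rad_0_1_of_real[OF p] e c1_def by (simp only: scaleR_conv_of_real of_real_mult)
   also have "t ^ CARD('n) * (shell t (t^2 * (norm z)^2) * (t^2 * (norm z)^2 * (c1 * (exp (- nu * ln ((norm z)^2)) / t ^ CARD('n))))) = c1 * profile z"
    using t by (simp add: profile_def nu_def shell_def)
   finally show ?thesis .
  qed (simp add: f_def profile_def)
 qed
 finally have "(LI y. f y) = of_real (c1 * (LI z. profile z))" using profile(2) by simp
 thus ?thesis unfolding f_def nu_def c1_def cQ_def by (simp add: norm_mult)
qed

end

lemma c1_lipschitz:
 fixes f :: "real^'n::finite => real"
 assumes pd: "!!k z. z : cube y r ==> partial_differentiable k f z"
  and B: "!!k z. z : cube y r ==> \<bar>partial k f z\<bar> <= B"
  and p: "p : cube y r" and q: "q : cube y r"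
 shows "\<bar>f q - f p\<bar> <= B * (real CARD('n) * norm (q - p))"
proof -
 have B0: "0 <= B" using B[OF p] abs_ge_zero order_trans by blast
 have "\<bar>f (\<chi> i. if i : UNIV then q $ i else p $ i) - f p\<bar> <= B * (\<Oplus>i. \<bar>q $ i - p $ i\<bar>)"
  by (rule c1_increment_le[OF pd B p q])
 also have "(\<Oplus>i. \<bar>q $ i - p $ i\<bar>) <= (\<Sum>i\<in>(UNIV::'n set). norm (q - p))"
  using component_le_norm_cart[of "q - p"] by (intro sum_mono) (simp add: vector_minus_component)
 finally show ?thesis using B0 by (simp add: mult_left_mono)
qed

lemma exp_ln_of_real: "s > 0 ==> exp (complex_of_real (ln s)) = of_real s"
 by (simp only: exp_of_real exp_ln)

lemma rad_relation:
 fixes ty :: "'n::finite itself"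
 shows "of_nat (CARD('n) + 2) * rad (real CARD('n) / 2) 1 2 l + exp l * rad (real CARD('n) / 2) 1 3 l = rad (real CARD('n) / 2) 0 1 l"
 using rad_laplace_general[of "real CARD('n) / 2" 1 1 l]
 by (simp add: numeral_2_eq_2 numeral_3_eq_3 algebra_simps)

context elastic
begin

abbreviation "ct_vec v \<equiv> (\<chi> i. complex_of_real (v $ i))"

text \<open>The field is frozen at the constants c. By \<open>leading_sum\<close> the integrand is a
  radial tensor, whose moments reduce it to the scalar flux, so component (s0, i) of the field is
  singled out.\<close>

lemma leading_integral:
 fixes x :: "(real, 'n) vec" and c :: "bool => 'n => complex" and s0 i
 assumes t: "t > 0"
 defines "h \<equiv> %y. of_real (shell t ((norm (y - x))^2)) * (\<Oplus>s k. c s k * (\<Oplus>p. of_real ((y - x) $ p) *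
   sg s k p (%s k. 0) (%s k p. V0 (ct_vec (y - x)) (of_real (ln ((norm (y - x))^2))) s k (s0, i) [p])))"
 shows "integrable lborel h"
  and "(LI y. h y) = c s0 i * (LI y. of_real (shell t ((norm (y - x))^2)) *
   (of_real ((norm (y - x))^2) * rad (real CARD('n) / 2) 0 1 (of_real (ln ((norm (y - x))^2)))))"
proof -
 define A where "A s = rad (real CARD('n) / 2) 0 1 (of_real (ln s))" for s
 define B where "B s = rad (real CARD('n) / 2) 1 2 (of_real (ln s))" for s
 define C where "C s = rad (real CARD('n) / 2) 1 3 (of_real (ln s))" for s
 define ka where "ka = dco s0 1"
 define f1 where "f1 s = (cl s0 * (1 / ca s0 - ka) + cm s0 / ca s0) * A s - ka * (cm s0 + ca s0) * (2 * B s + of_real s * C s)" for s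
 define f2 where "f2 s = of_real s * (A s - ka * (cm s0 + ca s0) * B s)" for s
 define g where "g j s = of_real (shell t s) * j s" for j :: "real => complex" and s
 have c3: "continuous_on {0<..} A" "continuous_on {0<..} B" "continuous_on {0<..} C"
  unfolding A_def B_def C_def by (rule continuous_on_rad_ln)+
 have cg: "continuous_on UNIV (g f1)" "continuous_on UNIV (g f2)" "continuous_on UNIV (g (%s. of_real s * A s))"
  unfolding g_def f1_def f2_def by (intro continuous_on_shell_mult t continuous_intros c3)+
 define N where "N y = (norm (y - x))^2" for y
 have g0: "g j s = 0" if "s >= t^2" for j s using that t by (simp add: g_def shell_eq_0)
 have cgN: "continuous_on UNIV (%y. g j (N y))" if "continuous_on UNIV (g j)" for j
  by (rule continuous_on_compose2[OF that]) (auto simp: N_def intro!: continuous_intros)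
 have supp: "g j (N y) = 0" if "norm y > norm x + t" for j y
 proof -
  have "t <= norm (y - x)" using that norm_triangle_ineq2[of y x] by linarith
  thus ?thesis using t by (intro g0) (auto simp: N_def intro: power_mono)
 qed
 have cc: "continuous_on UNIV (%y. complex_of_real ((y - x) $ k))" for k
  by (intro continuous_on_of_real continuous_on_component continuous_intros)
 have heq: "h y = (\<Oplus>k. c s0 k * (g f1 (N y) * of_real ((y - x) $ k * (y - x) $ i) + (if k = i then g f2 (N y) else 0)))" for y
 proof (cases "y = x")
  case True thus ?thesis using t by (simp add: h_def N_def g_def f2_def cong: if_cong)
 next
  case False
  hence N0: "N y > 0" by (simp add: N_def)
  have e: "exp (complex_of_real (ln (N y))) = sq_sum (ct_vec (y - x))"
   unfolding sq_sum_of_real exp_ln_of_real[OF N0] by (simp add: N_def)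
  have S: "(\<Oplus>p. of_real ((y - x) $ p) * sg s k p (%s k. 0) (%s k p. V0 (ct_vec (y - x)) (of_real (ln (N y))) s k (s0, i) [p]))
   = (if s = s0 then of_real ((y - x) $ k * (y - x) $ i) * f1 (N y) + (if k = i then f2 (N y) else 0) else 0)" for s k
   using leading_sum[OF e, of s k s0 i] unfolding exp_ln_of_real[OF N0]
   by (simp add: f1_def f2_def A_def B_def C_def ka_def)
  have "(\<Oplus>s k. c s k * (if s = s0 then of_real ((y - x) $ k * (y - x) $ i) * f1 (N y) + (if k = i then f2 (N y) else 0) else 0))
   = (\<Oplus>k. c s0 k * (of_real ((y - x) $ k * (y - x) $ i) * f1 (N y) + (if k = i then f2 (N y) else 0)))"
   by (cases s0) (simp_all add: UNIV_bool)
  hence "h y = of_real (shell t (N y)) * (\<Oplus>k. c s0 k * (of_real ((y - x) $ k * (y - x) $ i) * f1 (N y) + (if k = i then f2 (N y) else 0)))"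
   unfolding h_def N_def[symmetric] S by simp
  thus ?thesis unfolding sum_distrib_left by (rule trans) (intro sum.cong refl, simp add: g_def algebra_simps)
 qed
 have i1: "integrable lborel (%y. g f1 (N y) * of_real ((y - x) $ k * (y - x) $ i))" for k
  by (rule integrable_continuous_bounded_support[of _ "norm x + t"])
   (simp_all add: supp, intro continuous_intros cgN cg cc)
 have i2: "integrable lborel (%y. g f2 (N y))"
  by (rule integrable_continuous_bounded_support[of _ "norm x + t"]) (simp_all add: supp cgN cg)
 have i3: "integrable lborel (%y. g f1 (N y) * of_real (N y))"
  by (rule integrable_continuous_bounded_support[of _ "norm x + t"])
   (simp_all add: supp, intro continuous_intros cgN cg, simp add: N_def, intro continuous_intros)
 have i12: "integrable lborel (%y. if k = i then g f2 (N y) else 0)" for k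
  using i2 by (cases "k = i") auto
 show "integrable lborel h" unfolding heq[abs_def] by (intro Bochner_Integration.integrable_sum integrable_mult_right Bochner_Integration.integrable_add i1 i12)
 have "(LI y. h y) = (\<Oplus>k. c s0 k * ((LI y. g f1 (N y) * of_real ((y - x) $ k * (y - x) $ i)) + (LI y. (if k = i then g f2 (N y) else 0))))"
  unfolding heq[abs_def] using i1 i12 by (simp add: integral_sum)
 also have "... = (\<Oplus>k. if k = i then c s0 k * ((LI y. g f1 (N y) * of_real (N y)) / of_nat CARD('n) + (LI y. g f2 (N y))) else 0)"
 proof (intro sum.cong refl)
  fix k
  have "(LI y. g f1 (N y) * of_real ((y - x) $ k * (y - x) $ i)) = (if k = i then (LI y. g f1 (N y) * of_real (N y)) / of_nat CARD('n) else 0)"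
   using radial_second_moment[OF cg(1), of "t^2" x k i] g0 by (simp add: N_def)
  thus "c s0 k * ((LI y. g f1 (N y) * of_real ((y - x) $ k * (y - x) $ i)) + (LI y. (if k = i then g f2 (N y) else 0)))
   = (if k = i then c s0 k * ((LI y. g f1 (N y) * of_real (N y)) / of_nat CARD('n) + (LI y. g f2 (N y))) else 0)" by simp
 qed
 also have "... = c s0 i * ((LI y. g f1 (N y) * of_real (N y)) / of_nat CARD('n) + (LI y. g f2 (N y)))" by simp
 also have "(LI y. g f1 (N y) * of_real (N y)) / of_nat CARD('n) + (LI y. g f2 (N y))
  = (LI y. g f1 (N y) * of_real (N y) / of_nat CARD('n) + g f2 (N y))"
  using i2 i3 by simp
 also have "... = (LI y. of_real (shell t (N y)) * (of_real (N y) * A (N y)))"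
 proof (intro Bochner_Integration.integral_cong refl)
  fix y
  show "g f1 (N y) * of_real (N y) / of_nat CARD('n) + g f2 (N y) = of_real (shell t (N y)) * (of_real (N y) * A (N y))"
  proof (cases "y = x")
   case True thus ?thesis by (simp add: N_def g_def f2_def)
  next
   case False
   hence N0: "N y > 0" by (simp add: N_def)
   have "of_nat (CARD('n) + 2) * B (N y) + of_real (N y) * C (N y) = A (N y)"
    using rad_relation[where 'n = 'n, of "of_real (ln (N y))"] unfolding exp_ln_of_real[OF N0] by (simp add: A_def B_def C_def)
   from leading_moment[OF this, of s0]
   have "of_real (N y) * f1 (N y) / of_nat CARD('n) + f2 (N y) = of_real (N y) * A (N y)"
    by (simp add: f1_def f2_def ka_def)
   hence "of_real (shell t (N y)) * (of_real (N y) * f1 (N y) / of_nat CARD('n) + f2 (N y)) = of_real (shell t (N y)) * (of_real (N y) * A (N y))"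
    by simp
   thus ?thesis by (simp add: g_def algebra_simps)
  qed
 qed
 finally show "(LI y. h y) = c s0 i * (LI y. of_real (shell t ((norm (y - x))^2)) *
   (of_real ((norm (y - x))^2) * rad (real CARD('n) / 2) 0 1 (of_real (ln ((norm (y - x))^2)))))"
  by (simp add: N_def A_def)
qed

definition rl :: "(real, 'n) vec => (real, 'n) vec => complex" where
 "rl x y = of_real (ln ((norm (y - x))^2))"

lemma KX_real: "KX x (of_real (x $ NN)) y = ct_vec (y - x)"
 by (auto simp: KX_def vec_eq_iff)

lemma branch_rl: "open Om ==> x ~: Om ==> branch x (of_real (x $ NN)) Om (rl x)"
 unfolding branch_def KX_real sq_sum_of_real rl_def
proof (intro conjI ballI continuous_intros)
 fix y assume "x ~: Om" "y : Om"
 hence "(norm (y - x))^2 > 0" by auto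
 thus "exp (complex_of_real (ln ((norm (y - x))^2))) = of_real ((norm (y - x))^2)" by (rule exp_ln_of_real)
qed auto

end

section \<open>Representation of the solution at the pole\<close>

context solution
begin

lemma sum_F:
 fixes v :: "(real, 'n) vec"
 shows "(\<Oplus>p. of_real (v $ p) * F x z l q p y) = (\<Oplus>s k.
  KV x z l q [] s k y * (\<Oplus>p. of_real (v $ p) * sg s k p (%s k. UU s k y) (%s k p. UJ s k p y))
  - UU s k y * (\<Oplus>p. of_real (v $ p) * sg s k p (%s k. KV x z l q [] s k y) (%s k p. KV x z l q [p] s k y)))"
proof -
 have "(\<Oplus>p. of_real (v $ p) * F x z l q p y) = (\<Oplus>s k p.
  KV x z l q [] s k y * (of_real (v $ p) * sg s k p (%s k. UU s k y) (%s k p. UJ s k p y))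
  - UU s k y * (of_real (v $ p) * sg s k p (%s k. KV x z l q [] s k y) (%s k p. KV x z l q [p] s k y)))"
  unfolding F_def FF_def sum_distrib_left
  by (subst sum.swap, rule sum.cong[OF refl], subst sum.swap, rule sum.cong[OF refl], rule sum.cong[OF refl]) (simp add: algebra_simps)
 thus ?thesis by (simp add: sum_subtractf sum_distrib_left)
qed

lemma norm_moment_le:
 fixes v :: "(real, 'n) vec" and g :: "'n => complex"
 assumes "!!p. norm (g p) <= b" "norm v <= r"
 shows "norm (\<Oplus>p. of_real (v $ p) * g p) <= real CARD('n) * (r * b)"
proof -
 have "norm (of_real (v $ p) * g p) <= r * b" for p
  unfolding norm_mult using assms component_le_norm_cart[of v p] norm_ge_zero[of "g p"]
  by (intro mult_mono) (auto intro: order_trans)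
 thus ?thesis using sum_norm_le[of UNIV "%p. of_real (v $ p) * g p" "%_. r * b"] by simp
qed

lemma solution_bound_near:
 assumes x: "x : D"
 obtains r b where "0 < r" "r <= 1" "cball x r \<subseteq> D" "b >= 1"
  "!!y s k. y : cball x r ==> norm (UU s k y) <= b" "!!y s k p. y : cball x r ==> norm (UJ s k p y) <= b"
  "!!y s k. y : cball x r ==> norm (UU s k y - UU s k x) <= b * norm (y - x)"
proof -
 obtain r0 where r0: "r0 > 0" "cube x r0 \<subseteq> D" using open_contains_cube[OF openD x] .
 define r where "r = min 1 (min r0 (r0 / 2))"
 have "cball x r \<subseteq> ball x r0" using r0 by (auto simp: r_def)
 hence cb: "cball x r \<subseteq> cube x r0" using ball_subset_cube by blast
 have "EX B. B >= 0 & (ALL y:cball x r. (ALL p. norm (UJ s k p y) <= B) & norm (UU s k y - UU s k x) <= B * norm (y - x) & norm (UU s k y) <= B)" for s k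
 proof -
  have "C1_on D (fn s k)" using fn_C2[of s k] by (simp add: C2_on_def)
  from C1_on_bounded_partials[OF this r0(2)]
  obtain B where B: "B >= 0" "!!p z. z : cube x r0 ==> \<bar>partial p (fn s k) z\<bar> <= B" by metis
  define n where "n = real CARD('n)"
  have n: "n >= 1" by (simp add: n_def Suc_le_eq)
  have xc: "x : cube x r0" using r0 by (simp add: cube_def)
  have lip: "\<bar>fn s k y - fn s k x\<bar> <= B * n * norm (y - x)" if "y : cball x r" for y
   using c1_lipschitz[OF fn_pd(1)[OF subsetD[OF r0(2)]] B(2) xc subsetD[OF cb that]] by (simp add: n_def mult.assoc)
  define B' where "B' = \<bar>fn s k x\<bar> + B * n"
  have BB: "B <= B'" "B * n <= B'" using B(1) n mult_left_mono[of 1 n B] by (auto simp: B'_def)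
  have "B' >= 0 & (ALL y:cball x r. (ALL p. norm (UJ s k p y) <= B') & norm (UU s k y - UU s k x) <= B' * norm (y - x) & norm (UU s k y) <= B')"
  proof (intro conjI ballI allI)
   show "B' >= 0" using BB B by linarith
   fix y p assume y: "y : cball x r"
   show "norm (UJ s k p y) <= B'" using B(2)[of y p] y cb BB by (auto simp: UJ_def)
   have ny: "norm (y - x) <= 1" using y by (auto simp: r_def dist_norm norm_minus_commute)
   have e: "norm (UU s k y - UU s k x) = \<bar>fn s k y - fn s k x\<bar>" by (simp add: UU_def of_real_diff[symmetric] del: of_real_diff)
   show "norm (UU s k y - UU s k x) <= B' * norm (y - x)"
    unfolding e using lip[OF y] BB(2) by (meson mult_right_mono norm_ge_zero order_trans)
   have "B * n * norm (y - x) <= B * n" using B(1) n ny by (intro mult_left_le) auto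
   thus "norm (UU s k y) <= B'" using lip[OF y] by (simp add: UU_def B'_def)
  qed
  thus ?thesis by blast
 qed
 then obtain B where B: "!!s k. B s k >= 0" "!!s k y p. y : cball x r ==> norm (UJ s k p y) <= B s k"
  "!!s k y. y : cball x r ==> norm (UU s k y - UU s k x) <= B s k * norm (y - x)"
  "!!s k y. y : cball x r ==> norm (UU s k y) <= B s k" by metis
 define b where "b = 1 + (\<Oplus>s k. B s k)"
 have Bb: "B s k <= b" for s k
 proof -
  have "B s k <= (\<Oplus>k. B s k)" by (rule member_le_sum) (auto simp: B)
  also have "... <= (\<Oplus>s k. B s k)" by (rule member_le_sum[of s UNIV "%s. \<Oplus>k. B s k"]) (auto intro!: sum_nonneg B)
  finally show ?thesis by (simp add: b_def)
 qed
 have b1: "b >= 1" by (auto simp: b_def intro!: sum_nonneg B)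
 show thesis
 proof (rule that[of r b])
  show "0 < r" "r <= 1" "cball x r \<subseteq> D" "b >= 1" using r0 cb b1 by (auto simp: r_def)
  fix y s k p assume y: "y : cball x r"
  show "norm (UU s k y) <= b" "norm (UJ s k p y) <= b" using B(2,4)[OF y, of s k] Bb[of s k] order_trans by blast+
  show "norm (UU s k y - UU s k x) <= b * norm (y - x)"
   using B(3)[OF y, of s k] Bb[of s k] by (meson mult_right_mono norm_ge_zero order_trans)
 qed
qed

end

context solution
begin

abbreviation "Fr x q v y \<equiv> (\<Oplus>p. of_real (v $ p) * F x (of_real (x $ NN)) (rl x) q p y)"

lemma integrable_Fr:
 assumes c: "cutoff C ct d" "C \<subseteq> D" and r: "r > 0" "!!y. y : ball x r ==> d y = 0"
 shows "integrable lborel (%y. Fr x q (d y) y)"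
proof -
 have C: "compact C" and dc: "continuous_on UNIV d" and z: "!!y. y ~: C ==> d y = 0" using c by (auto simp: cutoff_def)
 have "continuous_on UNIV (%y. Fr x q (d y) y)"
 proof (rule continuous_on_zero_extension[where Om = "D - {x}" and C = "C - ball x r"])
  have br: "branch x (of_real (x $ NN)) (D - {x}) (rl x)" by (rule branch_rl) (use openD in auto)
  have "continuous_on (D - {x}) (%y. d y $ p)" for p
   by (rule continuous_on_component[OF continuous_on_subset[OF dc]]) simp
  thus "continuous_on (D - {x}) (%y. Fr x q (d y) y)"
   by (intro continuous_on_sum continuous_on_mult continuous_on_of_real continuous_on_F[OF br]) auto
  show "closed (C - ball x r)" using compact_imp_closed[OF C] by (rule closed_Diff) simp
  show "Fr x q (d y) y = 0" if "y ~: C - ball x r" for y using that z r by force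
 qed (use openD c r in auto)
 moreover obtain B where B: "!!y. y : C ==> norm y <= B" using compact_imp_bounded[OF C] by (auto simp: bounded_iff)
 have "Fr x q (d y) y = 0" if "norm y > B" for y
 proof -
  have "y ~: C" using that B by force
  thus ?thesis by (simp add: z)
 qed
 ultimately show ?thesis by (rule integrable_continuous_bounded_support[of _ B])
qed

text \<open>Both cutoffs equal 1 near the pole, so their difference is a cutoff supported in D
  without the pole, where the flux is divergence free.\<close>

lemma cutoff_integral_Fr_eq:
 assumes c: "cutoff C ct d" "C \<subseteq> D" and r: "r > 0" "!!y. y : ball x r ==> ct y = 1 & d y = 0"
  and t: "t > 0" "t <= r" "cball x t \<subseteq> D"
 shows "(LI y. Fr x q (d y) y) = (LI y. Fr x q (bump' x t y) y)"
proof -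
 have cl: "compact C" using c by (simp add: cutoff_def)
 have b1: "bump x t y = 1 & bump' x t y = 0" if "y : ball x (t / 2)" for y
  using that bump_eq_1[OF t(1), of y x] by auto
 have br: "branch x (of_real (x $ NN)) (D - {x}) (rl x)" by (rule branch_rl) (use openD in auto)
 have "cutoff (C Un cball x t - ball x (t / 2)) (%y. ct y - bump x t y) (%y. d y - bump' x t y)"
 proof (rule cutoff_subset[OF cutoff_diff[OF c(1) cutoff_bump[OF t(1)]]])
  show "compact (C Un cball x t - ball x (t / 2))" using cl by (intro compact_diff compact_Un) auto
  show "ct y - bump x t y = 0 & d y - bump' x t y = 0" if "y : C Un cball x t - (C Un cball x t - ball x (t / 2))" for y
   using that b1[of y] r(2)[of y] t by auto
 qed
 moreover have "C Un cball x t - ball x (t / 2) \<subseteq> D - {x}" using c t by auto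
 ultimately have "(LI y. Fr x q (d y - bump' x t y) y) = 0" by (intro cutoff_integral_F[OF br]) auto
 moreover have "(LI y. Fr x q (d y - bump' x t y) y) = (LI y. Fr x q (d y) y) - (LI y. Fr x q (bump' x t y) y)"
 proof -
  have "integrable lborel (%y. Fr x q (d y) y)" using r by (intro integrable_Fr[OF c r(1)]) auto
  moreover have "integrable lborel (%y. Fr x q (bump' x t y) y)"
   by (rule integrable_Fr[OF cutoff_bump[OF t(1)] t(3), of "t / 2"]) (use t b1 in auto)
  moreover have "Fr x q (d y - bump' x t y) y = Fr x q (d y) y - Fr x q (bump' x t y) y" for y
   by (simp add: algebra_simps sum_subtractf)
  ultimately show ?thesis by simp
 qed
 ultimately show ?thesis by simp
qed

text \<open>On a shell of radius t, U is replaced by its value at x and V by its leading part. Each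
  error is better than the singularity by one power of t up to a logarithm, and sqrt t dominates
  that.\<close>

lemma bump_integral_error:
 assumes x: "x : D" and card: "CARD('n) >= 2"
 obtains c r where "0 < r" "r <= 1" "cball x r \<subseteq> D" "!!t q. 0 < t ==> t <= r ==>
  cQ * norm (UU (fst q) (snd q) x) <= norm (LI y. Fr x q (bump' x t y) y) + c * sqrt t"
proof -
 obtain r b where rb: "0 < r" "r <= 1" "cball x r \<subseteq> D" "b >= 1"
  "!!y s k. y : cball x r ==> norm (UU s k y) <= b" "!!y s k p. y : cball x r ==> norm (UJ s k p y) <= b"
  "!!y s k. y : cball x r ==> norm (UU s k y - UU s k x) <= b * norm (y - x)"
  by (rule solution_bound_near[OF x]) blast
 obtain K where K: "K >= 1"
  "!!X l s k q I. exp l = sq_sum X ==> norm X <= 1 ==> length I <= 4 ==> norm (V X l s k q I) <= K * W X l (length I)"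
  "!!X l s k q I. exp l = sq_sum X ==> norm X <= 1 ==> length I <= 4 ==>
   norm (V X l s k q I - V0 X l s k q I) <= K * W X l (length I) * norm X"
  by (rule V_bound[of 1]) auto
 define B where "B = (4::real)"
 have B: "B >= 1" "!!s. \<bar>step' s\<bar> <= B" using step'_le by (simp_all add: B_def)
 define n where "n = real CARD('n)"
 have n2: "n >= 2" using card by (simp add: n_def)
 \<comment> \<open>12 is the 6 of \<open>trm\<close> times the two blocks; the second factor n
   counts the components of a block.\<close>
 define c1 where "c1 = 12 * n * n * K * b * Csg"
 define c where "c = 2 * B * c1 * (unit_ball_vol n * 2 ^ CARD('n)) * 12"
 have c10: "c1 >= 0" unfolding c1_def using n2 K(1) rb(4) Csg_ge_1 by simp
 show thesis
 proof (rule that[OF rb(1-3), of c])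
  fix t and q :: "bool \<times> 'n" assume t: "0 < t" "t <= r"
  obtain s0 i where q: "q = (s0, i)" by (cases q)
  have t1: "t <= 1" using t rb by linarith
  define z0 where "z0 = complex_of_real (x $ NN)"
  let ?K = "KV x z0 (rl x) q"
  let ?F = "%y. Fr x q (bump' x t y) y"
  define SU where "SU y s k = (\<Oplus>p. of_real ((y - x) $ p) * sg s k p (%s k. UU s k y) (%s k p. UJ s k p y))" for y s k
  define SV where "SV y s k = (\<Oplus>p. of_real ((y - x) $ p) * sg s k p (%s k. ?K [] s k y) (%s k p. ?K [p] s k y))" for y s k
  define S0 where "S0 y s k = (\<Oplus>p. of_real ((y - x) $ p) * sg s k p (%s k. 0) (%s k p. V0 (ct_vec (y - x)) (of_real (ln ((norm (y - x))^2))) s k q [p]))" for y s k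
  define sh where "sh y = shell t ((norm (y - x))^2)" for y
  let ?E = "%y s k. (?K [] s k y * SU y s k - UU s k y * SV y s k) - (- UU s k x) * S0 y s k"
  have T: "?F y = of_real (sh y) * (\<Oplus>s k. ?K [] s k y * SU y s k - UU s k y * SV y s k)" for y
  proof -
   have "?F y = of_real (sh y) * Fr x q (y - x) y"
    unfolding bump'_eq_shell sum_distrib_left sh_def by (simp add: mult.assoc)
   thus ?thesis unfolding sum_F SU_def SV_def z0_def .
  qed
  define Mn where "Mn y = of_real (sh y) * (\<Oplus>s k. (- UU s k x) * S0 y s k)" for y
  have Mi: "integrable lborel Mn" and MI: "(LI y. Mn y) = - UU s0 i x * (LI y. of_real (sh y) *
   (of_real ((norm (y - x))^2) * rad (real CARD('n) / 2) 0 1 (of_real (ln ((norm (y - x))^2)))))"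
   unfolding Mn_def S0_def sh_def q by (rule leading_integral[OF t(1), of x "%s k. - UU s k x" s0 i])+
  have Ti: "integrable lborel (%y. ?F y)"
   by (rule integrable_Fr[OF cutoff_bump[OF t(1)], of _ "t / 2"]) (use t rb in \<open>auto intro!: bump_eq_1\<close>)
  define L where "L = (1 + 2 * \<bar>ln (t / 2)\<bar>) * ((t / 2)^2 / (t / 2) ^ CARD('n))"
  have L0: "L >= 0" using t by (simp add: L_def)
  define M where "M = 2 * B / t^2 * (c1 * (L * t))"
  have M0: "M >= 0" unfolding M_def using B L0 c10 t by simp
  have bound: "norm (?F y - Mn y) <= M * indicator (cball x t) y" for y
  proof (cases "t^2 / 2 < (norm (y - x))^2 & (norm (y - x))^2 < t^2")
   case False
   hence "sh y = 0" unfolding sh_def using shell_eq_0[OF t(1)] by (auto simp: not_less)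
   thus ?thesis unfolding T Mn_def using M0 by simp
  next
   case True
   define eta where "eta = norm (y - x)"
   have e1: "eta < t" using True t power2_less_imp_less[of eta t] by (simp add: eta_def)
   have e2: "t / 2 < eta"
   proof (rule power2_less_imp_less)
    have "(t / 2)^2 <= t^2 / 2" using t by (simp add: power_divide)
    thus "(t / 2)^2 < eta^2" using True by (simp add: eta_def)
   qed (simp add: eta_def)
   have e0: "0 < eta" using e2 t by simp
   have yr: "y : cball x r" and xr: "x : cball x r" using e1 t rb by (auto simp: eta_def dist_norm norm_minus_commute)
   define X where "X = (ct_vec (y - x) :: (complex, 'n) vec)"
   define l where "l = complex_of_real (ln (eta^2))"
   have el: "exp l = sq_sum X" unfolding X_def l_def sq_sum_of_real using e0 by (subst exp_ln_of_real) (auto simp: eta_def)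
   have nX: "norm X = eta" unfolding X_def norm_vec_of_real by (simp add: eta_def)
   have nX1: "norm X <= 1" using e1 t1 by (simp add: nX)
   have KVX: "?K I s k y = V X l s k q I" for I s k
    by (simp add: KV_def z0_def KX_real X_def rl_def l_def eta_def)
   define w where "w = W X l 0"
   have w_eq: "w = (1 + \<bar>ln (eta^2)\<bar>) * exp ((1 - n / 2) * ln (eta^2))"
    using e0 unfolding w_def W_def nX l_def n_def by (simp add: power2_eq_square)
   have W1: "W X l 1 = w / eta"
    using e0 unfolding w_def W_def nX by (simp add: l_def power2_eq_square field_simps)
   have w0: "w >= 0" by (simp add: w_eq)
   have wL: "w <= L"
   proof -
    have h: "0 < t / 2" "eta < 1" using t e1 t1 by auto
    have ln1: "ln (t / 2) <= ln eta" using h e2 e0 by simp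
    have ln0: "ln eta <= 0" using h e0 by simp
    have l2: "ln (eta^2) = 2 * ln eta" using e0 by (simp add: ln_realpow)
    have "\<bar>ln (eta^2)\<bar> <= 2 * \<bar>ln (t / 2)\<bar>" unfolding l2 using ln1 ln0 by auto
    moreover have "exp ((1 - n / 2) * ln (eta^2)) <= (t / 2)^2 / (t / 2) ^ CARD('n)"
    proof -
     have "(1 - n / 2) * ln (eta^2) <= 2 * ln (t / 2) - n * ln (t / 2)"
      unfolding l2 using mult_left_mono_neg[OF ln1, of "2 - n"] n2 by (simp add: algebra_simps)
     hence "exp ((1 - n / 2) * ln (eta^2)) <= exp (2 * ln (t / 2) - n * ln (t / 2))" by simp
     also have "exp (2 * ln (t / 2) - n * ln (t / 2)) = (t / 2)^2 / (t / 2) ^ CARD('n)"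
      using h exp_of_nat_mult[of 2 "ln (t / 2)"] exp_of_nat_mult[of "CARD('n)" "ln (t / 2)"] by (simp add: exp_diff n_def)
     finally show ?thesis .
    qed
    ultimately show ?thesis unfolding w_eq L_def by (intro mult_mono) auto
   qed
   have wK: "0 <= K * w" using K w0 by simp
   have V: "norm (V X l s k q []) <= K * w" "norm (V X l s k q [p]) <= K * (w / eta)"
    "norm (V X l s k q [p] - V0 X l s k q [p]) <= K * w" for s k p
    using K(2)[OF el nX1, of "[]" s k q] K(2)[OF el nX1, of "[p]" s k q] K(3)[OF el nX1, of "[p]" s k q] W1 e0
    by (simp_all add: w_def[symmetric] nX)
   have nY: "norm (y - x) <= eta" by (simp add: eta_def)
   have a1: "norm (?K [] s k y * SU y s k) <= K * w * (n * (eta * (Csg * (b + b))))" for s k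
    unfolding norm_mult SU_def KVX n_def by (intro mult_mono V norm_moment_le norm_sg_le rb yr nY wK) auto
   have a2: "norm ((UU s k y - UU s k x) * SV y s k) <= b * eta * (n * (eta * (Csg * (K * w + K * (w / eta)))))" for s k
    unfolding norm_mult SV_def KVX n_def using rb(7)[OF yr, of s k] rb(4) e0
    by (intro mult_mono norm_moment_le norm_sg_le V nY) (auto simp: eta_def)
   have a3: "norm (UU s k x * (SV y s k - S0 y s k)) <= b * (n * (eta * (Csg * (K * w + K * w))))" for s k
   proof -
    have "SV y s k - S0 y s k = (\<Oplus>p. of_real ((y - x) $ p) * sg s k p (%s k. V X l s k q []) (%s k p. V X l s k q [p] - V0 X l s k q [p]))"
     unfolding SV_def S0_def KVX sum_subtractf[symmetric] right_diff_distrib[symmetric] sg_diff by (simp add: X_def l_def eta_def)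
    thus ?thesis unfolding norm_mult n_def using rb(4)
     by (simp only:) (intro mult_mono norm_moment_le norm_sg_le V nY rb(5)[OF xr]; simp)
   qed
   have trm: "norm (?E y s k) <= 6 * n * K * b * Csg * (w * eta)" for s k
   proof -
    \<comment> \<open>Three errors: the kernel multiplied by the stress of U, the increment of U
      against the stress of the kernel, and U(x) against the difference between the stresses of V
      and of \<open>V0\<close>.\<close>
    have e: "?E y s k
     = ?K [] s k y * SU y s k - (UU s k y - UU s k x) * SV y s k - UU s k x * (SV y s k - S0 y s k)"
     by (simp add: algebra_simps)
    define P where "P = n * K * b * Csg * (w * eta)"
    have P0: "P >= 0" using n2 K(1) rb(4) Csg_ge_1 w0 e0 by (simp add: P_def)
    have 1: "K * w * (n * (eta * (Csg * (b + b)))) = 2 * P" by (simp add: P_def algebra_simps)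
    have 2: "b * eta * (n * (eta * (Csg * (K * w + K * (w / eta))))) = P * eta + P" using e0 by (simp add: P_def field_simps)
    have 3: "b * (n * (eta * (Csg * (K * w + K * w)))) = 2 * P" by (simp add: P_def algebra_simps)
    have "P * eta <= P" using P0 e1 t1 by (intro mult_left_le) auto
    thus ?thesis unfolding e
     using norm_triangle_le_diff[OF order_refl, of "?K [] s k y * SU y s k - (UU s k y - UU s k x) * SV y s k" "UU s k x * (SV y s k - S0 y s k)"]
      norm_triangle_le_diff[OF order_refl, of "?K [] s k y * SU y s k" "(UU s k y - UU s k x) * SV y s k"]
      a1[of s k] a2[of s k] a3[of s k] unfolding 1 2 3 by (simp add: P_def)
   qed
   have "norm (?F y - Mn y) = \<bar>sh y\<bar> * norm (\<Oplus>s k. ?E y s k)"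
    unfolding T Mn_def right_diff_distrib[symmetric] sum_subtractf[symmetric] by (simp add: norm_mult)
   also have "... <= 2 * B / t^2 * (c1 * (L * t))"
   proof (intro mult_mono)
    show "\<bar>sh y\<bar> <= 2 * B / t^2" unfolding sh_def shell_def abs_mult abs_divide using B(2) t by (simp add: divide_right_mono)
    have "norm (\<Oplus>s k. ?E y s k)
     <= (\<Sum>s\<in>(UNIV::bool set). \<Sum>k\<in>(UNIV::'n set). 6 * n * K * b * Csg * (w * eta))" by (intro sum_norm_le trm)
    also have "... = c1 * (w * eta)" by (simp add: c1_def n_def)
    also have "... <= c1 * (L * t)" using c10 wL L0 e1 e0 by (intro mult_left_mono mult_mono) auto
    finally show "norm (\<Oplus>s k. ?E y s k) <= c1 * (L * t)" .
   qed (use B in auto)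
   also have "... = M * indicator (cball x t) y" using e1 by (simp add: M_def eta_def dist_norm norm_minus_commute)
   finally show ?thesis .
  qed
  have diff: "norm ((LI y. ?F y) - (LI y. Mn y)) <= M * measure lborel (cball x t)"
  proof -
   have "norm (LI y. ?F y - Mn y) <= M * measure lborel (cball x t)"
    by (rule norm_integral_le_measure[OF _ bound M0]) (intro Bochner_Integration.integrable_diff Ti Mi)
   thus ?thesis using Ti Mi by simp
  qed
  \<comment> \<open>The volume t^n of the ball cancels the singularity of the kernel; t times a
    logarithm is left.\<close>
  have "M * measure lborel (cball x t) <= c * sqrt t"
  proof -
   have mb: "measure lborel (cball x t) = unit_ball_vol n * t ^ CARD('n)"
    using content_cball[of t x] t by (simp add: n_def)
   define h where "h = t / 2"
   have h: "0 < h" "h <= 1" using t t1 by (auto simp: h_def)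
   have te: "t = 2 * h" by (simp add: h_def)
   have "M * measure lborel (cball x t) = 2 * B * c1 * (unit_ball_vol n * 2 ^ CARD('n)) * (h / 2 * (1 + 2 * \<bar>ln h\<bar>))"
    unfolding M_def mb L_def unfolding te using h by (simp add: power_mult_distrib power2_eq_square field_simps)
   also have "... <= 2 * B * c1 * (unit_ball_vol n * 2 ^ CARD('n)) * (12 * sqrt t)"
   proof (intro mult_left_mono)
    have "h / 2 * (1 + 2 * a) <= 2 * (h * (1 + a))" if "a >= 0" for a using h that by (simp add: algebra_simps)
    hence "h / 2 * (1 + 2 * \<bar>ln h\<bar>) <= 2 * (h * (1 + \<bar>ln h\<bar>))" by simp
    also have "... <= 2 * (3 * sqrt h)" using ln_bound_sqrt[OF h] by simp
    also have "... <= 12 * sqrt t"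
    proof -
     have "sqrt h <= sqrt t" "0 <= sqrt h" using h by (simp_all add: te)
     thus ?thesis by linarith
    qed
    finally show "h / 2 * (1 + 2 * \<bar>ln h\<bar>) <= 12 * sqrt t" .
    show "0 <= 2 * B * c1 * (unit_ball_vol n * 2 ^ CARD('n))" using B c10 n2 by (simp add: unit_ball_vol_nonneg)
   qed
   finally show ?thesis by (simp add: c_def)
  qed
  moreover have "cQ * norm (UU s0 i x) <= norm (LI y. Mn y)"
   unfolding MI norm_mult sh_def shell_moment[OF t(1)] by (simp add: mult.commute)
  ultimately show "cQ * norm (UU (fst q) (snd q) x) <= norm (LI y. ?F y) + c * sqrt t"
   using diff norm_triangle_sub[of "LI y. Mn y" "LI y. ?F y"]
   by (simp add: q norm_minus_commute)
 qed
qed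

text \<open>The left side does not depend on t, and the integral over the shell equals that of the
  given cutoff for all small t; so t tends to 0.\<close>

lemma cutoff_representation:
 assumes x: "x : D" and card: "CARD('n) >= 2"
  and c: "cutoff C ct d" "C \<subseteq> D" and r: "r > 0" "!!y. y : ball x r ==> ct y = 1 & d y = 0"
 shows "cQ * norm (UU (fst q) (snd q) x) <= norm (LI y. Fr x q (d y) y)"
proof -
 obtain e r0 where e: "0 < r0" "r0 <= 1" "cball x r0 \<subseteq> D" "!!t q. 0 < t ==> t <= r0 ==>
  cQ * norm (UU (fst q) (snd q) x) <= norm (LI y. Fr x q (bump' x t y) y) + e * sqrt t"
  by (rule bump_integral_error[OF x card]) blast
 have ev: "eventually (%t. 0 < t & t <= min r r0) (at_right (0::real))"
  unfolding eventually_at_right_field using e r by (intro exI[of _ "min r r0"]) auto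
 show ?thesis
 proof (rule tendsto_lowerbound)
  show "((%t. norm (LI y. Fr x q (d y) y) + e * sqrt t) \<longlongrightarrow> norm (LI y. Fr x q (d y) y)) (at_right 0)"
   by (auto intro!: tendsto_eq_intros)
  show "\<forall>\<^sub>F t in at_right 0. cQ * norm (UU (fst q) (snd q) x) <= norm (LI y. Fr x q (d y) y) + e * sqrt t"
   using ev
  proof eventually_elim
   case (elim t)
   hence "cball x t \<subseteq> D" using e(3) by (auto intro: subset_trans[OF _ e(3)])
   thus ?case using e(4)[of t q] cutoff_integral_Fr_eq[OF c r, where t = t and q = q] elim by simp
  qed
 qed simp
qed

end

section \<open>Boundary layers and Hausdorff measure\<close>

text \<open>A set of diameter d <= ta, swept by ta along an axis, lies in a box of height at most 4
  ta and width 2 d. As (2 d)^(n-1) = 4^(n-1) (d / 2)^(n-1), division by the ball volume turns this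
  into the Hausdorff weight.\<close>

definition sweep_const :: "nat => real" where
 "sweep_const n = 4 * 4 ^ (n - 1) / unit_ball_vol (real (n - 1))"

lemma sweep_const_pos: "sweep_const n > 0"
 unfolding sweep_const_def by (simp add: unit_ball_vol_pos)

text \<open>Sweeping any admissible cover of A by sets of diameter at most ta covers T by boxes,
  each of volume at most the constant times ta times the weight of its set. Volume near the boundary
  is thus controlled by Hausdorff measure without a parametrisation.\<close>

lemma emeasure_sweep_le:
 fixes A T :: "(real^'n::finite) set"
 assumes ta: "ta > 0" and n: "CARD('n) >= 2" and T: "T : sets lborel"
  and sw: "!!z. z : T ==> EX y:A. EX s. \<bar>s\<bar> <= ta & z = y + s *\<^sub>R axis k 1"
 shows "emeasure lborel T <= ennreal (sweep_const CARD('n) * ta) * hcod A"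
proof -
 define N where "N = CARD('n) - 1"
 define c where "c = sweep_const CARD('n) * ta"
 have c0: "c > 0" unfolding c_def using ta sweep_const_pos by simp
 have "ennreal (1 / c) * emeasure lborel T <= hausdorff_pre N ta A"
  unfolding hausdorff_pre_def
 proof (rule INF_greatest)
  fix B :: "nat => (real^'n) set"
  assume "B : {B. A \<subseteq> (\<Union>i. B i) & (ALL i. bounded (B i) & diameter (B i) <= ta)}"
  hence B: "A \<subseteq> (\<Union>i. B i)" "!!i. bounded (B i)" "!!i. diameter (B i) <= ta" by auto
  define d where "d i = diameter (B i)" for i
  have d0: "d i >= 0" for i unfolding d_def by (rule diameter_ge_0[OF B(2)])
  define b where "b i = (SOME y. y : B i)" for i
  define v where "v i = (\<chi> j. if j = k then d i + ta else d i)" for i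
  define Q where "Q i = (if B i = {} then {} else cbox (b i - v i) (b i + v i))" for i
  have b: "b i : B i" if "B i ~= {}" for i unfolding b_def using that some_in_eq by blast
  have TQ: "T \<subseteq> (\<Union>i. Q i)"
  proof
   fix z assume "z : T"
   then obtain y s where y: "y : A" "\<bar>s\<bar> <= ta" "z = y + s *\<^sub>R axis k 1" using sw by blast
   then obtain i where i: "y : B i" using B by auto
   hence bi: "b i : B i" using b by blast
   have "norm (y - b i) <= d i" unfolding d_def using diameter_bounded_bound[OF B(2) i bi] by (simp add: dist_norm)
   hence c: "\<bar>y $ j - b i $ j\<bar> <= d i" for j using component_le_norm_cart[of "y - b i" j] by simp
   have "z : cbox (b i - v i) (b i + v i)"
    unfolding mem_box_cart
   proof
    fix j
    show "(b i - v i) $ j <= z $ j & z $ j <= (b i + v i) $ j"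
     using c[of j] y(2) by (cases "j = k") (auto simp: y(3) v_def axis_def)
   qed
   thus "z : (\<Union>i. Q i)" using i by (auto simp: Q_def)
  qed
  have vol: "emeasure lborel (Q i) <= ennreal c * hausdorff_weight N (B i)" for i
  proof (cases "B i = {}")
   case False
   have "measure lborel (cbox (b i - v i) (b i + v i)) = (\<Prod>j\<in>UNIV. 2 * v i $ j)"
   proof -
    have "ALL j. (b i - v i) $ j <= (b i + v i) $ j" using d0[of i] ta by (auto simp: v_def)
    hence "cbox (b i - v i) (b i + v i) ~= {}" by (simp add: interval_ne_empty_cart)
    from content_cbox_cart[OF this] show ?thesis by (simp add: algebra_simps)
   qed
   also have "... = 2 * (d i + ta) * (2 * d i) ^ N"
   proof -
    have "(\<Prod>j\<in>UNIV. 2 * v i $ j) = (2 * v i $ k) * (\<Prod>j\<in>UNIV - {k}. 2 * v i $ j)" by (rule prod.remove) auto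
    also have "(\<Prod>j\<in>UNIV - {k}. 2 * v i $ j) = (\<Prod>j\<in>UNIV - {k}. 2 * d i)" by (intro prod.cong) (auto simp: v_def)
    finally show ?thesis by (simp add: v_def N_def)
   qed
   also have "... <= 2 * (ta + ta) * (2 * d i) ^ N" using B(3)[of i] d0[of i] by (intro mult_mono) (auto simp: d_def)
   also have "... = c * (unit_ball_vol (real N) * (d i / 2) ^ N)"
   proof -
    have "(2 * d i) ^ N = 4 ^ N * (d i / 2) ^ N" by (subst power_mult_distrib[symmetric]) simp
    moreover have "unit_ball_vol (real N) ~= 0" using unit_ball_vol_pos[of "real N"] by linarith
    ultimately show ?thesis by (simp add: c_def sweep_const_def N_def)
   qed
   finally show ?thesis using False c0
    by (simp add: Q_def hausdorff_weight_def d_def emeasure_eq_measure2 ennreal_mult[symmetric] unit_ball_vol_nonneg d0[unfolded d_def] ennreal_leI)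
  qed (simp add: Q_def)
  have "emeasure lborel T <= emeasure lborel (\<Union>i. Q i)" using TQ by (intro emeasure_mono) (auto simp: Q_def)
  also have "... <= (\<Sum>i. emeasure lborel (Q i))" by (intro emeasure_subadditive_countably) (auto simp: Q_def)
  also have "... <= (\<Sum>i. ennreal c * hausdorff_weight N (B i))" by (intro suminf_le vol) auto
  also have "... = ennreal c * (\<Sum>i. hausdorff_weight N (B i))" by simp
  finally have "ennreal (1 / c) * emeasure lborel T <= ennreal (1 / c) * (ennreal c * (\<Sum>i. hausdorff_weight N (B i)))"
   by (rule mult_left_mono) simp
  thus "ennreal (1 / c) * emeasure lborel T <= (\<Sum>i. hausdorff_weight N (B i))"
   using c0 by (simp add: mult.assoc[symmetric] ennreal_mult[symmetric])
 qed
 also have "... <= hausdorff_outer N A" by (rule hausdorff_pre_le_outer[OF ta])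
 finally have "ennreal c * (ennreal (1 / c) * emeasure lborel T) <= ennreal c * hausdorff_outer N A" by (rule mult_left_mono) simp
 moreover have "ennreal c * (ennreal (1 / c) * emeasure lborel T) = emeasure lborel T"
  using c0 by (simp add: mult.assoc[symmetric] ennreal_mult[symmetric])
 ultimately show ?thesis by (simp add: c_def N_def)
qed

definition grd :: "(real^'n::finite => real) => (real^'n => real^'n) => bool" where
 "grd f d \<longleftrightarrow> continuous_on UNIV f & continuous_on UNIV d \<and>
  (ALL y p. ((%t. f (y + t *\<^sub>R axis p 1)) has_real_derivative d y $ p) (at 0))"

lemma grd_const: "grd (%y. c) (%y. 0)"
 by (simp add: grd_def)

lemma grd_bump: "r > 0 ==> grd (bump x r) (bump' x r)"
 using cutoff_bump[of r x] by (simp add: cutoff_def grd_def)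

lemma grd_diff: "grd f d ==> grd g e ==> grd (%y. f y - g y) (%y. d y - e y)"
 unfolding grd_def by (auto intro!: continuous_intros derivative_eq_intros)

lemma grd_mult: "grd f d ==> grd g e ==> grd (%y. f y * g y) (%y. f y *\<^sub>R e y + g y *\<^sub>R d y)"
 unfolding grd_def by (auto intro!: continuous_intros derivative_eq_intros)

lemma grd_sum: "finite J ==> (!!j. j : J ==> grd (f j) (d j)) ==> grd (%y. \<Sum>j\<in>J. f j y) (%y. \<Sum>j\<in>J. d j y)"
 unfolding grd_def by (auto intro!: continuous_intros DERIV_sum)

lemma grd_zero_extension:
 assumes Om: "open Om" and C: "closed C" "C \<subseteq> Om" "!!x. x ~: C ==> f x = 0 & d x = 0"
  and f: "continuous_on Om f" "continuous_on Om d"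
  and d: "!!y p. y : Om ==> ((%t. f (y + t *\<^sub>R axis p 1)) has_real_derivative d y $ p) (at 0)"
 shows "grd f d"
 unfolding grd_def
proof (intro conjI allI)
 show "continuous_on UNIV f" by (rule continuous_on_zero_extension[OF f(1) Om C(1,2)]) (use C(3) in auto)
 show "continuous_on UNIV d" by (rule continuous_on_zero_extension[OF f(2) Om C(1,2)]) (use C(3) in auto)
 fix y p
 show "((%t. f (y + t *\<^sub>R axis p 1)) has_real_derivative d y $ p) (at 0)"
 proof (cases "y : Om")
  case False
  hence y: "y ~: C" using C by auto
  have "((%t. f (y + t *\<^sub>R axis p 1)) has_real_derivative 0) (at 0)"
  proof (rule has_field_derivative_transform_within_open[OF DERIV_const[of 0]])
   show "open ((%t::real. y + t *\<^sub>R axis p 1) -` (- C))" using C by (intro open_vimage continuous_intros) auto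
  qed (use C y in auto)
  thus ?thesis using C y by simp
 qed (use d in auto)
qed

section \<open>Boundary charts and thin layers\<close>

definition grad :: "(real^'n::finite => real) => real^'n => real^'n" where
 "grad ph z = (\<chi> p. partial p ph z)"

lemma continuous_on_grad: "C1_on W ph ==> continuous_on W (grad ph)"
 unfolding grad_def[abs_def] by (rule continuous_on_vec_lambda) (simp add: C1_on_def)

text \<open>k is a direction in which the defining function is strictly monotone, \<open>si\<close>
  the sign and m a lower bound of that derivative. The gradient is at most 4 n m, so the ratio of
  the two depends on the dimension alone. The doubled cube leaves room to move out of the inner one
  up to the boundary.\<close>

definition chart :: "(real^'n::finite) set => (real^'n) set => (real^'n => real) => real^'n => real => 'n => real => real => bool" where
 "chart D W ph y r k si m \<longleftrightarrow> open W & cube y (2 * r) \<subseteq> W & C1_on W ph & D Int W = {z : W. ph z < 0} \<and>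
  r > 0 & m > 0 & \<bar>si\<bar> = 1 & (ALL z:cube y (2 * r). m <= si * partial k ph z & norm (grad ph z) <= 4 * real CARD('n) * m)"

lemma chart_exists:
 fixes y :: "real^'n::finite"
 assumes W: "open W" "y : W" "C1_on W ph" "D Int W = {z : W. ph z < 0}" "partial k0 ph y ~= 0"
  and V: "open V" "y : V"
 obtains r k si m where "chart D (W Int V) ph y r k si m"
proof -
 obtain k where k: "!!p. \<bar>partial p ph y\<bar> <= \<bar>partial k ph y\<bar>"
 proof -
  have "Max (range (%p. \<bar>partial p ph y\<bar>)) : range (%p. \<bar>partial p ph y\<bar>)" by (rule Max_in) auto
  then obtain k where k: "Max (range (%p. \<bar>partial p ph y\<bar>)) = \<bar>partial k ph y\<bar>" by (rule imageE)
  show thesis by (rule that[of k]) (unfold k[symmetric], rule Max_ge, auto)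
 qed
 \<comment> \<open>Half of the largest partial derivative. At y the gradient then has norm at most 2
   n m, strictly below 4 n m, so both bounds persist nearby.\<close>
 define m where "m = \<bar>partial k ph y\<bar> / 2"
 define si where "si = sgn (partial k ph y)"
 have pk: "partial k ph y ~= 0" using k[of k0] W(5) by auto
 have m0: "m > 0" using pk by (simp add: m_def)
 have sm: "si * partial k ph y = 2 * m" by (simp add: si_def m_def mult.commute[of "sgn _"] mult_sgn_abs abs_sgn[symmetric])
 define U where "U = {z : W Int V. m < si * partial k ph z} Int {z : W Int V. norm (grad ph z) < 4 * real CARD('n) * m}"
 have cs: "continuous_on (W Int V) (%z. si * partial k ph z)" "continuous_on (W Int V) (%z. norm (grad ph z))"
  using W(3) continuous_on_grad[OF W(3)] by (auto simp: C1_on_def intro!: continuous_intros intro: continuous_on_subset)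
 have "openin (top_of_set (W Int V)) {z : W Int V. m < si * partial k ph z}"
  using continuous_openin_preimage_gen[OF cs(1), of "{m<..}"] by (simp add: vimage_def Int_def)
 moreover have "openin (top_of_set (W Int V)) {z : W Int V. norm (grad ph z) < 4 * real CARD('n) * m}"
  using continuous_openin_preimage_gen[OF cs(2), of "{..<4 * real CARD('n) * m}"] by (simp add: vimage_def Int_def)
 ultimately have "open U" unfolding U_def using W V openin_open_trans by (intro open_Int) blast+
 moreover have "y : U"
 proof -
  have "norm (grad ph y) <= (\<Oplus>p. \<bar>grad ph y $ p\<bar>)" by (rule norm_le_l1_cart)
  also have "... <= (\<Sum>p\<in>(UNIV::'n set). 2 * m)" using k by (intro sum_mono) (auto simp: grad_def m_def)
  also have "... < 4 * real CARD('n) * m" using m0 by simp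
  finally show ?thesis using W V m0 sm by (auto simp: U_def)
 qed
 ultimately obtain r where r: "r > 0" "cube y r \<subseteq> U" using open_contains_cube by metis
 show thesis
 proof (rule that[of "r / 2" k si m])
  have "C1_on (W Int V) ph" using W(3) by (auto simp: C1_on_def intro: continuous_on_subset)
  thus "chart D (W Int V) ph y (r / 2) k si m"
   unfolding chart_def
  proof (intro conjI ballI)
   fix z assume "z : cube y (2 * (r / 2))"
   hence "z : U" using r by auto
   thus "m <= si * partial k ph z" "norm (grad ph z) <= 4 * real CARD('n) * m" by (auto simp: U_def)
  next
   show "cube y (2 * (r / 2)) \<subseteq> W Int V" using r by (auto simp: U_def)
   show "D Int (W Int V) = {z : W Int V. ph z < 0}" using W by blast
  qed (use W V r m0 pk in \<open>auto simp: si_def abs_sgn_eq\<close>)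
 qed
qed

lemma chart_closure:
 assumes ch: "chart D W ph y r k si m" and z: "z : W"
 shows "z : closure D ==> ph z <= 0" and "open D ==> z : frontier D ==> ph z = 0"
proof -
 have W: "open W" "D Int W = {z : W. ph z < 0}" and c: "continuous_on W ph"
  using ch C1_on_imp_continuous_on[of W ph] by (auto simp: chart_def)
 show le: "ph z <= 0" if "z : closure D"
 proof (rule ccontr)
  assume "~ ph z <= 0"
  have "openin (top_of_set W) (W Int ph -` {0<..})" by (rule continuous_openin_preimage_gen[OF c]) simp
  hence "open (W Int ph -` {0<..})" using W openin_open_trans by blast
  moreover have "z : W Int ph -` {0<..}" using \<open>~ ph z <= 0\<close> z by auto
  moreover have "(W Int ph -` {0<..}) Int D = {}" using W by force
  ultimately show False using that open_Int_closure_eq_empty by blast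
 qed
 show "ph z = 0" if "open D" "z : frontier D"
 proof -
  have "z : closure D" "z ~: D" using that by (auto simp: frontier_def interior_open)
  thus ?thesis using le W z by force
 qed
qed

text \<open>Moving along axis k with sign \<open>si\<close> raises ph at a rate of at least m, so
  from a point of the layer of depth h the level 0 is met within h / m. Just before the crossing the
  path lies in D, at it outside, so the crossing belongs to the frontier.\<close>

lemma chart_hit:
 assumes ch: "chart D W ph y r k si m" and D: "open D" and z: "z : D" "z : cube y r" "- h < ph z" and h: "0 < h" "h <= m * r"
 shows "EX x:frontier D Int cube y (2 * r). EX s. \<bar>s\<bar> <= h / m & z = x + s *\<^sub>R axis k 1"
proof -
 have W: "open W" "cube y (2 * r) \<subseteq> W" "C1_on W ph" "D Int W = {z : W. ph z < 0}" and r: "r > 0" "m > 0" "\<bar>si\<bar> = 1"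
  and m: "!!z. z : cube y (2 * r) ==> m <= si * partial k ph z" using ch by (auto simp: chart_def)
 have c: "continuous_on W ph" by (rule C1_on_imp_continuous_on[OF W(1,3)])
 define p where "p t = z + (t * si) *\<^sub>R axis k 1" for t
 have hr: "h / m <= r" using h r by (simp add: field_simps)
 have pc: "p t : cube y (2 * r)" if "0 <= t" "t <= h / m" for t
 proof -
  have "\<bar>z $ i - y $ i\<bar> <= r" for i using z by (auto simp: cube_def)
  moreover have "\<bar>(t * si) * axis k 1 $ i\<bar> <= r" for i using that hr r by (auto simp: axis_def abs_mult)
  ultimately have "\<bar>(z $ i - y $ i) + (t * si) * axis k 1 $ i\<bar> <= r + r" for i
   by (intro order_trans[OF abs_triangle_ineq] add_mono)
  thus ?thesis by (simp add: cube_def p_def algebra_simps)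
 qed
 have inc: "ph (p t) + m * (s - t) <= ph (p s)" if ts: "0 <= t" "t <= s" "s <= h / m" for t s
 proof -
  have e: "p t + u *\<^sub>R axis k 1 = p (t + u * si)" for u
  proof -
   have "si * si = 1" using r(3) by (metis abs_mult_self_eq mult_1)
   hence "(t + u * si) * si = t * si + u" by (simp add: distrib_right mult.assoc)
   thus ?thesis by (simp add: p_def scaleR_add_left)
  qed
  have seg: "0 <= t + u * si & t + u * si <= h / m" if us: "u : closed_segment 0 ((s - t) * si)" for u
  proof -
   obtain v where v: "0 <= v" "v <= 1" "u = v * ((s - t) * si)" using us unfolding closed_segment_def by force
   have "si * si = 1" using r(3) by (metis abs_mult_self_eq mult_1)
   hence "u * si = v * (s - t)" by (simp add: v(3) mult.assoc)
   moreover have "v * (s - t) <= s - t" using v ts by (intro mult_left_le_one_le) auto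
   moreover have "0 <= v * (s - t)" using v ts by simp
   ultimately show ?thesis using ts by auto
  qed
  obtain u where u: "u : closed_segment 0 ((s - t) * si)"
   "ph (p t + ((s - t) * si) *\<^sub>R axis k 1) - ph (p t) = ((s - t) * si) * partial k ph (p t + u *\<^sub>R axis k 1)"
  proof (rule partial_mvt[of "(s - t) * si" k ph "p t"])
   fix u assume "u : closed_segment 0 ((s - t) * si)"
   hence "p (t + u * si) : W" using seg[of u] pc W(2) by blast
   thus "partial_differentiable k ph (p t + u *\<^sub>R axis k 1)"
    unfolding e using W(3) by (simp add: C1_on_def)
  qed blast
  have "p t + ((s - t) * si) *\<^sub>R axis k 1 = p s"
  proof -
   have "si * si = 1" using r(3) by (metis abs_mult_self_eq mult_1)
   thus ?thesis unfolding e by (simp add: mult.assoc)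
  qed
  hence "ph (p s) - ph (p t) = (s - t) * (si * partial k ph (p t + u *\<^sub>R axis k 1))" using u(2) by (simp add: mult.assoc)
  also have "... >= (s - t) * m" using ts seg[OF u(1)] by (intro mult_left_mono m) (auto simp: e intro!: pc)
  finally show ?thesis by (simp add: algebra_simps)
 qed
 have pz: "p 0 = z" by (simp add: p_def)
 have zW: "z : W" using pc[of 0] h r W by (auto simp: pz)
 have neg: "ph (p 0) < 0" using z(1) zW W(4) pz by auto
 have hm: "0 <= h / m" using h r by simp
 have "0 <= ph (p (h / m))" using inc[of 0 "h / m"] hm z(3) r by (simp add: pz)
 moreover have "continuous_on {0..h / m} (%t. ph (p t))"
  using pc W by (intro continuous_on_compose2[OF c]) (auto simp: p_def intro!: continuous_intros)
 ultimately obtain t where t: "0 <= t" "t <= h / m" "ph (p t) = 0"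
  using IVT'[of "%t. ph (p t)" 0 0 "h / m"] neg hm by auto
 have t0: "t > 0" using t neg by (cases "t = 0") auto
 have ptW: "p t : W" using pc[OF t(1,2)] W by auto
 have "p t ~: D"
 proof
  assume "p t : D"
  hence "p t : {z : W. ph z < 0}" using ptW W(4) by blast
  thus False using t(3) by simp
 qed
 moreover have "p t : closure D"
  unfolding closure_approachable
 proof (intro allI impI)
  fix e :: real assume e: "e > 0"
  define s where "s = max 0 (t - e / 2)"
  have s: "0 <= s" "s < t" "t - s < e" using t0 e by (auto simp: s_def)
  hence "ph (p s) < 0" using inc[of s t] t r mult_pos_pos[of m "t - s"] by linarith
  moreover have "p s : W" using pc[of s] s t W by auto
  ultimately have "p s : D" using W(4) by blast
  moreover have "dist (p s) (p t) < e"
  proof -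
   have "p s - p t = ((s - t) * si) *\<^sub>R axis k 1" by (simp add: p_def algebra_simps)
   thus ?thesis using s r by (simp add: dist_norm abs_mult)
  qed
  ultimately show "EX y:D. dist y (p t) < e" by blast
 qed
 ultimately have "p t : frontier D" using D by (simp add: frontier_def interior_open)
 moreover have "z = p t + (- t * si) *\<^sub>R axis k 1" by (simp add: p_def)
 moreover have "\<bar>- t * si\<bar> <= h / m" using t r by (simp add: abs_mult)
 ultimately show ?thesis using pc[OF t(1,2)] by blast
qed

text \<open>Discrete layer cake: the number of levels l e below v, times e, exceeds v by at most
  e.\<close>

lemma layer_cake_sum:
 fixes e v :: real
 assumes "0 < e" "0 <= v"
 shows "ennreal v <= (\<Sum>l. ennreal e * (if real l * e < v then 1 else 0))"
  and "(\<Sum>l. ennreal e * (if real l * e < v then 1 else 0)) <= ennreal (v + e)"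
proof -
 define N where "N = nat \<lceil>v / e\<rceil>"
 have l: "real l * e < v \<longleftrightarrow> l < N" for l
 proof -
  have "l < N \<longleftrightarrow> int l < \<lceil>v / e\<rceil>" by (simp add: N_def zless_nat_eq_int_zless)
  thus ?thesis using assms by (simp add: less_ceiling_iff pos_less_divide_eq)
 qed
 have "(\<Sum>l. ennreal e * (if l < N then 1 else 0)) = (\<Sum>l<N. ennreal e * (if l < N then 1 else 0))"
  by (rule suminf_finite) auto
 also have "... = ennreal (real N * e)" using assms by (simp add: ennreal_mult ennreal_of_nat_eq_real_of_nat)
 finally have s: "(\<Sum>l. ennreal e * (if real l * e < v then 1 else 0)) = ennreal (real N * e)" unfolding l .
 have "0 <= v / e" using assms by simp
 hence "v / e <= real N" "real N <= v / e + 1" unfolding N_def by linarith+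
 hence "v <= real N * e" "real N * e <= v + e" using assms by (simp_all add: field_simps)
 thus "ennreal v <= (\<Sum>l. ennreal e * (if real l * e < v then 1 else 0))"
  "(\<Sum>l. ennreal e * (if real l * e < v then 1 else 0)) <= ennreal (v + e)" unfolding s by (simp_all add: ennreal_leI)
qed

text \<open>By uniform continuity a superlevel set of g in the thin layer is swept out by a slightly
  lower superlevel set of g on the frontier. \<open>emeasure_sweep_le\<close> compares the two, and
  summing over levels compares the integrals. The inequality is one-sided, with a dimensional
  constant.\<close>

lemma layer_integral:
 fixes D :: "(real^'n::finite) set"
 assumes ch: "chart D W ph y r k si m" and D: "open D" "bounded D" and n: "CARD('n) >= 2"
  and fin: "emeasure (hausdorff_measure (CARD('n) - 1)) (frontier D) < \<infinity>"
  and g: "continuous_on (closure D Int cube y (2 * r)) g" "!!z. z : closure D Int cube y (2 * r) ==> 0 <= g z"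
  and ep: "ep > 0"
 defines "A \<equiv> frontier D Int cube y (2 * r)" and "Z \<equiv> %h. {z : D Int cube y r. - h < ph z}"
 shows "eventually (%h. Z h : sets lborel & (LI z. indicator (Z h) z * g z)
  <= h * (sweep_const CARD('n) / m * (LINT z|hausdorff_measure (CARD('n) - 1). indicator A z * g z) + ep)) (at_right 0)"
proof -
 define H :: "(real^'n) measure" where "H = hausdorff_measure (CARD('n) - 1)"
 define sc where "sc = sweep_const CARD('n)"
 have sc0: "sc > 0" by (simp add: sc_def sweep_const_pos)
 define K where "K = closure D Int cube y (2 * r)"
 have K: "compact K" unfolding K_def using D by (intro compact_Int_closed) (auto simp: compact_cube compact_imp_closed)
 have r: "r > 0" "m > 0" and W: "open W" "cube y (2 * r) \<subseteq> W" "continuous_on W ph"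
  using ch C1_on_imp_continuous_on[of W ph] by (auto simp: chart_def)
 have gK: "continuous_on K g" and g0: "!!z. z : K ==> 0 <= g z" using g by (auto simp: K_def)
 have cr: "cube y r \<subseteq> cube y (2 * r)" using r by (intro cube_mono) auto
 have ccl: "closed (cube y s)" for s :: real and y :: "real^'n" by (rule compact_imp_closed[OF compact_cube])
 have Asub: "A \<subseteq> K" by (auto simp: A_def K_def frontier_def)
 have Ab: "A : sets borel" unfolding A_def by (intro sets.Int borel_closed frontier_closed ccl)
 have Hb: "sets H = sets borel" by (simp add: H_def)
 have HA: "emeasure H A < \<infinity>"
 proof -
  have "emeasure H A <= emeasure H (frontier D)" by (intro emeasure_mono) (auto simp: Hb A_def)
  thus ?thesis using fin by (simp add: H_def)
 qed
 define mu where "mu = measure H A"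
 have mu0: "mu >= 0" by (simp add: mu_def)
 \<comment> \<open>Chosen so that the oscillation and the level spacing together cost at most ep;
   the 1 guards against a frontier piece of measure zero.\<close>
 define e where "e = ep * m / (2 * sc * (mu + 1))"
 have e0: "e > 0" using ep r sc0 mu0 by (simp add: e_def)
 obtain d where d: "d > 0" "!!z z'. z : K ==> z' : K ==> dist z' z < d ==> dist (g z') (g z) < e"
  using compact_uniformly_continuous[OF gK K] e0 unfolding uniformly_continuous_on_def by metis
 have ZK: "Z h \<subseteq> K" for h using cr closure_subset[of D] by (auto simp: Z_def K_def)
 have Zb: "Z h : sets borel" for h
 proof -
  have "openin (top_of_set W) (W Int ph -` {- h<..})" by (rule continuous_openin_preimage_gen[OF W(3)]) simp
  hence "open (W Int ph -` {- h<..})" using W openin_open_trans by blast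
  moreover have "Z h = (W Int ph -` {- h<..}) Int D Int cube y r" using cr W by (auto simp: Z_def)
  ultimately show ?thesis using D ccl[of y r] by auto
 qed
 have meas: "(%z. indicator B z * g z) : borel_measurable borel" if "B : sets borel" "B \<subseteq> K" for B
  using borel_measurable_continuous_on_indicator[OF that(1) continuous_on_subset[OF gK that(2)]] by simp
 have iA: "integrable H (%z. indicator A z * a)" for a :: real
  using Ab HA by (intro integrable_mult_left integrable_real_indicator) (auto simp: Hb)
 obtain Gm where Gm: "!!z. z : K ==> g z <= Gm"
  using compact_imp_bounded[OF compact_continuous_image[OF gK K]] by (auto simp: bounded_iff) (metis abs_le_D1)
 have i4: "integrable H (%z. indicator A z * g z)"
  by (rule Bochner_Integration.integrable_bound[OF iA[of Gm]])
   (use meas[OF Ab Asub] g0 Gm Asub in \<open>auto simp: indicator_def measurable_cong_sets[OF Hb refl] intro!: AE_I2, force\<close>)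
 have IA: "0 <= (LINT z|H. indicator A z * g z)" using g0 Asub by (intro integral_nonneg_AE AE_I2) (auto simp: indicator_def)
 define B where "B l = {x : A. real l * e - e < g x}" for l :: nat
 have Bb: "B l : sets borel" for l
 proof -
  have "{x. real l * e - e < indicator A x * g x} : sets borel" using meas[OF Ab Asub] by measurable
  moreover have "B l = A Int {x. real l * e - e < indicator A x * g x}" by (auto simp: B_def)
  ultimately show ?thesis using Ab by auto
 qed
 have main: "(LI z. indicator (Z h) z * g z) <= h * (sc / m * (LINT z|H. indicator A z * g z) + ep)"
  if h: "0 < h" "h <= m * r" "h < d * m" for h
 proof -
  define c where "c = sc * (h / m)"
  have c0: "c >= 0" using sc0 h r by (simp add: c_def)
  define T where "T l = {z : Z h. real l * e < g z}" for l :: nat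
  have Tb: "T l : sets borel" for l
  proof -
   have "{z. real l * e < indicator (Z h) z * g z} : sets borel" using meas[OF Zb ZK] by measurable
   moreover have "T l = Z h Int {z. real l * e < indicator (Z h) z * g z}" by (auto simp: T_def)
   ultimately show ?thesis using Zb by auto
  qed
  have TB: "emeasure lborel (T l) <= ennreal c * emeasure H (B l)" for l
  proof -
   have "emeasure lborel (T l) <= ennreal (sweep_const CARD('n) * (h / m)) * hcod (B l)"
   proof (rule emeasure_sweep_le[where k = k])
    fix z assume z: "z : T l"
    hence "z : D" "z : cube y r" "- h < ph z" by (auto simp: Z_def T_def)
    from chart_hit[OF ch D(1) this h(1,2)]
    obtain x s where x: "x : A" "\<bar>s\<bar> <= h / m" "z = x + s *\<^sub>R axis k 1" by (auto simp: A_def)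
    have "dist x z <= h / m" using x by (simp add: dist_norm)
    also have "... < d" using h r by (simp add: field_simps)
    finally have "dist (g x) (g z) < e" using z ZK[of h] Asub x(1) by (intro d(2)) (auto simp: T_def)
    hence "x : B l" using z x(1) by (auto simp: dist_real_def B_def T_def)
    thus "EX x:B l. EX s. \<bar>s\<bar> <= h / m & z = x + s *\<^sub>R axis k 1" using x by blast
   qed (use h r n Tb in auto)
   also have "hcod (B l) = emeasure H (B l)"
    using emeasure_hausdorff_measure[OF Bb, of "CARD('n) - 1"] by (simp add: H_def)
   finally show ?thesis by (simp add: c_def sc_def)
  qed
  have "(\<integral>\<^sup>+z. ennreal (indicator (Z h) z * g z) \<partial>lborel) <= (\<integral>\<^sup>+z. (\<Sum>l. ennreal e * indicator (T l) z) \<partial>lborel)"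
  proof (rule nn_integral_mono)
   fix z
   show "ennreal (indicator (Z h) z * g z) <= (\<Sum>l. ennreal e * indicator (T l) z)"
   proof (cases "z : Z h")
    case True
    hence "0 <= g z" using ZK g0 by blast
    moreover have "indicator (T l) z = (if real l * e < g z then 1 else 0 :: ennreal)" for l using True by (simp add: T_def)
    ultimately show ?thesis using layer_cake_sum(1)[OF e0] True by simp
   qed simp
  qed
  also have "... = (\<Sum>l. ennreal e * emeasure lborel (T l))"
   using Tb by (subst nn_integral_suminf) (auto simp: nn_integral_cmult_indicator)
  also have "... <= (\<Sum>l. ennreal c * (ennreal e * emeasure H (B l)))"
   using mult_left_mono[OF TB, of "ennreal e"] by (intro suminf_le summableI) (auto simp: mult_ac)
  also have "... = ennreal c * (\<integral>\<^sup>+x. (\<Sum>l. ennreal e * indicator (B l) x) \<partial>H)"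
   using Bb by (subst nn_integral_suminf) (auto simp: nn_integral_cmult_indicator Hb measurable_cong_sets[OF Hb refl])
  also have "(\<integral>\<^sup>+x. (\<Sum>l. ennreal e * indicator (B l) x) \<partial>H) <= (\<integral>\<^sup>+x. ennreal (indicator A x * g x + indicator A x * (2 * e)) \<partial>H)"
  proof (rule nn_integral_mono)
   fix x
   show "(\<Sum>l. ennreal e * indicator (B l) x) <= ennreal (indicator A x * g x + indicator A x * (2 * e))"
   proof (cases "x : A")
    case True
    hence "0 <= g x + e" using Asub g0 e0 by (intro add_nonneg_nonneg) auto
    moreover have "indicator (B l) x = (if real l * e < g x + e then 1 else 0 :: ennreal)" for l using True by (auto simp: B_def)
    ultimately show ?thesis using layer_cake_sum(2)[OF e0, of "g x + e"] True by (simp add: add.assoc)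
   qed (simp add: B_def)
  qed
  also have "... = ennreal (LINT x|H. indicator A x * g x + indicator A x * (2 * e))"
   by (rule nn_integral_eq_integral[OF Bochner_Integration.integrable_add[OF i4 iA]])
    (use g0 Asub e0 in \<open>auto simp: indicator_def intro!: AE_I2 add_nonneg_nonneg\<close>)
  also have "(LINT x|H. indicator A x * g x + indicator A x * (2 * e)) = (LINT z|H. indicator A z * g z) + 2 * e * mu"
   using sets_eq_imp_space_eq[OF Hb] by (subst Bochner_Integration.integral_add[OF i4 iA]) (simp add: mu_def)
  finally have "(\<integral>\<^sup>+z. ennreal (indicator (Z h) z * g z) \<partial>lborel) <= ennreal (c * ((LINT z|H. indicator A z * g z) + 2 * e * mu))"
   using c0 e0 mu0 IA by (simp add: ennreal_mult mult_left_mono)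
  hence "enn2real (\<integral>\<^sup>+z. ennreal (indicator (Z h) z * g z) \<partial>lborel) <= c * ((LINT z|H. indicator A z * g z) + 2 * e * mu)"
   using c0 e0 mu0 IA by (intro enn2real_leI) auto
  moreover have "(LI z. indicator (Z h) z * g z) = enn2real (\<integral>\<^sup>+z. ennreal (indicator (Z h) z * g z) \<partial>lborel)"
   using meas[OF Zb ZK] ZK g0 by (intro integral_eq_nn_integral AE_I2) (auto simp: indicator_def)
  ultimately have "(LI z. indicator (Z h) z * g z) <= h * (sc / m * (LINT z|H. indicator A z * g z) + 2 * e * mu * sc / m)"
   by (simp add: c_def algebra_simps)
  also have "... <= h * (sc / m * (LINT z|H. indicator A z * g z) + ep)"
  proof -
   have "2 * (ep * m / (2 * sc * b)) * mu * sc / m = ep * (mu / b)" if "b > 0" for b using r sc0 that by simp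
   from this[of "mu + 1"] have "2 * e * mu * sc / m = ep * (mu / (mu + 1))" using mu0 by (simp add: e_def)
   also have "... <= ep" using ep mu0 by (intro mult_left_le) auto
   finally show ?thesis using h by (intro mult_left_mono) auto
  qed
  finally show ?thesis .
 qed
 have "eventually (%h. 0 < h & h < min (m * r) (d * m)) (at_right (0::real))"
  unfolding eventually_at_right_field using d r by (intro exI[of _ "min (m * r) (d * m)"]) auto
 thus ?thesis
  by eventually_elim (use main Zb in \<open>auto simp: H_def sc_def\<close>)
qed

section \<open>Cutoffs that vanish near the edge\<close>

lemma grd_prod_one_minus:
 assumes "finite J" "!!j. j : J ==> grd (f j) (d j)" "!!j y. j : J ==> 0 <= f j y & f j y <= (1::real)"
 obtains e where "grd (%y. \<Prod>j\<in>J. 1 - f j y) e" "!!y. norm (e y) <= (\<Sum>j\<in>J. norm (d j y))"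
  "!!y. (!!j. j : J ==> d j y = 0) ==> e y = 0"
proof -
 have "EX e. grd (%y. \<Prod>j\<in>J. 1 - f j y) e & (ALL y. norm (e y) <= (\<Sum>j\<in>J. norm (d j y)))"
  using assms
 proof (induction J)
  case empty
  show ?case using grd_const[of 1] by (intro exI[of _ "%y. 0"]) auto
 next
  case (insert j J)
  then obtain e where e: "grd (%y. \<Prod>j\<in>J. 1 - f j y) e" "!!y. norm (e y) <= (\<Sum>j\<in>J. norm (d j y))" by auto
  have f1: "0 <= f j y" "f j y <= 1" for y using insert.prems(2)[of j y] by auto
  define P where "P y = (\<Prod>j\<in>J. 1 - f j y)" for y
  have P: "0 <= P y" "P y <= 1" for y unfolding P_def
   using insert.prems(2) by (auto intro!: prod_nonneg prod_le_1)
  have "grd (%y. 1 - f j y) (%y. 0 - d j y)" by (intro grd_diff grd_const insert.prems) simp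
  from grd_mult[OF this e(1)] have "grd (%y. \<Prod>j\<in>insert j J. 1 - f j y) (%y. (1 - f j y) *\<^sub>R e y + P y *\<^sub>R (0 - d j y))"
   using insert.hyps by (simp add: P_def)
  moreover have "norm ((1 - f j y) *\<^sub>R e y + P y *\<^sub>R (0 - d j y)) <= (\<Sum>j\<in>insert j J. norm (d j y))" for y
  proof -
   have "norm ((1 - f j y) *\<^sub>R e y + P y *\<^sub>R (0 - d j y)) <= (1 - f j y) * norm (e y) + P y * norm (d j y)"
    using norm_triangle_ineq[of "(1 - f j y) *\<^sub>R e y" "P y *\<^sub>R (0 - d j y)"] f1[of y] P[of y] by simp
   also have "... <= 1 * norm (e y) + 1 * norm (d j y)" using f1[of y] P[of y] by (intro add_mono mult_right_mono) auto
   finally show ?thesis using e(2)[of y] insert.hyps by simp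
  qed
  ultimately show ?case by blast
 qed
 then obtain e where e: "grd (%y. \<Prod>j\<in>J. 1 - f j y) e" "!!y. norm (e y) <= (\<Sum>j\<in>J. norm (d j y))" by blast
 moreover have "e y = 0" if "!!j. j : J ==> d j y = 0" for y using e(2)[of y] that by simp
 ultimately show thesis using that by blast
qed

text \<open>The gradient is of size 1 / r on a volume r^n. The resulting power r^(n-1) is the weight
  of (n-1)-dimensional Hausdorff measure, so a null set can be cut off at arbitrarily small
  cost.\<close>

lemma bump_gradient_integral:
 fixes x :: "real^'n::finite"
 assumes r: "r > 0"
 shows "integrable lborel (%y. norm (bump' x r y))"
  and "(LI y. norm (bump' x r y)) <= 8 * unit_ball_vol (real CARD('n)) * r ^ (CARD('n) - 1)"
proof -
 have le: "norm (bump' x r y) <= 8 / r * indicator (cball x r) y" for y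
 proof (cases "y : ball x r")
  case True
  hence y: "norm (y - x) <= r" by (simp add: dist_norm norm_minus_commute)
  have "norm (bump' x r y) = 2 * \<bar>step' ((norm (y - x))^2 / r^2)\<bar> / r^2 * norm (y - x)"
   by (simp add: bump'_def abs_mult)
  also have "... <= 2 * 4 / r^2 * r" using step'_le y r by (intro mult_mono divide_right_mono mult_left_mono) auto
  also have "... = 8 / r" using r by (simp add: power2_eq_square)
  finally show ?thesis using True by (simp add: indicator_def)
 next
  case False
  thus ?thesis using bump_eq_0[OF r False] r by simp
 qed
 show i: "integrable lborel (%y. norm (bump' x r y))"
 proof (rule integrable_continuous_bounded_support[of _ "norm x + r"])
  show "continuous_on UNIV (%y. norm (bump' x r y))" using continuous_on_bump(2)[of r] r by (intro continuous_on_norm) auto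
  fix y :: "real^'n" assume "norm x + r < norm y"
  hence "y ~: ball x r" using norm_triangle_sub[of y x] by (auto simp: dist_norm norm_minus_commute)
  thus "norm (bump' x r y) = 0" using bump_eq_0[OF r] by simp
 qed
 have "integrable lborel (%y. 8 / r * indicator (cball x r) y :: real)"
  using emeasure_bounded_finite[of "cball x r"] by (intro integrable_mult_right integrable_real_indicator) auto
 hence "(LI y. norm (bump' x r y)) <= (LI y. 8 / r * indicator (cball x r) y)"
  by (intro integral_mono i le)
 also have "... = 8 / r * (unit_ball_vol (real CARD('n)) * r ^ CARD('n))"
  using content_cball[of r x] r by simp
 also have "... = 8 * unit_ball_vol (real CARD('n)) * r ^ (CARD('n) - 1)"
  using r power_Suc[of r "CARD('n) - 1"] by simp
 finally show "(LI y. norm (bump' x r y)) <= 8 * unit_ball_vol (real CARD('n)) * r ^ (CARD('n) - 1)" .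
qed

text \<open>Covering sets are replaced by open balls around points of E, after which compactness
  leaves finitely many. Centres in E make it possible to stay away from any compact set disjoint
  from E.\<close>

lemma null_set_cover:
 fixes E :: "'a::metric_space set"
 assumes E: "compact E" "hausdorff_outer N E = 0" and N: "N >= 1" and ep: "ep > 0" and r0: "r0 > 0"
 shows "EX (I :: nat set) b ro. finite I & (ALL i:I. b i : E & 0 < ro i & ro i <= r0) \<and>
  E \<subseteq> (\<Union>i\<in>I. ball (b i) (ro i)) & (\<Sum>i\<in>I. ro i ^ N) <= ep"
proof -
 define u where "u = unit_ball_vol (real N) / 4 ^ N"
 have u: "u > 0" by (simp add: u_def unit_ball_vol_pos)
 have "hausdorff_pre N (r0 / 2) E = 0" using hausdorff_pre_le_outer[of "r0 / 2" N E] E r0 by simp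
 hence "hausdorff_pre N (r0 / 2) E < ennreal (u * (ep / 2))" using u ep by simp
 then obtain B where B: "E \<subseteq> (\<Union>i. B i)" "!!i. bounded (B i)" "!!i. diameter (B i) <= r0 / 2"
  "(\<Sum>i. hausdorff_weight N (B i)) < ennreal (u * (ep / 2))"
  unfolding hausdorff_pre_def INF_less_iff by auto
 define d where "d i = diameter (B i)" for i
 have d0: "d i >= 0" for i unfolding d_def by (rule diameter_ge_0[OF B(2)])
 define J where "J = {i. B i Int E ~= {}}"
 define b where "b i = (SOME y. y : B i Int E)" for i
 have b: "b i : B i Int E" if "i : J" for i unfolding b_def using that some_in_eq[of "B i Int E"] by (simp add: J_def)
 \<comment> \<open>A covering set may be a single point, so every radius is enlarged by a share of
   \<open>eta\<close>. The shares sum to at most \<open>eta\<close>, and the three bounds keep their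
   powers, the radii and the total weight small.\<close>
 define eta where "eta = Min {1, r0 / 2, ep / 2 / 2 ^ N}"
 have eta: "0 < eta" "eta <= 1" "eta <= r0 / 2" "eta <= ep / 2 / 2 ^ N" using ep r0 by (auto simp: eta_def)
 define ro where "ro i = d i + eta * (1/2) ^ Suc i" for i
 have rho0: "ro i > d i" for i using eta by (simp add: ro_def)
 have "E \<subseteq> (\<Union>i\<in>J. ball (b i) (ro i))"
 proof
  fix y assume y: "y : E"
  then obtain i where i: "y : B i" using B by auto
  hence iJ: "i : J" using y by (auto simp: J_def)
  have "dist (b i) y <= d i" unfolding d_def using diameter_bounded_bound[OF B(2)] b[OF iJ] i by auto
  thus "y : (\<Union>i\<in>J. ball (b i) (ro i))" using rho0[of i] iJ by (auto intro!: bexI[of _ i])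
 qed
 from compactE_image[OF E(1) _ this]
 obtain I where I: "I \<subseteq> J" "finite I" "E \<subseteq> (\<Union>i\<in>I. ball (b i) (ro i))" by auto
 have term_le: "ro i ^ N <= (2 * d i) ^ N + 2 ^ N * (eta * (1/2) ^ Suc i)" for i
 proof -
  define t where "t = eta * (1/2) ^ Suc i"
  have p: "(1/2::real) ^ Suc i <= 1" by (rule power_le_one) auto
  have t: "0 <= t" "t <= 1" unfolding t_def using eta(1) mult_le_one[OF eta(2) _ p] by simp_all
  have "ro i = d i + t" by (simp only: ro_def t_def)
  hence "ro i <= max (2 * d i) (2 * t)" by (simp add: max_def)
  hence "ro i ^ N <= (max (2 * d i) (2 * t)) ^ N" using rho0[of i] d0[of i] by (intro power_mono) auto
  also have "... <= (2 * d i) ^ N + (2 * t) ^ N" using d0[of i] t by (auto simp: max_def)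
  also have "(2 * t) ^ N <= 2 ^ N * t" unfolding power_mult_distrib
   using power_decreasing[of 1 N t] t N by (intro mult_left_mono) auto
  finally show ?thesis by (simp add: t_def)
 qed
 have s1: "(\<Sum>i\<in>I. (2 * d i) ^ N) <= ep / 2"
 proof -
  have w: "hausdorff_weight N (B i) = ennreal (u * (2 * d i) ^ N)" if "i : I" for i
  proof -
   have "B i ~= {}" using that I by (auto simp: J_def)
   moreover have "unit_ball_vol (real N) * (d i / 2) ^ N = u * (2 * d i) ^ N"
   proof -
    have "(2 * d i) ^ N = (4 * (d i / 2)) ^ N" by simp
    also have "... = 4 ^ N * (d i / 2) ^ N" by (rule power_mult_distrib)
    finally show ?thesis by (simp add: u_def)
   qed
   ultimately show ?thesis by (simp add: hausdorff_weight_def d_def)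
  qed
  have "ennreal (\<Sum>i\<in>I. u * (2 * d i) ^ N) = (\<Sum>i\<in>I. hausdorff_weight N (B i))"
   using u d0 by (subst sum_ennreal[symmetric]) (auto simp: w)
  also have "... <= (\<Sum>i. hausdorff_weight N (B i))" by (rule sum_le_suminf) (use I in auto)
  finally have "ennreal (\<Sum>i\<in>I. u * (2 * d i) ^ N) <= ennreal (u * (ep / 2))" using B(4) by (rule order.trans[OF _ less_imp_le])
  hence "u * (\<Sum>i\<in>I. (2 * d i) ^ N) <= u * (ep / 2)" using u ep by (simp add: sum_distrib_left)
  thus ?thesis using u by (simp only: mult_le_cancel_left_pos)
 qed
 have s2: "(\<Sum>i\<in>I. (1/2::real) ^ Suc i) <= 1"
  using sum_le_suminf[OF sums_summable[OF power_half_series] I(2)] sums_unique[OF power_half_series] by simp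
 have "(\<Sum>i\<in>I. ro i ^ N) <= (\<Sum>i\<in>I. (2 * d i) ^ N + 2 ^ N * (eta * (1/2) ^ Suc i))" by (intro sum_mono term_le)
 also have "... = (\<Sum>i\<in>I. (2 * d i) ^ N) + 2 ^ N * (eta * (\<Sum>i\<in>I. (1/2) ^ Suc i))"
  by (simp only: sum.distrib sum_distrib_left)
 also have "... <= ep / 2 + 2 ^ N * (ep / 2 / 2 ^ N * 1)"
  using eta s2 by (intro add_mono s1 mult_left_mono mult_mono) (auto intro!: sum_nonneg)
 also have "... = ep" by simp
 finally have s: "(\<Sum>i\<in>I. ro i ^ N) <= ep" .
 show ?thesis
 proof (intro exI conjI ballI)
  show "finite I" "E \<subseteq> (\<Union>i\<in>I. ball (b i) (ro i))" "(\<Sum>i\<in>I. ro i ^ N) <= ep" by fact+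
  fix i assume i: "i : I"
  have p: "(1/2::real) ^ Suc i <= 1" by (rule power_le_one) auto
  have "ro i <= d i + eta * 1" unfolding ro_def by (intro add_left_mono mult_left_mono p) (use eta in simp)
  hence "ro i <= r0" using B(3)[of i] eta(3) by (simp add: d_def)
  thus "b i : E" "0 < ro i" "ro i <= r0" using b[of i] i I rho0[of i] d0[of i] by auto
 qed
qed

text \<open>One minus a bump on each covering ball, all multiplied together. The gradient of the
  product is at most the sum of the gradients, whose integral is small because E is null.\<close>

lemma edge_cutoff:
 fixes E :: "(real^'n::finite) set"
 assumes E: "compact E" "hcod E = 0" and n: "CARD('n) >= 2" and ep: "ep > 0"
  and K: "closed K" "E Int K = {}"
 obtains th e V where "grd th e" "!!y. 0 <= th y & th y <= 1" "open V" "E \<subseteq> V" "!!y. y : V ==> th y = 0 & e y = 0"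
  "!!y. y : K ==> th y = 1 & e y = 0" "integrable lborel (%y. norm (e y))" "(LI y. norm (e y)) <= ep"
proof -
 define N where "N = CARD('n) - 1"
 define c where "c = 8 * unit_ball_vol (real CARD('n)) * 4 ^ N"
 have c0: "c > 0" by (simp add: c_def unit_ball_vol_pos)
 obtain r0 where r0: "r0 > 0" "!!x y. x : E ==> y : K ==> r0 <= dist x y"
  using separate_compact_closed[OF E(1) K] by auto
 have "CARD('n) - 1 >= 1" "ep / c > 0" "r0 / 8 > 0" using n ep c0 r0 by auto
 from null_set_cover[OF E this]
 obtain I :: "nat set" and b ro where I0: "finite I" "ALL i:I. b i : E & 0 < ro i & ro i <= r0 / 8"
  "E \<subseteq> (\<Union>i\<in>I. ball (b i) (ro i))" "(\<Sum>i\<in>I. ro i ^ (CARD('n) - 1)) <= ep / c" by blast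
 hence I: "finite I" "!!i. i : I ==> b i : E & 0 < ro i & ro i <= r0 / 8"
  "E \<subseteq> (\<Union>i\<in>I. ball (b i) (ro i))" "(\<Sum>i\<in>I. ro i ^ N) <= ep / c" unfolding N_def by blast+
 \<comment> \<open>With radius 4 ro the bump equals 1 on the ball of radius 2 ro, which contains the
   covering ball. Since ro <= r0 / 8, it vanishes on K.\<close>
 define f where "f i = bump (b i) (4 * ro i)" for i
 define d where "d i = bump' (b i) (4 * ro i)" for i
 obtain e where e: "grd (%y. \<Prod>i\<in>I. 1 - f i y) e" "!!y. norm (e y) <= (\<Sum>i\<in>I. norm (d i y))"
  "!!y. (!!i. i : I ==> d i y = 0) ==> e y = 0"
  by (rule grd_prod_one_minus[OF I(1), of f d]) (use I(2) bump_range in \<open>auto simp: f_def d_def intro!: grd_bump\<close>)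
 define V where "V = (\<Union>i\<in>I. ball (b i) (ro i))"
 have ie: "integrable lborel (%y. norm (e y))"
 proof -
  have "integrable lborel (%y. \<Sum>i\<in>I. norm (d i y))"
   using I(2) by (intro Bochner_Integration.integrable_sum) (auto simp: d_def intro!: bump_gradient_integral(1))
  thus ?thesis
  proof (rule Bochner_Integration.integrable_bound)
   have "continuous_on UNIV e" using e(1) by (simp add: grd_def)
   hence "continuous_on UNIV (%y. norm (e y))" by (rule continuous_on_norm)
   thus "(%y. norm (e y)) : borel_measurable lborel" using borel_measurable_continuous_onI by simp
   show "AE y in lborel. norm (norm (e y)) <= norm (\<Sum>i\<in>I. norm (d i y))"
    using e(2) by (intro AE_I2) (simp add: order_trans[OF _ abs_ge_self])
  qed
 qed
 have "(LI y. norm (e y)) <= (LI y. (\<Sum>i\<in>I. norm (d i y)))"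
  using I(2) by (intro integral_mono ie Bochner_Integration.integrable_sum e(2)) (auto simp: d_def intro!: bump_gradient_integral(1))
 also have "... = (\<Sum>i\<in>I. LI y. norm (d i y))"
  using I(2) by (intro Bochner_Integration.integral_sum) (auto simp: d_def intro!: bump_gradient_integral(1))
 also have "... <= (\<Sum>i\<in>I. c * ro i ^ N)"
 proof (intro sum_mono)
  fix i assume "i : I"
  hence "4 * ro i > 0" using I(2) by auto
  from bump_gradient_integral(2)[OF this, of "b i"] show "(LI y. norm (d i y)) <= c * ro i ^ N"
   by (simp add: d_def c_def N_def power_mult_distrib mult_ac)
 qed
 also have "... <= ep" using I(4) c0 by (simp add: sum_distrib_left[symmetric] field_simps)
 finally have int: "(LI y. norm (e y)) <= ep" .
 have eV: "(\<Prod>i\<in>I. 1 - f i y) = 0" if y: "y : V" for y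
 proof -
  from y obtain i where i: "i : I" "y : ball (b i) (ro i)" by (auto simp: V_def)
  hence "f i y = 1" unfolding f_def using I(2)[OF i(1)] by (intro bump_eq_1) auto
  thus ?thesis using i I(1) by (auto intro!: prod_zero bexI[of _ i])
 qed
 have Vo: "open V" by (auto simp: V_def)
 show thesis
 proof (rule that[OF e(1) _ Vo _ _ _ ie int])
  show "0 <= (\<Prod>i\<in>I. 1 - f i y) & (\<Prod>i\<in>I. 1 - f i y) <= 1" for y
   using bump_range by (auto simp: f_def intro!: prod_nonneg prod_le_1)
  show "E \<subseteq> V" using I(3) by (simp add: V_def)
  show "(\<Prod>i\<in>I. 1 - f i y) = 0 & e y = 0" if y: "y : V" for y
  proof
   show "(\<Prod>i\<in>I. 1 - f i y) = 0" by (rule eV[OF y])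
   have "e y $ p = 0" for p
   proof -
    have 1: "((%t. \<Prod>i\<in>I. 1 - f i (y + t *\<^sub>R axis p 1)) has_real_derivative e y $ p) (at 0)" using e(1) by (simp add: grd_def)
    have "((%t. \<Prod>i\<in>I. 1 - f i (y + t *\<^sub>R axis p 1)) has_real_derivative 0) (at 0)"
    proof (rule has_field_derivative_transform_within_open[OF DERIV_const[of 0]])
     show "open ((%t::real. y + t *\<^sub>R axis p 1) -` V)" by (intro open_vimage continuous_intros Vo)
    qed (use y eV in auto)
    from DERIV_unique[OF 1 this] show ?thesis .
   qed
   thus "e y = 0" by (simp add: vec_eq_iff)
  qed
  show "(\<Prod>i\<in>I. 1 - f i y) = 1 & e y = 0" if y: "y : K" for y
  proof -
   have "f i y = 0 & d i y = 0" if i: "i : I" for i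
   proof -
    have "y ~: ball (b i) (4 * ro i)" using r0(2)[OF _ y, of "b i"] I(2)[OF i] r0(1) by auto
    thus ?thesis using bump_eq_0[of "4 * ro i" y "b i"] I(2)[OF i] by (simp add: f_def d_def)
   qed
   thus ?thesis using e(3)[of y] by simp
  qed
 qed
qed

lemma grd_zero_open:
 assumes g: "grd f d" and V: "open V" "!!y. y : V ==> f y = 0" and y: "y : V"
 shows "d y = 0"
proof -
 have "d y $ p = 0" for p
 proof -
  have 1: "((%t. f (y + t *\<^sub>R axis p 1)) has_real_derivative d y $ p) (at 0)" using g by (simp add: grd_def)
  have "((%t. f (y + t *\<^sub>R axis p 1)) has_real_derivative 0) (at 0)"
  proof (rule has_field_derivative_transform_within_open[OF DERIV_const[of 0]])
   show "open ((%t::real. y + t *\<^sub>R axis p 1) -` V)" by (intro open_vimage continuous_intros V)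
  qed (use y V in auto)
  from DERIV_unique[OF 1 this] show ?thesis .
 qed
 thus ?thesis by (simp add: vec_eq_iff)
qed

text \<open>As f vanishes on a neighbourhood of the frontier, cutting it off to 0 outside D creates
  no jump and leaves a support that is compact inside D.\<close>

lemma cutoff_restrict:
 assumes D: "open D" "bounded D" and g: "grd f d" and N: "frontier D \<subseteq> interior {y. f y = 0}"
 shows "cutoff (closure D - interior {y. f y = 0}) (%y. if y : D then f y else 0) (%y. if y : D then d y else 0)"
  and "closure D - interior {y. f y = 0} \<subseteq> D"
proof -
 define C where "C = closure D - interior {y. f y = 0}"
 have C: "compact C" unfolding C_def using D by (intro compact_diff) auto
 have cD: "closure D - D = frontier D" using D by (simp add: frontier_def interior_open)
 show CD: "closure D - interior {y. f y = 0} \<subseteq> D" using N cD by blast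
 have f0: "f y = 0 & d y = 0" if "y : interior {y. f y = 0}" for y
 proof
  show "f y = 0" using that interior_subset by blast
  show "d y = 0" by (rule grd_zero_open[OF g open_interior _ that]) (use interior_subset in blast)
 qed
 have "grd (%y. if y : D then f y else 0) (%y. if y : D then d y else 0)"
 proof (rule grd_zero_extension[OF D(1) compact_imp_closed[OF C] CD[folded C_def]])
  show "(if x : D then f x else 0) = 0 & (if x : D then d x else 0) = 0" if "x ~: C" for x
   using that f0[of x] closure_subset[of D] by (auto simp: C_def)
  show "continuous_on D (%y. if y : D then f y else 0)" "continuous_on D (%y. if y : D then d y else 0)"
   using g by (auto simp: grd_def cong: continuous_on_cong_simp intro: continuous_on_subset)
  fix y p assume y: "y : D"
  have "((%t. f (y + t *\<^sub>R axis p 1)) has_real_derivative d y $ p) (at 0)" using g by (simp add: grd_def)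
  hence "((%t. if y + t *\<^sub>R axis p 1 : D then f (y + t *\<^sub>R axis p 1) else 0) has_real_derivative d y $ p) (at 0)"
  proof (rule has_field_derivative_transform_within_open)
   show "open ((%t::real. y + t *\<^sub>R axis p 1) -` D)" by (intro open_vimage continuous_intros D)
  qed (use y in auto)
  thus "((%t. if y + t *\<^sub>R axis p 1 : D then f (y + t *\<^sub>R axis p 1) else 0) has_real_derivative (if y : D then d y else 0) $ p) (at 0)"
   using y by simp
 qed
 moreover have "x ~: C --> (if x : D then f x else 0) = 0 & (if x : D then d x else 0) = 0" for x
  using f0[of x] closure_subset[of D] by (auto simp: C_def)
 ultimately show "cutoff (closure D - interior {y. f y = 0}) (%y. if y : D then f y else 0) (%y. if y : D then d y else 0)"
  unfolding C_def[symmetric] cutoff_def grd_def using C by auto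
qed

section \<open>Cutoffs near the regular part of the boundary\<close>

lemma integrable_indicator_continuous:
 fixes f :: "'a::euclidean_space => real"
 assumes "compact K" "continuous_on K f" "A : sets borel" "A \<subseteq> K"
 shows "integrable lborel (%z. indicator A z * f z)"
proof -
 have "integrable lborel (%z. indicator A z *\<^sub>R (indicator K z *\<^sub>R f z))"
  by (rule integrable_mult_indicator[OF _ borel_integrable_compact[OF assms(1,2)]]) (use assms(3) in simp)
 moreover have "indicator A z *\<^sub>R (indicator K z *\<^sub>R f z) = indicator A z * f z" for z using assms(4) by (auto simp: indicator_def)
 ultimately show ?thesis by (simp only:)
qed

text \<open>Inside D, - ph is the depth below the boundary: the function is the full bump at depth
  up to h / 2 and 0 from depth h on. Its gradient therefore contains a part of size 1 / h in the
  direction of the normal.\<close>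

definition layer_bump :: "real^'n::finite => real => (real^'n => real) => real => real^'n => real" where
 "layer_bump y r ph h z = bump y r z * step (- ph z / h)"

definition layer_bump' :: "real^'n::finite => real => (real^'n => real) => real => real^'n => real^'n" where
 "layer_bump' y r ph h z = step (- ph z / h) *\<^sub>R bump' y r z + (bump y r z * step' (- ph z / h) * (- 1 / h)) *\<^sub>R grad ph z"

lemma bump_outside_cube:
 assumes "r > 0" "z ~: cube y r"
 shows "bump y r z = 0" "bump' y r z = 0"
proof -
 have "z ~: ball y r" using assms(2) ball_subset_cube[of y r] by blast
 thus "bump y r z = 0" "bump' y r z = 0" using bump_eq_0[OF assms(1)] by auto
qed

lemma grd_layer_bump:
 assumes ch: "chart D W ph y r k si m" and h: "h > 0"
 shows "grd (layer_bump y r ph h) (layer_bump' y r ph h)"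
proof (rule grd_zero_extension[where Om = W and C = "cube y r"])
 have r: "r > 0" and W: "open W" "C1_on W ph" "cube y (2 * r) \<subseteq> W" using ch by (auto simp: chart_def)
 show "open W" by fact
 show "closed (cube y r)" by (rule compact_imp_closed[OF compact_cube])
 show "cube y r \<subseteq> W" using W(3) cube_mono[of r "2 * r" y] r by auto
 show "layer_bump y r ph h z = 0 & layer_bump' y r ph h z = 0" if "z ~: cube y r" for z
  using bump_outside_cube[OF r that] by (simp add: layer_bump_def layer_bump'_def)
 have c: "continuous_on W ph" by (rule C1_on_imp_continuous_on[OF W(1,2)])
 have c2: "continuous_on W (%z. - ph z / h)" using h by (intro continuous_intros c) auto
 have cs: "continuous_on W (%z. step (- ph z / h))" "continuous_on W (%z. step' (- ph z / h))"
  using continuous_on_compose2[OF continuous_on_step[of UNIV] c2] continuous_on_compose2[OF continuous_on_step'[of UNIV] c2] by auto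
 show "continuous_on W (layer_bump y r ph h)" "continuous_on W (layer_bump' y r ph h)"
  unfolding layer_bump_def[abs_def] layer_bump'_def[abs_def] using r h
  by (intro continuous_intros cs continuous_on_bump continuous_on_grad W(2); simp)+
 fix z p assume z: "z : W"
 have "((%t. ph (z + t *\<^sub>R axis p 1)) has_real_derivative partial p ph z) (at 0)"
  using W(2) z by (intro partial_has_real_derivative) (simp add: C1_on_def)
 hence "((%t. - ph (z + t *\<^sub>R axis p 1) / h) has_real_derivative - partial p ph z / h) (at 0)"
  by (intro DERIV_cdivide DERIV_minus)
 from DERIV_chain2[OF step_deriv this]
 have "((%t. step (- ph (z + t *\<^sub>R axis p 1) / h)) has_real_derivative step' (- ph z / h) * (- partial p ph z / h)) (at 0)" by simp
 from DERIV_mult[OF bump_deriv[of y r z p] this]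
 show "((%t. layer_bump y r ph h (z + t *\<^sub>R axis p 1)) has_real_derivative layer_bump' y r ph h z $ p) (at 0)"
  by (simp add: layer_bump_def layer_bump'_def grad_def mult_ac)
qed

lemma layer_bump_range:
 "0 <= layer_bump y r ph h z" "layer_bump y r ph h z <= bump y r z"
 using bump_range[of y r z] step_range[of "- ph z / h"] by (auto simp: layer_bump_def mult_left_le)

lemma layer_bump_eq_0:
 assumes ch: "chart D W ph y r k si m" and h: "h > 0" and z: "z : D" "~ (z : cube y r & - h < ph z)"
 shows "layer_bump y r ph h z = 0" "layer_bump' y r ph h z = 0"
proof -
 have r: "r > 0" using ch by (auto simp: chart_def)
 have "layer_bump y r ph h z = 0 & layer_bump' y r ph h z = 0"
 proof (cases "z : cube y r")
  case True
  hence "1 <= - ph z / h" using z h by (simp add: field_simps)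
  thus ?thesis by (simp add: layer_bump_def layer_bump'_def step_simps)
 next
  case False
  thus ?thesis using bump_outside_cube[OF r False] by (simp add: layer_bump_def layer_bump'_def)
 qed
 thus "layer_bump y r ph h z = 0" "layer_bump' y r ph h z = 0" by auto
qed

text \<open>Each summand is the difference of two consecutive products, so the sum
  telescopes.\<close>

lemma partition_sum:
 fixes b :: "nat => real"
 shows "(\<Sum>j<M. (\<Prod>i<j. 1 - b i) * b j) = 1 - (\<Prod>i<M. 1 - b i)"
 by (induction M) (simp_all add: algebra_simps)

text \<open>16 n is the bound 4 for the derivative of \<open>step\<close> times the ratio 4 n
  between gradient and m in a chart.\<close>

definition geo_const :: "nat => real" where "geo_const n = 16 * real n * sweep_const n"

text \<open>An abstraction of the flux: G is a seminorm in its second argument, continuous up to the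
  boundary, whose value at a unit normal is known to be at most \<open>bd\<close>. Normals are
  available off the null set E, and \<open>om\<close> is a weight.\<close>

locale boundary_seminorm =
 fixes D E :: "(real^'n::finite) set" and G :: "real^'n => real^'n => real" and om bd :: "real^'n => real" and Bd :: real
 assumes D: "open D" "bounded D" and n: "CARD('n) >= 2"
  and E: "compact E" "E \<subseteq> frontier D" "hcod E = 0"
  and reg: "!!y. y : frontier D - E ==>
   EX W ph k. open W & y : W & C1_on W ph & D Int W = {z : W. ph z < 0} & partial k ph y ~= 0"
  and fin: "emeasure (hausdorff_measure (CARD('n) - 1)) (frontier D) < \<infinity>"
  and G: "!!y v w. G y (v + w) <= G y v + G y w" "!!y c v. G y (c *\<^sub>R v) = \<bar>c\<bar> * G y v"
   "continuous_on (closure D \<times> UNIV) (%(y, v). G y v)"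
  and Gbd: "!!y v. y : frontier D - E ==> unit_outward_normal D y v ==> G y v <= bd y"
  and om: "continuous_on UNIV om" "!!y. 0 <= om y"
  and bd: "bd : borel_measurable borel" "!!y. 0 <= bd y" "!!y. bd y <= Bd"
begin

abbreviation "H \<equiv> hausdorff_measure (CARD('n) - 1) :: (real^'n) measure"

lemma G_0: "G y 0 = 0" using G(2)[of y 0 0] by simp

lemma G_nonneg: "0 <= G y v"
 using G(1)[of y v "- v"] G(2)[of y "- 1" v] by (simp add: G_0)

lemma G_sum: "finite J ==> G y (\<Sum>j\<in>J. f j) <= (\<Sum>j\<in>J. G y (f j))"
proof (induction J rule: finite_induct)
 case (insert j J) thus ?case using G(1)[of y "f j" "\<Sum>j\<in>J. f j"] by simp
qed (simp add: G_0)

lemma continuous_on_G: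
 assumes "continuous_on T d" "T \<subseteq> closure D"
 shows "continuous_on T (%y. G y (d y))"
proof -
 have "continuous_on T (%y. (y, d y))" by (intro continuous_intros assms)
 moreover have "(%y. (y, d y)) ` T \<subseteq> closure D \<times> UNIV" using assms(2) by auto
 ultimately show ?thesis using continuous_on_compose2[OF G(3)] by force
qed

lemma compact_closure: "compact (closure D)" using D by simp

lemma G_le_norm: obtains b where "b >= 0" "!!y v. y : closure D ==> G y v <= b * norm v"
proof -
 have "compact (closure D \<times> sphere (0::real^'n) 1)" by (intro compact_Times compact_closure) auto
 moreover have "continuous_on (closure D \<times> sphere (0::real^'n) 1) (%(y, v). G y v)" by (rule continuous_on_subset[OF G(3)]) auto
 ultimately have "bounded ((%(y, v). G y v) ` (closure D \<times> sphere 0 1))"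
  using compact_continuous_image compact_imp_bounded by blast
 then obtain b where "ALL x:(%(y, v). G y v) ` (closure D \<times> sphere 0 1). norm x <= b" unfolding bounded_iff by blast
 hence b: "G y v <= b" if "y : closure D" "norm v = 1" for y v using that by force
 show thesis
 proof (rule that[of "max 0 b"])
  fix y v assume y: "y : closure D"
  show "G y v <= max 0 b * norm v"
  proof (cases "v = 0")
   case False
   have "G y v = norm v * G y (v /\<^sub>R norm v)" using False G(2)[of y "norm v" "v /\<^sub>R norm v"] by simp
   also have "... <= norm v * b" using b[OF y, of "v /\<^sub>R norm v"] False by (intro mult_left_mono) auto
   also have "... <= max 0 b * norm v" unfolding mult.commute[of "norm v"] by (intro mult_right_mono) auto
   finally show ?thesis .
  qed (simp add: G_0)
 qed simp
qed

lemma integrable_boundary: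
 assumes f: "f : borel_measurable borel" "!!y. 0 <= f y" "!!y. f y <= c" and A: "A : sets borel" "A \<subseteq> frontier D"
 shows "integrable H (%y. indicator A y * (f y * om y))"
proof -
 have fc: "compact (frontier D)" by (rule compact_frontier_bounded[OF D(2)])
 obtain w where w: "!!y. y : frontier D ==> om y <= w"
  using compact_imp_bounded[OF compact_continuous_image[OF continuous_on_subset[OF om(1)] fc]] by (auto simp: bounded_iff) (metis abs_le_D1)
 have Hb: "sets H = sets borel" by simp
 have "integrable H (%y. indicator (frontier D) y * (c * w))"
  using fin fc by (intro integrable_mult_left integrable_real_indicator) (auto intro: borel_compact)
 thus ?thesis
 proof (rule Bochner_Integration.integrable_bound)
  have "om : borel_measurable borel" using om(1) by (rule borel_measurable_continuous_onI)
  hence "(%y. indicator A y * (f y * om y)) : borel_measurable borel" using f A by measurable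
  thus "(%y. indicator A y * (f y * om y)) : borel_measurable H" by (simp cong: measurable_cong_sets)
  show "AE y in H. norm (indicator A y * (f y * om y)) <= norm (indicator (frontier D) y * (c * w))"
  proof (rule AE_I2)
   fix y
   show "norm (indicator A y * (f y * om y)) <= norm (indicator (frontier D) y * (c * w))"
   proof (cases "y : A")
    case True
    hence yf: "y : frontier D" using A by auto
    have "f y * om y <= c * w" using f(2,3)[of y] om(2)[of y] w[OF yf] by (intro mult_mono) (auto intro: order_trans)
    moreover have "0 <= f y * om y" using f om by simp
    ultimately show ?thesis using True yf by simp
   qed simp
  qed
 qed
qed

text \<open>The normalised gradient of a defining function is a unit outward normal by definition,
  so \<open>bd\<close> bounds G on it; the length of the gradient is bounded in the chart.\<close>

lemma chart_grad_bound:
 assumes ch: "chart D W ph y r k si m" and W: "W Int E = {}" and z: "z : frontier D" "z : cube y (2 * r)"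
 shows "G z (grad ph z) <= 4 * real CARD('n) * m * bd z"
proof -
 have zW: "z : W" and m: "m > 0" "m <= si * partial k ph z" "norm (grad ph z) <= 4 * real CARD('n) * m" and s: "\<bar>si\<bar> = 1"
  using ch z by (auto simp: chart_def)
 have g0: "grad ph z ~= 0"
 proof
  assume "grad ph z = 0"
  hence "partial k ph z = 0" by (simp add: grad_def vec_eq_iff)
  thus False using m by simp
 qed
 have "unit_outward_normal D z (grad ph z /\<^sub>R norm (grad ph z))"
  unfolding unit_outward_normal_def Let_def grad_def[symmetric]
  using ch zW g0 chart_closure(2)[OF ch zW D(1) z(1)] by (intro exI[of _ W] exI[of _ ph]) (auto simp: chart_def)
 hence "G z (grad ph z /\<^sub>R norm (grad ph z)) <= bd z" using z zW W by (intro Gbd) auto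
 moreover have "G z (grad ph z) = norm (grad ph z) * G z (grad ph z /\<^sub>R norm (grad ph z))"
  using g0 G(2)[of z "norm (grad ph z)" "grad ph z /\<^sub>R norm (grad ph z)"] by simp
 ultimately have "G z (grad ph z) <= norm (grad ph z) * bd z" by (simp add: mult_left_mono)
 also have "... <= 4 * real CARD('n) * m * bd z" by (intro mult_right_mono m bd)
 finally show ?thesis .
qed

end

context boundary_seminorm
begin

text \<open>Charts avoid E, so that the frontier inside them has normals, and K0, where the cutoff
  must remain 1. V takes care of the edge, and the rest of the frontier is compact. The half balls
  are where the bumps equal 1.\<close>

lemma finite_charts:
 assumes K0: "compact K0" "K0 \<subseteq> D" and V: "open V" "E \<subseteq> V"
 obtains M :: nat and W ph p r k si m where "!!j. j < M ==> chart D (W j) (ph j) (p j) (r j) (k j) (si j) (m j)"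
  "!!j. j < M ==> W j Int E = {}" "!!j. j < M ==> W j Int K0 = {}" "frontier D - V \<subseteq> (\<Union>j<M. ball (p j) (r j / 2))"
proof -
 have op: "open (- (K0 Un E))" using K0 E by (intro open_Compl closed_Un) (auto intro: compact_imp_closed)
 have ex: "EX c. case c of (W, ph, r, k, si, m) => chart D W ph y r k si m & W Int (K0 Un E) = {}" if y: "y : frontier D - V" for y
 proof -
  have "y ~: K0" using y K0 D by (auto simp: frontier_def interior_open)
  hence yo: "y : - (K0 Un E)" using y V by auto
  from reg[of y] obtain W ph k where W: "open W" "y : W" "C1_on W ph" "D Int W = {z : W. ph z < 0}" "partial k ph y ~= 0"
   using y V by blast
  show ?thesis
  proof (rule chart_exists[OF W op yo])
   fix r k si m assume "chart D (W Int - (K0 Un E)) ph y r k si m"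
   thus ?thesis by (intro exI[of _ "(W Int - (K0 Un E), ph, r, k, si, m)"]) auto
  qed
 qed
 have "EX c. ALL y:frontier D - V. case c y of (W, ph, r, k, si, m) => chart D W ph y r k si m & W Int (K0 Un E) = {}"
  by (rule bchoice) (intro ballI ex)
 then obtain c where c0: "ALL y:frontier D - V. case c y of (W, ph, r, k, si, m) => chart D W ph y r k si m & W Int (K0 Un E) = {}" ..
 note c = bspec[OF c0, unfolded split_beta]
 define R where "R y = fst (snd (snd (c y)))" for y
 have R0: "R y > 0" if "y : frontier D - V" for y
  using c[OF that] by (simp add: R_def chart_def)
 have cpt: "compact (frontier D - V)" using compact_frontier_bounded[OF D(2)] V by (intro compact_diff)
 have cvr: "frontier D - V \<subseteq> (\<Union>y\<in>frontier D - V. ball y (R y / 2))" using R0 by (fastforce intro!: bexI)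
 obtain Y where Y: "Y \<subseteq> frontier D - V" "finite Y" "frontier D - V \<subseteq> (\<Union>y\<in>Y. ball y (R y / 2))"
  by (rule compactE_image[OF cpt _ cvr]) auto
 obtain q where q: "bij_betw q {0..<card Y} Y" using ex_bij_betw_nat_finite[OF Y(2)] by blast
 have qY: "q j : Y" if "j < card Y" for j using q that by (auto simp: bij_betw_def)
 show thesis
 proof (rule that[of "card Y" "%j. fst (c (q j))" "%j. fst (snd (c (q j)))" q "%j. R (q j)"
   "%j. fst (snd (snd (snd (c (q j)))))" "%j. fst (snd (snd (snd (snd (c (q j))))))" "%j. snd (snd (snd (snd (snd (c (q j))))))"])
  fix j assume "j < card Y"
  hence "q j : frontier D - V" using qY Y by auto
  from c[OF this]
  show "chart D (fst (c (q j))) (fst (snd (c (q j)))) (q j) (R (q j)) (fst (snd (snd (snd (c (q j))))))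
    (fst (snd (snd (snd (snd (c (q j))))))) (snd (snd (snd (snd (snd (c (q j)))))))"
   "fst (c (q j)) Int E = {}" "fst (c (q j)) Int K0 = {}" unfolding R_def by blast+
 next
  have "Y = q ` {..<card Y}" using q by (auto simp: bij_betw_def atLeast0LessThan)
  hence "(\<Union>y\<in>Y. ball y (R y / 2)) = (\<Union>j<card Y. ball (q j) (R (q j) / 2))" by (metis (no_types, lifting) SUP_image comp_apply image_cong)
  thus "frontier D - V \<subseteq> (\<Union>j<card Y. ball (q j) (R (q j) / 2))" using Y(3) by simp
 qed
qed

text \<open>The gradient of the cutoff has three parts. That of the edge factor has small integral.
  That of the bumps stays bounded while the layer shrinks with h. That of the depth is of size 4 / h
  on a layer of thickness h, and becomes the surface integral.\<close>

theorem boundary_cutoff: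
 assumes K0: "compact K0" "K0 \<subseteq> D" and ep: "ep > 0"
 shows "EX C ct d. cutoff C ct d & C \<subseteq> D & (ALL y:K0. ct y = 1 & d y = 0) \<and>
  (LI y. indicator D y * (G y (d y) * om y))
   <= geo_const CARD('n) * (LINT y|H. indicator (frontier D) y * (bd y * om y)) + ep"
proof -
 obtain Gb where Gb: "Gb >= 0" "!!y v. y : closure D ==> G y v <= Gb * norm v" by (rule G_le_norm) blast
 obtain w where w: "w >= 0" "!!y. y : closure D ==> om y <= w"
 proof -
  obtain w where "ALL x:om ` closure D. norm x <= w"
   using compact_imp_bounded[OF compact_continuous_image[OF continuous_on_subset[OF om(1)] compact_closure]] unfolding bounded_iff by blast
  hence "om y <= max 0 w" if "y : closure D" for y using that om(2)[of y] by fastforce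
  thus thesis using that[of "max 0 w"] by auto
 qed
 define ep1 where "ep1 = ep / (2 * (Gb * w + 1))"
 have Gbw: "0 <= Gb * w" using Gb w by simp
 have e1: "ep1 > 0" using ep Gbw by (simp add: ep1_def)
 have EK: "E Int K0 = {}" using E K0 D by (auto simp: frontier_def interior_open)
 obtain th e V where th: "grd th e" "!!y. 0 <= th y & th y <= 1" "open V" "E \<subseteq> V" "!!y. y : V ==> th y = 0 & e y = 0"
  "!!y. y : K0 ==> th y = 1 & e y = 0" "integrable lborel (%y. norm (e y))" "(LI y. norm (e y)) <= ep1"
  by (rule edge_cutoff[OF E(1,3) n e1 compact_imp_closed[OF K0(1)] EK]) blast
 obtain M :: nat and W ph p r k si m where ch: "!!j. j < M ==> chart D (W j) (ph j) (p j) (r j) (k j) (si j) (m j)"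
  and WE: "!!j. j < M ==> W j Int E = {}" and WK: "!!j. j < M ==> W j Int K0 = {}" and cov: "frontier D - V \<subseteq> (\<Union>j<M. ball (p j) (r j / 2))"
  by (rule finite_charts[OF K0 th(3,4)]) blast
 have r0: "r j > 0" and m0: "m j > 0" and Wo: "open (W j)" and cW: "cube (p j) (2 * r j) \<subseteq> W j" "cube (p j) (r j) \<subseteq> W j"
  and ph: "C1_on (W j) (ph j)" if "j < M" for j
  using ch[OF that] cube_mono[of "r j" "2 * r j" "p j"] by (auto simp: chart_def)
 define b where "b j = bump (p j) (r j)" for j
 \<comment> \<open>The products \<open>P j * b j\<close> have sum at most 1, so they replace a partition of unity.\<close>
 define P where "P j z = (\<Prod>i<j. 1 - b i z)" for j z
 let ?q = "%j y. indicator (frontier D) y * (P j y * b j y * bd y * om y)"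
 have b01: "0 <= b j z" "b j z <= 1" for j z by (simp_all add: b_def bump_range)
 have P01: "0 <= P j z" "P j z <= 1" for j z unfolding P_def using b01 by (auto intro!: prod_nonneg prod_le_1)
 have "EX e. grd (P j) e & (ALL z. (ALL i<j. bump' (p i) (r i) z = 0) --> e z = 0)" if "j < M" for j
 proof -
  obtain e where "grd (%y. \<Prod>i<j. 1 - b i y) e" "!!y. (!!i. i : {..<j} ==> bump' (p i) (r i) y = 0) ==> e y = 0"
  proof (rule grd_prod_one_minus[of "{..<j}" b "%i. bump' (p i) (r i)"])
   show "grd (b i) (bump' (p i) (r i))" if "i : {..<j}" for i
    unfolding b_def using that \<open>j < M\<close> by (intro grd_bump r0) auto
  qed (use b01 in auto)
  thus ?thesis unfolding P_def[abs_def] by auto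
 qed
 then obtain P' where P': "!!j. j < M ==> grd (P j) (P' j)"
  "!!j z. j < M ==> (!!i. i < j ==> bump' (p i) (r i) z = 0) ==> P' j z = 0" by metis
 define T where "T h j = layer_bump (p j) (r j) (ph j) h" for h j
 define T' where "T' h j = layer_bump' (p j) (r j) (ph j) h" for h j
 define ct0 where "ct0 h z = 1 - (\<Sum>j<M. P j z * T h j z)" for h z
 define d0 where "d0 h z = 0 - (\<Sum>j<M. P j z *\<^sub>R T' h j z + T h j z *\<^sub>R P' j z)" for h z
 define ct1 where "ct1 h z = th z * ct0 h z" for h z
 define d1 where "d1 h z = th z *\<^sub>R d0 h z + ct0 h z *\<^sub>R e z" for h z
 have T01: "0 <= T h j z" "T h j z <= b j z" for h j z unfolding T_def b_def by (rule layer_bump_range)+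
 have Ple: "(\<Sum>j<M. P j z * b j z) <= 1" for z
  using partition_sum[where M = M and b = "%j. b j z"] P01(1)[of M z] by (simp add: P_def)
 have ct0: "0 <= ct0 h z" "ct0 h z <= 1" for h z
 proof -
  have "(\<Sum>j<M. P j z * T h j z) <= (\<Sum>j<M. P j z * b j z)" by (intro sum_mono mult_left_mono T01 P01)
  thus "0 <= ct0 h z" using Ple[of z] by (simp add: ct0_def)
  show "ct0 h z <= 1" unfolding ct0_def using P01 T01 by (auto intro!: sum_nonneg)
 qed
 have grd1: "grd (ct1 h) (d1 h)" if "h > 0" for h
  unfolding ct1_def[abs_def] d1_def[abs_def] ct0_def[abs_def] d0_def[abs_def] T_def T'_def
  by (intro grd_mult th(1) grd_diff grd_const grd_sum P' grd_layer_bump[OF ch that]) auto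
 have bz: "b j z = 0" "bump' (p j) (r j) z = 0" if "j < M" "z ~: W j" for j z
  using bump_outside_cube[OF r0[OF that(1)], of z "p j"] cW(2)[OF that(1)] that(2) by (auto simp: b_def)
 have K0z: "ct1 h z = 1 & d1 h z = 0" if z: "z : K0" for h z
 proof -
  have z0: "b j z = 0" "bump' (p j) (r j) z = 0" if "j < M" for j using bz[OF that] WK[OF that] z by blast+
  have T0: "T h j z = 0" "T' h j z = 0" if "j < M" for j
   using z0[OF that] by (simp_all add: T_def T'_def layer_bump_def layer_bump'_def b_def)
  have "P' j z = 0" if "j < M" for j using P'(2)[OF that] z0 that by simp
  thus ?thesis using th(6)[OF z] by (simp add: ct1_def d1_def ct0_def d0_def T0)
 qed
 \<comment> \<open>Close to the frontier, off the edge, every layer function equals its bump. The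
   sum is then 1 minus the product of all 1 - b j, and that product vanishes where some bump is
   1.\<close>
 have near: "frontier D \<subseteq> interior {z. ct1 h z = 0}" if h: "h > 0" for h
 proof
  fix z assume z: "z : frontier D"
  show "z : interior {z. ct1 h z = 0}"
  proof (cases "z : V")
   case True
   have "V \<subseteq> {z. ct1 h z = 0}" using th(5) by (auto simp: ct1_def)
   thus ?thesis using True th(3) by (meson interior_maximal subsetD)
  next
   case False
   then obtain j0 where j0: "j0 < M" "z : ball (p j0) (r j0 / 2)" using cov z by auto
   define U where "U j = (if z : W j then W j Int ph j -` {- (h / 2)<..} else - cube (p j) (r j))" for j
   have U: "open (U j) & z : U j & (ALL x:U j. T h j x = b j x)" if j: "j < M" for j
   proof (cases "z : W j")
    case True
    have c: "continuous_on (W j) (ph j)" by (rule C1_on_imp_continuous_on[OF Wo[OF j] ph[OF j]])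
    have "openin (top_of_set (W j)) (W j Int ph j -` {- (h / 2)<..})" by (rule continuous_openin_preimage_gen[OF c]) simp
    hence "open (U j)" using Wo[OF j] openin_open_trans True by (auto simp: U_def)
    moreover have "z : U j" using chart_closure(2)[OF ch[OF j] True D(1) z] True h by (simp add: U_def)
    moreover have "T h j x = b j x" if "x : U j" for x
    proof -
     have "- ph j x / h <= 1 / 2" using that True h by (simp add: U_def field_simps)
     thus ?thesis by (simp add: T_def layer_bump_def step_simps b_def)
    qed
    ultimately show ?thesis by blast
   next
    case False
    have "closed (cube (p j) (r j))" by (rule compact_imp_closed[OF compact_cube])
    moreover have "T h j x = b j x" if "x ~: cube (p j) (r j)" for x
     using bump_outside_cube[OF r0[OF j] that] by (simp add: T_def layer_bump_def b_def)
    ultimately show ?thesis using False cW(2)[OF j] by (auto simp: U_def)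
   qed
   define U' where "U' = ball (p j0) (r j0 / 2) Int (\<Inter>j<M. U j)"
   have "open U'" unfolding U'_def using U by (intro open_Int open_INT) auto
   moreover have "z : U'" using j0 U by (auto simp: U'_def)
   moreover have "ct1 h x = 0" if x: "x : U'" for x
   proof -
    have "ct0 h x = 1 - (\<Sum>j<M. P j x * b j x)"
     using U x by (simp add: ct0_def U'_def)
    also have "... = P M x" using partition_sum[where M = M and b = "%j. b j x"] by (simp add: P_def)
    also have "... = 0"
    proof -
     have "b j0 x = 1" unfolding b_def using x j0 by (intro bump_eq_1 r0) (auto simp: U'_def)
     thus ?thesis unfolding P_def using j0 by (intro prod_zero) (auto intro!: bexI[of _ j0])
    qed
    finally show ?thesis by (simp add: ct1_def)
   qed
   ultimately show ?thesis by (intro interiorI[of U']) auto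
  qed
 qed
 define Z where "Z j h = {z : D Int cube (p j) (r j). - h < ph j z}" for j h
 define A where "A j = frontier D Int cube (p j) (2 * r j)" for j
 \<comment> \<open>\<open>g1\<close> collects the gradients that do not depend on h,
   \<open>g2\<close> the gradient of the depth without its factor 4 / h.\<close>
 define g1 where "g1 j z = (G z (bump' (p j) (r j) z) + G z (P' j z)) * om z" for j z
 define g2 where "g2 j z = P j z * (b j z * (G z (grad (ph j) z) * om z))" for j z
 let ?IZ = "%g j h. LI z. indicator (Z j h) z * g j z"
 let ?IA = "%g j. LINT z|H. indicator (A j) z * g j z"
 have cg1: "continuous_on (closure D Int cube (p j) (2 * r j)) (g1 j)" if j: "j < M" for j
 proof -
  have c: "continuous_on UNIV (P' j)" using P'(1)[OF j] by (simp add: grd_def)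
  show ?thesis unfolding g1_def using r0[OF j]
   by (intro continuous_on_mult continuous_on_add continuous_on_G continuous_on_bump continuous_on_subset[OF om(1)] continuous_on_subset[OF c]) auto
 qed
 have cg2: "continuous_on (closure D Int cube (p j) (2 * r j)) (g2 j)" if j: "j < M" for j
 proof -
  have c: "continuous_on UNIV (P j)" using P'(1)[OF j] by (simp add: grd_def)
  show ?thesis unfolding g2_def b_def using r0[OF j] cW(1)[OF j]
   by (intro continuous_on_mult continuous_on_G continuous_on_bump continuous_on_subset[OF om(1)] continuous_on_subset[OF c] continuous_on_subset[OF continuous_on_grad[OF ph[OF j]]]) auto
 qed
 have g10: "0 <= g1 j z" "0 <= g2 j z" for j z by (auto simp: g1_def g2_def G_nonneg om P01 b01)
 define sc where "sc = sweep_const CARD('n)"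
 have sc0: "sc > 0" by (simp add: sc_def sweep_const_pos)
 \<comment> \<open>Each chart spends \<open>ep2\<close> once for \<open>g1\<close> and four times
   through the factor 4 / h for \<open>g2\<close>; five times M of them stay below ep / 2.\<close>
 define ep2 where "ep2 = ep / (10 * (real M + 1))"
 have e2: "ep2 > 0" using ep by (simp add: ep2_def)
 \<comment> \<open>The summand 1 is the error allowed in \<open>layer_integral\<close>; any finite
   rate makes this part tend to 0 with h.\<close>
 define J1 where "J1 j = sc / m j * ?IA g1 j + 1" for j
 define J2 where "J2 j = sc / m j * ?IA g2 j" for j
 have ev: "eventually (%h. 0 < h & (ALL j:{..<M}. (Z j h : sets lborel & ?IZ g1 j h <= h * J1 j) \<and>
   ?IZ g2 j h <= h * (J2 j + ep2) & h * J1 j < ep2)) (at_right 0)"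
 proof (intro eventually_conj eventually_at_right_less)
  show "\<forall>\<^sub>F h in at_right 0. ALL j:{..<M}. (Z j h : sets lborel & ?IZ g1 j h <= h * J1 j) \<and>
   ?IZ g2 j h <= h * (J2 j + ep2) & h * J1 j < ep2"
  proof (intro eventually_ball_finite ballI)
   fix j assume "j : {..<M}"
   hence j: "j < M" by simp
   have 1: "\<forall>\<^sub>F h in at_right 0. Z j h : sets lborel & ?IZ g1 j h <= h * J1 j"
    using layer_integral[OF ch[OF j] D n fin cg1[OF j] _ zero_less_one] g10 by (simp add: Z_def A_def J1_def sc_def)
   have 2: "\<forall>\<^sub>F h in at_right 0. Z j h : sets lborel & ?IZ g2 j h <= h * (J2 j + ep2)"
    using layer_integral[OF ch[OF j] D n fin cg2[OF j] _ e2] g10 by (simp add: Z_def A_def J2_def sc_def)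
   have "((%h. h * J1 j) \<longlongrightarrow> 0 * J1 j) (at_right 0)" by (intro tendsto_intros)
   hence 3: "\<forall>\<^sub>F h in at_right 0. h * J1 j < ep2" using e2 by (intro order_tendstoD(2)[of _ "0 * J1 j"]) auto
   show "\<forall>\<^sub>F h in at_right 0. (Z j h : sets lborel & ?IZ g1 j h <= h * J1 j) \<and>
    ?IZ g2 j h <= h * (J2 j + ep2) & h * J1 j < ep2"
    using 1 2 3 by eventually_elim auto
  qed simp
 qed
 from eventually_happens'[OF _ ev]
 obtain h where h: "h > 0" and hZ: "!!j. j < M ==> Z j h : sets borel"
  and h1: "!!j. j < M ==> ?IZ g1 j h <= ep2"
  and h2: "!!j. j < M ==> ?IZ g2 j h <= h * (J2 j + ep2)"
  by (auto simp: trivial_limit_at_right_real) (meson less_imp_le order_trans lessThan_iff)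
 let ?s = "%j z. indicator (Z j h) z * g1 j z + 4 / h * (indicator (Z j h) z * g2 j z)"
 let ?Gs = "%j z. G z (bump' (p j) (r j) z) + G z (P' j z) + 4 / h * (P j z * (b j z * G z (grad (ph j) z)))"
 let ?B = "LINT y|H. indicator (frontier D) y * (bd y * om y)"
 have pt: "indicator D z * (G z (d1 h z) * om z) <= Gb * w * norm (e z) + (\<Sum>j<M. ?s j z)" for z
 proof (cases "z : D")
  case False
  thus ?thesis using Gb w h by (auto intro!: add_nonneg_nonneg sum_nonneg mult_nonneg_nonneg divide_nonneg_pos g10)
 next
  case True
  hence zc: "z : closure D" using closure_subset by blast
  have Gneg: "G z (- v) = G z v" for v using G(2)[of z "- 1" v] by simp
  have "G z (d1 h z) <= th z * G z (d0 h z) + ct0 h z * G z (e z)"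
   unfolding d1_def using G(1)[of z "th z *\<^sub>R d0 h z" "ct0 h z *\<^sub>R e z"] th(2)[of z] ct0[of h z] by (simp add: G(2))
  also have "... <= G z (d0 h z) + G z (e z)"
   using th(2)[of z] ct0[of h z] G_nonneg by (intro add_mono mult_left_le_one_le) auto
  also have "G z (e z) <= Gb * norm (e z)" by (rule Gb(2)[OF zc])
  also have "G z (d0 h z) <= (\<Sum>j<M. G z (P j z *\<^sub>R T' h j z + T h j z *\<^sub>R P' j z))"
   unfolding d0_def using Gneg G_sum[of "{..<M}" z "%j. P j z *\<^sub>R T' h j z + T h j z *\<^sub>R P' j z"] by simp
  also have "... <= (\<Sum>j<M. indicator (Z j h) z * ?Gs j z)"
  proof (intro sum_mono)
   fix j assume "j : {..<M}"
   hence j: "j < M" by simp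
   show "G z (P j z *\<^sub>R T' h j z + T h j z *\<^sub>R P' j z)
    <= indicator (Z j h) z * ?Gs j z"
   proof (cases "z : Z j h")
    case False
    hence "~ (z : cube (p j) (r j) & - h < ph j z)" using True by (auto simp: Z_def)
    from layer_bump_eq_0[OF ch[OF j] h True this] show ?thesis using False by (simp add: T_def T'_def G_0)
   next
    case z: True
    define s where "s = - ph j z / h"
    have "G z (T' h j z) <= step s * G z (bump' (p j) (r j) z) + b j z * \<bar>step' s\<bar> / h * G z (grad (ph j) z)"
     unfolding T'_def layer_bump'_def s_def[symmetric] b_def[symmetric]
    proof (rule order_trans[OF G(1)], rule eq_refl, rule arg_cong2[where f = "(+)"])
     show "G z (step s *\<^sub>R bump' (p j) (r j) z) = step s * G z (bump' (p j) (r j) z)"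
      using step_range[of s] by (simp only: G(2) abs_of_nonneg)
     show "G z ((b j z * step' s * (- 1 / h)) *\<^sub>R grad (ph j) z) = b j z * \<bar>step' s\<bar> / h * G z (grad (ph j) z)"
      unfolding G(2) using b01[of j z] h by (simp add: abs_mult)
    qed
    also have "... <= 1 * G z (bump' (p j) (r j) z) + b j z * 4 / h * G z (grad (ph j) z)"
     using step_range[of s] step'_le[of s] b01[of j z] h by (intro add_mono mult_right_mono divide_right_mono mult_left_mono G_nonneg) auto
    finally have GT: "G z (T' h j z) <= G z (bump' (p j) (r j) z) + b j z * 4 / h * G z (grad (ph j) z)" by simp
    have "G z (P j z *\<^sub>R T' h j z + T h j z *\<^sub>R P' j z) <= P j z * G z (T' h j z) + T h j z * G z (P' j z)"
     using G(1)[of z "P j z *\<^sub>R T' h j z" "T h j z *\<^sub>R P' j z"] P01[of j z] T01(1)[of h j z] by (simp add: G(2))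
    also have "T h j z * G z (P' j z) <= G z (P' j z)"
     using T01[of h j z] b01[of j z] G_nonneg by (intro mult_left_le_one_le) auto
    also have "P j z * G z (T' h j z) <= P j z * (G z (bump' (p j) (r j) z) + b j z * 4 / h * G z (grad (ph j) z))"
     by (intro mult_left_mono GT P01)
    also have "... <= G z (bump' (p j) (r j) z) + 4 / h * (P j z * (b j z * G z (grad (ph j) z)))"
    proof -
     have "P j z * G z (bump' (p j) (r j) z) <= G z (bump' (p j) (r j) z)"
      using P01[of j z] G_nonneg by (intro mult_left_le_one_le) auto
     thus ?thesis by (simp add: algebra_simps)
    qed
    finally show ?thesis using z by simp
   qed
  qed
  finally have "G z (d1 h z) * om z <= ((\<Sum>j<M. indicator (Z j h) z * ?Gs j z) + Gb * norm (e z)) * om z"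
   by (intro mult_right_mono om) simp
  also have "... = Gb * norm (e z) * om z + (\<Sum>j<M. ?s j z)"
   unfolding distrib_right[of _ _ "om z"] sum_distrib_right
   by (subst add.commute, intro arg_cong2[where f = "(+)"] refl sum.cong) (simp_all add: g1_def g2_def algebra_simps)
  also have "Gb * norm (e z) * om z <= Gb * norm (e z) * w" using Gb w(2)[OF zc] by (intro mult_left_mono) auto
  finally show ?thesis using True by (simp add: mult_ac)
 qed
 have iZ: "integrable lborel (%z. indicator (Z j h) z * g1 j z)" "integrable lborel (%z. indicator (Z j h) z * g2 j z)" if j: "j < M" for j
 proof -
  have K: "compact (closure D Int cube (p j) (2 * r j))" using compact_closure compact_cube by (intro compact_Int) auto
  have "Z j h \<subseteq> closure D Int cube (p j) (2 * r j)"
   using closure_subset[of D] cube_mono[of "r j" "2 * r j" "p j"] r0[OF j] by (auto simp: Z_def)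
  thus "integrable lborel (%z. indicator (Z j h) z * g1 j z)" "integrable lborel (%z. indicator (Z j h) z * g2 j z)"
   by (rule integrable_indicator_continuous[OF K cg1[OF j] hZ[OF j]] integrable_indicator_continuous[OF K cg2[OF j] hZ[OF j]])+
 qed
 have "(LI z. indicator D z * (G z (d1 h z) * om z)) <= (LI z. Gb * w * norm (e z) + (\<Sum>j<M. ?s j z))"
 proof (intro integral_mono pt)
  have c: "continuous_on UNIV (d1 h)" using grd1[OF h] by (simp add: grd_def)
  have "continuous_on (closure D) (%z. G z (d1 h z) * om z)"
   by (intro continuous_on_mult continuous_on_G continuous_on_subset[OF om(1)] continuous_on_subset[OF c]) auto
  thus "integrable lborel (%z. indicator D z * (G z (d1 h z) * om z))"
   using D closure_subset[of D] by (intro integrable_indicator_continuous[OF compact_closure]) auto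
  show "integrable lborel (%z. Gb * w * norm (e z) + (\<Sum>j<M. ?s j z))"
   using iZ th(7) by (intro Bochner_Integration.integrable_add Bochner_Integration.integrable_sum integrable_mult_right) auto
 qed
 also have "... = Gb * w * (LI z. norm (e z)) + (\<Sum>j<M. ?IZ g1 j h + 4 / h * ?IZ g2 j h)"
 proof -
  have i: "integrable lborel (?s j)" "(LI z. ?s j z) = ?IZ g1 j h + 4 / h * ?IZ g2 j h" if "j < M" for j
   using iZ[OF that] by simp_all
  have "(LI z. (\<Sum>j<M. ?s j z)) = (\<Sum>j<M. ?IZ g1 j h + 4 / h * ?IZ g2 j h)"
   using i by (subst Bochner_Integration.integral_sum) auto
  moreover have "integrable lborel (%z. \<Sum>j<M. ?s j z)" using i(1) by (intro Bochner_Integration.integrable_sum) auto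
  ultimately show ?thesis using th(7) by (subst Bochner_Integration.integral_add) auto
 qed
 also have "... <= Gb * w * ep1 + (\<Sum>j<M. ep2 + 4 * (J2 j + ep2))"
 proof (intro add_mono sum_mono mult_left_mono th(8) Gbw)
  fix j assume "j : {..<M}"
  hence j: "j < M" by simp
  show "?IZ g1 j h <= ep2" by (rule h1[OF j])
  have "4 / h * ?IZ g2 j h <= 4 / h * (h * (J2 j + ep2))"
   using h by (intro mult_left_mono h2[OF j]) auto
  thus "4 / h * ?IZ g2 j h <= 4 * (J2 j + ep2)" using h by simp
 qed
 also have "... = Gb * w * ep1 + 5 * (real M * ep2) + 4 * (\<Sum>j<M. J2 j)"
 proof -
  have "(\<Sum>j<M. ep2 + 4 * (J2 j + ep2)) = (\<Sum>j<M. 5 * ep2 + 4 * J2 j)" by (intro sum.cong) auto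
  thus ?thesis by (simp add: sum.distrib sum_distrib_left[symmetric])
 qed
 also have "... <= ep / 2 + 5 * (ep / 10) + geo_const CARD('n) * ?B"
 proof (intro add_mono mult_left_mono)
  have "Gb * w * ep1 = ep / 2 * (Gb * w / (Gb * w + 1))" by (simp add: ep1_def)
  also have "... <= ep / 2 * 1" using ep Gbw by (intro mult_left_mono) auto
  finally show "Gb * w * ep1 <= ep / 2" by simp
  have "real M * ep2 = ep / 10 * (real M / (real M + 1))" by (simp add: ep2_def)
  also have "... <= ep / 10 * 1" using ep by (intro mult_left_mono) auto
  finally show "real M * ep2 <= ep / 10" by simp
  have fb: "frontier D : sets borel" by (simp add: borel_closed)
  define c4 where "c4 = 4 * real CARD('n)"
  have Pm: "(%z. P j z * b j z * bd z) : borel_measurable borel" if "j < M" for j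
  proof -
   have "continuous_on UNIV (P j)" using P'(1)[OF that] by (simp add: grd_def)
   moreover have "continuous_on UNIV (b j)" unfolding b_def using r0[OF that] by (intro continuous_on_bump) auto
   ultimately have "P j : borel_measurable borel" "b j : borel_measurable borel" by (auto intro: borel_measurable_continuous_onI)
   thus ?thesis using bd(1) by measurable
  qed
  have iP: "integrable H (%y. indicator S y * (P j y * b j y * bd y * om y))" if "j < M" "S : sets borel" "S \<subseteq> frontier D" for j S
  proof (rule integrable_boundary[OF Pm[OF that(1)] _ _ that(2,3)])
   show "0 <= P j y * b j y * bd y" for y using P01 b01 bd by simp
   show "P j y * b j y * bd y <= Bd" for y
   proof -
    have "P j y * b j y <= 1" using P01[of j y] b01[of j y] by (intro mult_le_one) auto
    hence "P j y * b j y * bd y <= 1 * bd y" using bd(2) by (intro mult_right_mono) auto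
    thus ?thesis using bd(3)[of y] by simp
   qed
  qed
  have Ab: "A j : sets borel" "A j \<subseteq> frontier D" for j
   using compact_imp_closed[OF compact_cube, of "p j" "2 * r j"] fb by (auto simp: A_def borel_closed)
  have J2le: "J2 j <= sc * c4 * (LINT y|H. ?q j y)" if j: "j < M" for j
  proof -
   have le: "indicator (A j) y * g2 j y <= c4 * m j * (?q j y)" for y
   proof (cases "y : A j")
    case True
    hence y: "y : frontier D" "y : cube (p j) (2 * r j)" by (auto simp: A_def)
    have "g2 j y <= P j y * (b j y * (c4 * m j * bd y * om y))"
     unfolding g2_def c4_def using P01 b01 om
     by (intro mult_left_mono mult_right_mono chart_grad_bound[OF ch[OF j] WE[OF j] y]) auto
    thus ?thesis using True y by (simp add: mult_ac)
   next
    case False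
    thus ?thesis using m0[OF j] P01 b01 bd om by (auto simp: c4_def)
   qed
   have i2: "integrable H (%y. c4 * m j * (?q j y))"
    by (intro integrable_mult_right iP[OF j fb order_refl])
   have "?IA g2 j <= (LINT y|H. c4 * m j * (?q j y))"
   \<comment> \<open>A non-integrable function has integral 0 by convention, and the right side is
     nonnegative.\<close>
   proof (cases "integrable H (%z. indicator (A j) z * g2 j z)")
    case True thus ?thesis using le i2 by (intro integral_mono) auto
   next
    case False
    hence "?IA g2 j = 0" by (rule not_integrable_integral_eq)
    also have "0 <= (LINT y|H. c4 * m j * (?q j y))"
     using m0[OF j] P01 b01 bd om by (intro integral_nonneg_AE AE_I2) (auto simp: c4_def)
    finally show ?thesis .
   qed
   hence "sc / m j * ?IA g2 j <= sc / m j * (c4 * m j * (LINT y|H. ?q j y))"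
    using sc0 m0[OF j] by (intro mult_left_mono) auto
   thus ?thesis using m0[OF j] by (simp add: J2_def)
  qed
  have "(\<Sum>j<M. J2 j) <= (\<Sum>j<M. sc * c4 * (LINT y|H. ?q j y))"
   by (intro sum_mono J2le) auto
  also have "... = sc * c4 * (LINT y|H. (\<Sum>j<M. ?q j y))"
  proof -
   have "(LINT y|H. (\<Sum>j<M. ?q j y))
     = (\<Sum>j<M. LINT y|H. ?q j y)"
    using iP[OF _ fb order_refl] by (intro Bochner_Integration.integral_sum) auto
   thus ?thesis by (simp only: sum_distrib_left[where r = "sc * c4"])
  qed
  also have "... <= sc * c4 * ?B"
  proof (intro mult_left_mono integral_mono)
   show "integrable H (%y. \<Sum>j<M. ?q j y)"
    by (intro Bochner_Integration.integrable_sum iP fb order_refl) auto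
   show "integrable H (%y. indicator (frontier D) y * (bd y * om y))" by (rule integrable_boundary[OF bd(1,2,3) fb order_refl])
   fix y
   have "(\<Sum>j<M. ?q j y) = indicator (frontier D) y * ((\<Sum>j<M. P j y * b j y) * (bd y * om y))"
    by (simp add: sum_distrib_left sum_distrib_right mult_ac)
   also have "... <= indicator (frontier D) y * (1 * (bd y * om y))" by (intro mult_left_mono mult_right_mono Ple mult_nonneg_nonneg bd om) auto
   finally show "(\<Sum>j<M. ?q j y) <= indicator (frontier D) y * (bd y * om y)" by simp
  qed (use sc0 in \<open>auto simp: c4_def\<close>)
  finally show "4 * (\<Sum>j<M. J2 j) <= geo_const CARD('n) * ?B"
   by (simp add: geo_const_def c4_def sc_def mult_ac)
 qed auto
 finally have fin_est: "(LI z. indicator D z * (G z (d1 h z) * om z)) <= geo_const CARD('n) * ?B + ep" by simp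
 define ct where "ct y = (if y : D then ct1 h y else 0)" for y
 define d where "d y = (if y : D then d1 h y else 0)" for y
 have "cutoff (closure D - interior {y. ct1 h y = 0}) ct d" "closure D - interior {y. ct1 h y = 0} \<subseteq> D"
  unfolding ct_def[abs_def] d_def[abs_def] by (rule cutoff_restrict[OF D grd1[OF h] near[OF h]])+
 moreover have "ALL y:K0. ct y = 1 & d y = 0" using K0z K0 by (auto simp: ct_def d_def)
 moreover have "(LI z. indicator D z * (G z (d z) * om z)) = (LI z. indicator D z * (G z (d1 h z) * om z))"
  by (intro Bochner_Integration.integral_cong refl) (auto simp: d_def indicator_def)
 ultimately show ?thesis using fin_est
  by (intro exI[of _ "closure D - interior {y. ct1 h y = 0}"] exI[of _ ct] exI[of _ d] conjI) simp_all
qed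

end

section \<open>Domains in the half-space\<close>

lemma hausdorff_pre_finite_cover:
 fixes B :: "'i => 'a::metric_space set"
 assumes I: "finite I" "A \<subseteq> (\<Union>i\<in>I. B i)" "!!i. i : I ==> bounded (B i) & diameter (B i) <= r" and r: "r >= 0"
 shows "hausdorff_pre s r A <= (\<Sum>i\<in>I. hausdorff_weight s (B i))"
proof -
 obtain h where h: "bij_betw h {0..<card I} I" using ex_bij_betw_nat_finite[OF I(1)] by blast
 define B' where "B' j = (if j < card I then B (h j) else {})" for j
 have hI: "h j : I" if "j < card I" for j using h that by (auto simp: bij_betw_def)
 have "(\<Union>i\<in>I. B i) \<subseteq> (\<Union>j. B' j)"
 proof
  fix x assume "x : (\<Union>i\<in>I. B i)"
  then obtain i where i: "i : I" "x : B i" by auto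
  hence "i : h ` {0..<card I}" using h by (simp add: bij_betw_def)
  then obtain j where "j < card I" "h j = i" by auto
  thus "x : (\<Union>j. B' j)" using i by (auto simp: B'_def intro!: exI[of _ j])
 qed
 hence "hausdorff_pre s r A <= (\<Sum>j. hausdorff_weight s (B' j))"
  using I(2,3) hI r by (intro hausdorff_pre_le) (auto simp: B'_def)
 also have "... = (\<Sum>j<card I. hausdorff_weight s (B' j))" by (rule suminf_finite) (auto simp: B'_def)
 also have "... = (\<Sum>i\<in>I. hausdorff_weight s (B i))"
  using sum.reindex_bij_betw[OF h, of "%i. hausdorff_weight s (B i)"] by (simp add: B'_def atLeast0LessThan)
 finally show ?thesis .
qed

text \<open>The coordinates other than k are divided into N parts each. By the Lipschitz bound the
  points over one cell form a set of diameter at most c / N, and the number of cells balances the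
  powers of N.\<close>

lemma hausdorff_outer_lipschitz_graph:
 fixes Q :: "(real^'n::finite) set"
 assumes Q: "Q \<subseteq> cube y r" and r: "r > 0" and L: "L >= 0"
  and lip: "!!p q. p : Q ==> q : Q ==> \<bar>p $ k - q $ k\<bar> <= L * (\<Sum>i\<in>-{k}. \<bar>p $ i - q $ i\<bar>)"
 shows "hcod Q < \<infinity>"
proof -
 define s where "s = CARD('n) - 1"
 have ks: "card (- {k}) = s" by (simp add: s_def Compl_eq_Diff_UNIV card_Diff_singleton)
 define c where "c = (real CARD('n) + L * real CARD('n)) * (2 * r)"
 have c0: "c > 0" using r L by (simp add: c_def add_pos_nonneg)
 define C where "C = unit_ball_vol (real s) * c ^ s"
 have pre: "hausdorff_pre s (c / real N) Q <= ennreal C" if N: "N >= 1" for N :: nat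
 proof -
  define u where "u p i = nat \<lfloor>(p $ i - y $ i + r) * real N / (2 * r)\<rfloor>" for p :: "real^'n" and i
  \<comment> \<open>The index N occurs on the far face of the cube, hence N + 1 values for each
    coordinate.\<close>
  define I where "I = PiE (- {k}) (%_. {0..N})"
  define B where "B f = {p : Q. ALL i:-{k}. u p i = f i}" for f
  have fI: "finite I" unfolding I_def by (intro finite_PiE) auto
  have cI: "card I = Suc N ^ s" unfolding I_def by (simp add: card_PiE ks)
  have QI: "Q \<subseteq> (\<Union>f\<in>I. B f)"
  proof
   fix p assume p: "p : Q"
   define f where "f = restrict (u p) (- {k})"
   have "u p i <= N" for i
   proof -
    have "\<bar>p $ i - y $ i\<bar> <= r" using p Q by (auto simp: cube_def)
    hence "(p $ i - y $ i + r) * real N <= (2 * r) * real N" by (intro mult_right_mono) auto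
    hence "(p $ i - y $ i + r) * real N / (2 * r) <= real N" using r by (simp add: field_simps)
    hence "\<lfloor>(p $ i - y $ i + r) * real N / (2 * r)\<rfloor> <= int N" by linarith
    thus ?thesis by (simp add: u_def)
   qed
   hence "f : I" by (auto simp: f_def I_def)
   moreover have "p : B f" using p by (auto simp: B_def f_def)
   ultimately show "p : (\<Union>f\<in>I. B f)" by blast
  qed
  have dist: "dist p q <= c / real N" if "p : B f" "q : B f" for p q f
  proof -
   have pq: "p : Q" "q : Q" using that by (auto simp: B_def)
   have co: "\<bar>p $ i - q $ i\<bar> <= 2 * r / real N" if i: "i ~= k" for i
   proof -
    define a where "a = (p $ i - y $ i + r) * real N / (2 * r)"
    define b where "b = (q $ i - y $ i + r) * real N / (2 * r)"
    have "\<bar>p $ i - y $ i\<bar> <= r" "\<bar>q $ i - y $ i\<bar> <= r" using pq Q by (auto simp: cube_def)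
    hence ab: "a >= 0" "b >= 0" using r by (auto simp: a_def b_def)
    have "nat \<lfloor>a\<rfloor> = nat \<lfloor>b\<rfloor>" using \<open>p : B f\<close> \<open>q : B f\<close> i by (auto simp: B_def u_def a_def b_def)
    hence "\<lfloor>a\<rfloor> = \<lfloor>b\<rfloor>" using ab by (simp add: nat_eq_iff)
    hence "\<bar>a - b\<bar> <= 1" by linarith
    moreover have "a - b = (p $ i - q $ i) * (real N / (2 * r))" by (simp add: a_def b_def diff_divide_distrib[symmetric] algebra_simps)
    ultimately have "\<bar>p $ i - q $ i\<bar> * (real N / (2 * r)) <= 1" using r by (simp add: abs_mult)
    thus ?thesis using r N by (simp add: field_simps)
   qed
   have S: "(\<Sum>i\<in>-{k}. \<bar>p $ i - q $ i\<bar>) <= real s * (2 * r / real N)"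
    using sum_bounded_above[of "- {k}" "%i. \<bar>p $ i - q $ i\<bar>" "2 * r / real N"] co by (simp add: ks)
   have "norm (p - q) <= (\<Oplus>i. \<bar>p $ i - q $ i\<bar>)" using norm_le_l1_cart[of "p - q"] by simp
   also have "... = \<bar>p $ k - q $ k\<bar> + (\<Sum>i\<in>-{k}. \<bar>p $ i - q $ i\<bar>)"
    using sum.remove[of UNIV k "%i. \<bar>p $ i - q $ i\<bar>"] by (simp add: Compl_eq_Diff_UNIV)
   also have "... <= L * (real s * (2 * r / real N)) + real s * (2 * r / real N)"
    by (rule add_mono[OF order_trans[OF lip[OF pq] mult_left_mono[OF S L]] S])
   also have "... <= L * (real CARD('n) * (2 * r / real N)) + real CARD('n) * (2 * r / real N)"
    using L r by (intro add_mono mult_left_mono mult_right_mono) (auto simp: s_def)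
   also have "... = c / real N" by (simp add: c_def algebra_simps add_divide_distrib)
   finally show ?thesis by (simp add: dist_norm)
  qed
  have bB: "bounded (B f) & diameter (B f) <= c / real N" for f
  proof
   have "bounded (cube y r)" using compact_cube compact_imp_bounded by blast
   thus "bounded (B f)" by (rule bounded_subset) (use Q in \<open>auto simp: B_def\<close>)
   show "diameter (B f) <= c / real N" using c0 dist by (intro diameter_le) (auto simp: dist_norm)
  qed
  have w: "hausdorff_weight s (B f) <= ennreal (unit_ball_vol (real s) * (c / (2 * real N)) ^ s)" for f
  proof (cases "B f = {}")
   case False
   have "(diameter (B f) / 2) ^ s <= (c / (2 * real N)) ^ s"
    using bB[of f] diameter_ge_0[of "B f"] by (intro power_mono) auto
   thus ?thesis using False unit_ball_vol_nonneg[of "real s"]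
    by (auto simp: hausdorff_weight_def intro!: ennreal_leI mult_left_mono)
  qed simp
  have "hausdorff_pre s (c / real N) Q <= (\<Sum>f\<in>I. hausdorff_weight s (B f))"
   using c0 by (intro hausdorff_pre_finite_cover fI QI bB) auto
  also have "... <= (\<Sum>f\<in>I. ennreal (unit_ball_vol (real s) * (c / (2 * real N)) ^ s))" by (intro sum_mono w)
  also have "... = ennreal (real (card I) * (unit_ball_vol (real s) * (c / (2 * real N)) ^ s))"
   using c0 unit_ball_vol_nonneg[of "real s"] by (simp add: ennreal_mult'' ennreal_of_nat_eq_real_of_nat)
  also have "... <= ennreal C"
  proof (rule ennreal_leI)
   have "real (card I) * (c / (2 * real N)) ^ s = (real (Suc N) * (c / (2 * real N))) ^ s"
    unfolding cI of_nat_power by (rule power_mult_distrib[symmetric])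
   also have "... <= c ^ s" using N c0 by (intro power_mono) (auto simp: field_simps)
   finally have "unit_ball_vol (real s) * (real (card I) * (c / (2 * real N)) ^ s) <= unit_ball_vol (real s) * c ^ s"
    using unit_ball_vol_nonneg[of "real s"] by (intro mult_left_mono) auto
   thus "real (card I) * (unit_ball_vol (real s) * (c / (2 * real N)) ^ s) <= C" by (simp add: C_def mult_ac)
  qed
  finally show ?thesis .
 qed
 have "hausdorff_outer s Q <= ennreal C"
  unfolding hausdorff_outer_def
 proof (rule SUP_least)
  fix t :: real assume t: "t : {0<..}"
  obtain N :: nat where N: "c / t < real N" using reals_Archimedean2 by blast
  have "0 < c / t" using c0 t by simp
  hence N1: "N >= 1" using N by (cases N) auto
  have "c / real N <= t" using N N1 t by (simp add: field_simps)
  hence "hausdorff_pre s t Q <= hausdorff_pre s (c / real N) Q" by (rule hausdorff_pre_antimono)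
  also have "... <= ennreal C" by (rule pre[OF N1])
  finally show "hausdorff_pre s t Q <= ennreal C" .
 qed
 thus ?thesis unfolding s_def[symmetric] infinity_ennreal_def by (rule le_less_trans[OF _ ennreal_less_top])
qed

text \<open>Near each point of the closure, A lies on a level set that is a Lipschitz graph over the
  other coordinates. As the closure is compact, finitely many such pieces suffice; local graphs up
  to the closure are what makes the area finite.\<close>

lemma hausdorff_outer_hypersurface:
 fixes A :: "(real^'n::finite) set"
 assumes A: "bounded A" and loc: "smooth_up_to_edge A"
 shows "hcod A < \<infinity>"
proof -
 have ex: "EX U. open U & y : U & hcod (A Int U) < \<infinity>" if y: "y : closure A" for y
 proof -
  obtain W ph k0 where W: "open W" "y : W" "C1_on W ph" "partial k0 ph y ~= 0" "A Int W \<subseteq> {z. ph z = 0}"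
   using loc y unfolding smooth_up_to_edge_def by blast
  \<comment> \<open>\<open>chart\<close> is formulated for a domain; the sublevel set of ph itself
    serves as one.\<close>
  have W0: "{z : W. ph z < 0} Int W = {z : W. ph z < 0}" by auto
  obtain r k si m where ch: "chart {z : W. ph z < 0} W ph y r k si m"
   using chart_exists[OF W(1,2,3) W0 W(4) open_UNIV UNIV_I] unfolding Int_UNIV_right by metis
  have r: "r > 0" "m > 0" "\<bar>si\<bar> = 1" and cW: "cube y (2 * r) \<subseteq> W"
   and m: "!!z. z : cube y (2 * r) ==> m <= si * partial k ph z" "!!z. z : cube y (2 * r) ==> norm (grad ph z) <= 4 * real CARD('n) * m"
   using ch by (auto simp: chart_def)
  have cr: "cube y r \<subseteq> cube y (2 * r)" using r by (intro cube_mono) auto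
  have pd: "partial_differentiable p ph z" if "z : cube y r" for p z using W(3) cW cr that by (auto simp: C1_on_def)
  have "hcod (A Int cube y r) < \<infinity>"
  proof (rule hausdorff_outer_lipschitz_graph[where L = "4 * real CARD('n)" and y = y and r = r and k = k])
   fix p q assume pq: "p : A Int cube y r" "q : A Int cube y r"
   have z: "ph p = 0" "ph q = 0" using pq W(5) cW cr by auto
   define v where "v = (\<chi> i. if i : - {k} then q $ i else p $ i)"
   have B: "\<bar>partial j ph z\<bar> <= 4 * real CARD('n) * m" if "z : cube y r" for j z
    using m(2)[of z] cr that component_le_norm_cart[of "grad ph z" j] by (auto simp: grad_def)
   have 1: "\<bar>ph v - ph p\<bar> <= 4 * real CARD('n) * m * (\<Sum>i\<in>- {k}. \<bar>q $ i - p $ i\<bar>)"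
    unfolding v_def by (rule c1_increment_le[OF pd B]) (use pq in auto)
   have seg: "v + t *\<^sub>R axis k 1 : cube y r" if "t : closed_segment 0 (q $ k - p $ k)" for t
   proof -
    have "\<bar>(v + t *\<^sub>R axis k 1) $ i - y $ i\<bar> <= r" for i
    proof (cases "i = k")
     case True
     have "\<bar>p $ k - y $ k\<bar> <= r" "\<bar>q $ k - y $ k\<bar> <= r" using pq by (auto simp: cube_def)
     thus ?thesis using that True by (auto simp: v_def axis_def closed_segment_eq_real_ivl split: if_splits)
    next
     case False thus ?thesis using pq by (auto simp: cube_def v_def axis_def)
    qed
    thus ?thesis by (simp add: cube_def)
   qed
   obtain t where t: "t : closed_segment 0 (q $ k - p $ k)"
    "ph (v + (q $ k - p $ k) *\<^sub>R axis k 1) - ph v = (q $ k - p $ k) * partial k ph (v + t *\<^sub>R axis k 1)"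
    by (rule partial_mvt[of "q $ k - p $ k" k ph v]) (use pd seg in auto)
   have "v + (q $ k - p $ k) *\<^sub>R axis k 1 = q" by (auto simp: v_def vec_eq_iff axis_def)
   hence "\<bar>q $ k - p $ k\<bar> * \<bar>partial k ph (v + t *\<^sub>R axis k 1)\<bar> = \<bar>ph v - ph p\<bar>" using t(2) z by (simp add: abs_mult[symmetric])
   moreover have "m <= \<bar>partial k ph (v + t *\<^sub>R axis k 1)\<bar>"
   proof -
    have "m <= si * partial k ph (v + t *\<^sub>R axis k 1)" using m(1) seg[OF t(1)] cr by auto
    also have "... <= \<bar>si * partial k ph (v + t *\<^sub>R axis k 1)\<bar>" by simp
    finally show ?thesis using r(3) by (simp add: abs_mult)
   qed
   ultimately have "\<bar>q $ k - p $ k\<bar> * m <= \<bar>ph v - ph p\<bar>" by (metis abs_ge_zero mult_left_mono)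
   also note 1
   finally have "m * \<bar>q $ k - p $ k\<bar> <= m * (4 * real CARD('n) * (\<Sum>i\<in>- {k}. \<bar>q $ i - p $ i\<bar>))" by (simp add: mult_ac)
   thus "\<bar>p $ k - q $ k\<bar> <= 4 * real CARD('n) * (\<Sum>i\<in>- {k}. \<bar>p $ i - q $ i\<bar>)" using r(2) by (simp add: abs_minus_commute)
  qed (use r in auto)
  moreover have "hcod (A Int ball y r) <= hcod (A Int cube y r)"
   using ball_subset_cube[of y r] by (intro hausdorff_outer_mono) auto
  ultimately have "hcod (A Int ball y r) < \<infinity>" by (rule le_less_trans[rotated])
  thus ?thesis using r by (intro exI[of _ "ball y r"]) auto
 qed
 have "EX U. ALL y:closure A. open (U y) & y : U y & hcod (A Int U y) < \<infinity>"
  by (rule bchoice) (intro ballI ex)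
 then obtain U where U: "ALL y:closure A. open (U y) & y : U y & hcod (A Int U y) < \<infinity>" ..
 have cpt: "compact (closure A)" using A by simp
 have cov: "closure A \<subseteq> (\<Union>y\<in>closure A. U y)" using U by blast
 obtain Y where Y: "Y \<subseteq> closure A" "finite Y" "closure A \<subseteq> (\<Union>y\<in>Y. U y)"
  by (rule compactE_image[OF cpt _ cov]) (use U in auto)
 have "hcod (\<Union>y\<in>Y. A Int U y) < \<infinity>"
  using Y(2,1)
 proof (induction Y rule: finite_induct)
  case (insert y Y)
  have "hcod (\<Union>y\<in>insert y Y. A Int U y)
    <= hcod (A Int U y) + hcod (\<Union>y\<in>Y. A Int U y)"
   using hausdorff_outer_Un[of "CARD('n) - 1" "A Int U y" "\<Union>y\<in>Y. A Int U y"] by simp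
  also have "... < \<infinity>" using insert U by (auto simp: ennreal_add_less_top)
  finally show ?case .
 qed simp
 moreover have "A = (\<Union>y\<in>Y. A Int U y)" using Y(3) closure_subset[of A] by auto
 ultimately show ?thesis by simp
qed

lemma component_C1:
 fixes k :: "'n::finite"
 shows "C1_on W (%z :: real^'n. c * z $ k)" "partial p (%z :: real^'n. c * z $ k) y = (if p = k then c else 0)"
proof -
 have d: "((%t. c * (x + t *\<^sub>R axis p 1) $ k) has_real_derivative (if p = k then c else 0)) (at 0)" for x :: "real^'n" and p
  by (auto simp: axis_def intro!: derivative_eq_intros)
 have "partial_differentiable p (%z :: real^'n. c * z $ k) x & partial p (%z. c * z $ k) x = (if p = k then c else 0)" for p x
  by (rule partialI[OF d])
 thus "C1_on W (%z :: real^'n. c * z $ k)" "partial p (%z :: real^'n. c * z $ k) y = (if p = k then c else 0)"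
  by (auto simp: C1_on_def)
qed

lemma half_space_domain_facts:
 fixes D \<Sigma> S :: "(real^'n::{finite,linorder}) set"
 assumes dom: "half_space_domain D \<Sigma> S"
 shows "open D" "bounded D" "D ~= {}" and half_space_pos: "!!x. x : D ==> 0 < last_coord x"
  and half_space_S: "S = {y : frontier D. 0 < last_coord y}"
  and half_space_edge: "compact (\<Sigma> Int closure S)" "\<Sigma> Int closure S \<subseteq> frontier D" "hcod (\<Sigma> Int closure S) = 0"
  and half_space_regular: "!!y. y : frontier D - \<Sigma> Int closure S ==>
   EX W ph k. open W & y : W & C1_on W ph & D Int W = {z : W. ph z < 0} & partial k ph y ~= 0"
  and half_space_finite: "emeasure (hausdorff_measure (CARD('n) - 1)) (frontier D) < \<infinity>"
proof -
 have D: "open D" "bounded D" "D ~= {}" and fr: "frontier D = \<Sigma> Un S"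
  and \<Sigma>: "!!y. y : \<Sigma> ==> last_coord y = 0" and S: "!!y. y : S ==> last_coord y > 0" "!!y. y : S ==> EX v. unit_outward_normal D y v"
  and sm: "smooth_up_to_edge S" and nul: "emeasure (hausdorff_measure (CARD('n) - 1)) (\<Sigma> Int closure S) = 0"
  using dom by (auto simp: half_space_domain_def)
 show "open D" "bounded D" "D ~= {}" by fact+
 define N where "N = (Max UNIV :: 'n)"
 have lc: "last_coord x = x $ N" for x :: "(real, 'n) vec" by (simp add: last_coord_def N_def)
 have clc: "continuous_on T (%x :: (real, 'n) vec. x $ N)" for T by (intro continuous_intros)
 \<comment> \<open>The height attains its minimum over the closure, but not inside D, where one can
   still move down. So it is attained on the frontier, where the height is nonnegative.\<close>
 show pos: "0 < last_coord x" if x: "x : D" for x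
 proof -
  have "compact (closure D)" "closure D ~= {}" using D by auto
  from continuous_attains_inf[OF this clc]
  obtain y where y: "y : closure D" "!!z. z : closure D ==> y $ N <= z $ N" by auto
  have low: False if "z : D" "z $ N <= y $ N" for z
  proof -
   obtain e where e: "e > 0" "cball z e \<subseteq> D" using D(1) \<open>z : D\<close> open_contains_cball by blast
   have "z - e *\<^sub>R axis N 1 : cball z e" using e by (simp add: dist_norm)
   hence "z - e *\<^sub>R axis N 1 : closure D" using e closure_subset by blast
   from y(2)[OF this] show False using that e by simp
  qed
  hence "y ~: D" by blast
  hence "y : frontier D" using y D by (simp add: frontier_def interior_open)
  hence "0 <= y $ N" using fr \<Sigma> S(1) by (force simp: lc)
  thus ?thesis using low[OF x] by (force simp: lc)
 qed
 show Seq: "S = {y : frontier D. 0 < last_coord y}" using fr \<Sigma> S(1) by force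
 have \<Sigma>eq: "\<Sigma> = frontier D Int {y. y $ N = 0}" using fr \<Sigma> S(1) by (force simp: lc)
 have "closed {y :: (real, 'n) vec. y $ N = 0}" by (intro closed_Collect_eq clc continuous_on_const)
 hence \<Sigma>c: "compact \<Sigma>" unfolding \<Sigma>eq by (intro compact_Int_closed compact_frontier_bounded D)
 show "compact (\<Sigma> Int closure S)" by (intro compact_Int_closed \<Sigma>c) simp
 hence "\<Sigma> Int closure S : sets borel" by (rule borel_compact)
 from emeasure_hausdorff_measure[OF this] nul show "hcod (\<Sigma> Int closure S) = 0" by simp
 show "\<Sigma> Int closure S \<subseteq> frontier D" using fr by auto
 show "EX W ph k. open W & y : W & C1_on W ph & D Int W = {z : W. ph z < 0} & partial k ph y ~= 0"
  if y: "y : frontier D - \<Sigma> Int closure S" for y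
 proof (cases "y : S")
  case True
  then obtain v where "unit_outward_normal D y v" using S(2) by blast
  then obtain W ph where W: "open W" "y : W" "C1_on W ph" "D Int W = {z : W. ph z < 0}" "(\<chi> k. partial k ph y) ~= 0"
   unfolding unit_outward_normal_def Let_def by blast
  from W(5) obtain k where "partial k ph y ~= 0" by (auto simp: vec_eq_iff)
  thus ?thesis using W by blast
 next
  case False
  hence y\<Sigma>: "y : \<Sigma>" "y : - closure S" using y fr by auto
  then obtain e where e: "e > 0" "ball y e \<subseteq> - closure S" using open_contains_ball[of "- closure S"] by auto
  \<comment> \<open>A frontier point in the upper half ball would have positive height and so lie on
    S, from which the ball is disjoint. Hence the half ball, being connected and meeting D, lies in
    D.\<close>
  define Hp where "Hp = ball y e Int {z. axis N 1 \<bullet> z > 0}"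
  have Hpi: "z : Hp \<longleftrightarrow> z : ball y e & z $ N > 0" for z by (simp add: Hp_def inner_axis')
  have con: "connected Hp" unfolding Hp_def by (intro convex_connected convex_Int convex_ball convex_halfspace_gt)
  have nf: "Hp Int frontier D = {}"
  proof (rule ccontr)
   assume "Hp Int frontier D ~= {}"
   then obtain z where z: "z : Hp" "z : frontier D" by blast
   hence "z : S" using Seq by (simp add: Hpi lc)
   thus False using z e closure_subset[of S] by (auto simp: Hpi)
  qed
  have "y : closure D" using y by (simp add: frontier_def)
  moreover have "y : ball y e" using e by simp
  ultimately have "ball y e Int D ~= {}" using open_Int_closure_eq_empty[of "ball y e" D] by blast
  hence "Hp Int D ~= {}" using pos by (force simp: Hpi lc)
  hence sub: "Hp \<subseteq> D" using connected_Int_frontier[OF con, of D] nf by blast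
  have "D Int ball y e = {z : ball y e. (- 1) * z $ N < 0}" using sub pos by (auto simp: Hpi lc subset_iff)
  thus ?thesis using e component_C1(1)[where W = "ball y e" and c = "- 1" and k = N] component_C1(2)[where p = N and c = "- 1" and k = N and y = y]
   by (intro exI[of _ "ball y e"] exI[of _ "%z. (- 1) * z $ N"] exI[of _ N]) auto
 qed
 have bS: "bounded (frontier D)" by (rule compact_imp_bounded[OF compact_frontier_bounded[OF D(2)]])
 have hS: "hcod S < \<infinity>"
  by (rule hausdorff_outer_hypersurface[OF bounded_subset[OF bS] sm]) (use fr in auto)
 have h\<Sigma>: "hcod \<Sigma> < \<infinity>"
 proof (rule hausdorff_outer_hypersurface[OF bounded_subset[OF bS]])
  show "smooth_up_to_edge \<Sigma>"
   unfolding smooth_up_to_edge_def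
  proof (intro ballI exI conjI)
   show "C1_on UNIV (%z :: (real, 'n) vec. 1 * z $ N)" by (rule component_C1)
   show "partial N (%z :: (real, 'n) vec. 1 * z $ N) y ~= 0" for y unfolding component_C1(2) by simp
  qed (auto simp: \<Sigma>eq)
 qed (use fr in auto)
 have "emeasure (hausdorff_measure (CARD('n) - 1)) (frontier D) = hcod (\<Sigma> Un S)"
  unfolding fr[symmetric] by (intro emeasure_hausdorff_measure borel_closed frontier_closed)
 also have "... <= hcod \<Sigma> + hcod S" by (rule hausdorff_outer_Un)
 also have "... < \<infinity>" using hS h\<Sigma> by (simp add: ennreal_add_less_top)
 finally show "emeasure (hausdorff_measure (CARD('n) - 1)) (frontier D) < \<infinity>" .
qed

section \<open>Two-constants estimates on a rectangle\<close>

lemma sin_pi_ge: "0 <= t ==> t <= 1/2 ==> t <= sin (pi * (t::real))"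
proof -
 assume t: "0 <= t" "t <= 1/2"
 define x where "x = pi * t"
 have x: "0 <= x" "x <= 8/5" using t pi_approx mult_mono[of pi "16/5" t "1/2"] by (auto simp: x_def)
 have "\<bar>sin x - (\<Sum>m<3. sin_coeff m * x ^ m)\<bar> <= inverse (fact 3) * \<bar>x\<bar> ^ 3" by (rule Maclaurin_sin_bound)
 moreover have "(\<Sum>m<3. sin_coeff m * x ^ m) = x" "inverse (fact 3) * \<bar>x\<bar> ^ 3 = x ^ 3 / 6"
  using x by (simp_all add: numeral_3_eq_3 sin_coeff_def fact_numeral)
 ultimately have "\<bar>sin x - x\<bar> <= x ^ 3 / 6" by (simp only:)
 hence "x - x ^ 3 / 6 <= sin x" by linarith
 moreover have "x ^ 3 <= (8/5)^2 * x" using power_mono[of x "8/5" 2] x mult_right_mono[of "x^2" "(8/5)^2" x] by (simp add: power3_eq_cube power2_eq_square)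
 ultimately have "x / 2 <= sin x" using x by (simp add: power2_eq_square)
 moreover have "t <= x / 2" using t pi_ge_two mult_right_mono[of 2 pi t] by (simp add: x_def)
 ultimately show ?thesis by (simp add: x_def)
qed

text \<open>The conditions are invariant under z -> Y - z together with xn -> Y - xn. It therefore
  suffices to estimate h at points of the left half.\<close>

definition rect_bounds :: "nat => nat => real => real => real => real => real => real => (complex => complex) => bool" where
 "rect_bounds n N R ta eta Y xn P h \<longleftrightarrow> h holomorphic_on {z. eta <= Re z & Re z <= Y - eta} \<and>
  (ALL z. \<bar>Im z\<bar> <= R --> (Re z = eta --> norm (h z) <= P * (xn / eta) ^ n * (norm z / eta) ^ N) \<and>
    (Re z = Y - eta --> norm (h z) <= P * ((Y - xn) / eta) ^ n * (norm (of_real Y - z) / eta) ^ N)) \<and>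
  (ALL z. eta <= Re z --> Re z <= Y - eta --> \<bar>Im z\<bar> = R --> norm (h z) <= P * exp (- ta * Re z) | norm (h z) <= P * exp (- ta * (Y - Re z)))"

lemma rect_bounds_reflect:
 assumes "rect_bounds n N R ta eta Y xn P h"
 shows "rect_bounds n N R ta eta Y (Y - xn) P (%z. h (of_real Y - z))"
proof -
 note * = assms[unfolded rect_bounds_def]
 have "(h \<circ> (%z. of_real Y - z)) holomorphic_on {z. eta <= Re z & Re z <= Y - eta}"
  using * by (intro holomorphic_on_compose_gen[where t = "{z. eta <= Re z & Re z <= Y - eta}"] holomorphic_intros) auto
 moreover have "\<bar>Im (of_real Y - z)\<bar> = \<bar>Im z\<bar>" "Re (of_real Y - z) = Y - Re z" for z by auto
 moreover have "norm (h (of_real Y - z)) <= P * exp (- ta * Re z) | norm (h (of_real Y - z)) <= P * exp (- ta * (Y - Re z))"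
  if "eta <= Re z" "Re z <= Y - eta" "\<bar>Im z\<bar> = R" for z
  using *[THEN conjunct2, THEN conjunct2, THEN spec, of "of_real Y - z"] that by auto
 ultimately show ?thesis unfolding rect_bounds_def
  using *[THEN conjunct2, THEN conjunct1, THEN spec, of "of_real Y - _"] by (auto simp: o_def)
qed

lemma half_rectangle_bound:
 fixes X R L0 :: real and n N :: nat
 assumes X: "X > 0" "R > 0" "L0 > 0"
 obtains C where "C > 0"
  "!!h L eta xn P. L >= L0 ==> eta = X / (L + 1) ==> P >= 0 ==> eta <= xn ==> 2 * xn <= X + 2 * eta ==>
   rect_bounds n N R (L / X) eta (X + 2 * eta) xn P h ==> norm (h (of_real xn)) <= C * P"
proof -
 \<comment> \<open>This makes e times the real part of the sine at most the distance to either of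
   the lines Re z = 0 and Re z = Y: the cosh bounds its growth in Im z, and X <= Y.\<close>
 define e where "e = X / (pi * cosh (pi * R / X))"
 define c where "c = L0 / (L0 + 1) * e / (3 * X)"
 have e0: "e > 0" and c0: "c > 0" using X by (simp_all add: e_def c_def)
 \<comment> \<open>The total power of xn / eta to be absorbed: n from the bound on the boundary, and
   n and N from undoing the two auxiliary factors at xn.\<close>
 define k where "k = 2 * n + N"
 \<comment> \<open>3 bounds e; the two summands serve the vertical and the horizontal sides.\<close>
 define A where "A = 3 * ((1 / X) ^ N + (X / R^2) ^ N)"
 have A0: "A > 0" using X by (simp add: A_def add_pos_nonneg)
 show thesis
 proof (rule that[of "A * (3 * X) ^ N * (fact k / c ^ k)"])
  show "A * (3 * X) ^ N * (fact k / c ^ k) > 0" using X A0 c0 by simp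
  fix h L eta xn P
  assume L: "L >= L0" and eta: "eta = X / (L + 1)" and P: "P >= 0" and xn: "eta <= xn" "2 * xn <= X + 2 * eta"
   and "rect_bounds n N R (L / X) eta (X + 2 * eta) xn P h"
  define Y where "Y = X + 2 * eta"
  define ta where "ta = L / X"
  note h = \<open>rect_bounds n N R (L / X) eta (X + 2 * eta) xn P h\<close>[folded Y_def ta_def, unfolded rect_bounds_def]
  have L1: "L > 0" using L X by simp
  have et: "eta > 0" "eta <= X" using X L1 by (auto simp: eta field_simps)
  have Y: "X <= Y - eta" "Y <= 3 * X" "Y > 0" using et by (auto simp: Y_def)
  have ta: "ta > 0" "ta * eta <= 1" using X L1 by (auto simp: ta_def eta)
  define u where "u = xn / eta"
  have u: "u >= 1" using xn et by (simp add: u_def)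
  define S where "S z = sin (of_real (pi / Y) * z)" for z :: complex
 \<comment> \<open>\<open>(eta / z)^n\<close> cancels \<open>((Y - xn) / eta)^n\<close> on the right side, and the last factor the growth in \<open>z\<close>
       on both vertical sides.  The powers of \<open>xn / eta\<close> which they cost at \<open>xn\<close> are paid for by the sine.\<close>
  define H where "H z = h z * exp (of_real (ta * e) * S z) * (of_real eta / z) ^ n * (of_real eta / (z * (of_real Y - z))) ^ N" for z
  define Q where "Q = cbox (Complex eta (- R)) (Complex (Y - eta) R)"
  have Qi: "z : Q \<longleftrightarrow> eta <= Re z & Re z <= Y - eta & \<bar>Im z\<bar> <= R" for z by (auto simp: Q_def in_cbox_complex_iff)
  have ab: "Re z <= norm z" "Y - Re z <= norm (of_real Y - z)" for z
   using complex_Re_le_cmod[of z] complex_Re_le_cmod[of "of_real Y - z"] by auto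
  have hol: "H holomorphic_on Q"
  proof -
   have "z ~= 0" "of_real Y - z ~= 0" if "z : Q" for z using that et ab[of z] by (auto simp: Qi)
   moreover have "h holomorphic_on Q" using h by (elim conjE holomorphic_on_subset) (auto simp: Qi)
   ultimately show ?thesis unfolding H_def[abs_def] S_def[abs_def] by (intro holomorphic_intros) auto
  qed
  have ReS: "Re (S z) = sin (pi * Re z / Y) * cosh (pi * Im z / Y)" for z
   unfolding S_def Re_sin by (simp add: cosh_def)
  have nH: "norm (H z) = norm (h z) * exp (ta * (e * Re (S z))) * (eta / norm z) ^ n * (eta / (norm z * norm (of_real Y - z))) ^ N" for z
   using et by (simp add: H_def norm_mult norm_power norm_divide mult.assoc)
  have es: "e * Re (S z) <= Re z" "e * Re (S z) <= Y - Re z" if z: "z : Q" for z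
  proof -
   have r: "0 <= Re z" "Re z <= Y" using z et by (auto simp: Qi)
   have "\<bar>pi * Im z / Y\<bar> <= pi * R / X" using z X Y et by (auto simp: Qi abs_mult intro!: frac_le mult_left_mono)
   hence "cosh \<bar>pi * Im z / Y\<bar> <= cosh (pi * R / X)" using X by (subst cosh_real_nonneg_le_iff) auto
   hence ch: "cosh (pi * Im z / Y) <= cosh (pi * R / X)" by (simp only: cosh_real_abs)
   have main: "e * Re (S z) <= t" if t: "sin (pi * Re z / Y) = sin (pi * t / Y)" "0 <= t" "t <= Y" for t
   proof -
    have "0 <= sin (pi * t / Y)" using t Y by (intro sin_ge_zero) (auto simp: field_simps)
    moreover have "sin (pi * t / Y) <= pi * t / Y" using t Y by (intro sin_x_le_x) auto
    ultimately have "e * Re (S z) <= e * (pi * t / Y * cosh (pi * R / X))"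
     unfolding ReS t(1) using e0 ch t Y by (intro mult_left_mono mult_mono) auto
    also have "... = X * t / Y" by (simp add: e_def)
    also have "... <= t" using t Y et by (simp add: field_simps mult_right_mono)
    finally show ?thesis .
   qed
   show "e * Re (S z) <= Re z" by (rule main) (use r in auto)
   have "pi * (Y - Re z) / Y = pi - pi * Re z / Y" using Y by (simp add: field_simps)
   thus "e * Re (S z) <= Y - Re z" by (intro main) (use r in auto)
  qed
  have un: "1 <= u ^ n" using u by (rule one_le_power)
  have B: "3 * P * u ^ n * (1 / X) ^ N <= A * P * u ^ n" "P * (X / R^2) ^ N <= A * P * u ^ n"
  proof -
   show "3 * P * u ^ n * (1 / X) ^ N <= A * P * u ^ n" using P u X by (simp add: A_def algebra_simps)
   have "(X / R^2) ^ N * P * 1 <= A * P * u ^ n"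
    using P u X un A0 by (intro mult_mono mult_right_mono) (auto simp: A_def)
   thus "P * (X / R^2) ^ N <= A * P * u ^ n" by (simp add: mult.commute)
  qed
  have side: "norm (H z) <= A * P * u ^ n"
   if "norm (h z) * (eta / norm z) ^ n <= P * u ^ n * (t / eta) ^ N" "norm z * norm (of_real Y - z) = t * s" "0 < t" "X <= s" "e * Re (S z) <= eta" for z t s
  proof -
   have "ta * (e * Re (S z)) <= 1" using ta mult_left_mono[OF that(5), of ta] by linarith
   hence "exp (ta * (e * Re (S z))) <= exp 1" by simp
   hence "exp (ta * (e * Re (S z))) <= 3" using exp_le by linarith
   hence "norm (H z) <= P * u ^ n * (t / eta) ^ N * 3 * (eta / (t * s)) ^ N"
    unfolding nH that(2)[symmetric] using that P u et mult_mono[OF that(1), of "exp (ta * (e * Re (S z)))" 3]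
    by (intro mult_right_mono) (auto simp: mult_ac)
   also have "... = 3 * P * u ^ n * ((t / eta) ^ N * (eta / (t * s)) ^ N)" by (simp only: mult_ac)
   also have "(t / eta) ^ N * (eta / (t * s)) ^ N = (1 / s) ^ N"
    unfolding power_mult_distrib[symmetric] using that et by simp
   also have "3 * P * u ^ n * (1 / s) ^ N <= 3 * P * u ^ n * (1 / X) ^ N" using that P u X by (intro mult_left_mono power_mono frac_le) auto
   finally show ?thesis using B by linarith
  qed
  have bnd: "norm (H z) <= A * P * u ^ n" if z: "z : Q" and fr: "Re z = eta | Re z = Y - eta | \<bar>Im z\<bar> = R" for z
  proof -
   note zz = z[unfolded Qi]
   have a: "eta <= norm z" "eta <= norm (of_real Y - z)" using ab[of z] zz by auto
   have a1: "(eta / norm z) ^ n <= 1" using a et by (intro power_le_one) (auto simp: divide_le_eq_1)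
   consider "Re z = eta" | "Re z = Y - eta" | "\<bar>Im z\<bar> = R" using fr by blast
   thus ?thesis
   proof cases
    case 1
    have "norm (h z) * (eta / norm z) ^ n <= P * u ^ n * (norm z / eta) ^ N * 1"
     using h zz 1 a1 P u et by (intro mult_mono) (auto simp: u_def)
    thus ?thesis by (intro side[OF _ refl]) (use a et ab[of z] 1 Y es[OF z] in auto)
   next
    case 2
    have "norm (h z) * (eta / norm z) ^ n <= P * ((Y - xn) / eta) ^ n * (norm (of_real Y - z) / eta) ^ N * (eta / norm z) ^ n"
     using h zz 2 et by (intro mult_right_mono) auto
    also have "... = P * ((Y - xn) / norm z) ^ n * (norm (of_real Y - z) / eta) ^ N"
     using et by (simp add: power_divide)
    also have "... <= P * u ^ n * (norm (of_real Y - z) / eta) ^ N"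
    proof (intro mult_right_mono mult_left_mono P)
     have "((Y - xn) / norm z) ^ n <= 1" using 2 ab[of z] a et xn by (intro power_le_one) (auto simp: divide_le_eq_1 Y_def)
     thus "((Y - xn) / norm z) ^ n <= u ^ n" using un by linarith
    qed (use et in auto)
    finally show ?thesis by (rule side[OF _ mult.commute]) (use a et ab[of z] 2 Y es[OF z] in auto)
   next
    case 3
    have "norm (h z) * exp (ta * (e * Re (S z))) <= P"
    proof -
     have "norm (h z) * exp (ta * (e * Re (S z))) <= P" if "norm (h z) <= P * exp (- ta * t)" "e * Re (S z) <= t" for t
     proof -
      have "norm (h z) * exp (ta * (e * Re (S z))) <= P * exp (- ta * t) * exp (ta * t)"
       using that ta P by (intro mult_mono) auto
      thus ?thesis by (simp add: exp_minus mult.assoc)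
     qed
     thus ?thesis using h zz 3 es[OF z] by blast
    qed
    moreover have "eta / (norm z * norm (of_real Y - z)) <= X / R^2"
    proof -
     have "R <= norm z" "R <= norm (of_real Y - z)"
      using 3 abs_Im_le_cmod[of z] abs_Im_le_cmod[of "of_real Y - z"] by auto
     hence "R * R <= norm z * norm (of_real Y - z)" using X by (intro mult_mono) auto
     thus ?thesis unfolding power2_eq_square using et X by (intro frac_le) auto
    qed
    ultimately have "norm (H z) <= P * 1 * (X / R^2) ^ N"
     unfolding nH using a1 P et by (intro mult_mono power_mono) auto
    thus ?thesis using B by simp
   qed
  qed
  have "norm (H (of_real xn)) <= A * P * u ^ n"
  proof (rule maximum_modulus_frontier[of H Q])
   show "H holomorphic_on interior Q" by (rule holomorphic_on_subset[OF hol interior_subset])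
   show "continuous_on (closure Q) H" using holomorphic_on_imp_continuous_on[OF hol] by (simp add: Q_def)
   show "bounded Q" by (simp add: Q_def)
   show "norm (H z) <= A * P * u ^ n" if "z : frontier Q" for z
   proof -
    have "z : Q" "z ~: box (Complex eta (- R)) (Complex (Y - eta) R)" using that by (auto simp: Q_def frontier_cbox)
    thus ?thesis by (intro bnd) (auto simp: Qi in_box_complex_iff)
   qed
   show "of_real xn : Q" using xn X et by (auto simp: Qi Y_def)
  qed
  define E where "E = exp (ta * (e * sin (pi * xn / Y)))"
  have E: "E > 0" "1 / E <= exp (- c * u)"
  proof -
   have "c * u <= L / (L + 1) * e / Y * u"
   proof -
    have "L0 / (L0 + 1) <= L / (L + 1)" using L L1 X by (simp add: field_simps)
    hence "L0 / (L0 + 1) * e <= L / (L + 1) * e" using e0 by (intro mult_right_mono) auto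
    hence "L0 / (L0 + 1) * e / (3 * X) <= L / (L + 1) * e / Y" by (rule frac_le[rotated]) (use e0 Y L1 in auto)
    thus ?thesis unfolding c_def using u by (intro mult_right_mono) auto
   qed
   also have "... = ta * (e * (xn / Y))" using X et L1 by (simp add: u_def ta_def eta)
   also have "... <= ta * (e * sin (pi * (xn / Y)))"
    using xn Y et e0 ta by (intro mult_left_mono sin_pi_ge) (auto simp: Y_def field_simps)
   finally show "1 / E <= exp (- c * u)" by (simp add: E_def exp_minus divide_inverse mult.assoc)
  qed (simp add: E_def)
  have "norm (h (of_real xn)) = norm (H (of_real xn)) * (1 / E) * u ^ n * (u * (Y - xn)) ^ N"
  proof -
   have "norm (complex_of_real Y - of_real xn) = Y - xn"
    using xn et X by (simp add: of_real_diff[symmetric] Y_def del: of_real_diff of_real_add)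
   thus ?thesis using xn et X E(1) unfolding nH ReS by (simp add: E_def u_def power_divide Y_def power_mult_distrib)
  qed
  also have "... <= A * P * u ^ n * exp (- c * u) * u ^ n * (u * (3 * X)) ^ N"
   using \<open>norm (H (of_real xn)) <= _\<close> E u xn Y P A0 et by (intro mult_mono power_mono) (auto simp: Y_def)
  also have "... = A * (3 * X) ^ N * P * (u ^ k * exp (- c * u))" by (simp add: k_def power_mult_distrib power_add power_mult power2_eq_square mult_ac)
  also have "u ^ k * exp (- c * u) <= fact k / c ^ k"
   using power_le_exp_fact[of "c * u" k] c0 u by (simp add: power_mult_distrib exp_minus field_simps)
  hence "A * (3 * X) ^ N * P * (u ^ k * exp (- c * u)) <= A * (3 * X) ^ N * P * (fact k / c ^ k)"
   using A0 X P by (intro mult_left_mono) auto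
  finally show "norm (h (of_real xn)) <= A * (3 * X) ^ N * (fact k / c ^ k) * P" by (simp add: mult_ac)
 qed
qed

definition strip_bounds :: "nat => nat => real => real => real => real => real => real => (complex => complex) => bool" where
 "strip_bounds n N X R L eta xn \<Phi> f \<longleftrightarrow> f holomorphic_on {z. eta / 2 < Re z} \<and>
  (ALL z. \<bar>Im z\<bar> <= R --> (Re z = eta --> norm (f z) <= \<Phi> * (xn / eta) ^ n * (norm z / eta) ^ N) \<and>
   (Re z = X + eta --> norm (f z) <= exp (- L) * \<Phi> * ((X + 2 * eta - xn) / eta) ^ n * (norm (of_real (X + 2 * eta) - z) / eta) ^ N)) \<and>
  (ALL z. eta <= Re z --> Re z <= X + eta --> \<bar>Im z\<bar> = R --> norm (f z) <= exp (- L) * \<Phi>)"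

text \<open>The factor exp (L z / X) makes the bounds 1 and exp (- L) on the two vertical sides
  comparable; dividing it out at xn produces the exponential in the conclusion. On the horizontal
  sides a decay towards the left is gained.\<close>

lemma two_constants:
 fixes X R L0 :: real and n N :: nat
 assumes X: "X > 0" "R > 0" "L0 > 0"
 obtains C where "C > 0"
  "!!f L eta \<Phi> xn. L >= L0 ==> eta = X / (L + 1) ==> \<Phi> >= 0 ==> eta <= xn ==> xn <= X ==> strip_bounds n N X R L eta xn \<Phi> f ==>
   norm (f (of_real xn)) <= C * exp (- L * xn / X) * \<Phi>"
proof -
 from half_rectangle_bound[OF X, of n N] obtain C where C: "C > 0"
  "!!h L eta xn P. L >= L0 ==> eta = X / (L + 1) ==> P >= 0 ==> eta <= xn ==> 2 * xn <= X + 2 * eta ==>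
   rect_bounds n N R (L / X) eta (X + 2 * eta) xn P h ==> norm (h (of_real xn)) <= C * P" by blast
 show thesis
 proof (rule that[of "C * 9"])
  show "C * 9 > 0" using C by simp
  fix f :: "complex => complex" and L eta \<Phi> xn :: real
  assume L: "L >= L0" and eta: "eta = X / (L + 1)" and \<Phi>: "\<Phi> >= 0" and xn: "eta <= xn" "xn <= X"
   and f: "strip_bounds n N X R L eta xn \<Phi> f"
  note f = f[unfolded strip_bounds_def]
  have et: "eta > 0" "L > 0" "L / X * eta <= 1" using X L by (auto simp: eta field_simps)
  have "exp (L / X * eta) <= exp 1" using et by simp
  hence e3: "exp (L / X * eta) <= 3" using exp_le by linarith
  define Y where "Y = X + 2 * eta"
  define h where "h z = f z * exp (of_real (L / X) * z)" for z
  have nh: "norm (h z) = norm (f z) * exp (L / X * Re z)" for z by (simp add: h_def norm_mult)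
  \<comment> \<open>exp (L eta / X) is at most 3. On the horizontal sides it occurs twice, because Y
    exceeds X by 2 eta; hence 9.\<close>
  have b9: "norm (h z) <= 9 * \<Phi> * a * b" if "norm (f z) * exp (L / X * Re z) <= \<Phi> * a * b * exp (L / X * eta)" "0 <= a" "0 <= b" for z a b
  proof -
   have "norm (h z) <= \<Phi> * a * b * 9" unfolding nh using e3 that \<Phi> by (intro order_trans[OF that(1)] mult_left_mono) auto
   thus ?thesis by (simp add: mult_ac)
  qed
  have rb: "rect_bounds n N R (L / X) eta Y xn (9 * \<Phi>) h"
   unfolding rect_bounds_def
  proof (intro conjI allI impI)
   have "f holomorphic_on {z. eta <= Re z & Re z <= Y - eta}" using f et by (elim conjE holomorphic_on_subset) auto
   thus "h holomorphic_on {z. eta <= Re z & Re z <= Y - eta}" unfolding h_def[abs_def] by (intro holomorphic_intros)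
   show "norm (h z) <= 9 * \<Phi> * (xn / eta) ^ n * (norm z / eta) ^ N" if "Re z = eta" "\<bar>Im z\<bar> <= R" for z
    using f that et xn \<Phi> by (intro b9 mult_mono) auto
   show "norm (h z) <= 9 * \<Phi> * ((Y - xn) / eta) ^ n * (norm (of_real Y - z) / eta) ^ N" if z: "Re z = Y - eta" "\<bar>Im z\<bar> <= R" for z
   proof (rule b9)
    have "norm (f z) * exp (L / X * Re z) <= exp (- L) * \<Phi> * ((Y - xn) / eta) ^ n * (norm (of_real Y - z) / eta) ^ N * exp (L / X * Re z)"
     using f z by (intro mult_right_mono) (auto simp: Y_def)
    also have "... = \<Phi> * ((Y - xn) / eta) ^ n * (norm (of_real Y - z) / eta) ^ N * (exp (- L) * exp (L / X * Re z))" by (simp add: mult_ac)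
    also have "exp (- L) * exp (L / X * Re z) = exp (L / X * eta)" unfolding exp_add[symmetric] using X z by (simp add: Y_def field_simps)
    finally show "norm (f z) * exp (L / X * Re z) <= \<Phi> * ((Y - xn) / eta) ^ n * (norm (of_real Y - z) / eta) ^ N * exp (L / X * eta)" .
   qed (use xn et in \<open>auto simp: Y_def\<close>)
   show "norm (h z) <= 9 * \<Phi> * exp (- (L / X) * Re z) | norm (h z) <= 9 * \<Phi> * exp (- (L / X) * (Y - Re z))"
    if z: "eta <= Re z" "Re z <= Y - eta" "\<bar>Im z\<bar> = R" for z
   proof (rule disjI2)
    have "norm (h z) <= exp (- L) * \<Phi> * exp (L / X * Re z)"
     unfolding nh using f z by (intro mult_right_mono) (auto simp: Y_def)
    also have "... = \<Phi> * (exp (L / X * eta) * exp (L / X * eta)) * exp (- (L / X) * (Y - Re z))"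
    proof -
     have "exp (- L) * exp (L / X * Re z) = exp (L / X * eta) * exp (L / X * eta) * exp (- (L / X) * (Y - Re z))"
      unfolding exp_add[symmetric] using X by (simp add: Y_def field_simps)
     thus ?thesis by (simp add: mult_ac)
    qed
    also have "... <= \<Phi> * 9 * exp (- (L / X) * (Y - Re z))"
     using \<Phi> mult_mono[OF e3 e3] by (intro mult_right_mono mult_left_mono) auto
    finally show "norm (h z) <= 9 * \<Phi> * exp (- (L / X) * (Y - Re z))" by (simp add: mult_ac)
   qed
  qed
  have "norm (h (of_real xn)) <= C * (9 * \<Phi>)"
  proof (cases "2 * xn <= Y")
   case True
   thus ?thesis using C(2)[OF L eta _ xn(1)] rb \<Phi> by (simp add: Y_def)
  next
   case False
   have "norm (h (of_real Y - of_real (Y - xn))) <= C * (9 * \<Phi>)"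
    unfolding Y_def by (rule C(2)[OF L eta _ _ _ rect_bounds_reflect[OF rb, unfolded Y_def]]) (use False xn \<Phi> et in \<open>auto simp: Y_def\<close>)
   thus ?thesis by simp
  qed
  hence "norm (f (of_real xn)) <= C * (9 * \<Phi>) * exp (- L * xn / X)" by (simp add: nh exp_minus field_simps)
  thus "norm (f (of_real xn)) <= C * 9 * exp (- L * xn / X) * \<Phi>" by (simp add: mult_ac)
 qed
qed

section \<open>The kernel with complexified height\<close>

context elastic
begin

definition sd :: "(real, 'n) vec => (real, 'n) vec => real" where
 "sd x y = sqrt (\<Sum>i\<in>-{NN}. (y $ i - x $ i)^2)"

definition lc :: "(real, 'n) vec => complex => (real, 'n) vec => complex" where
 "lc x z y = Ln (z - of_real (y $ NN) + \<i> * of_real (sd x y)) + Ln (z - of_real (y $ NN) - \<i> * of_real (sd x y))"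

text \<open>
  The squared distance factors as \<open>(z - y_n + i s) (z - y_n - i s)\<close> with \<open>s\<close> the horizontal distance;
  goodness keeps both factors off the branch cut of the logarithm.
\<close>
definition good :: "(real, 'n) vec => complex => (real, 'n) vec => bool" where
 "good x z y \<longleftrightarrow> y $ NN < Re z | sd x y < \<bar>Im z\<bar>"

lemma sd_nonneg: "0 <= sd x y" by (simp add: sd_def sum_nonneg)

lemma sd_sq: "(sd x y)^2 = (\<Sum>i\<in>-{NN}. (y $ i - x $ i)^2)" by (simp add: sd_def sum_nonneg)

lemma sum_NN: "(\<Oplus>i. f i) = f NN + (\<Sum>i\<in>-{NN}. f i)" for f :: "'n => 'a::comm_monoid_add"
 using sum.remove[of UNIV NN f] by (simp add: Compl_eq_Diff_UNIV)

lemma norm_diff_sq: "(norm (y - x))^2 = (y $ NN - x $ NN)^2 + (sd x y)^2" for x y :: "(real, 'n) vec"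
 unfolding sd_sq power2_norm_eq_inner inner_vec_def by (subst sum_NN) (simp add: power2_eq_square)

lemma sd_le: "sd x y <= norm (y - x)"
 by (rule power2_le_imp_le) (simp_all add: norm_diff_sq)

lemma norm_KX_sq: "(norm (KX x z y))^2 = (norm (z - of_real (y $ NN)))^2 + (sd x y)^2"
proof -
 have "(norm (KX x z y))^2 = (\<Oplus>i. (norm (KX x z y $ i))^2)" by (simp add: norm_vec_def L2_set_def sum_nonneg)
 also have "... = (norm (z - of_real (y $ NN)))^2 + (sd x y)^2"
  unfolding sd_sq by (subst sum_NN) (simp add: KX_def norm_minus_commute norm_power[symmetric] del: of_real_diff)
 finally show ?thesis .
qed

lemma sq_sum_KX:
 "sq_sum (KX x z y) = (z - of_real (y $ NN) + \<i> * of_real (sd x y)) * (z - of_real (y $ NN) - \<i> * of_real (sd x y))"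
proof -
 have "(\<Sum>i\<in>-{NN}. (KX x z y $ i)^2) = complex_of_real (\<Sum>i\<in>-{NN}. (y $ i - x $ i)^2)"
  by (simp add: KX_def)
 hence "(\<Sum>i\<in>-{NN}. (KX x z y $ i)^2) = (of_real (sd x y))^2" unfolding sd_sq[symmetric] by simp
 hence "sq_sum (KX x z y) = (z - of_real (y $ NN))^2 + (of_real (sd x y))^2"
  unfolding sq_sum_def by (subst sum_NN) (simp add: KX_def power2_commute)
 thus ?thesis by (simp add: power2_eq_square algebra_simps)
qed

lemma good_slit:
 assumes "good x z y"
 shows "z - of_real (y $ NN) + \<i> * of_real (sd x y) ~: \<real>\<^sub>\<le>\<^sub>0" "z - of_real (y $ NN) - \<i> * of_real (sd x y) ~: \<real>\<^sub>\<le>\<^sub>0"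
 using assms sd_nonneg[of x y] by (auto simp: good_def complex_nonpos_Reals_iff)

lemma exp_lc: "good x z y ==> exp (lc x z y) = sq_sum (KX x z y)"
 using good_slit[of x z y] unfolding lc_def sq_sum_KX exp_add by (subst (1 2) exp_Ln) auto

text \<open>With bounded imaginary part, the logarithmic factor in \<open>W\<close> is controlled by
  the modulus of s alone.\<close>

lemma Im_lc: "\<bar>Im (lc x z y)\<bar> <= 2 * pi" if "good x z y"
proof -
 have n: "z - of_real (y $ NN) + \<i> * of_real (sd x y) ~= 0" "z - of_real (y $ NN) - \<i> * of_real (sd x y) ~= 0" using good_slit[OF that] by auto
 show ?thesis using mpi_less_Im_Ln[OF n(1)] Im_Ln_le_pi[OF n(1)] mpi_less_Im_Ln[OF n(2)] Im_Ln_le_pi[OF n(2)]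
  unfolding lc_def plus_complex.sel by linarith
qed

lemma continuous_on_sd:
 assumes "continuous_on T g" shows "continuous_on T (%u. sd x (g u))"
proof -
 have "continuous_on T (%u. g u $ i)" for i by (rule continuous_on_component[OF assms])
 thus ?thesis unfolding sd_def
  by (intro continuous_on_real_sqrt continuous_on_sum continuous_on_power continuous_on_diff continuous_on_const)
qed

lemma continuous_on_lc:
 assumes "continuous_on T f" "continuous_on T g" "!!u. u : T ==> good x (f u) (g u)"
 shows "continuous_on T (%u. lc x (f u) (g u))"
proof -
 have c: "continuous_on T (%u. g u $ NN)" by (rule continuous_on_component[OF assms(2)])
 show ?thesis unfolding lc_def using good_slit[OF assms(3)]
  by (intro continuous_on_add continuous_on_Ln' continuous_on_diff continuous_on_mult continuous_on_of_real continuous_on_sd assms(1,2) c continuous_on_const) auto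
qed

lemma branch_lc: "open Om ==> (!!y. y : Om ==> good x z y) ==> branch x z Om (lc x z)"
 unfolding branch_def using exp_lc by (auto intro!: continuous_on_lc continuous_intros)

text \<open>For a real pole above y the two factors are complex conjugates in the right half-plane,
  so their principal logarithms add up to the real logarithm of the squared distance.\<close>

lemma lc_real:
 assumes "y $ NN < x $ NN"
 shows "lc x (of_real (x $ NN)) y = rl x y"
proof -
 define a where "a = complex_of_real (x $ NN) - of_real (y $ NN) + \<i> * of_real (sd x y)"
 have ra: "Re a > 0" using assms by (simp add: a_def)
 have c: "complex_of_real (x $ NN) - of_real (y $ NN) - \<i> * of_real (sd x y) = cnj a" by (simp add: a_def)
 have "a ~= 0" using ra by auto
 have "lc x (of_real (x $ NN)) y = Ln a + cnj (Ln a)"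
  unfolding lc_def c a_def[symmetric] using ra by (subst cnj_Ln) (auto simp: complex_nonpos_Reals_iff)
 also have "... = of_real (2 * ln (norm a))" using \<open>a ~= 0\<close> by (simp add: complex_add_cnj)
 also have "2 * ln (norm a) = ln ((norm a)^2)" using \<open>a ~= 0\<close> by (simp add: ln_realpow)
 also have "(norm a)^2 = (norm (y - x))^2" unfolding norm_diff_sq cmod_power2 by (simp add: a_def power2_commute)
 finally show ?thesis by (simp add: rl_def)
qed

text \<open>|s| is the product of the moduli of the two factors. One of them is at least |X|. The
  other is at least a = Re z - y_n and at least the difference of |Im z| and the horizontal
  distance; so |X| is at most 2 + 2 |Im z| / a times it.\<close>

lemma quotient_bound:
 assumes "y $ NN < Re z"
 shows "(norm (KX x z y))^2 <= (2 + 2 * \<bar>Im z\<bar> / (Re z - y $ NN)) * norm (sq_sum (KX x z y))"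
proof -
 define a where "a = Re z - y $ NN"
 define b where "b = Im z"
 define s where "s = sd x y"
 define m where "m = norm (KX x z y)"
 define u where "u = norm (z - of_real (y $ NN) + \<i> * of_real s)"
 define v where "v = norm (z - of_real (y $ NN) - \<i> * of_real s)"
 have a0: "a > 0" and s0: "s >= 0" using assms sd_nonneg by (auto simp: a_def s_def)
 have m2: "m^2 = a^2 + b^2 + s^2" unfolding m_def norm_KX_sq cmod_power2 by (simp add: a_def b_def s_def)
 have u2: "u^2 = a^2 + (b + s)^2" and v2: "v^2 = a^2 + (b - s)^2" unfolding u_def v_def cmod_power2 by (simp_all add: a_def b_def)
 have nn: "m >= 0" "u >= 0" "v >= 0" by (simp_all add: m_def u_def v_def)
 have key: "m * m <= (2 + 2 * \<bar>b\<bar> / a) * (p * w)"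
  if p: "m^2 <= p^2" "p >= 0" and w: "w^2 = a^2 + (\<bar>b\<bar> - s)^2" "w >= 0" for p w
 proof -
  have wa: "a <= w" "\<bar>\<bar>b\<bar> - s\<bar> <= w" by (rule power2_le_imp_le; use w in simp)+
  have "0 <= a * \<bar>b\<bar>" "0 <= a * s" "0 <= \<bar>b\<bar> * s" using a0 s0 by auto
  hence "m^2 <= (a + \<bar>b\<bar> + s)^2" unfolding m2 by (simp add: power2_sum distrib_right)
  hence "m <= a + \<bar>b\<bar> + s" by (rule power2_le_imp_le) (use a0 s0 in simp)
  also have "... <= 2 * w + 2 * \<bar>b\<bar>" using wa by auto
  also have "... <= 2 * w + 2 * \<bar>b\<bar> / a * w" using wa a0 by (simp add: field_simps mult_right_mono)
  also have "... = (2 + 2 * \<bar>b\<bar> / a) * w" by (simp add: algebra_simps)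
  finally have "m <= (2 + 2 * \<bar>b\<bar> / a) * w" .
  hence "m * m <= p * ((2 + 2 * \<bar>b\<bar> / a) * w)" using power2_le_imp_le[OF p] nn p by (intro mult_mono) auto
  thus ?thesis by (simp add: mult_ac)
 qed
 have "m * m <= (2 + 2 * \<bar>b\<bar> / a) * (u * v)"
 proof (cases "b >= 0")
  case True
  have "0 <= 2 * (b * s)" using True s0 by simp
  hence "m^2 <= u^2" unfolding m2 u2 by (simp add: power2_sum)
  thus ?thesis using key[of u v] True nn v2 by simp
 next
  case False
  have "2 * (b * s) <= 0" using False s0 by (simp add: mult_nonpos_nonneg)
  hence "m^2 <= v^2" unfolding m2 v2 by (simp add: power2_diff)
  moreover have "u^2 = a^2 + (\<bar>b\<bar> - s)^2" using False u2 by (simp add: power2_eq_square algebra_simps)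
  ultimately have "m * m <= (2 + 2 * \<bar>b\<bar> / a) * (v * u)" by (intro key nn)
  thus ?thesis by (simp only: mult.commute[of u])
 qed
 thus ?thesis unfolding sq_sum_KX norm_mult s_def[symmetric] u_def[symmetric] v_def[symmetric] m_def[symmetric] a_def[symmetric] b_def[symmetric]
  by (simp add: power2_eq_square)
qed

text \<open>D |ln D| is bounded for bounded D. The kernel and its first derivatives leave one power
  of D to spare against D^(-n), and here it pays for the logarithm.\<close>

lemma log_weight_bound:
 assumes D: "0 < D" "D <= R" and q: "1 <= q" and l: "Re l = 2 * ln D - ln q" "\<bar>Im l\<bar> <= 2 * pi"
 shows "(1 + norm l) * D <= (10 * R + 2 * (1 + R^2)) * q"
proof -
 have lnD: "D * \<bar>ln D\<bar> <= 1 + R^2"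
 proof (cases "D >= 1")
  case True
  have "D * \<bar>ln D\<bar> <= R * R" using True ln_le_minus_one[of D] D by (intro mult_mono) auto
  thus ?thesis by (simp add: power2_eq_square)
 next
  case False
  have "\<bar>ln D\<bar> = ln (1 / D)" using False D by (simp add: ln_div)
  also have "... <= 1 / D" using ln_le_minus_one[of "1 / D"] D by simp
  finally have "D * \<bar>ln D\<bar> <= D * (1 / D)" using D by (intro mult_left_mono) auto
  thus ?thesis using D by (simp add: add_increasing2)
 qed
 have lq: "0 <= ln q" "ln q <= q" using q ln_le_minus_one[of q] by auto
 have pi4: "2 * pi <= 8" using pi_less_4 by simp
 have "norm l <= \<bar>Re l\<bar> + \<bar>Im l\<bar>" by (rule cmod_le)
 also have "... <= 2 * \<bar>ln D\<bar> + ln q + 8" unfolding l(1) using l(2) lq pi4 by linarith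
 finally have "(1 + norm l) * D <= (9 + 2 * \<bar>ln D\<bar> + ln q) * D" using D by (intro mult_right_mono) auto
 also have "... = 9 * D + 2 * (D * \<bar>ln D\<bar>) + ln q * D" by (simp add: algebra_simps)
 also have "... <= 9 * (R * q) + 2 * (1 + R^2) * q + q * R"
 proof -
  have "1 * D <= q * R" using q D by (intro mult_mono) auto
  moreover have "ln q * D <= q * R" using q D lq by (intro mult_mono) auto
  moreover have "(1 + R^2) * 1 <= (1 + R^2) * q" using q by (intro mult_left_mono) auto
  moreover have key: "a + 2 * b + c <= 9 * (R * q) + 2 * A * q + q * R"
   if "a <= 9 * (q * R)" "c <= q * R" "A * 1 <= A * q" "b <= A" for a b c A
   using that by (simp add: mult.commute[of R])
  ultimately show ?thesis using lnD mult.assoc[of 2 D] by (intro key) auto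
 qed
 also have "... = (10 * R + 2 * (1 + R^2)) * q" by (simp add: algebra_simps)
 finally show ?thesis .
qed

text \<open>With p = |X|^2 / |s| the exponent n + 3 arises as n from the power of |s|, and one each
  from the logarithm, from the derivative, and from the last factor of \<open>W\<close>.\<close>

lemma kernel_bound:
 assumes card: "CARD('n) >= 2" and R: "R >= 1"
 obtains K where "K >= 1" "!!X l s k q I Q. exp l = sq_sum X ==> norm X <= R ==> length I <= 1 ==> \<bar>Im l\<bar> <= 2 * pi ==>
  (norm X)^2 <= Q * norm (sq_sum X) ==> norm (V X l s k q I) <= K * Q ^ (CARD('n) + 3) / norm X ^ CARD('n)"
proof -
 obtain K where K: "K >= 1" "!!X l s k q I. exp l = sq_sum X ==> norm X <= R ==> length I <= 4 ==> norm (V X l s k q I) <= K * W X l (length I)"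
  by (rule V_bound[of R]) (use R in auto)
 define B where "B = (10 * R + 2 * (1 + R^2)) * R"
 have "(10 * R + 2 * (1 + R^2)) * 1 <= B" unfolding B_def using R by (intro mult_left_mono add_nonneg_nonneg) auto
 moreover have "1 + 0 <= 10 * R + 2 * (1 + R^2)" using R by (intro add_mono) auto
 ultimately have B0: "B >= 1" by simp
 show thesis
 proof (rule that[of "K * B"])
  show "K * B >= 1" using mult_mono[of 1 K 1 B] K(1) B0 by simp
  fix X :: "(complex, 'n) vec" and l s k q and I :: "'n list" and Q :: real
  assume h: "exp l = sq_sum X" "norm X <= R" "length I <= 1" "\<bar>Im l\<bar> <= 2 * pi" "(norm X)^2 <= Q * norm (sq_sum X)"
  define n where "n = CARD('n)"
  define D where "D = norm X"
  define z where "z = exp (Re l)"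
  have z0: "z > 0" and zs: "norm (sq_sum X) = z" by (simp_all add: z_def h(1)[symmetric])
  have zD: "z <= D^2" using norm_sq_sum_le[of X] by (simp add: zs D_def)
  have D0: "D > 0" using zD z0 by (cases "D = 0") (auto simp: D_def)
  define p where "p = D^2 / z"
  have p1: "1 <= p" using zD z0 by (simp add: p_def)
  have pQ: "p <= Q" using h(5) z0 by (simp add: p_def zs D_def field_simps)
  have zp: "z = D^2 / p" using D0 z0 by (simp add: p_def)
  have Rl: "Re l = 2 * ln D - ln p"
  proof -
   have "Re l = ln z" by (simp add: z_def)
   also have "... = ln (D^2) - ln p" unfolding zp using D0 p1 by (subst ln_div) auto
   finally show ?thesis using D0 by (simp add: ln_realpow)
  qed
  have lw: "(1 + norm l) * D <= (10 * R + 2 * (1 + R^2)) * p" by (rule log_weight_bound[OF D0 _ p1 Rl h(4)]) (use h D_def in auto)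
  have ex: "exp ((1 - real n / 2) * Re l) <= D^2 / D ^ n * p ^ n"
  proof -
   have lp: "0 <= ln p" using p1 by simp
   have "(1 - real n / 2) * Re l = (2 * ln D - real n * ln D) + (real n / 2 - 1) * ln p" unfolding Rl by (simp add: algebra_simps)
   also have "... <= (2 * ln D - real n * ln D) + real n * ln p" using lp by (intro add_left_mono mult_right_mono) auto
   finally have "exp ((1 - real n / 2) * Re l) <= exp ((2 * ln D - real n * ln D) + real n * ln p)" by simp
   also have "... = D^2 / D ^ n * p ^ n"
    using D0 p1 exp_of_nat_mult[of 2 "ln D"] exp_of_nat_mult[of n "ln D"] exp_of_nat_mult[of n "ln p"] by (simp add: exp_add exp_diff)
   finally show ?thesis .
  qed
  have Wle: "W X l (length I) <= B * p ^ (n + 3) / D ^ n"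
  proof -
   have Xz: "norm X / z = p / D" using D0 z0 by (simp add: p_def D_def power2_eq_square)
   have "W X l (length I) = (1 + norm l) * exp ((1 - real n / 2) * Re l) * (p / D) ^ length I * p"
    unfolding W_def z_def[symmetric] Xz by (simp add: p_def D_def n_def)
   also have "... <= (1 + norm l) * (D^2 / D ^ n * p ^ n) * (p / D) ^ length I * p"
    using ex D0 p1 by (intro mult_right_mono mult_left_mono) auto
   also have "... = ((1 + norm l) * D) * (D * (p / D) ^ length I) * p ^ (n + 1) / D ^ n" by (simp add: power2_eq_square)
   also have "... <= ((10 * R + 2 * (1 + R^2)) * p) * (R * p) * p ^ (n + 1) / D ^ n"
   proof (intro divide_right_mono mult_right_mono mult_mono[OF lw])
    show "D * (p / D) ^ length I <= R * p"
    proof (cases I)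
     case Nil
     have "D * 1 <= R * p" using h(2) p1 D0 R by (intro mult_mono) (auto simp: D_def)
     thus ?thesis using Nil by simp
    next
     case (Cons i J)
     hence "length I = 1" using h(3) by simp
     thus ?thesis using D0 p1 R mult_right_mono[of 1 R p] by simp
    qed
   qed (use D0 p1 R in \<open>auto simp: add_nonneg_nonneg\<close>)
   also have "... = B * p ^ (n + 3) / D ^ n" by (simp add: B_def power_add power3_eq_cube)
   finally show ?thesis .
  qed
  have "norm (V X l s k q I) <= K * W X l (length I)" using h by (intro K) auto
  also have "... <= K * (B * Q ^ (n + 3) / D ^ n)"
  proof (intro mult_left_mono)
   have "p ^ (n + 3) <= Q ^ (n + 3)" using p1 pQ by (intro power_mono) auto
   hence "B * p ^ (n + 3) / D ^ n <= B * Q ^ (n + 3) / D ^ n" using B0 D0 by (intro divide_right_mono mult_left_mono) auto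
   thus "W X l (length I) <= B * Q ^ (n + 3) / D ^ n" using Wle by linarith
  qed (use K in simp)
  finally show "norm (V X l s k q I) <= K * B * Q ^ (CARD('n) + 3) / norm X ^ CARD('n)" by (simp add: n_def D_def mult_ac)
 qed
qed

end

context solution
begin

text \<open>The derivatives extended continuously to the closure. On the frontier they agree with
  the limits that define \<open>closure_jacobian\<close>, so the stress there is that of the Cauchy
  data.\<close>

definition fJ :: "bool => 'n => 'n => (real, 'n) vec => real" where
 "fJ s k p = (SOME g. continuous_on (closure D) g & (ALL x:D. g x = partial p (fn s k) x))"

lemma fJ: "continuous_on (closure D) (fJ s k p)" "x : D ==> fJ s k p x = partial p (fn s k) x"
proof -
 have "EX g. continuous_on (closure D) g & (ALL x:D. g x = partial p (fn s k) x)" using fn_closure[of s k] by (simp add: C1_closure_def)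
 from someI_ex[OF this] show "continuous_on (closure D) (fJ s k p)" "x : D ==> fJ s k p x = partial p (fn s k) x"
  unfolding fJ_def by auto
qed

lemma continuous_on_fn: "continuous_on (closure D) (fn s k)"
 using fn_closure[of s k] by (simp add: C1_closure_def)

lemma Lim_partial:
 assumes y: "y : frontier D"
 shows "Lim (at y within D) (partial p (fn s k)) = fJ s k p y"
proof (rule tendsto_Lim)
 have yc: "y : closure D" "y ~: D" using y openD by (auto simp: frontier_def interior_open)
 thus "~ trivial_limit (at y within D)" by (simp add: trivial_limit_within closure_def)
 have "(fJ s k p \<longlongrightarrow> fJ s k p y) (at y within closure D)" using fJ(1) yc by (simp add: continuous_on_def)
 hence "(fJ s k p \<longlongrightarrow> fJ s k p y) (at y within D)" by (rule tendsto_within_subset) (rule closure_subset)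
 thus "(partial p (fn s k) \<longlongrightarrow> fJ s k p y) (at y within D)"
  by (rule Lim_transform_within[OF _ zero_less_one]) (simp add: fJ(2))
qed

definition Sg :: "bool => 'n => (real, 'n) vec => (real, 'n) vec => complex" where
 "Sg s k y v = (\<Oplus>p. of_real (v $ p) * sg s k p (%s k. of_real (fn s k y)) (%s k p. of_real (fJ s k p y)))"

text \<open>The stress is linear in the normal, so its modulus is a seminorm in v; the factor |v|
  makes the values of U part of the same seminorm.\<close>

definition GG :: "(real, 'n) vec => (real, 'n) vec => real" where
 "GG y v = (\<Oplus>s k. norm (Sg s k y v)) + norm v * (\<Oplus>s k. \<bar>fn s k y\<bar>)"

lemma GG_seminorm: "GG y (v + v') <= GG y v + GG y v'" "GG y (c *\<^sub>R v) = \<bar>c\<bar> * GG y v"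
proof -
 have "Sg s k y (v + v') = Sg s k y v + Sg s k y v'" for s k by (simp add: Sg_def algebra_simps sum.distrib)
 hence "(\<Oplus>s k. norm (Sg s k y (v + v'))) <= (\<Oplus>s k. norm (Sg s k y v) + norm (Sg s k y v'))"
  by (intro sum_mono) (simp add: norm_triangle_ineq)
 moreover have "norm (v + v') * (\<Oplus>s k. \<bar>fn s k y\<bar>) <= (norm v + norm v') * (\<Oplus>s k. \<bar>fn s k y\<bar>)"
  by (intro mult_right_mono norm_triangle_ineq sum_nonneg) auto
 ultimately show "GG y (v + v') <= GG y v + GG y v'" unfolding GG_def sum.distrib distrib_right by linarith
 have "Sg s k y (c *\<^sub>R v) = of_real c * Sg s k y v" for s k by (simp add: Sg_def sum_distrib_left mult.assoc)
 thus "GG y (c *\<^sub>R v) = \<bar>c\<bar> * GG y v" by (simp add: GG_def norm_mult sum_distrib_left[symmetric] algebra_simps)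
qed

lemma GG_nonneg: "0 <= GG y v" by (auto simp: GG_def intro!: sum_nonneg add_nonneg_nonneg mult_nonneg_nonneg)

lemma continuous_on_GG: "continuous_on (closure D \<times> UNIV) (%(y, v). GG y v)"
proof -
 have f: "continuous_on (closure D \<times> UNIV) (%a :: (real, 'n) vec \<times> (real, 'n) vec. fn s k (fst a))" for s k
  by (rule continuous_on_compose2[OF continuous_on_fn]) (auto intro!: continuous_intros)
 have J: "continuous_on (closure D \<times> UNIV) (%a :: (real, 'n) vec \<times> (real, 'n) vec. fJ s k p (fst a))" for s k p
  by (rule continuous_on_compose2[OF fJ(1)]) (auto intro!: continuous_intros)
 have v: "continuous_on (closure D \<times> UNIV) (%a :: (real, 'n) vec \<times> (real, 'n) vec. snd a $ p)" for p
  by (intro continuous_on_component continuous_on_snd continuous_on_id)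
 show ?thesis unfolding GG_def Sg_def split_beta
  by (intro continuous_on_add continuous_on_sum continuous_on_mult continuous_on_norm continuous_on_of_real continuous_on_rabs
    continuous_on_sg f J v continuous_on_snd continuous_on_id)
qed

lemma Sg_eq_sum:
 "Sg s k y v = cl s * (of_real (v $ k) * (\<Oplus>j. of_real (fJ s j j y))) + cm s * (\<Oplus>p. of_real (v $ p) * of_real (fJ s p k y))
  + ca s * (\<Oplus>p. of_real (v $ p) * of_real (fJ s k p y))
  - (if s then cg * (\<Oplus>j p. lev k j p * of_real (v $ p) * of_real (fn False j y)) else 0)"
proof -
 have "Sg s k y v = (\<Oplus>p. (if k = p then cl s * (of_real (v $ k) * (\<Oplus>j. of_real (fJ s j j y))) else 0)
   + cm s * (of_real (v $ p) * of_real (fJ s p k y)) + ca s * (of_real (v $ p) * of_real (fJ s k p y))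
   - (if s then cg * (\<Oplus>j. lev k j p * of_real (v $ p) * of_real (fn False j y)) else 0))"
  unfolding Sg_def sg_def by (intro sum.cong refl) (auto simp: algebra_simps sum_distrib_left)
 also have "... = cl s * (of_real (v $ k) * (\<Oplus>j. of_real (fJ s j j y))) + cm s * (\<Oplus>p. of_real (v $ p) * of_real (fJ s p k y))
  + ca s * (\<Oplus>p. of_real (v $ p) * of_real (fJ s k p y))
  - (\<Oplus>p. if s then cg * (\<Oplus>j. lev k j p * of_real (v $ p) * of_real (fn False j y)) else 0)"
  by (simp only: sum.distrib sum_subtractf sum_distrib_left[symmetric]) simp
 also have "(\<Oplus>p. if s then cg * (\<Oplus>j. lev k j p * of_real (v $ p) * of_real (fn False j y)) else 0)
  = (if s then cg * (\<Oplus>j p. lev k j p * of_real (v $ p) * of_real (fn False j y)) else 0)"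
  by (cases s) (simp_all add: sum_distrib_left[symmetric] sum.swap[of "%p j. lev k j p * of_real (v $ p) * of_real (fn False j y)"])
 finally show ?thesis .
qed

lemma Sg_stress:
 assumes y: "y : frontier D"
 shows "Sg True k y v = of_real (force_stress lam mu al v (closure_jacobian D u y) (w y) $ k)"
  and "Sg False k y v = of_real (couple_stress ep nu be v (closure_jacobian D w y) $ k)"
proof -
 have fu: "fn True j = (%z. u z $ j)" and fw: "fn False j = (%z. w z $ j)" for j by (simp_all add: fn_def[abs_def])
 have Ju: "closure_jacobian D u y $ j $ p = fJ True j p y" and Jw: "closure_jacobian D w y $ j $ p = fJ False j p y" for j p
  unfolding closure_jacobian_def using Lim_partial[OF y, of p True j] Lim_partial[OF y, of p False j] by (simp_all add: fu fw)
 show "Sg True k y v = of_real (force_stress lam mu al v (closure_jacobian D u y) (w y) $ k)"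
  unfolding Sg_eq_sum force_stress_def by (simp add: Ju cl_def cm_def ca_def cg_def lev_def fw)
 show "Sg False k y v = of_real (couple_stress ep nu be v (closure_jacobian D w y) $ k)"
  unfolding Sg_eq_sum couple_stress_def by (simp add: Jw cl_def cm_def ca_def)
qed

text \<open>Each of the 2 n components of U and of the stress is at most the norm of the
  pair.\<close>

lemma GG_boundary:
 assumes y: "y : frontier D" and v: "unit_outward_normal D y v" and c: "cauchy_data_le lam mu nu be ep al D u w y c"
 shows "GG y v <= 2 * real CARD('n) * c"
proof -
 define T1 where "T1 = force_stress lam mu al v (closure_jacobian D u y) (w y)"
 define T2 where "T2 = couple_stress ep nu be v (closure_jacobian D w y)"
 have nv: "norm v = 1" using v unfolding unit_outward_normal_def Let_def by auto
 have le: "norm (u y, w y) + norm (T1, T2) <= c" using c v by (simp add: cauchy_data_le_def T1_def T2_def)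
 have "norm (Sg s k y v) <= norm (T1, T2)" for s k
 proof (cases s)
  case True
  have "\<bar>T1 $ k\<bar> <= norm T1" by (rule component_le_norm_cart)
  also have "... <= norm (T1, T2)" by (rule norm_fst_le)
  finally show ?thesis using True Sg_stress(1)[OF y, of k v] by (simp add: T1_def)
 next
  case False
  have "\<bar>T2 $ k\<bar> <= norm T2" by (rule component_le_norm_cart)
  also have "... <= norm (T1, T2)" by (rule norm_snd_le)
  finally show ?thesis using False Sg_stress(2)[OF y, of k v] by (simp add: T2_def)
 qed
 hence 1: "(\<Sum>s\<in>(UNIV::bool set). \<Sum>k\<in>(UNIV::'n set). norm (Sg s k y v)) <= (\<Sum>s\<in>(UNIV::bool set). \<Sum>k\<in>(UNIV::'n set). norm (T1, T2))" by (intro sum_mono)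
 have "\<bar>fn s k y\<bar> <= norm (u y, w y)" for s k
 proof (cases s)
  case True
  hence "\<bar>fn s k y\<bar> <= norm (u y)" using component_le_norm_cart[of "u y" k] by (simp add: fn_def)
  thus ?thesis using norm_fst_le[of "u y" "w y"] by linarith
 next
  case False
  hence "\<bar>fn s k y\<bar> <= norm (w y)" using component_le_norm_cart[of "w y" k] by (simp add: fn_def)
  thus ?thesis using norm_snd_le[of "w y" "u y"] by linarith
 qed
 hence 2: "(\<Sum>s\<in>(UNIV::bool set). \<Sum>k\<in>(UNIV::'n set). \<bar>fn s k y\<bar>) <= (\<Sum>s\<in>(UNIV::bool set). \<Sum>k\<in>(UNIV::'n set). norm (u y, w y))" by (intro sum_mono)
 have "GG y v <= 2 * real CARD('n) * (norm (u y, w y) + norm (T1, T2))"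
  unfolding GG_def nv using 1 2 by (simp add: algebra_simps)
 also have "... <= 2 * real CARD('n) * c" using le by (intro mult_left_mono) auto
 finally show ?thesis .
qed

text \<open>One bound b for the kernel and its first derivatives controls both products in the flux:
  the kernel times the stress of U, and U times the stress of the kernel.\<close>

lemma norm_sum_F_le:
 assumes y: "y : D" and b: "b >= 0" "!!s k. norm (KV x z l q [] s k y) <= b" "!!s k p. norm (KV x z l q [p] s k y) <= b"
 shows "norm (\<Oplus>p. of_real (v $ p) * F x z l q p y) <= (1 + 2 * real CARD('n) * Csg) * b * GG y v"
proof -
 define n where "n = real CARD('n)"
 have S: "(\<Oplus>p. of_real (v $ p) * sg s k p (%s k. UU s k y) (%s k p. UJ s k p y)) = Sg s k y v" for s k
  by (simp add: Sg_def UU_def UJ_def fJ(2)[OF y])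
 have "norm (\<Oplus>p. of_real (v $ p) * F x z l q p y) <= (\<Oplus>s k. b * norm (Sg s k y v) + \<bar>fn s k y\<bar> * (n * (norm v * (Csg * (b + b)))))"
  unfolding sum_F S
 proof (intro sum_norm_le)
  fix s k
  have "norm (KV x z l q [] s k y * Sg s k y v) <= b * norm (Sg s k y v)"
   unfolding norm_mult by (intro mult_right_mono b) auto
  moreover have "norm (UU s k y * (\<Oplus>p. of_real (v $ p) * sg s k p (%s k. KV x z l q [] s k y) (%s k p. KV x z l q [p] s k y)))
   <= \<bar>fn s k y\<bar> * (n * (norm v * (Csg * (b + b))))"
   unfolding norm_mult n_def by (intro mult_mono norm_moment_le norm_sg_le b) (auto simp: UU_def)
  ultimately show "norm (KV x z l q [] s k y * Sg s k y v - UU s k y * (\<Oplus>p. of_real (v $ p) * sg s k p (%s k. KV x z l q [] s k y) (%s k p. KV x z l q [p] s k y)))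
   <= b * norm (Sg s k y v) + \<bar>fn s k y\<bar> * (n * (norm v * (Csg * (b + b))))"
   by (intro order_trans[OF norm_triangle_ineq4] add_mono)
 qed
 also have "... = b * (\<Oplus>s k. norm (Sg s k y v)) + 2 * n * Csg * b * (norm v * (\<Oplus>s k. \<bar>fn s k y\<bar>))"
  by (simp add: sum.distrib sum_distrib_left sum_distrib_right algebra_simps)
 also have "... <= (1 + 2 * n * Csg) * b * (\<Oplus>s k. norm (Sg s k y v)) + (1 + 2 * n * Csg) * b * (norm v * (\<Oplus>s k. \<bar>fn s k y\<bar>))"
  using b(1) Csg_ge_1 by (intro add_mono mult_right_mono) (auto simp: n_def intro!: sum_nonneg mult_nonneg_nonneg mult_right_mono[of 1 "1 + 2 * real CARD('n) * Csg" b, simplified])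
 finally show ?thesis by (simp add: GG_def n_def distrib_left)
qed

end

section \<open>The main estimate\<close>

text \<open>If h is not integrable its integral is 0 by convention, while the integral of the
  nonnegative g is at least 0.\<close>

lemma norm_integral_le:
 fixes h :: "'a => complex"
 assumes "integrable M g" "!!y. norm (h y) <= g y"
 shows "norm (LINT y|M. h y) <= (LINT y|M. g y)"
proof (cases "integrable M h")
 case True
 have "norm (LINT y|M. h y) <= (LINT y|M. norm (h y))" by (rule integral_norm_bound)
 also have "... <= (LINT y|M. g y)" using True assms by (intro integral_mono integrable_norm) auto
 finally show ?thesis .
next
 case False
 have "0 <= (LINT y|M. g y)" using assms(2) by (intro integral_nonneg_AE AE_I2) (meson norm_ge_zero order_trans)
 thus ?thesis using False by (simp add: not_integrable_integral_eq)
qed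

lemma continuous_on_zero_extension_Times:
 fixes f :: "'a::topological_space \<times> 'b::topological_space => 'c::{topological_space, zero}"
 assumes "open U" "open Om" "Om \<subseteq> U \<times> UNIV" "closed S" "U \<times> S \<subseteq> Om" "continuous_on Om f" "!!z y. y ~: S ==> f (z, y) = 0"
 shows "continuous_on (U \<times> UNIV) f"
proof -
 have "continuous_on (Om Un U \<times> (- S)) f"
 proof (rule continuous_on_open_Un)
  have "continuous_on (U \<times> (- S)) (%x. 0 :: 'c)" by (rule continuous_on_const)
  thus "continuous_on (U \<times> (- S)) f" by (rule continuous_on_eq) (use assms(7) in auto)
  show "open (U \<times> (- S))" using assms by (intro open_Times open_Compl)
 qed (use assms in auto)
 moreover have "Om Un U \<times> (- S) = U \<times> UNIV" using assms(3,5) by auto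
 ultimately show ?thesis by simp
qed

text \<open>Horizontal distances in D are at most R / 2, so a pole with |Im z| = R is good for all
  of D; 4 (X + R) bounds |KX| for all poles in the rectangle. The kernel constant K is a parameter,
  fixed before the solution, the point and the cutoff.\<close>

locale estimate = solution lam mu nu be ep al ro si \<theta> ty D u w
 for lam mu nu be ep al ro si \<theta> and ty :: "'n::{finite,linorder} itself" and D u w +
 fixes Ct :: "(real, 'n) vec set" and ct :: "(real, 'n) vec => real" and d :: "(real, 'n) vec => (real, 'n) vec"
  and x :: "(real, 'n) vec" and r0 X R L K eta :: real
 assumes card: "CARD('n) >= 2" and xD: "x : D" and bD: "bounded D"
  and height: "!!y. y : D ==> 0 < y $ NN & y $ NN <= X" and diam: "!!y. y : D ==> norm (y - x) <= R / 2"
  and R: "R >= 1" and L: "L > 0" and eta: "eta = X / (L + 1)"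
  and cut: "cutoff Ct ct d" "Ct \<subseteq> D" and r0: "r0 > 0" "!!y. y : ball x r0 ==> ct y = 1 & d y = 0"
  and K: "K >= 1" "!!Y l s (k :: 'n) q I Q. exp l = sq_sum Y ==> norm Y <= 4 * (X + R) ==> length I <= 1 ==> \<bar>Im l\<bar> <= 2 * pi ==>
  (norm Y)^2 <= Q * norm (sq_sum Y) ==> norm (V Y l s k q I) <= K * Q ^ (CARD('n) + 3) / norm Y ^ CARD('n)"
begin

definition th :: "(real, 'n) vec => real" where "th y = step (y $ NN / (eta / 2))"
text \<open>
  The factor \<open>exp L = M / delta\<close> occurs only at heights where the boundary data are at most \<open>delta\<close>.
\<close>
definition om :: "(real, 'n) vec => real" where
 "om y = (1 + exp L * (1 - th y)) / max (norm (y - x)) r0 ^ CARD('n)"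
definition Phi :: real where "Phi = (LI y. indicator D y * (GG y (d y) * om y))"
definition KK :: real where "KK = (1 + 2 * real CARD('n) * Csg) * K"
definition FS :: "bool \<times> 'n => complex => (real, 'n) vec => complex" where
 "FS q z y = (\<Oplus>p. of_real (d y $ p) * F x z (lc x z) q p y)"
definition ff :: "bool \<times> 'n => complex => complex" where "ff q z = (LI y. of_real (th y) * FS q z y)"

abbreviation "xn \<equiv> x $ NN"

lemma X0: "X > 0" using height[OF xD] by linarith

lemma eta0: "eta > 0" "eta <= X" using X0 L by (auto simp: eta field_simps)

lemma th_range: "0 <= th y" "th y <= 1" by (simp_all add: th_def step_range)

lemma th_0: "eta / 2 <= y $ NN ==> th y = 0"
 unfolding th_def by (rule step_simps(2)) (use eta0 in \<open>simp add: field_simps\<close>)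

lemma continuous_on_th: "continuous_on T th"
proof -
 have "continuous_on T (%y :: (real, 'n) vec. y $ NN / (eta / 2))" using eta0
  by (intro continuous_on_divide continuous_on_component continuous_on_id continuous_on_const) auto
 thus ?thesis unfolding th_def[abs_def] by (rule continuous_on_compose2[OF continuous_on_step[of UNIV]]) auto
qed

lemma KK1: "KK >= 1"
 unfolding KK_def using K(1) Csg_ge_1 mult_mono[of 1 "1 + 2 * real CARD('n) * Csg" 1 K] by simp

lemma cutD: "compact Ct" "continuous_on UNIV d" "y ~: Ct ==> d y = 0"
 using cut by (auto simp: cutoff_def)

lemma FS_bound:
 assumes y: "y : D" and l: "exp l = sq_sum (KX x z y)" "\<bar>Im l\<bar> <= 2 * pi"
  and nX: "norm (KX x z y) <= 4 * (X + R)" and Q: "Q >= 0" "(norm (KX x z y))^2 <= Q * norm (sq_sum (KX x z y))"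
  and lf: "lf y = l"
 shows "norm (\<Oplus>p. of_real (v $ p) * F x z lf q p y) <= KK * Q ^ (CARD('n) + 3) / norm (KX x z y) ^ CARD('n) * GG y v"
proof -
 have "norm (\<Oplus>p. of_real (v $ p) * F x z lf q p y) <= (1 + 2 * real CARD('n) * Csg) * (K * Q ^ (CARD('n) + 3) / norm (KX x z y) ^ CARD('n)) * GG y v"
 proof (rule norm_sum_F_le[OF y])
  show "norm (KV x z lf q [] s k y) <= K * Q ^ (CARD('n) + 3) / norm (KX x z y) ^ CARD('n)"
   "norm (KV x z lf q [p] s k y) <= K * Q ^ (CARD('n) + 3) / norm (KX x z y) ^ CARD('n)" for s k p
   unfolding KV_def lf using K(2)[OF l(1) nX _ l(2) Q(2)] by auto
 qed (use K Q in auto)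
 thus ?thesis by (simp add: KK_def mult_ac)
qed

lemma integrable_Phi: "integrable lborel (%y. indicator D y * (GG y (d y) * om y))"
proof (rule integrable_indicator_continuous[of "closure D"])
 have "continuous_on (closure D) (%y. (y, d y))" using continuous_on_subset[OF cutD(2)] by (intro continuous_intros) auto
 hence "continuous_on (closure D) (%y. GG y (d y))" using continuous_on_compose2[OF continuous_on_GG] by force
 moreover have "continuous_on (closure D) om" unfolding om_def[abs_def] using r0
  by (intro continuous_intros continuous_on_th) auto
 ultimately show "continuous_on (closure D) (%y. GG y (d y) * om y)" by (rule continuous_on_mult)
qed (use bD openD closure_subset in auto)

lemma om_nonneg: "0 <= om y" unfolding om_def using th_range[of y] r0 by (intro divide_nonneg_nonneg add_nonneg_nonneg) auto

lemma Phi_nonneg: "Phi >= 0" unfolding Phi_def using GG_nonneg om_nonneg by (intro integral_nonneg_AE AE_I2) auto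

lemma integral_le_Phi:
 fixes h :: "(real, 'n) vec => complex"
 assumes c: "c >= 0" and h: "!!y. y : D ==> r0 <= norm (y - x) ==> norm (h y) <= c * (GG y (d y) * om y)" and z: "!!y. d y = 0 ==> h y = 0"
 shows "norm (LI y. h y) <= c * Phi"
proof -
 have "norm (LI y. h y) <= (LI y. c * (indicator D y * (GG y (d y) * om y)))"
 proof (rule norm_integral_le)
  show "integrable lborel (%y. c * (indicator D y * (GG y (d y) * om y)))" by (intro integrable_mult_right integrable_Phi)
  fix y
  show "norm (h y) <= c * (indicator D y * (GG y (d y) * om y))"
  proof (cases "d y = 0")
   case True thus ?thesis using z c GG_nonneg om_nonneg by simp
  next
   case False
   hence "y : D" "y ~: ball x r0" using cutD(3) cut(2) r0(2) by auto
   thus ?thesis using h[of y] by (simp add: dist_norm norm_minus_commute)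
  qed
 qed
 thus ?thesis by (simp add: Phi_def)
qed

lemma om_lower:
 assumes "r0 <= norm (y - x)"
 shows "1 / norm (y - x) ^ CARD('n) <= om y" "exp L * (1 - th y) / norm (y - x) ^ CARD('n) <= om y"
proof -
 have m: "max (norm (y - x)) r0 = norm (y - x)" using assms by simp
 show "1 / norm (y - x) ^ CARD('n) <= om y" "exp L * (1 - th y) / norm (y - x) ^ CARD('n) <= om y"
  unfolding om_def m using th_range[of y] by (auto intro!: divide_right_mono)
qed

lemma integrable_weighted:
 assumes br: "branch x z Om l" and Om: "Om \<subseteq> D" and a: "continuous_on UNIV a" and S: "closed S" "S \<subseteq> Om" "!!y. y ~: S ==> a y *\<^sub>R d y = 0"
 shows "integrable lborel (%y. of_real (a y) * (\<Oplus>p. of_real (d y $ p) * F x z l q p y))"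
proof -
 have z: "of_real (a y) * (\<Oplus>p. of_real (d y $ p) * F x z l q p y) = 0" if "y ~: S" for y
  using S(3)[OF that] by auto
 have "continuous_on UNIV (%y. of_real (a y) * (\<Oplus>p. of_real (d y $ p) * F x z l q p y))"
 proof (rule continuous_on_zero_extension[OF _ _ S(1,2) z])
  show "open Om" using br by (simp add: branch_def)
  have "continuous_on Om (%y. d y $ p)" for p
   by (rule continuous_on_component[OF continuous_on_subset[OF cutD(2)]]) simp
  thus "continuous_on Om (%y. of_real (a y) * (\<Oplus>p. of_real (d y $ p) * F x z l q p y))"
   by (intro continuous_on_sum continuous_on_mult continuous_on_of_real continuous_on_F[OF br Om] continuous_on_subset[OF a]) auto
 qed
 moreover obtain B where B: "!!y. y : Ct ==> norm y <= B" using compact_imp_bounded[OF cutD(1)] by (auto simp: bounded_iff)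
 have "of_real (a y) * (\<Oplus>p. of_real (d y $ p) * F x z l q p y) = 0" if "norm y > B" for y
  using B[of y] cutD(3)[of y] that by force
 ultimately show ?thesis by (rule integrable_continuous_bounded_support[of _ B])
qed

lemma ff_complement:
 assumes "!!y. y : D ==> good x z y"
 shows "ff q z = - (LI y. of_real (1 - th y) * FS q z y)"
proof -
 have br: "branch x z D (lc x z)" by (rule branch_lc[OF openD assms])
 have cl: "closed Ct" using cutD compact_imp_closed by blast
 have i: "integrable lborel (%y. of_real (a y) * FS q z y)" if "continuous_on UNIV a" for a
  unfolding FS_def by (rule integrable_weighted[OF br order_refl that cl cut(2)]) (use cutD in auto)
 have "(LI y. of_real (th y) * FS q z y) + (LI y. of_real (1 - th y) * FS q z y)
  = (LI y. of_real (th y) * FS q z y + of_real (1 - th y) * FS q z y)"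
  by (rule Bochner_Integration.integral_add[symmetric]) (intro i continuous_intros continuous_on_th)+
 also have "... = (LI y. FS q z y)" by (intro Bochner_Integration.integral_cong) (auto simp: algebra_simps)
 also have "... = 0" unfolding FS_def by (rule cutoff_integral_F[OF br order_refl cut])
 finally show ?thesis unfolding ff_def by (simp add: eq_neg_iff_add_eq_0)
qed

text \<open>Where the height cutoff is nonzero, y lies below the pole, and there the complexified
  logarithm is the real one.\<close>

lemma ff_real:
 assumes "eta / 2 < xn"
 shows "(LI y. Fr x q (d y) y) = ff q (of_real xn) + (LI y. of_real (1 - th y) * Fr x q (d y) y)"
proof -
 have br: "branch x (of_real xn) (D - {x}) (rl x)" by (rule branch_rl) (use openD in auto)
 have cl: "closed (Ct - ball x r0)" using cutD compact_imp_closed by (intro closed_Diff) auto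
 have i: "integrable lborel (%y. of_real (a y) * Fr x q (d y) y)" if "continuous_on UNIV a" for a
  by (rule integrable_weighted[OF br _ that cl]) (use cutD cut r0 in auto)
 have "ff q (of_real xn) = (LI y. of_real (th y) * Fr x q (d y) y)"
  unfolding ff_def
 proof (intro Bochner_Integration.integral_cong refl)
  fix y
  show "of_real (th y) * FS q (of_real xn) y = of_real (th y) * Fr x q (d y) y"
  proof (cases "eta / 2 <= y $ NN")
   case False
   hence "lc x (of_real xn) y = rl x y" using assms by (intro lc_real) auto
   thus ?thesis by (simp add: FS_def F_def KV_def)
  qed (simp add: th_0)
 qed
 hence "ff q (of_real xn) + (LI y. of_real (1 - th y) * Fr x q (d y) y)
  = (LI y. of_real (th y) * Fr x q (d y) y) + (LI y. of_real (1 - th y) * Fr x q (d y) y)" by simp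
 also have "... = (LI y. of_real (th y) * Fr x q (d y) y + of_real (1 - th y) * Fr x q (d y) y)"
  by (rule Bochner_Integration.integral_add[symmetric]) (intro i continuous_intros continuous_on_th)+
 also have "... = (LI y. Fr x q (d y) y)" by (intro Bochner_Integration.integral_cong) (auto simp: algebra_simps)
 finally show ?thesis by simp
qed

text \<open>The integrand is supported in a compact part of D below height eta / 2, where every pole
  in the half-plane is good, so one may differentiate under the integral. Extending by 0 makes
  integrand and derivative jointly continuous on the half-plane times the whole space.\<close>

lemma ff_holomorphic: "ff q holomorphic_on {z. eta / 2 < Re z}"
proof -
 define U where "U = {z. eta / 2 < Re z}"
 define S where "S = {y : Ct. y $ NN <= eta / 2}"
 define Om where "Om = {a : U \<times> D. snd a $ NN < Re (fst a)}"
 have U: "open U" "convex U" unfolding U_def by (rule open_halfspace_Re_gt convex_halfspace_Re_gt)+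
 have cN: "continuous_on T (%y :: (real, 'n) vec. y $ NN)" for T by (rule continuous_on_component[OF continuous_on_id])
 have S: "closed S"
 proof -
  have "closed {y :: (real, 'n) vec. y $ NN <= eta / 2}" by (intro closed_Collect_le cN continuous_on_const)
  thus ?thesis unfolding S_def Collect_conj_eq using compact_imp_closed[OF cutD(1)] by (intro closed_Int) auto
 qed
 have cN2: "continuous_on T (%a :: complex \<times> (real, 'n) vec. snd a $ NN)" for T
  by (intro continuous_on_component continuous_on_snd continuous_on_id)
 have Om: "open Om" "Om \<subseteq> U \<times> UNIV" "U \<times> S \<subseteq> Om"
 proof -
  have "open {a :: complex \<times> (real, 'n) vec. snd a $ NN < Re (fst a)}"
   by (intro open_Collect_less cN2 continuous_intros)
  moreover have "open (U \<times> D)" by (intro open_Times U openD)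
  moreover have "Om = U \<times> D Int {a. snd a $ NN < Re (fst a)}" by (auto simp: Om_def)
  ultimately show "open Om" by (simp add: open_Int)
  show "Om \<subseteq> U \<times> UNIV" by (auto simp: Om_def)
  show "U \<times> S \<subseteq> Om" using cut(2) by (auto simp: Om_def U_def S_def)
 qed
 define A where "A I z s k y = V (KX x z y) (lc x z y) s k q I" for I z s k y
 define P where "P B J z y = of_real (th y) * (\<Oplus>p. of_real (d y $ p) * FF (%s k. B z s k y) (%s k p. J p z s k y) (%s k. UU s k y) (%s k p. UJ s k p y) p)"
  for B :: "complex => bool => 'n => (real, 'n) vec => complex" and J z y
 let ?P = "P (A []) (%p. A [p])"
 \<comment> \<open>The pole enters the last coordinate as y_n - z, so the derivative in z is minus
   the derivative along \<open>NN\<close>.\<close>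
 define B' where "B' z s k y = - A [NN] z s k y" for z s k y
 define J' where "J' p z s k y = - A [NN, p] z s k y" for p z s k y
 have outside: "P B J z y = 0" if "y ~: S" for B J z y
 proof (cases "y : Ct")
  case True thus ?thesis using that th_0[of y] by (simp add: P_def S_def)
 qed (use cutD in \<open>simp add: P_def\<close>)
 have cA: "continuous_on Om (%a. A I (fst a) s k (snd a))" if "length I <= 4" for I s k
  unfolding A_def
 proof (rule continuous_on_V[OF _ _ _ that])
  show "continuous_on Om (%a. KX x (fst a) (snd a))" by (intro continuous_on_KX continuous_on_fst continuous_on_snd continuous_on_id)
  have g: "good x (fst a) (snd a)" if "a : Om" for a using that by (auto simp: Om_def good_def)
  thus "continuous_on Om (%a. lc x (fst a) (snd a))" by (intro continuous_on_lc continuous_on_fst continuous_on_snd continuous_on_id)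
  show "exp (lc x (fst a) (snd a)) = sq_sum (KX x (fst a) (snd a))" if "a : Om" for a using g[OF that] by (rule exp_lc)
 qed
 have sndD: "snd ` Om \<subseteq> D" by (auto simp: Om_def)
 have cP: "continuous_on (U \<times> UNIV) (%(z, y). P B J z y)"
  if "!!s k. continuous_on Om (%a. B (fst a) s k (snd a))" "!!s k p. continuous_on Om (%a. J p (fst a) s k (snd a))" for B J
 proof (rule continuous_on_zero_extension_Times[OF U(1) Om(1,2) S Om(3)])
  have cU: "continuous_on Om (%a. UU s k (snd a))" "continuous_on Om (%a. UJ s k p (snd a))" for s k p
   by (rule continuous_on_compose2[OF continuous_on_U(1)] continuous_on_compose2[OF continuous_on_U(2)], intro continuous_on_snd continuous_on_id, rule sndD)+
  have cd: "continuous_on Om (%a. d (snd a) $ p)" for p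
   by (intro continuous_on_component continuous_on_compose2[OF cutD(2)] continuous_on_snd continuous_on_id) auto
  have ct: "continuous_on Om (%a. th (snd a))"
   by (rule continuous_on_compose2[OF continuous_on_th[of UNIV]]) (auto intro: continuous_on_snd continuous_on_id)
  show "continuous_on Om (%(z, y). P B J z y)"
   unfolding P_def FF_def split_beta
   by (intro continuous_on_mult continuous_on_sum continuous_on_diff continuous_on_of_real continuous_on_sg that cU cd ct)
 qed (simp add: outside)
 have der: "((%z. ?P z y) has_field_derivative P B' J' z y) (at z within U)" if z: "z : U" for z y
 proof (cases "y : S")
  case False thus ?thesis by (simp add: outside)
 next
  case True
  hence yN: "y $ NN <= eta / 2" by (simp add: S_def)
  have dA: "((%z. A I z s k y) has_field_derivative - A (NN # I) z s k y) (at z within U)" if "length I <= 3" for I s k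
  proof -
   have g: "good x z y" if "z : U" for z using that yN by (auto simp: U_def good_def)
   have "((%z. V (KX x z y) (lc x z y) s k q I) has_field_derivative (\<Oplus>i. (if i = NN then - 1 else 0) * V (KX x z y) (lc x z y) s k q (i # I))) (at z within U)"
   proof (rule V_has_field_derivative[OF U(2) z _ _ _ that])
    show "((%z. KX x z y $ i) has_field_derivative (if i = NN then - 1 else 0)) (at u within U)" for i u
     by (cases "i = NN") (auto simp: KX_def intro!: derivative_eq_intros)
    show "continuous_on U (%z. lc x z y)" by (intro continuous_on_lc continuous_intros g)
    show "exp (lc x u y) = sq_sum (KX x u y)" if "u : U" for u by (rule exp_lc[OF g[OF that]])
   qed
   moreover have "(\<Oplus>i. (if i = NN then - 1 else 0) * V (KX x z y) (lc x z y) s k q (i # I)) = - A (NN # I) z s k y"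
    by (simp add: A_def if_distrib[of "%x. x * _"] cong: if_cong)
   ultimately show ?thesis by (simp add: A_def)
  qed
  have dsg: "((%z. sg s k p (%s k. A [] z s k y) (%s k p. A [p] z s k y)) has_field_derivative sg s k p (%s k. B' z s k y) (%s k p. J' p z s k y)) (at z within U)" for s k p
  proof -
   have a: "((%z. A [] z s k y) has_field_derivative B' z s k y) (at z within U)" for s k unfolding B'_def by (rule dA) simp
   have j: "((%z. A [p] z s k y) has_field_derivative J' p z s k y) (at z within U)" for s k p unfolding J'_def by (rule dA) simp
   have 1: "((%z. if k = p then \<Oplus>j. A [j] z s j y else 0) has_field_derivative (if k = p then \<Oplus>j. J' j z s j y else 0)) (at z within U)"
    by (cases "k = p") (auto intro!: DERIV_sum j)
   have 2: "((%z. if s then cg * (\<Oplus>j. lev k j p * A [] z False j y) else 0) has_field_derivative (if s then cg * (\<Oplus>j. lev k j p * B' z False j y) else 0)) (at z within U)"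
    by (cases s) (auto intro!: DERIV_sum DERIV_cmult a)
   show ?thesis unfolding sg_def by (intro DERIV_add DERIV_diff DERIV_cmult 1 2 j)
  qed
  have a: "((%z. A [] z s k y) has_field_derivative B' z s k y) (at z within U)" for s k unfolding B'_def by (rule dA) simp
  show ?thesis unfolding P_def FF_def by (intro DERIV_cmult DERIV_sum DERIV_diff DERIV_cmult_right a dsg)
 qed
 obtain a where a: "Ct \<subseteq> cbox (- a) a" using bounded_subset_cbox_symmetric[OF compact_imp_bounded[OF cutD(1)]] by metis
 have cPz: "continuous_on T (?P z)" if "z : U" for z T
 proof -
  have "continuous_on (U \<times> UNIV) (%(z, y). ?P z y)" by (intro cP cA) auto
  moreover have "continuous_on T (%y. (z, y))" by (intro continuous_intros)
  moreover have "(%y. (z, y)) ` T \<subseteq> U \<times> UNIV" using that by auto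
  ultimately have "continuous_on T (%y. (%(z, y). ?P z y) (z, y))" by (rule continuous_on_compose2)
  thus ?thesis by simp
 qed
 have P_int: "ff q z = integral (cbox (- a) a) (?P z)" if "z : U" for z
 proof -
  have e: "of_real (th y) * FS q z y = ?P z y" for y by (simp add: FS_def P_def F_def KV_def A_def)
  have c: "continuous_on UNIV (?P z)" by (rule cPz[OF that])
  obtain b where b: "!!y. y : Ct ==> norm y <= b" using compact_imp_bounded[OF cutD(1)] by (auto simp: bounded_iff)
  have z0: "?P z y = 0" if "y ~: Ct" for y using that by (intro outside) (simp add: S_def)
  have "integrable lborel (?P z)"
   by (rule integrable_continuous_bounded_support[OF c, of b]) (use b z0 in force)
  hence "(LI y. ?P z y) = integral UNIV (?P z)" by (rule integral_lborel[symmetric])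
  also have "... = integral UNIV (%y. if y : cbox (- a) a then ?P z y else 0)"
   by (intro arg_cong[where f = "integral UNIV"] ext) (use z0 a in auto)
  also have "... = integral (cbox (- a) a) (?P z)" by (rule integral_restrict_UNIV)
  finally show ?thesis unfolding ff_def e .
 qed
 have "(%z. integral (cbox (- a) a) (?P z)) holomorphic_on U"
 proof (rule leibniz_rule_holomorphic[OF der _ _ U(2)])
  show "?P z integrable_on cbox (- a) a" if "z : U" for z
   by (rule integrable_continuous[OF cPz[OF that]])
  have "continuous_on (U \<times> UNIV) (%(z, y). P B' J' z y)"
   unfolding B'_def[abs_def] J'_def[abs_def] by (intro cP continuous_on_minus cA) auto
  thus "continuous_on (U \<times> cbox (- a) a) (%(z, y). P B' J' z y)" by (rule continuous_on_subset) auto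
 qed
 thus ?thesis unfolding U_def[symmetric] using P_int by (simp cong: holomorphic_cong)
qed

end

context estimate
begin

text \<open>\<open>wt\<close> selects the part of the weight that is used: 1 for the layer, exp L
  for its complement. The factor t exchanges the distance to the complex pole for the distance to x,
  which is the one in the weight.\<close>

lemma weighted_bound:
 assumes y: "y : D" "r0 <= norm (y - x)" and l: "exp (lf y) = sq_sum (KX x z y)" "\<bar>Im (lf y)\<bar> <= 2 * pi"
  and nX: "norm (KX x z y) <= 4 * (X + R)" and Q: "Q >= 0" "(norm (KX x z y))^2 <= Q * norm (sq_sum (KX x z y))"
  and t: "t >= 0" "norm (y - x) <= t * norm (KX x z y)"
  and a: "a >= 0" "wt > 0" "wt * a / norm (y - x) ^ CARD('n) <= om y"
 shows "norm (of_real a * (\<Oplus>p. of_real (d y $ p) * F x z lf q p y)) <= KK * Q ^ (CARD('n) + 3) * t ^ CARD('n) / wt * (GG y (d y) * om y)"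
proof -
 define r where "r = norm (y - x)"
 define m where "m = norm (KX x z y)"
 define n where "n = CARD('n)"
 have r: "r > 0" "r <= t * m" using y r0 t by (auto simp: r_def m_def)
 have m: "m > 0"
 proof (rule ccontr)
  assume "~ m > 0"
  hence "m = 0" by (simp add: m_def)
  thus False using r by simp
 qed
 have "r ^ n <= (t * m) ^ n" using r by (intro power_mono) auto
 hence "1 / m ^ n <= t ^ n / r ^ n" using m r by (simp add: power_mult_distrib field_simps)
 hence "a * (1 / m ^ n) <= a * (t ^ n / r ^ n)" using a by (intro mult_left_mono)
 also have "... = t ^ n / wt * (wt * a / r ^ n)" using a by simp
 also have "... <= t ^ n / wt * om y" using a t by (intro mult_left_mono) (auto simp: r_def n_def)
 finally have am: "a / m ^ n <= t ^ n / wt * om y" by simp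
 have "norm (of_real a * (\<Oplus>p. of_real (d y $ p) * F x z lf q p y)) <= a * (KK * Q ^ (n + 3) / m ^ n * GG y (d y))"
  unfolding norm_mult n_def m_def using a FS_bound[where lf = lf, OF y(1) l nX Q refl] by (intro mult_mono) auto
 also have "... = KK * Q ^ (n + 3) * GG y (d y) * (a / m ^ n)" by simp
 also have "... <= KK * Q ^ (n + 3) * GG y (d y) * (t ^ n / wt * om y)"
  using KK1 Q GG_nonneg by (intro mult_left_mono am) auto
 finally show ?thesis by (simp add: n_def mult_ac)
qed

lemma norm_KX_le:
 assumes y: "y : D" and z: "0 <= Re z" "Re z <= 2 * X" "\<bar>Im z\<bar> <= R"
 shows "norm (KX x z y) <= 4 * (X + R)"
proof (rule power2_le_imp_le)
 have s: "0 <= sd x y" "sd x y <= R / 2" using sd_nonneg sd_le[of x y] diam[OF y] by auto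
 have "norm (z - of_real (y $ NN)) <= \<bar>Re z - y $ NN\<bar> + \<bar>Im z\<bar>" using cmod_le[of "z - of_real (y $ NN)"] by simp
 also have "... <= 2 * X + R" using z height[OF y] by (intro add_mono) auto
 finally have wz: "norm (z - of_real (y $ NN)) <= 2 * X + R" .
 have "(norm (KX x z y))^2 <= (norm (z - of_real (y $ NN)) + sd x y)^2" unfolding norm_KX_sq using s by (simp add: power2_sum)
 also have "... <= (4 * (X + R))^2" using wz s X0 R by (intro power_mono) auto
 finally show "(norm (KX x z y))^2 <= (4 * (X + R))^2" .
qed (use X0 R in simp)

lemma KX_lower: "\<bar>Re z - y $ NN\<bar> <= norm (KX x z y)" "\<bar>Im z\<bar> <= norm (KX x z y)" "sd x y <= norm (KX x z y)"
proof -
 have "norm (z - of_real (y $ NN)) <= norm (KX x z y)" by (rule power2_le_imp_le) (simp_all add: norm_KX_sq)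
 thus "\<bar>Re z - y $ NN\<bar> <= norm (KX x z y)" "\<bar>Im z\<bar> <= norm (KX x z y)"
  using abs_Re_le_cmod[of "z - of_real (y $ NN)"] abs_Im_le_cmod[of "z - of_real (y $ NN)"] by auto
 show "sd x y <= norm (KX x z y)" by (rule power2_le_imp_le) (simp_all add: norm_KX_sq)
qed

lemma dist_le: "norm (y - x) <= \<bar>y $ NN - xn\<bar> + sd x y"
 by (rule power2_le_imp_le) (use sd_nonneg[of x y] in \<open>simp_all add: norm_diff_sq power2_sum\<close>)

text \<open>The layer lies at least eta / 2 below the pole, and |z| >= eta. Hence |X|^2 / |s| is at
  most 2 + 4 |z| / eta <= 6 |z| / eta. Moreover |y - x| is at most xn + |KX|, and both summands are
  multiples of |KX|, with factors 2 xn / eta and xn / eta.\<close>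

lemma ff_left:
 assumes xe: "eta <= xn" and z: "Re z = eta" "\<bar>Im z\<bar> <= R"
 shows "norm (ff q z) <= KK * (6 * norm z / eta) ^ (CARD('n) + 3) * (3 * xn / eta) ^ CARD('n) / 1 * Phi"
 unfolding ff_def
proof (rule integral_le_Phi)
 show "0 <= KK * (6 * norm z / eta) ^ (CARD('n) + 3) * (3 * xn / eta) ^ CARD('n) / 1" using KK1 eta0 xe by simp
 fix y assume y: "y : D" "r0 <= norm (y - x)"
 show "norm (of_real (th y) * FS q z y) <= KK * (6 * norm z / eta) ^ (CARD('n) + 3) * (3 * xn / eta) ^ CARD('n) / 1 * (GG y (d y) * om y)"
 proof (cases "eta / 2 <= y $ NN")
  case True thus ?thesis using KK1 eta0 xe GG_nonneg om_nonneg by (simp add: th_0)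
 next
  case False
  hence yN: "y $ NN < Re z" "eta / 2 <= Re z - y $ NN" using z eta0 by auto
  have g: "good x z y" using yN by (simp add: good_def)
  show ?thesis unfolding FS_def
  proof (rule weighted_bound[where lf = "lc x z", OF y exp_lc[OF g] Im_lc[OF g]])
   show "norm (KX x z y) <= 4 * (X + R)" by (rule norm_KX_le[OF y(1)]) (use z eta0 in auto)
   have n: "eta <= norm z" "\<bar>Im z\<bar> <= norm z" using complex_Re_le_cmod[of z] abs_Im_le_cmod[of z] z by auto
   have "2 + 2 * \<bar>Im z\<bar> / (Re z - y $ NN) <= 2 * (norm z / eta) + 2 * norm z / (eta / 2)"
    using n yN eta0 by (intro add_mono frac_le) (auto simp: field_simps)
   also have "... = 6 * norm z / eta" by simp
   finally have "(2 + 2 * \<bar>Im z\<bar> / (Re z - y $ NN)) * norm (sq_sum (KX x z y)) <= 6 * norm z / eta * norm (sq_sum (KX x z y))"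
    by (rule mult_right_mono) simp
   thus "(norm (KX x z y))^2 <= 6 * norm z / eta * norm (sq_sum (KX x z y))" using quotient_bound[OF yN(1), of x] by linarith
   have k: "eta / 2 <= norm (KX x z y)" "sd x y <= norm (KX x z y)" using KX_lower[where z = z and y = y] yN by auto
   have "\<bar>y $ NN - xn\<bar> <= xn" using height[OF y(1)] False xe eta0 by auto
   hence 1: "norm (y - x) <= xn + norm (KX x z y)" using dist_le[of y] k by linarith
   have 2: "xn <= xn * (norm (KX x z y) / (eta / 2))"
    using mult_left_mono[of 1 "norm (KX x z y) / (eta / 2)" xn] k eta0 xe by (simp add: field_simps)
   have 3: "norm (KX x z y) <= xn / eta * norm (KX x z y)" using xe eta0 mult_right_mono[of 1 "xn / eta" "norm (KX x z y)"] by simp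
   have "norm (y - x) <= xn * (norm (KX x z y) / (eta / 2)) + xn / eta * norm (KX x z y)"
    by (rule order_trans[OF 1 add_mono[OF 2 3]])
   thus "norm (y - x) <= 3 * xn / eta * norm (KX x z y)" by (simp add: field_simps)
   show "1 * th y / norm (y - x) ^ CARD('n) <= om y"
    using om_lower(1)[OF y(2)] th_range(2)[of y] divide_right_mono[of "th y" 1 "norm (y - x) ^ CARD('n)"] by simp
  qed (use eta0 xe th_range in auto)
 qed
qed (simp add: FS_def)

text \<open>With no pole over D the layer part is minus the rest of the formula. In the rest the
  factor 1 - th is matched by exp L in the weight, which is where the gain exp (- L) comes
  from.\<close>

lemma complement_bound:
 assumes z: "0 <= Re z" "Re z <= 2 * X" "\<bar>Im z\<bar> <= R" and g: "!!y. y : D ==> good x z y" and Qt: "Q >= 0" "t >= 0"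
  and Q: "!!y. y : D ==> (norm (KX x z y))^2 <= Q * norm (sq_sum (KX x z y))"
  and t: "!!y. y : D ==> norm (y - x) <= t * norm (KX x z y)"
 shows "norm (ff q z) <= KK * Q ^ (CARD('n) + 3) * t ^ CARD('n) / exp L * Phi"
proof -
 have "norm (LI y. of_real (1 - th y) * FS q z y) <= KK * Q ^ (CARD('n) + 3) * t ^ CARD('n) / exp L * Phi"
 proof (rule integral_le_Phi)
  show "0 <= KK * Q ^ (CARD('n) + 3) * t ^ CARD('n) / exp L" using KK1 Qt by simp
  fix y assume y: "y : D" "r0 <= norm (y - x)"
  show "norm (of_real (1 - th y) * FS q z y) <= KK * Q ^ (CARD('n) + 3) * t ^ CARD('n) / exp L * (GG y (d y) * om y)"
   unfolding FS_def
   by (rule weighted_bound[where lf = "lc x z", OF y exp_lc[OF g[OF y(1)]] Im_lc[OF g[OF y(1)]] norm_KX_le[OF y(1) z] Qt(1) Q[OF y(1)] Qt(2) t[OF y(1)]])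
    (use th_range om_lower(2)[OF y(2)] in auto)
 qed (simp add: FS_def)
 moreover have "ff q z = - (LI y. of_real (1 - th y) * FS q z y)" by (rule ff_complement[OF g])
 ultimately show ?thesis by (simp only: norm_minus_cancel)
qed

lemma ff_right:
 assumes z: "Re z = X + eta" "\<bar>Im z\<bar> <= R"
 shows "norm (ff q z) <= KK * (4 * norm (of_real (X + 2 * eta) - z) / eta) ^ (CARD('n) + 3) * (3 * (X + 2 * eta - xn) / eta) ^ CARD('n) / exp L * Phi"
proof (rule complement_bound)
 let ?N = "norm (of_real (X + 2 * eta) - z)"
 have v: "eta <= X + 2 * eta - xn" using height[OF xD] eta0 by simp
 show "0 <= Re z" "Re z <= 2 * X" "\<bar>Im z\<bar> <= R" using z eta0 X0 by auto
 show "0 <= 4 * ?N / eta" "0 <= 3 * (X + 2 * eta - xn) / eta" using eta0 v by auto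
 fix y assume y: "y : D"
 have yN: "y $ NN < Re z" "eta <= Re z - y $ NN" using z height[OF y] eta0 by auto
 thus "good x z y" by (simp add: good_def)
 have n: "eta <= ?N" "\<bar>Im z\<bar> <= ?N"
  using complex_Re_le_cmod[of "of_real (X + 2 * eta) - z"] abs_Im_le_cmod[of "of_real (X + 2 * eta) - z"] z by auto
 define N where "N = ?N"
 have N: "eta <= N" "\<bar>Im z\<bar> <= N" using n by (simp_all add: N_def)
 have "2 + 2 * \<bar>Im z\<bar> / (Re z - y $ NN) <= 2 * (N / eta) + 2 * N / eta"
  using N yN eta0 by (intro add_mono frac_le) (auto simp: field_simps)
 also have "... = 4 * ?N / eta" by (simp add: N_def del: of_real_add)
 finally have "(2 + 2 * \<bar>Im z\<bar> / (Re z - y $ NN)) * norm (sq_sum (KX x z y)) <= 4 * ?N / eta * norm (sq_sum (KX x z y))"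
  by (rule mult_right_mono) simp
 thus "(norm (KX x z y))^2 <= 4 * ?N / eta * norm (sq_sum (KX x z y))" using quotient_bound[OF yN(1), of x] by linarith
 define m where "m = norm (KX x z y)"
 have k: "Re z - y $ NN <= m" "eta <= m" "sd x y <= m" using KX_lower[where z = z and y = y] yN by (auto simp: m_def)
 define v where "v = X + 2 * eta - xn"
 have v1: "1 <= v / eta" using \<open>eta <= X + 2 * eta - xn\<close> eta0 by (simp add: v_def)
 have m0: "m >= 0" by (simp add: m_def)
 have mv: "m <= v / eta * m" using mult_right_mono[OF v1 m0] by simp
 have vm: "v <= v / eta * m" using k(2) eta0 v1 by (simp add: field_simps mult_left_mono)
 have "\<bar>y $ NN - xn\<bar> <= m + v" using k height[OF y] z eta0 m0 v1 height[OF xD] by (auto simp: v_def abs_le_iff)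
 hence "norm (y - x) <= 2 * m + v" using dist_le[of y] k by linarith
 also have "... <= 3 * p" if "m <= p" "v <= p" for p using that by linarith
 from this[OF mv vm] have "2 * m + v <= 3 * (v / eta * m)" .
 also have "3 * (v / eta * m) = 3 * v / eta * m" by simp
 finally show "norm (y - x) <= 3 * (X + 2 * eta - xn) / eta * norm (KX x z y)" unfolding v_def m_def .
qed

lemma ff_lateral:
 assumes z: "eta <= Re z" "Re z <= X + eta" "\<bar>Im z\<bar> = R"
 shows "norm (ff q z) <= KK * (64 * (X + R)^2 / R^2) ^ (CARD('n) + 3) * 1 ^ CARD('n) / exp L * Phi"
proof (rule complement_bound)
 show z': "0 <= Re z" "Re z <= 2 * X" "\<bar>Im z\<bar> <= R" using z eta0 by auto
 show "0 <= 64 * (X + R)^2 / R^2" "0 <= (1::real)" by auto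
 fix y assume y: "y : D"
 have s: "sd x y <= R / 2" "0 <= sd x y" using sd_le[of x y] diam[OF y] sd_nonneg by auto
 thus "good x z y" using z R by (auto simp: good_def)
 \<comment> \<open>The horizontal distance is at most R / 2 and |Im z| = R, so each of the two
   factors of s has imaginary part at least R / 2.\<close>
 have i: "R / 2 <= \<bar>Im (z - of_real (y $ NN) + \<i> * of_real (sd x y))\<bar>" "R / 2 <= \<bar>Im (z - of_real (y $ NN) - \<i> * of_real (sd x y))\<bar>"
  using s z(3) by (auto simp: abs_if split: if_splits)
 have "R / 2 <= norm (z - of_real (y $ NN) + \<i> * of_real (sd x y))" "R / 2 <= norm (z - of_real (y $ NN) - \<i> * of_real (sd x y))"
  by - (rule order_trans[OF i(1) abs_Im_le_cmod] order_trans[OF i(2) abs_Im_le_cmod])+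
 hence "R / 2 * (R / 2) <= norm (sq_sum (KX x z y))" unfolding sq_sum_KX norm_mult using R by (intro mult_mono) auto
 hence q: "R^2 / 4 <= norm (sq_sum (KX x z y))" by (simp add: power2_eq_square)
 have "(norm (KX x z y))^2 <= (4 * (X + R))^2" using norm_KX_le[OF y z'] by (intro power_mono) auto
 also have "(4 * (X + R))^2 = 16 * (X + R)^2" by (simp only: power_mult_distrib) simp
 also have "... = 64 * (X + R)^2 / R^2 * (R^2 / 4)" using R by simp
 also have "... <= 64 * (X + R)^2 / R^2 * norm (sq_sum (KX x z y))" using q by (intro mult_left_mono) auto
 finally show "(norm (KX x z y))^2 <= 64 * (X + R)^2 / R^2 * norm (sq_sum (KX x z y))" .
 show "norm (y - x) <= 1 * norm (KX x z y)" using KX_lower(2)[where z = z and y = y] diam[OF y] z R by auto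
qed

lemma real_bound:
 assumes a: "!!y. 0 <= a y" "continuous_on UNIV a" and wt: "wt > 0" "!!y. r0 <= norm (y - x) ==> wt * a y / norm (y - x) ^ CARD('n) <= om y"
 shows "norm (LI y. of_real (a y) * Fr x q (d y) y) <= KK * 1 ^ (CARD('n) + 3) * 1 ^ CARD('n) / wt * Phi"
proof (rule integral_le_Phi)
 show "0 <= KK * 1 ^ (CARD('n) + 3) * 1 ^ CARD('n) / wt" using KK1 wt by simp
 fix y assume y: "y : D" "r0 <= norm (y - x)"
 have "(norm (y - x))^2 > 0" using y r0 by auto
 hence e: "exp (rl x y) = sq_sum (KX x (of_real xn) y)" unfolding KX_real sq_sum_of_real rl_def by (rule exp_ln_of_real)
 have nK: "norm (KX x (of_real xn) y) = norm (y - x)" unfolding KX_real by (rule norm_vec_of_real)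
 show "norm (of_real (a y) * Fr x q (d y) y) <= KK * 1 ^ (CARD('n) + 3) * 1 ^ CARD('n) / wt * (GG y (d y) * om y)"
 proof (rule weighted_bound[where lf = "rl x", OF y e])
  show "(norm (KX x (of_real xn) y))^2 <= 1 * norm (sq_sum (KX x (of_real xn) y))"
   unfolding nK unfolding KX_real sq_sum_of_real by (simp add: norm_power)
  show "norm (KX x (of_real xn) y) <= 4 * (X + R)" unfolding nK using diam[OF y(1)] X0 R by simp
 qed (use a wt y nK in \<open>auto simp: rl_def\<close>)
qed simp

text \<open>\<open>TC\<close> is the two-constants estimate for the present parameters. One majorant
  serves all sides: A the vertical ones, since 4 <= 6, and B the horizontal ones. What lies above
  the layer is bounded directly with the gain exp (- L), which is at most exp (- L xn / X).\<close>

lemma main_estimate: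
 assumes C2: "C2 > 0" and TC: "!!f \<Phi>. \<Phi> >= 0 ==> eta <= xn ==> xn <= X ==>
   strip_bounds CARD('n) (CARD('n) + 3) X R L eta xn \<Phi> f ==> norm (f (of_real xn)) <= C2 * exp (- L * xn / X) * \<Phi>"
 shows "cQ * norm (UU s k x) <= KK * (C2 * (6 ^ (CARD('n) + 3) * 3 ^ CARD('n) + (64 * (X + R)^2 / R^2) ^ (CARD('n) + 3)) + 3) * (exp (- L * xn / X) * Phi)"
proof -
 define n where "n = CARD('n)"
 define A where "A = 6 ^ (n + 3) * (3::real) ^ n"
 define B where "B = (64 * (X + R)^2 / R^2) ^ (n + 3)"
 define q where "q = (s, k)"
 have A0: "A >= 0" and B0: "B >= 0" by (simp_all add: A_def B_def)
 have xnX: "xn <= X" "xn > 0" using height[OF xD] by auto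
 have rep: "cQ * norm (UU s k x) <= norm (LI y. Fr x q (d y) y)"
  using cutoff_representation[OF xD card cut r0, of q] by (simp add: q_def)
 have KP: "KK * Phi >= 0" using KK1 Phi_nonneg by simp
 have eLX: "exp (- L) <= exp (- L * xn / X)" using xnX L X0 by (simp add: field_simps)
 show ?thesis
 proof (cases "eta <= xn")
  case True
  define \<Phi> where "\<Phi> = KK * (A + B) * Phi"
  have P: "\<Phi> >= 0" "KK * A * Phi <= \<Phi>" "KK * B * Phi <= \<Phi>"
   unfolding \<Phi>_def using KK1 Phi_nonneg A0 B0 by (auto intro!: mult_right_mono mult_left_mono)
  have A1: "4 ^ (n + 3) * 3 ^ n <= A" unfolding A_def by (intro mult_right_mono power_mono) auto
  have f1: "norm (ff q (of_real xn)) <= C2 * exp (- L * xn / X) * \<Phi>"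
  proof (rule TC[OF P(1) True xnX(1)], unfold strip_bounds_def, intro conjI allI impI ff_holomorphic)
   fix z :: complex assume "\<bar>Im z\<bar> <= R" "Re z = eta"
   note z = this(2,1)
   have "norm (ff q z) <= (KK * A * Phi) * ((xn / eta) ^ n * (norm z / eta) ^ (n + 3))"
    using ff_left[OF True z, of q] unfolding n_def[symmetric] times_divide_eq_right[symmetric] power_mult_distrib by (simp add: A_def mult_ac)
   also have "... <= \<Phi> * ((xn / eta) ^ n * (norm z / eta) ^ (n + 3))" using P(2) eta0 xnX by (intro mult_right_mono) auto
   finally show "norm (ff q z) <= \<Phi> * (xn / eta) ^ CARD('n) * (norm z / eta) ^ (CARD('n) + 3)" by (simp add: n_def mult_ac)
  next
   fix z :: complex assume "\<bar>Im z\<bar> <= R" "Re z = X + eta"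
   note z = this(2,1)
   define W where "W = ((X + 2 * eta - xn) / eta) ^ n * (norm (of_real (X + 2 * eta) - z) / eta) ^ (n + 3)"
   have W0: "W >= 0" using eta0 xnX by (simp add: W_def)
   have "norm (ff q z) <= exp (- L) * (KK * (4 ^ (n + 3) * 3 ^ n) * Phi) * W"
    using ff_right[OF z, of q] unfolding n_def[symmetric] times_divide_eq_right[symmetric] power_mult_distrib by (simp add: W_def exp_minus divide_inverse mult_ac)
   also have "... <= exp (- L) * \<Phi> * W"
   proof (intro mult_right_mono[OF _ W0] mult_left_mono)
    have "KK * (4 ^ (n + 3) * 3 ^ n) * Phi <= KK * A * Phi" using A1 KK1 Phi_nonneg by (intro mult_right_mono mult_left_mono) auto
    thus "KK * (4 ^ (n + 3) * 3 ^ n) * Phi <= \<Phi>" using P(2) by linarith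
   qed simp
   finally show "norm (ff q z) <= exp (- L) * \<Phi> * ((X + 2 * eta - xn) / eta) ^ CARD('n) * (norm (of_real (X + 2 * eta) - z) / eta) ^ (CARD('n) + 3)"
    by (simp add: n_def W_def mult_ac)
  next
   fix z :: complex assume z: "eta <= Re z" "Re z <= X + eta" "\<bar>Im z\<bar> = R"
   have "norm (ff q z) <= exp (- L) * (KK * B * Phi)"
    using ff_lateral[OF z, of q] by (simp add: n_def[symmetric] B_def exp_minus divide_inverse mult_ac)
   also have "... <= exp (- L) * \<Phi>" using P(3) by (intro mult_left_mono) auto
   finally show "norm (ff q z) <= exp (- L) * \<Phi>" .
  qed
  have "norm (LI y. of_real (1 - th y) * Fr x q (d y) y) <= KK * 1 ^ (CARD('n) + 3) * 1 ^ CARD('n) / exp L * Phi"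
   using th_range om_lower(2) by (intro real_bound continuous_intros continuous_on_th) auto
  hence f2: "norm (LI y. of_real (1 - th y) * Fr x q (d y) y) <= exp (- L) * (KK * Phi)"
   by (simp add: exp_minus divide_inverse mult_ac)
  also have "... <= exp (- L * xn / X) * (KK * Phi)" using eLX KP by (intro mult_right_mono)
  finally have f2: "norm (LI y. of_real (1 - th y) * Fr x q (d y) y) <= exp (- L * xn / X) * (KK * Phi)" .
  have "cQ * norm (UU s k x) <= norm (ff q (of_real xn)) + norm (LI y. of_real (1 - th y) * Fr x q (d y) y)"
   using rep ff_real[of q] True eta0 by (intro order_trans[OF rep]) (simp add: norm_triangle_ineq)
  also have "... <= C2 * exp (- L * xn / X) * \<Phi> + exp (- L * xn / X) * (KK * Phi)" by (intro add_mono f1 f2)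
  also have "... = KK * (C2 * (A + B) + 1) * (exp (- L * xn / X) * Phi)" by (simp add: \<Phi>_def algebra_simps)
  also have "... <= KK * (C2 * (A + B) + 3) * (exp (- L * xn / X) * Phi)"
   using KK1 Phi_nonneg by (intro mult_right_mono mult_left_mono) auto
  finally show ?thesis by (simp add: A_def B_def n_def)
 next
  \<comment> \<open>Below height eta the exponential factor is at least 1 / e, so the representation
    itself, with the weight 1, is enough.\<close>
  case False
  have "norm (LI y. of_real 1 * Fr x q (d y) y) <= KK * 1 ^ (CARD('n) + 3) * 1 ^ CARD('n) / 1 * Phi"
   using om_lower(1) by (intro real_bound) auto
  hence "cQ * norm (UU s k x) <= KK * Phi" using rep by simp
  also have "... <= 3 * exp (- L * xn / X) * (KK * Phi)"
  proof -
   have "L * xn / X <= L * eta / X" using False L X0 by (intro divide_right_mono mult_left_mono) auto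
   also have "... <= 1" using L X0 by (simp add: eta)
   finally have "exp (- 1) <= exp (- L * xn / X)" by simp
   moreover have "1 <= 3 * exp (- 1 :: real)" using exp_le by (simp add: exp_minus field_simps)
   ultimately have "1 <= 3 * exp (- L * xn / X)" by linarith
   from mult_right_mono[OF this KP] show ?thesis by simp
  qed
  also have "... = KK * 3 * (exp (- L * xn / X) * Phi)" by simp
  also have "... <= KK * (C2 * (A + B) + 3) * (exp (- L * xn / X) * Phi)"
   using KK1 Phi_nonneg C2 A0 B0 by (intro mult_right_mono mult_left_mono) auto
  finally show ?thesis by (simp add: A_def B_def n_def)
 qed
qed

end

text \<open>The left side is M^(1-t) \<delta>^t, and M^(1-t) lies below 1 or below M.\<close>

lemma interpolation_weight:
 fixes M \<delta> t M\<^sub>0 :: real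
 assumes "0 < \<delta>" "0 < M" "M <= M\<^sub>0" "0 <= t" "t <= 1"
 shows "exp (- ln (M / \<delta>) * t) * M <= max 1 M\<^sub>0 * \<delta> powr t"
proof -
 have "exp (- ln (M / \<delta>) * t) * M = exp (- ln (M / \<delta>) * t) * exp (ln M)" using assms by simp
 also have "... = exp ((1 - t) * ln M + t * ln \<delta>)"
  unfolding exp_add[symmetric] using assms by (intro arg_cong[where f = exp]) (simp add: ln_div algebra_simps)
 also have "... = M powr (1 - t) * \<delta> powr t" using assms by (simp add: powr_def exp_add mult.commute)
 also have "... <= max 1 M\<^sub>0 * \<delta> powr t"
 proof (intro mult_right_mono)
  show "M powr (1 - t) <= max 1 M\<^sub>0"
  proof (cases "M <= 1")
   case True
   hence "M powr (1 - t) <= 1 powr (1 - t)" using assms by (intro powr_mono2) auto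
   thus ?thesis by simp
  next
   case False
   hence "M powr (1 - t) <= M powr 1" using assms by (intro powr_mono) auto
   thus ?thesis using assms by simp
  qed
 qed simp
 finally show ?thesis .
qed

theorem theorem3:
  fixes D \<Sigma> S :: "(real^'n::{finite,linorder}) set"
    and m :: nat
    and lam \<mu> \<nu> \<beta> \<epsilon> \<alpha> \<rho> \<sigma> \<theta> :: real
    and M\<^sub>0 \<kappa> :: real
  assumes "m \<ge> 1" and "CARD('n) = 2 * m \<or> CARD('n) = 2 * m + 1"
    and "half_space_domain D \<Sigma> S"
    and "\<mu> > 0" and "3 * lam + 2 * \<mu> > 0" and "\<alpha> > 0" and "\<epsilon> > 0" and "3 * \<epsilon> + 2 * \<nu> > 0"
    and "\<beta> > 0" and "\<rho> > 0" and "\<sigma> > 0"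
    and "\<nu> + \<beta> \<noteq> 0" and "\<epsilon> + 2 * \<nu> \<noteq> 0"
    and "\<kappa> > 1"
  shows "\<exists>C>0. \<forall>u w M \<delta>.
    regular_solution lam \<mu> \<nu> \<beta> \<epsilon> \<alpha> \<rho> \<sigma> \<theta> D u w \<longrightarrow>
    0 < \<delta> \<longrightarrow> \<delta> < 1 \<longrightarrow> \<kappa> * \<delta> \<le> M \<longrightarrow> M \<le> M\<^sub>0 \<longrightarrow>
    (\<forall>y\<in>frontier D - S. cauchy_data_le lam \<mu> \<nu> \<beta> \<epsilon> \<alpha> D u w y M) \<longrightarrow>
    (\<forall>y\<in>S. cauchy_data_le lam \<mu> \<nu> \<beta> \<epsilon> \<alpha> D u w y \<delta>) \<longrightarrow>
    (\<forall>x\<in>D. norm (u x, w x)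
       \<le> C * inverse_distance_integral D x
           * \<delta> powr (last_coord x / (SUP z\<in>D. last_coord z)) * (ln (M / \<delta>)) ^ m)"
proof -
 interpret elastic lam \<mu> \<nu> \<beta> \<epsilon> \<alpha> \<rho> \<sigma> \<theta> "TYPE('n)"
  by unfold_locales (use assms in auto)
 have card: "CARD('n) >= 2" using assms(1,2) by auto
 note dom = half_space_domain_facts[OF assms(3)]
 have lc_NN: "last_coord y = y $ NN" for y :: "(real, 'n) vec" by (simp add: last_coord_def NN_def)
 define X where "X = (SUP z\<in>D. last_coord z)"
 obtain b where b: "!!y. y : D ==> norm y <= b" using dom(2) by (auto simp: bounded_iff)
 have bdd: "bdd_above (last_coord ` D)"
 proof (rule bdd_aboveI)
  fix a assume "a : last_coord ` D"
  then obtain y where y: "y : D" "a = y $ NN" by (auto simp: lc_NN)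
  show "a <= b" using component_le_norm_cart[of y NN] b[OF y(1)] y(2) by linarith
 qed
 have height: "0 < y $ NN & y $ NN <= X" if "y : D" for y
  using dom(4)[OF that] cSUP_upper[OF that bdd] by (simp add: lc_NN X_def)
 have X0: "X > 0" using dom(3) height by fastforce
 have b0: "b >= 0" using dom(3) b norm_ge_zero order_trans by blast
 \<comment> \<open>Two points of D are at most 2 b apart, which is below R / 2; the 1 ensures R >=
   1.\<close>
 define R where "R = 4 * b + 1"
 have R: "R >= 1" using b0 by (simp add: R_def)
 have diam: "norm (y - x) <= R / 2" if "x : D" "y : D" for x y
  using norm_triangle_ineq4[of y x] b[OF that(1)] b[OF that(2)] by (simp add: R_def)
 obtain K where K: "K >= 1" "!!Y l s (k :: 'n) q I Q. exp l = sq_sum Y ==> norm Y <= 4 * (X + R) ==> length I <= 1 ==> \<bar>Im l\<bar> <= 2 * pi ==>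
  (norm Y)^2 <= Q * norm (sq_sum Y) ==> norm (V Y l s k q I) <= K * Q ^ (CARD('n) + 3) / norm Y ^ CARD('n)"
  by (rule kernel_bound[OF card, of "4 * (X + R)"]) (use X0 R in auto)
 \<comment> \<open>A lower bound for ln (M / \<delta>), on which the two-constants estimate and the
   last factor of the claim rely.\<close>
 define L0 where "L0 = ln \<kappa>"
 have L0: "L0 > 0" using assms(14) by (simp add: L0_def)
 have R0: "R > 0" using R by simp
 obtain C2 where C2: "C2 > 0"
  "!!f L \<eta> \<Phi> xn. L >= L0 ==> \<eta> = X / (L + 1) ==> \<Phi> >= 0 ==> \<eta> <= xn ==> xn <= X ==>
   strip_bounds CARD('n) (CARD('n) + 3) X R L \<eta> xn \<Phi> f ==> norm (f (of_real xn)) <= C2 * exp (- L * xn / X) * \<Phi>"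
  by (rule two_constants[OF X0 R0 L0, of "CARD('n)" "CARD('n) + 3"]) blast
 define n where "n = real CARD('n)"
 have n2: "n >= 2" using card by (simp add: n_def)
 define Cm where "Cm = (1 + 2 * n * Csg) * K * (C2 * (6 ^ (CARD('n) + 3) * 3 ^ CARD('n) + (64 * (X + R)^2 / R^2) ^ (CARD('n) + 3)) + 3)"
 have Cm: "Cm > 0"
  unfolding Cm_def using n2 Csg_ge_1 K(1) C2(1) by (intro mult_pos_pos add_pos_pos add_nonneg_pos) (auto intro!: mult_nonneg_nonneg)
 define geo where "geo = geo_const CARD('n)"
 have geo: "geo > 0" unfolding geo_def geo_const_def using n2 sweep_const_pos[of "CARD('n)"] by (simp add: n_def)
 \<comment> \<open>2 n components, the estimate \<open>Cm\<close>, the boundary constant, and 4 n M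
   for the weighted data; the flux \<open>cQ\<close> divides.\<close>
 define C0 where "C0 = 2 * n * (Cm * (geo * (4 * n)) / cQ)"
 have C0: "C0 > 0" unfolding C0_def using n2 Cm geo cQ_pos by (intro mult_pos_pos divide_pos_pos) auto
 \<comment> \<open>Division by \<open>L0 ^ m\<close> allows the factor (ln (M / \<delta>))^m to be
   inserted at the end, since that logarithm is at least \<open>L0\<close>.\<close>
 define C where "C = C0 * max 1 M\<^sub>0 / L0 ^ m"
 show ?thesis
 proof (intro exI[of _ C] conjI allI impI ballI)
  show "C > 0" unfolding C_def using C0 L0 by (intro divide_pos_pos mult_pos_pos) auto
  fix u w M \<delta> x
  assume sol: "regular_solution lam \<mu> \<nu> \<beta> \<epsilon> \<alpha> \<rho> \<sigma> \<theta> D u w" and \<delta>: "0 < \<delta>" "\<delta> < 1" and M: "\<kappa> * \<delta> <= M" "M <= M\<^sub>0"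
   and data\<Sigma>: "ALL y:frontier D - S. cauchy_data_le lam \<mu> \<nu> \<beta> \<epsilon> \<alpha> D u w y M"
   and dataS: "ALL y:S. cauchy_data_le lam \<mu> \<nu> \<beta> \<epsilon> \<alpha> D u w y \<delta>" and x: "x : D"
  interpret S: solution lam \<mu> \<nu> \<beta> \<epsilon> \<alpha> \<rho> \<sigma> \<theta> "TYPE('n)" D u w by unfold_locales (use dom sol in auto)
  have dM: "\<delta> <= M" using M(1) \<delta> assms(14) mult_right_mono[of 1 \<kappa> \<delta>] by linarith
  have M0: "M > 0" using dM \<delta> by linarith
  define L where "L = ln (M / \<delta>)"
  have L: "L0 <= L" unfolding L_def L0_def using M \<delta> assms(14) by (intro ln_mono) (auto simp: field_simps)
  have eL: "exp L = M / \<delta>" using M0 \<delta> by (simp add: L_def)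
  define \<eta> where "\<eta> = X / (L + 1)"
  obtain r0 where r0: "r0 > 0" "cball x r0 \<subseteq> D" using dom(1) x open_contains_cball by blast
  define om0 where "om0 y = 1 / max (norm (y - x)) r0 ^ CARD('n)" for y :: "(real, 'n) vec"
  define om where "om y = (1 + exp L * (1 - step (y $ NN / (\<eta> / 2)))) / max (norm (y - x)) r0 ^ CARD('n)" for y :: "(real, 'n) vec"
  define E where "E = \<Sigma> Int closure S"
  define bd where "bd y = 2 * n * (if y : S then \<delta> else M)" for y
  have eta0: "\<eta> > 0" using X0 L L0 by (simp add: \<eta>_def)
  have Sb: "S : sets borel"
  proof -
   have "open {y :: (real, 'n) vec. 0 < y $ NN}"
    by (intro open_Collect_less continuous_on_const continuous_on_component[OF continuous_on_id])
   moreover have "S = frontier D Int {y. 0 < y $ NN}" using dom(5) by (auto simp: lc_NN)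
   ultimately show ?thesis by (auto intro!: sets.Int borel_closed borel_open)
  qed
  have bs: "boundary_seminorm D E S.GG om' bd (2 * n * M)" if om': "continuous_on UNIV om'" "!!y. 0 <= om' y" for om'
  proof
   show "open D" "bounded D" by (rule dom)+
   show "compact E" "E \<subseteq> frontier D" "hcod E = 0" unfolding E_def by (rule dom)+
   show "EX W \<phi> k. open W & y : W & C1_on W \<phi> & D Int W = {z : W. \<phi> z < 0} & partial k \<phi> y ~= 0" if "y : frontier D - E" for y
    by (rule dom(9)) (use that E_def in simp)
   show "emeasure (hausdorff_measure (CARD('n) - 1)) (frontier D) < \<infinity>" by (rule dom)
   show "S.GG y v <= bd y" if "y : frontier D - E" "unit_outward_normal D y v" for y v
   proof -
    have "cauchy_data_le lam \<mu> \<nu> \<beta> \<epsilon> \<alpha> D u w y (if y : S then \<delta> else M)" using that data\<Sigma> dataS by auto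
    from S.GG_boundary[OF _ that(2) this] show ?thesis using that by (simp add: bd_def n_def)
   qed
   show "bd : borel_measurable borel" unfolding bd_def[abs_def] using Sb by measurable
  qed (use card om' S.GG_seminorm S.continuous_on_GG \<delta> dM M0 n2 in \<open>auto simp: bd_def\<close>)
  have mx: "max (norm (y - x)) r0 ^ CARD('n) > 0" for y using r0 by (intro zero_less_power) auto
  have om0: "continuous_on UNIV om0" "0 <= om0 y" for y
   unfolding om0_def using mx less_imp_neq[OF mx] by (auto intro!: continuous_intros simp: less_imp_le)
  have s01: "0 <= 1 + exp L * (1 - step t)" for t using step_range[of t] by (simp add: add_nonneg_nonneg)
  have om: "continuous_on UNIV om" "0 <= om y" for y
  proof -
   have "continuous_on UNIV (%y :: (real, 'n) vec. y $ NN / (\<eta> / 2))" using eta0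
    by (intro continuous_on_divide continuous_on_component continuous_on_id continuous_on_const) auto
   hence "continuous_on UNIV (%y :: (real, 'n) vec. step (y $ NN / (\<eta> / 2)))" by (rule continuous_on_compose2[OF continuous_on_step[of UNIV]]) auto
   thus "continuous_on UNIV om" unfolding om_def[abs_def] using r0 by (intro continuous_intros) auto
   show "0 <= om y" unfolding om_def using mx[of y] s01 by (intro divide_nonneg_nonneg) (auto simp: less_imp_le)
  qed
  interpret B: boundary_seminorm D E S.GG om bd "2 * n * M" by (rule bs[OF om])
  interpret B0: boundary_seminorm D E S.GG om0 bd "2 * n * M" by (rule bs[OF om0])
  define I where "I = inverse_distance_integral D x"
  have fb: "frontier D : sets borel" by (simp add: borel_closed)
  have far: "r0 <= norm (y - x)" if "y : frontier D" for y
  proof (rule ccontr)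
   assume "~ r0 <= norm (y - x)"
   hence "y : D" using r0(2) by (auto simp: dist_norm norm_minus_commute subset_iff)
   thus False using that dom(1) by (simp add: frontier_def interior_open)
  qed
  have mxf: "max (norm (y - x)) r0 = norm (y - x)" if "y : frontier D" for y using far[OF that] by simp
  have I_eq: "I = (LINT y|B.H. indicator (frontier D) y * om0 y)"
   unfolding I_def inverse_distance_integral_def set_lebesgue_integral_def
   by (intro Bochner_Integration.integral_cong refl)
    (auto simp: om0_def indicator_def dist_norm norm_minus_commute mxf[simplified norm_minus_commute] mxf)
  have I0: "I >= 0" unfolding I_eq using om0 by (intro integral_nonneg_AE AE_I2) auto
  have bI: "(LINT y|B.H. indicator (frontier D) y * (bd y * om y)) <= 4 * n * M * I"
  proof -
   have i0: "integrable B.H (%y. indicator (frontier D) y * (1 * om0 y))" by (rule B0.integrable_boundary[of "%y. 1" 1]) (use fb in auto)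
   have "(LINT y|B.H. indicator (frontier D) y * (bd y * om y)) <= (LINT y|B.H. 4 * n * M * (indicator (frontier D) y * (1 * om0 y)))"
   proof (rule integral_mono)
    show "integrable B.H (%y. indicator (frontier D) y * (bd y * om y))"
     by (rule B.integrable_boundary[OF B.bd fb order_refl])
    show "integrable B.H (%y. 4 * n * M * (indicator (frontier D) y * (1 * om0 y)))" by (intro integrable_mult_right i0)
    fix y
    show "indicator (frontier D) y * (bd y * om y) <= 4 * n * M * (indicator (frontier D) y * (1 * om0 y))"
    proof (cases "y : frontier D")
     case True
     \<comment> \<open>On S the factor exp L = M / \<delta> raises the data \<delta> to at most 2 M.
       Elsewhere on the frontier the height is not positive, the step equals 1, and the data M keep
       the weight 1.\<close>
     have "bd y * (1 + exp L * (1 - step (y $ NN / (\<eta> / 2)))) <= 4 * n * M"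
     proof (cases "y : S")
      case True
      have "\<delta> * (1 + exp L * (1 - step (y $ NN / (\<eta> / 2)))) <= \<delta> * (1 + exp L * 1)"
       using \<delta> step_range(1) by (intro mult_left_mono add_left_mono) auto
      also have "... = \<delta> + M" using \<delta> by (simp add: eL distrib_left)
      also have "... <= 2 * M" using dM by simp
      finally have "2 * n * (\<delta> * (1 + exp L * (1 - step (y $ NN / (\<eta> / 2))))) <= 2 * n * (2 * M)" using n2 by (intro mult_left_mono) auto
      thus ?thesis using True by (simp add: bd_def mult_ac)
     next
      case False
      hence "y $ NN <= 0" using True dom(5) by (auto simp: lc_NN)
      hence "y $ NN / (\<eta> / 2) <= 1 / 2" using eta0 by (simp add: field_simps)
      hence "step (y $ NN / (\<eta> / 2)) = 1" by (rule step_simps)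
      thus ?thesis using False n2 M0 by (simp add: bd_def)
     qed
     hence "bd y * (1 + exp L * (1 - step (y $ NN / (\<eta> / 2)))) / max (norm (y - x)) r0 ^ CARD('n) <= 4 * n * M / max (norm (y - x)) r0 ^ CARD('n)"
      using mx[of y] by (intro divide_right_mono) auto
     thus ?thesis using True by (simp add: om_def om0_def)
    qed simp
   qed
   thus ?thesis by (simp add: I_eq)
  qed
  have point: "cQ * \<bar>S.fn s k x\<bar> <= Cm * exp (- L * (x $ NN) / X) * (geo * (4 * n * M * I))" for s k
  \<comment> \<open>The cutoff depends on the solution, on x and on the permitted error, but the
    constants do not, so the error can be sent to 0.\<close>
  proof (rule field_le_epsilon)
   fix e :: real assume e: "e > 0"
   define e' where "e' = e / (Cm * exp (- L * (x $ NN) / X))"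
   have e': "e' > 0" using e Cm by (simp add: e'_def)
   obtain Ct ct d where ct: "cutoff Ct ct d" "Ct \<subseteq> D" "ALL y:cball x r0. ct y = 1 & d y = 0"
    "(LI y. indicator D y * (S.GG y (d y) * om y)) <= geo_const CARD('n) * (LINT y|B.H. indicator (frontier D) y * (bd y * om y)) + e'"
    using B.boundary_cutoff[OF compact_cball r0(2) e'] by blast
   interpret T: estimate lam \<mu> \<nu> \<beta> \<epsilon> \<alpha> \<rho> \<sigma> \<theta> "TYPE('n)" D u w Ct ct d x r0 X R L K \<eta>
    by unfold_locales (use card x dom(2) height diam R L L0 \<eta>_def ct r0 K in auto)
   have ph: "T.Phi = (LI y. indicator D y * (S.GG y (d y) * om y))"
    unfolding T.Phi_def T.om_def[abs_def] T.th_def om_def ..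
   have "cQ * norm (S.UU s k x) <= T.KK * (C2 * (6 ^ (CARD('n) + 3) * 3 ^ CARD('n) + (64 * (X + R)^2 / R^2) ^ (CARD('n) + 3)) + 3) * (exp (- L * (x $ NN) / X) * T.Phi)"
    by (rule T.main_estimate[OF C2(1)]) (rule C2(2)[OF L \<eta>_def])
   hence "cQ * \<bar>S.fn s k x\<bar> <= Cm * exp (- L * (x $ NN) / X) * T.Phi"
    by (simp add: T.KK_def Cm_def n_def S.UU_def mult_ac)
   also have "... <= Cm * exp (- L * (x $ NN) / X) * (geo * (4 * n * M * I) + e')"
   proof (intro mult_left_mono)
    have "T.Phi <= geo * (LINT y|B.H. indicator (frontier D) y * (bd y * om y)) + e'" using ct(4) by (simp add: ph geo_def)
    also have "... <= geo * (4 * n * M * I) + e'" using geo by (intro add_right_mono mult_left_mono bI) auto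
    finally show "T.Phi <= geo * (4 * n * M * I) + e'" .
   qed (use Cm in simp)
   also have "... = Cm * exp (- L * (x $ NN) / X) * (geo * (4 * n * M * I)) + e" using Cm by (simp add: e'_def distrib_left)
   finally show "cQ * \<bar>S.fn s k x\<bar> <= Cm * exp (- L * (x $ NN) / X) * (geo * (4 * n * M * I)) + e" .
  qed
  define Q where "Q = Cm * exp (- L * (x $ NN) / X) * (geo * (4 * n * M * I)) / cQ"
  have fnQ: "\<bar>S.fn s k x\<bar> <= Q" for s k using point[of s k] cQ_pos by (simp add: Q_def field_simps)
  have "norm (u x, w x) <= norm (u x) + norm (w x)" by (rule norm_Pair_le)
  also have "... <= (\<Oplus>k. \<bar>u x $ k\<bar>) + (\<Oplus>k. \<bar>w x $ k\<bar>)" by (intro add_mono norm_le_l1_cart)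
  also have "... <= (\<Sum>k\<in>(UNIV::'n set). Q) + (\<Sum>k\<in>(UNIV::'n set). Q)"
   using fnQ[of True] fnQ[of False] by (intro add_mono sum_mono) (auto simp: S.fn_def)
  also have "... = 2 * n * Q" by (simp add: n_def)
  also have "... = C0 * I * (exp (- ln (M / \<delta>) * (x $ NN / X)) * M)" by (simp add: Q_def C0_def L_def)
  also have "... <= C0 * I * (max 1 M\<^sub>0 * \<delta> powr (x $ NN / X))"
   using C0 I0 height[OF x] X0 by (intro mult_left_mono interpolation_weight \<delta> M0 M) auto
  also have "... = C * I * \<delta> powr (x $ NN / X) * L0 ^ m" using L0 by (simp add: C_def)
  also have "... <= C * I * \<delta> powr (x $ NN / X) * L ^ m"
   using L L0 C0 I0 by (intro mult_left_mono power_mono) (auto simp: C_def)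
  finally show "norm (u x, w x) <= C * inverse_distance_integral D x * \<delta> powr (last_coord x / (SUP z\<in>D. last_coord z)) * (ln (M / \<delta>)) ^ m"
   by (simp add: I_def lc_NN X_def L_def)
 qed
qed

end
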